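(* Let $T>0$, $\varepsilon\ge0$, and let $\Omega=\mathbb{T}^1$ be the interval $[0,1]$ with endpoints identified. Let $\mathbf{u}=(u,v)^T$ be an entropy solution, with periodic boundary conditions, of $$\partial_tu-\partial_xv=0,\qquad\partial_tv-\partial_xu=\varepsilon\,\partial_{xx}v$$ with respect to $\eta(u,v)=\tfrac12u^2+\tfrac12v^2$, $q(u,v)=-uv$, with initial data $\mathbf{u}_0\in H^1(\mathbb{T}^1)^2$, $u\in L^2((0,T)\times\mathbb{T}^1)$ and, if $\varepsilon>0$, $v\in L^2(0,T;H^1(\mathbb{T}^1))$. Let $\{\mathbf{u}_h^i\}_{i=0}^N$, $\mathbf{u}_h^i\in(\mathbb{V}_q^s)^2$, be a Runge-Kutta discontinuous Galerkin approximation with an (IMEX) Runge-Kutta temporal discretization of order at most $3$, with temporal reconstruction $\widehat{\mathbf{u}}_h^t=(\widehat u_h^t,\widehat v_h^t)^T$ and space-time reconstruction $\widehat{\mathbf{u}}^{ts}=(\widehat u^{ts},\widehat v^{ts})^T$, with residuals $$r_u:=\partial_t\widehat u^{ts}-\partial_x\widehat v^{ts},\quad r_{v,1}:=\partial_t\widehat v^{ts}-\partial_x\widehat u^{ts}-\varepsilon\,\mathfrak{A}_h(\widehat{\mathbf{u}}_h^t)_2,\quad r_{v,2}:=\mathfrak{A}_h(\widehat{\mathbf{u}}_h^t)_2-\partial_{xx}\widehat v^{ts}.$$ Then for each $i=0,\dots,N$, $$\begin{aligned}\tfrac12\|\mathbf{u}(t_i)-\mathbf{u}_h^i\|_{L^2(\Omega)}^2&+\tfrac\varepsilon2|||v-\widehat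 v_h^t|||_{L^2(0,t_i;\mathbb{V}_q)}^2\\ \le\;&4\|\mathbf{u}(0)-\widehat{\mathbf{u}}^{ts}(0)\|_{L^2(\Omega)}^2+4\|(r_u,r_{v,1})\|_{L^1(0,t_i;L^2(\Omega))}^2+4\varepsilon\|r_{v,2}\|_{L^2(0,t_i;H^{-1}(\Omega))}^2\\&+2\|\widehat{\mathbf{u}}^{ts}(t_i)-\mathbf{u}_h^i\|_{L^2(\Omega)}^2+4\varepsilon\,|||\widehat v^{ts}-\widehat v_h^t|||_{L^2(0,t_i;\mathbb{V}_q)}^2.\end{aligned}$$
   Context: Entropy solution: $\mathbf{u}=(u,v)\in L^\infty((0,T)\times\mathbb{T}^1,\mathbb{R}^2)$ with $\varepsilon\partial_xv\in L^1$, satisfying for all test functions $\phi_1,\phi_2\in C_0^\infty([0,T)\times\mathbb{T}^1)$ the weak form $\int_0^T\!\int\partial_t\phi_1u-\partial_x\phi_1v\,dx\,dt+\int u_0\phi_1(0,\cdot)\,dx=0$, $\int_0^T\!\int\partial_t\phi_2v-\partial_x\phi_2(u+\varepsilon\partial_xv)\,dx\,dt+\int v_0\phi_2(0,\cdot)\,dx=0$, and $\int_0^T\!\int\partial_t\Phi\,\eta(u,v)+\partial_x\Phi(-uv-\varepsilon v\partial_xv)-\varepsilon\Phi(\partial_xv)^2\,dx\,dt+\int\Phi(0,\cdot)\eta(u_0,v_0)\,dx\ge0$ for all nonnegative $\Phi\in C_0^\infty([0,T)\times\mathbb{T}^1)$. Mesh and spaces: $0=x_0<\dots<x_M=1$ with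 $x_0,x_M$ identified, $I_j=(x_j,x_{j+1})$, $h_{k+1/2}=x_{k+1}-x_k$, $h_k=\tfrac12(h_{k+1/2}+h_{k-1/2})$, $h=\max_kh_{k+1/2}$. For $q\in\mathbb{N}$ (polynomial degree), $\mathbb{V}_q^s$ is the space of real functions on $[0,1]$ whose restriction to each $I_j$ is a polynomial of degree at most $q$. Write $[\![w]\!]_i=w(x_i^-)-w(x_i^+)$. Scheme, with $f(u,v)=(-v,-u)^T$ and diffusion matrix $\operatorname{diag}(0,1)$: $\mathfrak{f}_h:(\mathbb{V}_q^s)^2\to(\mathbb{V}_q^s)^2$ is defined by $\int\mathfrak{f}_h(\phi_h)\cdot\psi_h\,dx=-\int f(\phi_h)\cdot\partial_x\psi_h\,dx+\sum_{i=0}^{M-1}F(\phi_h(x_i^-),\phi_h(x_i^+))\cdot[\![\psi_h]\!]_i$ for all $\psi_h\in(\mathbb{V}_q^s)^2$ (derivatives elementwise). The numerical flux $F$ satisfies: there is a locally Lipschitz $w:\mathbb{R}^2\times\mathbb{R}^2\to\mathbb{R}^2$ such that for each compact $K$ there is $C_w(K)>0$ with $|w(\alpha,\beta)-\alpha|+|w(\alpha,\beta)-\beta|\le C_w(K)|\beta-\alpha|$ for $\alpha,\beta\in K$, and either $F(\alpha,\beta)=f(w(\alpha,\beta))$ or $F(\alpha,\beta)=f(w(\alpha,\beta))-\mu(\alpha,\beta;h)h^\nu(\beta-\alpha)$ with $\nu\in\mathbb{N}_0$ and $\mu$ matrix-valued such that, for each compact $K$, $|\mu(\alpha,\beta;h)|\le\mu_K(1+|\alpha-\beta|/h)$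 on $K$ for $h$ small. $\mathfrak{A}_h:(\mathbb{V}_q^s)^2\to(\mathbb{V}_q^s)^2$ is a discrete approximation of $\operatorname{diag}(0,1)\partial_{xx}$, with first component $0$ and second component $\mathfrak{A}_h(\cdot)_2$; no other structure is assumed beyond the Lipschitz constant of the semi-discrete ODE system being $O(h^{-1}+\varepsilon h^{-2})$ (and, as for consistent periodic discretizations such as interior penalty, $\int\mathfrak{A}_h(\cdot)_2\,dx=0$, so that the $H^{-1}$ norm below is finite). The semi-discrete scheme is $\partial_t\mathbf{u}_h+\mathfrak{f}_h(\mathbf{u}_h)=\varepsilon\mathfrak{A}_h(\mathbf{u}_h)$, with $\mathbf{u}_h(0)$ the $L^2$-projection of $\mathbf{u}(0)$; a Runge-Kutta (explicit or implicit-explicit) method at times $0=t_0<\dots<t_N=T$ yields $\mathbf{u}_h^0,\dots,\mathbf{u}_h^N$. Temporal reconstruction: $\widehat{\mathbf{u}}_h^t$ is the function which on each $[t_n,t_{n+1}]$ is the polynomial of degree at most $3$ in time with values in $(\mathbb{V}_q^s)^2$ satisfying $\widehat{\mathbf{u}}_h^t(t_j)=\mathbf{u}_h^j$ and $\partial_t\widehat{\mathbf{u}}_h^t(t_j)=-\mathfrak{f}_h(\mathbf{u}_h^j)+\varepsilon\mathfrak{A}_h(\mathbf{u}_h^j)$ for $j=n,n+1$ (one-sided derivatives from within the interval). Space-time reconstruction: for each $t$, $\widehat{\mathbf{u}}^{ts}(t,\cdot)$ is the unique element of $(\mathbb{V}_{q+1}^s)^2$ with $\int(\widehat{\mathbf{u}}^{ts}-\widehat{\mathbf{u}}_h^t)\cdot\psi_h\,dx=0$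 for all $\psi_h\in(\mathbb{V}_{q-1}^s)^2$ and $\widehat{\mathbf{u}}^{ts}(t,x_k^\pm)=w(\widehat{\mathbf{u}}_h^t(t,x_k^-),\widehat{\mathbf{u}}_h^t(t,x_k^+))$ for all $k$; it is Lipschitz continuous in space and time. Norms: $|||w|||_{L^2(0,t;\mathbb{V}_q)}^2:=\int_0^t\sum_{j=0}^{M-1}\big(\|\partial_xw(s)\|_{L^2(I_j)}^2+h_j^{-1}|[\![w(s)]\!]_j|^2\big)ds$. $\|g\|_{H^{-1}(\mathbb{T}^1)}=\sup\{\langle g,\phi\rangle:\phi\in H^1(\mathbb{T}^1),\ \|\partial_x\phi\|_{L^2}\le1\}$ (finite only when $g$ annihilates constants). *)

theory Defs
  imports "HOL-Analysis.Analysis"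
begin

section \<open>Functions on the torus\<close>

text \<open>
  A function on the one-dimensional torus is a 1-periodic function on the reals; integrals over the
  torus are integrals over \<open>{0..1}\<close>. A function of time and space is curried, \<open>u t x\<close>.
  Norms take values in \<^typ>\<open>ennreal\<close> and may be infinite.
\<close>

definition periodic1 :: "(real \<Rightarrow> 'a) \<Rightarrow> bool" where
  "periodic1 f \<longleftrightarrow> (\<forall>x. f (x + 1) = f x)"

definition L2sq_on :: "real set \<Rightarrow> (real \<Rightarrow> 'a::real_normed_vector) \<Rightarrow> ennreal" where
  "L2sq_on S f = (\<integral>\<^sup>+ x\<in>S. ennreal ((norm (f x))\<^sup>2) \<partial>lborel)"

abbreviation L2sq :: "(real \<Rightarrow> 'a::real_normed_vector) \<Rightarrow> ennreal" where
  "L2sq \<equiv> L2sq_on {0..1}"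

definition sqrt_ennreal :: "ennreal \<Rightarrow> ennreal" where
  "sqrt_ennreal a = (if a = \<infinity> then \<infinity> else ennreal (sqrt (enn2real a)))"

definition L2norm :: "(real \<Rightarrow> 'a::real_normed_vector) \<Rightarrow> ennreal" where
  "L2norm f = sqrt_ennreal (L2sq f)"

definition in_L2 :: "(real \<Rightarrow> real) \<Rightarrow> bool" where
  "in_L2 f \<longleftrightarrow> set_borel_measurable lborel {0..1} f \<and> L2sq f < \<infinity>"

definition smooth1 :: "(real \<Rightarrow> real) \<Rightarrow> bool" where
  "smooth1 f \<longleftrightarrow> (\<forall>k y. ((deriv ^^ k) f) field_differentiable (at y))"

definition weak_deriv_torus :: "(real \<Rightarrow> real) \<Rightarrow> (real \<Rightarrow> real) \<Rightarrow> bool" where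
  "weak_deriv_torus f g \<longleftrightarrow>
     set_integrable lborel {0..1} f \<and> set_integrable lborel {0..1} g \<and>
     (\<forall>\<phi>. smooth1 \<phi> \<and> periodic1 \<phi> \<longrightarrow>
        (LINT x:{0..1}|lborel. f x * deriv \<phi> x) = - (LINT x:{0..1}|lborel. g x * \<phi> x))"

text \<open>Weak derivatives are only determined up to null sets; every use below is insensitive to that.\<close>

definition wdx :: "(real \<Rightarrow> real) \<Rightarrow> (real \<Rightarrow> real)" where
  "wdx f = (SOME g. weak_deriv_torus f g)"

definition in_H1 :: "(real \<Rightarrow> real) \<Rightarrow> bool" where
  "in_H1 f \<longleftrightarrow> periodic1 f \<and> in_L2 f \<and> (\<exists>g. weak_deriv_torus f g \<and> in_L2 g)"

definition weak_deriv_on :: "real \<Rightarrow> real \<Rightarrow> (real \<Rightarrow> real) \<Rightarrow> (real \<Rightarrow> real) \<Rightarrow> bool" where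
  "weak_deriv_on a b f g \<longleftrightarrow>
     (\<forall>c d. a < c \<and> d < b \<longrightarrow> set_integrable lborel {c..d} f \<and> set_integrable lborel {c..d} g) \<and>
     (\<forall>\<phi> c d. smooth1 \<phi> \<and> a < c \<and> d < b \<and> (\<forall>x. x \<notin> {c..d} \<longrightarrow> \<phi> x = 0) \<longrightarrow>
        (LINT x:{a<..<b}|lborel. f x * deriv \<phi> x) = - (LINT x:{a<..<b}|lborel. g x * \<phi> x))"

definition wdx_on :: "real \<Rightarrow> real \<Rightarrow> (real \<Rightarrow> real) \<Rightarrow> (real \<Rightarrow> real)" where
  "wdx_on a b f = (SOME g. weak_deriv_on a b f g)"

text \<open>
  One-sided traces \<open>w(x\<^sup>-)\<close> and \<open>w(x\<^sup>+)\<close> are essential limits, i.e. limits up to a null set.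
  They agree with the one-sided limits of a piecewise polynomial and, for a Sobolev function given
  only almost everywhere, with the values of its continuous representative.
\<close>

definition tr_left :: "(real \<Rightarrow> 'a::t2_space) \<Rightarrow> real \<Rightarrow> 'a" where
  "tr_left w x = Lim (inf (at_left x) (ae_filter lborel)) w"

definition tr_right :: "(real \<Rightarrow> 'a::t2_space) \<Rightarrow> real \<Rightarrow> 'a" where
  "tr_right w x = Lim (inf (at_right x) (ae_filter lborel)) w"

definition jump :: "(real \<Rightarrow> 'a::{t2_space, minus}) \<Rightarrow> real \<Rightarrow> 'a" where
  "jump w x = tr_left w x - tr_right w x"

text \<open>
  A distribution on the torus is represented by its values on \<open>H\<^sup>1\<close> functions. The truncation of
  negative values by \<^const>\<open>ennreal\<close> is harmless since \<open>\<phi> = 0\<close> is admissible in the supremum.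
\<close>

definition Hm1norm :: "((real \<Rightarrow> real) \<Rightarrow> real) \<Rightarrow> ennreal" where
  "Hm1norm G = (SUP \<phi>\<in>{\<phi>. in_H1 \<phi> \<and> L2norm (wdx \<phi>) \<le> 1}. ennreal (G \<phi>))"

definition pair_fun :: "(real \<Rightarrow> real) \<Rightarrow> (real \<Rightarrow> real) \<Rightarrow> real" where
  "pair_fun g \<phi> = (LINT x:{0..1}|lborel. g x * \<phi> x)"

text \<open>The distribution \<open>\<partial>\<^sub>x\<^sub>x w\<close> for \<open>w\<close> in \<open>H\<^sup>1\<close>.\<close>

definition pair_dxx :: "(real \<Rightarrow> real) \<Rightarrow> (real \<Rightarrow> real) \<Rightarrow> real" where
  "pair_dxx w \<phi> = - (LINT x:{0..1}|lborel. wdx w x * wdx \<phi> x)"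


section \<open>Entropy solutions\<close>

text \<open>Continuity of a function of \<open>(t, x)\<close> and of all its partial derivatives up to order \<open>k\<close>.\<close>

primrec Ck2 :: "nat \<Rightarrow> (real \<Rightarrow> real \<Rightarrow> real) \<Rightarrow> bool" where
  "Ck2 0 f \<longleftrightarrow> continuous_on UNIV (\<lambda>z. f (fst z) (snd z))"
| "Ck2 (Suc k) f \<longleftrightarrow>
     (\<exists>ft fx. (\<forall>t x. ((\<lambda>s. f s x) has_real_derivative ft t x) (at t)) \<and>
              (\<forall>t x. ((\<lambda>y. f t y) has_real_derivative fx t x) (at x)) \<and> Ck2 k ft \<and> Ck2 k fx)"

definition smooth2 :: "(real \<Rightarrow> real \<Rightarrow> real) \<Rightarrow> bool" where
  "smooth2 f \<longleftrightarrow> (\<forall>k. Ck2 k f)"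

abbreviation dt :: "(real \<Rightarrow> real \<Rightarrow> real) \<Rightarrow> real \<Rightarrow> real \<Rightarrow> real" where
  "dt f t x \<equiv> deriv (\<lambda>s. f s x) t"

abbreviation dx :: "(real \<Rightarrow> real \<Rightarrow> real) \<Rightarrow> real \<Rightarrow> real \<Rightarrow> real" where
  "dx f t x \<equiv> deriv (\<lambda>y. f t y) x"

text \<open>
  Smooth functions with compact support in \<open>[0, T) \<times> torus\<close>: being smooth up to \<open>t = 0\<close>, they are
  the restrictions of the functions below, whose values for negative times play no role.
\<close>

definition test_fun :: "real \<Rightarrow> (real \<Rightarrow> real \<Rightarrow> real) \<Rightarrow> bool" where
  "test_fun T \<phi> \<longleftrightarrow>
     smooth2 \<phi> \<and> (\<forall>t. periodic1 (\<phi> t)) \<and> (\<exists>\<tau><T. \<forall>t x. \<tau> \<le> t \<longrightarrow> \<phi> t x = 0)"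

definition test_fun_open :: "real \<Rightarrow> (real \<Rightarrow> real \<Rightarrow> real) \<Rightarrow> bool" where
  "test_fun_open T \<phi> \<longleftrightarrow> test_fun T \<phi> \<and> (\<exists>\<sigma>>0. \<forall>t x. t \<le> \<sigma> \<longrightarrow> \<phi> t x = 0)"

definition cyl :: "real \<Rightarrow> (real \<times> real) set" where
  "cyl T = {0<..<T} \<times> {0<..<1}"

definition int_cyl :: "real \<Rightarrow> (real \<Rightarrow> real \<Rightarrow> real) \<Rightarrow> real" where
  "int_cyl T g = (LINT z:cyl T|lborel. g (fst z) (snd z))"

definition in_L1_cyl :: "real \<Rightarrow> (real \<Rightarrow> real \<Rightarrow> real) \<Rightarrow> bool" where
  "in_L1_cyl T g \<longleftrightarrow> set_integrable lborel (cyl T) (\<lambda>z. g (fst z) (snd z))"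

definition measurable_cyl :: "real \<Rightarrow> (real \<Rightarrow> real \<Rightarrow> real) \<Rightarrow> bool" where
  "measurable_cyl T g \<longleftrightarrow> set_borel_measurable lborel (cyl T) (\<lambda>z. g (fst z) (snd z))"

definition in_Linf_cyl :: "real \<Rightarrow> (real \<Rightarrow> real \<Rightarrow> real) \<Rightarrow> bool" where
  "in_Linf_cyl T g \<longleftrightarrow> measurable_cyl T g \<and>
     (\<exists>C. AE z in lborel. z \<in> cyl T \<longrightarrow> \<bar>g (fst z) (snd z)\<bar> \<le> C)"

definition in_L2_cyl :: "real \<Rightarrow> (real \<Rightarrow> real \<Rightarrow> real) \<Rightarrow> bool" where
  "in_L2_cyl T g \<longleftrightarrow> measurable_cyl T g \<and>
     (\<integral>\<^sup>+ z\<in>cyl T. ennreal ((g (fst z) (snd z))\<^sup>2) \<partial>lborel) < \<infinity>"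

definition in_L2_H1 :: "real \<Rightarrow> (real \<Rightarrow> real \<Rightarrow> real) \<Rightarrow> bool" where
  "in_L2_H1 T g \<longleftrightarrow> measurable_cyl T g \<and> (AE t in lborel. t \<in> {0<..<T} \<longrightarrow> in_H1 (g t)) \<and>
     (\<integral>\<^sup>+ t\<in>{0<..<T}. (L2sq (g t) + L2sq (wdx (g t))) \<partial>lborel) < \<infinity>"

definition eta :: "real \<Rightarrow> real \<Rightarrow> real" where
  "eta u v = u\<^sup>2 / 2 + v\<^sup>2 / 2"

text \<open>
  Here \<open>vx\<close> is the distributional derivative \<open>\<partial>\<^sub>x v\<close> on \<open>(0, T) \<times> torus\<close>; for \<open>\<epsilon> = 0\<close> it is not
  required to exist, and all terms containing it vanish. The entropy inequality is understood to
  include the integrability of its last term.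
\<close>

definition entropy_solution ::
  "real \<Rightarrow> real \<Rightarrow> (real \<Rightarrow> real \<Rightarrow> real) \<Rightarrow> (real \<Rightarrow> real \<Rightarrow> real) \<Rightarrow>
   (real \<Rightarrow> real) \<Rightarrow> (real \<Rightarrow> real) \<Rightarrow> bool" where
  "entropy_solution T \<epsilon> u v u0 v0 \<longleftrightarrow>
     (\<forall>t. periodic1 (u t) \<and> periodic1 (v t)) \<and> in_Linf_cyl T u \<and> in_Linf_cyl T v \<and>
     (\<exists>vx.
       (\<epsilon> > 0 \<longrightarrow> (\<forall>\<phi>. test_fun_open T \<phi> \<longrightarrow>
          int_cyl T (\<lambda>t x. v t x * dx \<phi> t x) = - int_cyl T (\<lambda>t x. vx t x * \<phi> t x))) \<and>
       in_L1_cyl T (\<lambda>t x. \<epsilon> * vx t x) \<and>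
       (\<forall>\<phi>. test_fun T \<phi> \<longrightarrow>
          int_cyl T (\<lambda>t x. dt \<phi> t x * u t x - dx \<phi> t x * v t x)
            + (LINT x:{0..1}|lborel. u0 x * \<phi> 0 x) = 0) \<and>
       (\<forall>\<phi>. test_fun T \<phi> \<longrightarrow>
          int_cyl T (\<lambda>t x. dt \<phi> t x * v t x - dx \<phi> t x * (u t x + \<epsilon> * vx t x))
            + (LINT x:{0..1}|lborel. v0 x * \<phi> 0 x) = 0) \<and>
       (\<forall>\<Phi>. test_fun T \<Phi> \<and> (\<forall>t\<ge>0. \<forall>x. \<Phi> t x \<ge> 0) \<longrightarrow>
          in_L1_cyl T (\<lambda>t x. \<epsilon> * \<Phi> t x * (vx t x)\<^sup>2) \<and>
          int_cyl T (\<lambda>t x. dt \<Phi> t x * eta (u t x) (v t x)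
                        + dx \<Phi> t x * (- u t x * v t x - \<epsilon> * v t x * vx t x)
                        - \<epsilon> * \<Phi> t x * (vx t x)\<^sup>2)
            + (LINT x:{0..1}|lborel. \<Phi> 0 x * eta (u0 x) (v0 x)) \<ge> 0))"

text \<open>
  An entropy solution is only an \<open>L\<^sup>\<infinity>\<close> class in space-time. It has a representative that is weakly
  continuous in time with values in \<open>L\<^sup>2\<close>, and the values \<open>u t\<close> at individual times refer to it.
\<close>

definition weakly_continuous_L2 :: "real \<Rightarrow> (real \<Rightarrow> real \<Rightarrow> real) \<Rightarrow> bool" where
  "weakly_continuous_L2 T g \<longleftrightarrow>
     (\<forall>t\<in>{0..T}. in_L2 (g t)) \<and>
     (\<forall>\<psi>. in_L2 \<psi> \<longrightarrow> continuous_on {0..T} (\<lambda>t. LINT x:{0..1}|lborel. g t x * \<psi> x))"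


section \<open>Mesh and discontinuous Galerkin spaces\<close>

definition periodic_mesh :: "(nat \<Rightarrow> real) \<Rightarrow> nat \<Rightarrow> bool" where
  "periodic_mesh x M \<longleftrightarrow> M \<ge> 1 \<and> x 0 = 0 \<and> x M = 1 \<and> (\<forall>k<M. x k < x (Suc k))"

definition mesh_size :: "(nat \<Rightarrow> real) \<Rightarrow> nat \<Rightarrow> real" where
  "mesh_size x M = Max ((\<lambda>k. x (Suc k) - x k) ` {..<M})"

definition h_node :: "(nat \<Rightarrow> real) \<Rightarrow> nat \<Rightarrow> nat \<Rightarrow> real" where
  "h_node x M k =
     ((x (Suc k) - x k) + (if k = 0 then x M - x (M - 1) else x k - x (k - 1))) / 2"

text \<open>
  Piecewise polynomials, as 1-periodic functions; the value at a node, which is not determined by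
  the restrictions to the open cells, is fixed by right-continuity.
\<close>

definition dg_space :: "(nat \<Rightarrow> real) \<Rightarrow> nat \<Rightarrow> nat \<Rightarrow> (real \<Rightarrow> real) set" where
  "dg_space x M q = {w. periodic1 w \<and>
     (\<forall>j<M. \<exists>p. degree p \<le> q \<and> (\<forall>y\<in>{x j..<x (Suc j)}. w y = poly p y))}"

type_synonym state = "real \<times> real"

definition dg_space2 :: "(nat \<Rightarrow> real) \<Rightarrow> nat \<Rightarrow> nat \<Rightarrow> (real \<Rightarrow> state) set" where
  "dg_space2 x M q =
     {w. (\<lambda>y. fst (w y)) \<in> dg_space x M q \<and> (\<lambda>y. snd (w y)) \<in> dg_space x M q}"

definition int_inner :: "(real \<Rightarrow> state) \<Rightarrow> (real \<Rightarrow> state) \<Rightarrow> real" where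
  "int_inner f g = (LINT y:{0..1}|lborel. f y \<bullet> g y)"

definition is_L2_projection ::
  "(nat \<Rightarrow> real) \<Rightarrow> nat \<Rightarrow> nat \<Rightarrow> (real \<Rightarrow> state) \<Rightarrow> (real \<Rightarrow> state) \<Rightarrow> bool" where
  "is_L2_projection x M q f g \<longleftrightarrow> g \<in> dg_space2 x M q \<and>
     (\<forall>\<psi>\<in>dg_space2 x M q. int_inner (\<lambda>y. g y - f y) \<psi> = 0)"

text \<open>
  The square of the broken norm \<open>|||w|||\<close> on \<open>L\<^sup>2(0, t)\<close>. It is meaningful if almost every \<open>w s\<close> is
  weakly differentiable on each cell, which is not required for the exact solution if \<open>\<epsilon> = 0\<close>; the
  norm then only occurs with the factor \<open>\<epsilon>\<close>.
\<close>

definition broken_sq ::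
  "(nat \<Rightarrow> real) \<Rightarrow> nat \<Rightarrow> real \<Rightarrow> (real \<Rightarrow> real \<Rightarrow> real) \<Rightarrow> ennreal" where
  "broken_sq x M t w = (\<integral>\<^sup>+ s\<in>{0..t}.
     (\<Sum>j<M. L2sq_on {x j<..<x (Suc j)} (wdx_on (x j) (x (Suc j)) (w s))
              + ennreal ((jump (w s) (x j))\<^sup>2 / h_node x M j)) \<partial>lborel)"


section \<open>The Runge-Kutta discontinuous Galerkin scheme\<close>

definition flux :: "state \<Rightarrow> state" where
  "flux a = (- snd a, - fst a)"

text \<open>
  The matrix field \<open>\<mu>\<close> depends on a mesh parameter and its bound is required for all small
  parameters, whereas the flux \<open>F\<close> is the one used on the given mesh, of size \<open>h\<close>.
\<close>

definition numerical_flux ::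
  "(state \<Rightarrow> state \<Rightarrow> state) \<Rightarrow> (state \<Rightarrow> state \<Rightarrow> state) \<Rightarrow> real \<Rightarrow> bool" where
  "numerical_flux F w h \<longleftrightarrow>
     (\<forall>z. \<exists>r>0. \<exists>L. L-lipschitz_on (ball z r) (\<lambda>(a, b). w a b)) \<and>
     (\<forall>K. compact K \<longrightarrow> (\<exists>C>0. \<forall>a\<in>K. \<forall>b\<in>K.
         norm (w a b - a) + norm (w a b - b) \<le> C * norm (b - a))) \<and>
     ((\<forall>a b. F a b = flux (w a b)) \<or>
      (\<exists>(\<nu>::nat) (\<mu> :: state \<Rightarrow> state \<Rightarrow> real \<Rightarrow> (state \<Rightarrow>\<^sub>L state)).
         (\<forall>K. compact K \<longrightarrow> (\<exists>\<mu>K. \<forall>\<^sub>F h' in at_right 0. \<forall>a\<in>K. \<forall>b\<in>K.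
             norm (\<mu> a b h') \<le> \<mu>K * (1 + norm (a - b) / h'))) \<and>
         (\<forall>a b. F a b = flux (w a b) - h ^ \<nu> *\<^sub>R blinfun_apply (\<mu> a b h) (b - a))))"

definition dg_flux_operator ::
  "(nat \<Rightarrow> real) \<Rightarrow> nat \<Rightarrow> nat \<Rightarrow> (state \<Rightarrow> state \<Rightarrow> state) \<Rightarrow>
   ((real \<Rightarrow> state) \<Rightarrow> (real \<Rightarrow> state)) \<Rightarrow> bool" where
  "dg_flux_operator x M q F fh \<longleftrightarrow>
     (\<forall>\<phi>\<in>dg_space2 x M q. fh \<phi> \<in> dg_space2 x M q \<and>
        (\<forall>\<psi>\<in>dg_space2 x M q.
           int_inner (fh \<phi>) \<psi> =
             - int_inner (\<lambda>y. flux (\<phi> y)) (\<lambda>y. vector_derivative \<psi> (at y))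
             + (\<Sum>i<M. F (tr_left \<phi> (x i)) (tr_right \<phi> (x i)) \<bullet> jump \<psi> (x i))))"

definition diffusion_operator ::
  "(nat \<Rightarrow> real) \<Rightarrow> nat \<Rightarrow> nat \<Rightarrow> ((real \<Rightarrow> state) \<Rightarrow> (real \<Rightarrow> state)) \<Rightarrow> bool" where
  "diffusion_operator x M q Ah \<longleftrightarrow>
     (\<forall>\<phi>\<in>dg_space2 x M q. Ah \<phi> \<in> dg_space2 x M q \<and> (\<forall>y. fst (Ah \<phi> y) = 0) \<and>
        (LINT y:{0..1}|lborel. snd (Ah \<phi> y)) = 0)"

text \<open>
  The Lipschitz constant of the semi-discrete right-hand side \<open>- fh + \<epsilon> Ah\<close> is
  \<open>O(1/h + \<epsilon>/h\<^sup>2)\<close>, uniformly in \<open>\<epsilon> \<ge> 0\<close>. It is taken on bounded sets because \<open>w\<close>, hence \<open>fh\<close>,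
  is only locally Lipschitz.
\<close>

definition semidiscrete_lipschitz ::
  "(nat \<Rightarrow> real) \<Rightarrow> nat \<Rightarrow> nat \<Rightarrow> ((real \<Rightarrow> state) \<Rightarrow> (real \<Rightarrow> state)) \<Rightarrow>
   ((real \<Rightarrow> state) \<Rightarrow> (real \<Rightarrow> state)) \<Rightarrow> bool" where
  "semidiscrete_lipschitz x M q fh Ah \<longleftrightarrow>
     (\<forall>R::real. \<exists>C::real. \<forall>\<epsilon>\<ge>0. \<forall>a\<in>dg_space2 x M q. \<forall>b\<in>dg_space2 x M q.
        L2norm a \<le> ennreal R \<and> L2norm b \<le> ennreal R \<longrightarrow>
        L2norm (\<lambda>y. (- fh a y + \<epsilon> *\<^sub>R Ah a y) - (- fh b y + \<epsilon> *\<^sub>R Ah b y))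
          \<le> ennreal (C * (1 / mesh_size x M + \<epsilon> / (mesh_size x M)\<^sup>2)) * L2norm (\<lambda>y. a y - b y))"

text \<open>
  An implicit-explicit method for \<open>y' = E y + G y\<close> is a pair of Butcher tableaux with common stages
  (\<open>Expl\<close> for \<open>E\<close>, \<open>Impl\<close> for \<open>G\<close>). If both tableaux coincide this is an explicit method for the
  full right-hand side.
\<close>

datatype rk_part = Expl | Impl

record imex_tableau =
  stages :: nat
  coeffs :: "rk_part \<Rightarrow> nat \<Rightarrow> nat \<Rightarrow> real"
  weights :: "rk_part \<Rightarrow> nat \<Rightarrow> real"

definition imex_method :: "imex_tableau \<Rightarrow> bool" where
  "imex_method m \<longleftrightarrow> (\<forall>i<stages m. \<forall>j<stages m. i \<le> j \<longrightarrow> coeffs m Expl i j = 0)"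

definition imex_step ::
  "imex_tableau \<Rightarrow> (real \<Rightarrow> 'a::real_normed_vector) set \<Rightarrow> ((real \<Rightarrow> 'a) \<Rightarrow> (real \<Rightarrow> 'a)) \<Rightarrow>
   ((real \<Rightarrow> 'a) \<Rightarrow> (real \<Rightarrow> 'a)) \<Rightarrow> real \<Rightarrow> (real \<Rightarrow> 'a) \<Rightarrow> (real \<Rightarrow> 'a) \<Rightarrow> bool" where
  "imex_step m V E G \<tau> y z \<longleftrightarrow>
     (\<exists>Y. (\<forall>i<stages m. Y i \<in> V \<and> (\<forall>\<xi>. Y i \<xi> = y \<xi> + \<tau> *\<^sub>R
              (\<Sum>j<stages m. coeffs m Expl i j *\<^sub>R E (Y j) \<xi> + coeffs m Impl i j *\<^sub>R G (Y j) \<xi>))) \<and>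
          (\<forall>\<xi>. z \<xi> = y \<xi> + \<tau> *\<^sub>R
              (\<Sum>j<stages m. weights m Expl j *\<^sub>R E (Y j) \<xi> + weights m Impl j *\<^sub>R G (Y j) \<xi>)))"

text \<open>
  The order of consistency is given by Butcher's order conditions for additive Runge-Kutta methods:
  the series expansions of the numerical and of the exact flow agree up to order \<open>p\<close> iff
  \<open>elementary weight * density = 1\<close> for all rooted trees with at most \<open>p\<close> nodes, each node being
  coloured by the part of the right-hand side that it stands for.
\<close>

datatype rk_tree = Node (colour: rk_part) (children: "rk_tree list")

fun nodes :: "rk_tree \<Rightarrow> nat" where
  "nodes (Node c ts) = 1 + sum_list (map nodes ts)"

fun density :: "rk_tree \<Rightarrow> nat" where
  "density (Node c ts) = nodes (Node c ts) * prod_list (map density ts)"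

fun stage_weight :: "imex_tableau \<Rightarrow> rk_tree \<Rightarrow> nat \<Rightarrow> real" where
  "stage_weight m (Node c ts) i =
     prod_list (map (\<lambda>s. \<Sum>j<stages m. coeffs m (colour s) i j * stage_weight m s j) ts)"

definition elementary_weight :: "imex_tableau \<Rightarrow> rk_tree \<Rightarrow> real" where
  "elementary_weight m s = (\<Sum>j<stages m. weights m (colour s) j * stage_weight m s j)"

definition order_conditions :: "imex_tableau \<Rightarrow> nat \<Rightarrow> bool" where
  "order_conditions m p \<longleftrightarrow>
     (\<forall>s. nodes s \<le> p \<longrightarrow> elementary_weight m s * real (density s) = 1)"

definition has_order :: "imex_tableau \<Rightarrow> nat \<Rightarrow> bool" where
  "has_order m p \<longleftrightarrow> order_conditions m p \<and> \<not> order_conditions m (Suc p)"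

definition time_grid :: "(nat \<Rightarrow> real) \<Rightarrow> nat \<Rightarrow> real \<Rightarrow> bool" where
  "time_grid tt N T \<longleftrightarrow> tt 0 = 0 \<and> tt N = T \<and> (\<forall>n<N. tt n < tt (Suc n))"

definition rkdg_approximation ::
  "(nat \<Rightarrow> real) \<Rightarrow> nat \<Rightarrow> nat \<Rightarrow> ((real \<Rightarrow> state) \<Rightarrow> (real \<Rightarrow> state)) \<Rightarrow>
   ((real \<Rightarrow> state) \<Rightarrow> (real \<Rightarrow> state)) \<Rightarrow> real \<Rightarrow> imex_tableau \<Rightarrow> (nat \<Rightarrow> real) \<Rightarrow> nat \<Rightarrow>
   (real \<Rightarrow> state) \<Rightarrow> (nat \<Rightarrow> real \<Rightarrow> state) \<Rightarrow> bool" where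
  "rkdg_approximation x M q fh Ah \<epsilon> m tt N init U \<longleftrightarrow>
     (\<forall>n\<le>N. U n \<in> dg_space2 x M q) \<and> is_L2_projection x M q init (U 0) \<and>
     (\<forall>n<N. imex_step m (dg_space2 x M q) (\<lambda>\<phi> y. - fh \<phi> y) (\<lambda>\<phi> y. \<epsilon> *\<^sub>R Ah \<phi> y)
              (tt (Suc n) - tt n) (U n) (U (Suc n)))"


section \<open>Reconstructions and residuals\<close>

definition temporal_reconstruction ::
  "(nat \<Rightarrow> real) \<Rightarrow> nat \<Rightarrow> nat \<Rightarrow> ((real \<Rightarrow> state) \<Rightarrow> (real \<Rightarrow> state)) \<Rightarrow>
   ((real \<Rightarrow> state) \<Rightarrow> (real \<Rightarrow> state)) \<Rightarrow> real \<Rightarrow> (nat \<Rightarrow> real) \<Rightarrow> nat \<Rightarrow>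
   (nat \<Rightarrow> real \<Rightarrow> state) \<Rightarrow> (real \<Rightarrow> real \<Rightarrow> state) \<Rightarrow> bool" where
  "temporal_reconstruction x M q fh Ah \<epsilon> tt N U ut \<longleftrightarrow>
     (\<forall>n<N.
        (\<exists>c. (\<forall>k\<le>3. c k \<in> dg_space2 x M q) \<and>
             (\<forall>t\<in>{tt n..tt (Suc n)}. \<forall>y. ut t y = (\<Sum>k\<le>(3::nat). t ^ k *\<^sub>R c k y))) \<and>
        (\<forall>j\<in>{n, Suc n}. ut (tt j) = U j \<and>
           (\<forall>y. ((\<lambda>t. ut t y) has_vector_derivative (- fh (U j) y + \<epsilon> *\<^sub>R Ah (U j) y))
                  (at (tt j) within {tt n..tt (Suc n)}))))"

definition space_time_reconstruction ::
  "(nat \<Rightarrow> real) \<Rightarrow> nat \<Rightarrow> nat \<Rightarrow> (state \<Rightarrow> state \<Rightarrow> state) \<Rightarrow> real \<Rightarrow>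
   (real \<Rightarrow> real \<Rightarrow> state) \<Rightarrow> (real \<Rightarrow> real \<Rightarrow> state) \<Rightarrow> bool" where
  "space_time_reconstruction x M q w T ut uts \<longleftrightarrow>
     (\<forall>t\<in>{0..T}. uts t \<in> dg_space2 x M (q + 1) \<and>
        (\<forall>\<psi>\<in>dg_space2 x M (q - 1). int_inner (\<lambda>y. uts t y - ut t y) \<psi> = 0) \<and>
        (\<forall>k\<le>M. tr_left (uts t) (x k) = w (tr_left (ut t) (x k)) (tr_right (ut t) (x k)) \<and>
                tr_right (uts t) (x k) = w (tr_left (ut t) (x k)) (tr_right (ut t) (x k))))"

text \<open>
  The derivatives of the Lipschitz function \<open>uts\<close> in the first two residuals exist almost
  everywhere. The third residual is a distribution.
\<close>

definition res_u :: "(real \<Rightarrow> real \<Rightarrow> state) \<Rightarrow> real \<Rightarrow> real \<Rightarrow> real" where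
  "res_u uts t y = dt (\<lambda>t y. fst (uts t y)) t y - dx (\<lambda>t y. snd (uts t y)) t y"

definition res_v1 ::
  "((real \<Rightarrow> state) \<Rightarrow> (real \<Rightarrow> state)) \<Rightarrow> real \<Rightarrow> (real \<Rightarrow> real \<Rightarrow> state) \<Rightarrow>
   (real \<Rightarrow> real \<Rightarrow> state) \<Rightarrow> real \<Rightarrow> real \<Rightarrow> real" where
  "res_v1 Ah \<epsilon> ut uts t y =
     dt (\<lambda>t y. snd (uts t y)) t y - dx (\<lambda>t y. fst (uts t y)) t y - \<epsilon> * snd (Ah (ut t) y)"

definition res_v2 ::
  "((real \<Rightarrow> state) \<Rightarrow> (real \<Rightarrow> state)) \<Rightarrow> (real \<Rightarrow> real \<Rightarrow> state) \<Rightarrow>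
   (real \<Rightarrow> real \<Rightarrow> state) \<Rightarrow> real \<Rightarrow> (real \<Rightarrow> real) \<Rightarrow> real" where
  "res_v2 Ah ut uts t \<phi> =
     pair_fun (\<lambda>y. snd (Ah (ut t) y)) \<phi> - pair_dxx (\<lambda>y. snd (uts t y)) \<phi>"

end

theory Submission
  imports Defs
begin

text \<open>
The proof compares the entropy solution \<open>(u, v)\<close> with the space-time reconstruction \<open>(U, V)\<close> by the
relative energy method. The reconstruction is Lipschitz, so it may be used as a test function, and
it solves the system up to the residuals. Three balances are combined: the energy inequality of the
entropy solution, the weak form tested with \<open>(U, V)\<close>, and the energy identity of \<open>(U, V)\<close>. The
system is linear and symmetric, hence in the sum all transport terms form the \<open>x\<close>-derivative of
\<open>U V\<close>, which integrates to zero over the torus. What remains is the fact \<open>relative_energy\<close>: half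
the squared distance in \<open>L\<^sup>2\<close>, plus the viscous work, is bounded by its initial value minus the
work of the residuals \<open>r\<^sub>u\<close> and \<open>r\<^sub>v\<^sub>,\<^sub>1\<close>.

The work of these two residuals is linear in the error. It is estimated by Cauchy-Schwarz and
absorbed into the supremum of the error over time (\<open>sup_absorption\<close>), which is where the squared
\<open>L\<^sup>1\<close>-in-time norm and the constants 2 and 4 in
\<open>error_estimate\<close> arise. The viscous work is \<open>\<epsilon>\<close> times the squared
derivative of the error plus the pairing of \<open>r\<^sub>v\<^sub>,\<^sub>2\<close> with the error; Young's inequality for the
\<open>H\<^sup>-\<^sup>1\<close> norm (\<open>Hm1norm_quadratic_bound\<close>) absorbs the pairing and keeps the derivative on the left.
This gives that estimate.

An entropy solution is merely bounded and weakly continuous in time, so the balances are first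
derived for test functions that are products of a temporal cutoff and a spatial function
(\<open>conservation_law_integrated\<close>, \<open>energy_dissipation\<close>), and then extended to products of Lipschitz
functions (\<open>conservation_law_product_rule\<close>). The reconstruction is a finite sum of such products
(\<open>uts_basis\<close>): its coefficients on the cells are Lipschitz in time, because the data that define it
are Lipschitz and determine a polynomial of degree \<open>q + 1\<close> stably
(\<open>coefficients_bounded_by_reconstruction_data\<close>).

Finally \<open>(U, V)\<close> is replaced by the numerical solution, extended to all times by the temporal
reconstruction \<open>(u\<^sub>h, v\<^sub>h)\<close>. For the \<open>L\<^sup>2\<close> part this is the triangle
inequality. In the broken norm neither \<open>v\<close> nor \<open>V\<close> has jumps, so the jumps of \<open>v - v\<^sub>h\<close> and of
\<open>V - v\<^sub>h\<close> coincide (\<open>jump_error_eq\<close>), and on the cells the triangle inequality applies again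
(\<open>broken_density_le\<close>).
\<close>

section \<open>Primitives of integrable functions\<close>

text \<open>
  Absolute continuity in the form in which it is used: \<open>g\<close> is a density of \<open>f\<close>. This class
  contains the Lipschitz functions and is closed under products, which is what testing the weak form
  with the reconstruction requires.
\<close>

definition primitive_on :: "real \<Rightarrow> real \<Rightarrow> (real \<Rightarrow> real) \<Rightarrow> (real \<Rightarrow> real) \<Rightarrow> bool" where
  "primitive_on a b f g \<longleftrightarrow> set_integrable lborel {a..b} g \<and>
     (\<forall>x\<in>{a..b}. f x = f a + (LINT y:{a..x}|lborel. g y))"

lemma set_integrable_interval_split:
  fixes f :: "real \<Rightarrow> real"
  assumes "set_integrable lborel {a..b} f" "a \<le> c" "c \<le> d" "d \<le> b"
  shows "(LINT y:{a..d}|lborel. f y) = (LINT y:{a..c}|lborel. f y) + (LINT y:{c..d}|lborel. f y)"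
proof -
  have "{a..d} = {a..c} \<union> {c..d}" using assms by auto
  moreover have "set_integrable lborel {a..c} f" "set_integrable lborel {c..d} f"
    using assms by (auto intro: set_integrable_subset)
  moreover have "AE x in lborel. \<not> (x \<in> {a..c} \<and> x \<in> {c..d})"
    using AE_lborel_singleton[of c] by eventually_elim auto
  ultimately show ?thesis using set_integral_Un_AE[of "{a..c}" "{c..d}" lborel f] by simp
qed

lemma set_integrable_const_Icc [simp]: "set_integrable lborel {a..b::real} (\<lambda>_. k :: real)"
  by (rule borel_integrable_atLeastAtMost') simp

lemma set_integral_const_Icc: "a \<le> b \<Longrightarrow> (LINT y:{a..b::real}|lborel. k) = k * (b - a :: real)"
  by (subst set_integral_const) (auto simp: field_simps)

text \<open>
  The Lebesgue differentiation theorem for one-sided intervals; reflection gives the other side.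
\<close>

lemma AE_right_deriv_integral:
  fixes f :: "real \<Rightarrow> real"
  assumes "integrable lborel f"
  shows "AE t in lborel. \<forall>e>0. \<exists>d>0. \<forall>h. 0 < h \<and> h < d \<longrightarrow>
           \<bar>(LINT y:{t..t+h}|lborel. f y) / h - f t\<bar> < e"
proof -
  have si: "set_integrable lborel {a..b} f" for a b
    unfolding set_integrable_def using assms by (intro integrable_mult_indicator) auto
  have "f integrable_on cbox a b" for a b
    using set_borel_integral_eq_integral(1)[OF si[of a b]] by simp
  then obtain K where K: "negligible K"
       "\<And>x e. \<lbrakk>x \<notin> K; 0 < e\<rbrakk> \<Longrightarrow> \<exists>d>0. \<forall>h. 0 < h \<and> h < d \<longrightarrow>
             norm (integral (cbox x (x + h *\<^sub>R One)) f /\<^sub>R h ^ DIM(real) - f x) < e"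
    using integrable_ccontinuous_explicit[of f] by metis
  have "AE t in lebesgue. t \<notin> K"
    using K(1) by (simp add: negligible_iff_null_sets AE_not_in)
  then have "AE t in lborel. t \<notin> K"
    by (simp add: AE_completion_iff)
  then show ?thesis
  proof eventually_elim
    case (elim t)
    show ?case
    proof (intro allI impI)
      fix e :: real assume "e > 0"
      from K(2)[OF elim this] obtain d where d: "d > 0"
        "\<And>h. 0 < h \<and> h < d \<Longrightarrow> norm (integral (cbox t (t + h *\<^sub>R One)) f /\<^sub>R h ^ DIM(real) - f t) < e"
        by blast
      have "\<bar>(LINT y:{t..t+h}|lborel. f y) / h - f t\<bar> < e" if "0 < h \<and> h < d" for h
        using d(2)[OF that] set_borel_integral_eq_integral(2)[OF si[of t "t+h"]]
        by (simp add: divide_inverse mult.commute)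
      then show "\<exists>d>0. \<forall>h. 0 < h \<and> h < d \<longrightarrow> \<bar>(LINT y:{t..t+h}|lborel. f y) / h - f t\<bar> < e"
        using d(1) by blast
    qed
  qed
qed

lemma AE_lborel_uminus:
  assumes "AE t in lborel. P (t::real)" shows "AE t in lborel. P (- t)"
proof -
  have "distr lborel borel uminus = (lborel :: real measure)"
    by (rule lborel_distr_uminus)
  then have "AE t in distr lborel borel uminus. P (t::real)" using assms by metis
  then show ?thesis by (rule AE_distrD[rotated]) simp
qed

lemma AE_deriv_integral:
  fixes f :: "real \<Rightarrow> real"
  assumes f: "set_integrable lborel {a..b} f"
  shows "AE t in lborel. t \<in> {a<..<b} \<longrightarrow>
           ((\<lambda>s. LINT y:{a..s}|lborel. f y) has_real_derivative f t) (at t)"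
proof -
  define g where "g = (\<lambda>x. indicator {a..b} x * f x)"
  have g: "integrable lborel g" using f by (simp add: g_def set_integrable_def)
  have gr: "integrable lborel (\<lambda>x. g (- x))"
    using g lborel_integrable_real_affine[of g "-1" 0] by simp
  have *: "(LINT y:{c..d}|lborel. f y) = (LINT y:{c..d}|lborel. g y)" if "a \<le> c" "d \<le> b" for c d
    using that by (intro set_lebesgue_integral_cong) (auto simp: g_def)
  have refl: "(LINT y:{-t..-t+h}|lborel. g (- y)) = (LINT y:{t-h..t}|lborel. g y)" for t h
  proof -
    have "(LINT y:{t-h..t}|lborel. g y) = (LINT y|lborel. indicator {t-h..t} (-y) * g (-y))"
      using lborel_integral_real_affine[of "-1" "\<lambda>y. indicator {t-h..t} y * g y" 0]
      by (simp add: set_lebesgue_integral_def)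
    also have "\<dots> = (LINT y|lborel. indicator {-t..-t+h} y * g (-y))"
      by (intro Bochner_Integration.integral_cong) (auto simp: indicator_def)
    finally show ?thesis by (simp add: set_lebesgue_integral_def)
  qed
  have R: "AE t in lborel. \<forall>e>0. \<exists>d>0. \<forall>h. 0 < h \<and> h < d \<longrightarrow> \<bar>(LINT y:{t..t+h}|lborel. g y) / h - g t\<bar> < e"
    by (rule AE_right_deriv_integral[OF g])
  have L: "AE t in lborel. \<forall>e>0. \<exists>d>0. \<forall>h. 0 < h \<and> h < d \<longrightarrow> \<bar>(LINT y:{t-h..t}|lborel. g y) / h - g t\<bar> < e"
    using AE_lborel_uminus[OF AE_right_deriv_integral[OF gr]] unfolding refl minus_minus .
  from R L show ?thesis
  proof eventually_elim
    case (elim t)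
    show ?case
    proof
      assume t: "t \<in> {a<..<b}"
      let ?I = "\<lambda>s. LINT y:{a..s}|lborel. f y"
      have "((\<lambda>h. (?I (t + h) - ?I t) / h) \<longlongrightarrow> f t) (at 0)"
        unfolding tendsto_iff eventually_at
      proof (intro allI impI)
        fix e :: real assume "e > 0"
        with elim obtain d1 d2 where d: "d1 > 0" "d2 > 0"
          "\<And>h. 0 < h \<Longrightarrow> h < d1 \<Longrightarrow> \<bar>(LINT y:{t..t+h}|lborel. g y) / h - g t\<bar> < e"
          "\<And>h. 0 < h \<Longrightarrow> h < d2 \<Longrightarrow> \<bar>(LINT y:{t-h..t}|lborel. g y) / h - g t\<bar> < e" by metis
        define d where "d = Min {d1, d2, t - a, b - t}"
        have d0: "d > 0" "d \<le> d1" "d \<le> d2" "d \<le> t - a" "d \<le> b - t" using d t by (auto simp: d_def)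
        have "dist ((?I (t + h) - ?I t) / h) (f t) < e" if h: "h \<noteq> 0" "dist h 0 < d" for h
        proof (cases "h > 0")
          case True
          have "?I (t + h) - ?I t = (LINT y:{t..t+h}|lborel. f y)"
            using set_integrable_interval_split[OF f, of t "t + h"] True h d0 t by auto
          also have "\<dots> = (LINT y:{t..t+h}|lborel. g y)" using True h d0 t by (intro *) auto
          finally show ?thesis using d(3)[of h] True h d0 t by (auto simp: dist_real_def g_def)
        next
          case False
          define k where "k = - h"
          have k: "0 < k" "k < d" using False h by (auto simp: k_def)
          have "?I t - ?I (t + h) = (LINT y:{t-k..t}|lborel. f y)"
            using set_integrable_interval_split[OF f, of "t - k" t] k d0 t by (auto simp: k_def)
          also have "\<dots> = (LINT y:{t-k..t}|lborel. g y)" using k d0 t by (intro *) auto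
          finally have "(?I (t + h) - ?I t) / h = (LINT y:{t-k..t}|lborel. g y) / k"
            using k(1) by (simp add: k_def field_simps)
          then show ?thesis using d(4)[of k] k d0 t by (auto simp: dist_real_def g_def)
        qed
        then show "\<exists>d>0. \<forall>h\<in>UNIV. h \<noteq> 0 \<and> dist h 0 < d \<longrightarrow> dist ((?I (t + h) - ?I t) / h) (f t) < e"
          using d0(1) by blast
      qed
      then show "(?I has_real_derivative f t) (at t)"
        by (simp add: DERIV_def)
    qed
  qed
qed

text \<open>
  Adding a steep linear function to the Lipschitz function makes it strictly increasing with
  Lipschitz inverse. The push-forward of Lebesgue measure under the inverse is absolutely continuous
  because Lipschitz maps preserve null sets, so the Radon-Nikodym theorem provides the density.
\<close>

lemma lipschitz_primitive:
  fixes c :: "real \<Rightarrow> real"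
  assumes ab: "a < b" and L: "L-lipschitz_on {a..b} c"
  obtains \<gamma> where "\<gamma> \<in> borel_measurable borel" "\<And>t. \<bar>\<gamma> t\<bar> \<le> L" "primitive_on a b c \<gamma>"
    "AE t in lborel. t \<in> {a<..<b} \<longrightarrow> (c has_real_derivative \<gamma> t) (at t)"
proof -
  \<comment> \<open>extension to the whole line, constant outside the interval\<close>
  define C where "C = (\<lambda>t. c (max a (min b t)))"
  have L0: "L \<ge> 0" using L by (rule lipschitz_on_nonneg)
  have C: "\<bar>C s - C t\<bar> \<le> L * \<bar>s - t\<bar>" for s t
  proof -
    have "dist (C s) (C t) \<le> L * dist (max a (min b s)) (max a (min b t))"
      unfolding C_def by (rule lipschitz_onD[OF L]) (use ab in auto)
    also have "\<dots> \<le> L * \<bar>s - t\<bar>"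
      by (intro mult_left_mono L0) (auto simp: dist_real_def max_def min_def)
    finally show ?thesis by (simp add: dist_real_def)
  qed
  \<comment> \<open>the slopes of \<open>F\<close> lie between \<open>1\<close> and \<open>2 L + 1\<close>\<close>
  define F where "F = (\<lambda>t. C t + (L + 1) * t)"
  have F1: "t - s \<le> F t - F s" if "s \<le> t" for s t
    using C[of t s] that by (auto simp: F_def algebra_simps abs_le_iff)
  have F2: "\<bar>F t - F s\<bar> \<le> (2 * L + 1) * \<bar>t - s\<bar>" for s t
  proof -
    have "\<bar>F t - F s\<bar> \<le> \<bar>C t - C s\<bar> + \<bar>(L + 1) * (t - s)\<bar>" by (simp add: F_def algebra_simps)
    also have "\<bar>(L + 1) * (t - s)\<bar> = (L + 1) * \<bar>t - s\<bar>" using L0 by (simp add: abs_mult)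
    finally show ?thesis using C[of t s] by (simp add: algebra_simps)
  qed
  have lipF: "(2 * L + 1)-lipschitz_on UNIV F"
    using F2 L0 by (intro lipschitz_onI) (auto simp: dist_real_def)
  have contF: "continuous_on S F" for S
    using lipschitz_on_continuous_on[OF lipF] continuous_on_subset by blast
  have injF: "inj F"
  proof (rule injI)
    fix s t assume "F s = F t"
    then show "s = t" using F1[of s t] F1[of t s] by linarith
  qed
  have surjF: "\<exists>t. F t = y" for y
  proof -
    define r where "r = \<bar>y - F 0\<bar>"
    have "F (- r) \<le> y" "y \<le> F r" using F1[of "-r" 0] F1[of 0 r] by (auto simp: r_def)
    then show ?thesis using IVT'[of F "-r" y r] contF by (auto simp: r_def)
  qed
  define G where "G = inv F"
  have GF: "G (F t) = t" for t using injF by (simp add: G_def)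
  have FG: "F (G y) = y" for y using surjF[of y] GF by auto
  have lipG: "1-lipschitz_on UNIV G"
  proof (rule lipschitz_onI)
    fix x y
    have "\<bar>G x - G y\<bar> \<le> \<bar>F (G x) - F (G y)\<bar>"
      using F1[of "G x" "G y"] F1[of "G y" "G x"] by linarith
    then show "dist (G x) (G y) \<le> 1 * dist x y" by (simp add: FG dist_real_def)
  qed simp
  have [measurable]: "G \<in> borel_measurable borel"
    using lipschitz_on_continuous_on[OF lipG] by (rule borel_measurable_continuous_onI)
  have vim: "G -` A = F ` A" for A using GF FG by (auto simp: image_iff) metis
  define \<mu> where "\<mu> = distr lborel borel G"
  have sets\<mu>: "sets \<mu> = sets lborel" by (simp add: \<mu>_def)
  have em: "emeasure \<mu> A = emeasure lborel (F ` A)" if "A \<in> sets borel" for A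
    using that by (simp add: \<mu>_def emeasure_distr vim)
  have ac: "absolutely_continuous lborel \<mu>"
    unfolding absolutely_continuous_def
  proof
    fix A assume A: "A \<in> null_sets (lborel :: real measure)"
    then have Ab: "A \<in> sets borel" by auto
    have "negligible A" using A by (simp add: negligible_iff_null_sets null_sets_completionI)
    then have "negligible (F ` A)"
      by (rule negligible_locally_Lipschitz_image[rotated])
         (use F2 in \<open>auto intro!: exI[of _ UNIV] exI[of _ "2 * L + 1"]\<close>)
    moreover have "F ` A \<in> sets borel" using vim[of A] Ab measurable_sets[of G borel borel A] by auto
    ultimately have "F ` A \<in> null_sets lborel"
      by (simp add: negligible_iff_null_sets null_sets_completion_iff)
    then show "A \<in> null_sets \<mu>" using em[OF Ab] Ab sets\<mu> by (auto simp: null_sets_def)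
  qed
  obtain f where f[measurable]: "f \<in> borel_measurable lborel" and dens: "Nonnegative_Lebesgue_Integration.density lborel f = \<mu>"
    using sigma_finite_measure.Radon_Nikodym[OF lborel.sigma_finite_measure_axioms ac sets\<mu>] by auto
  have nn: "(\<integral>\<^sup>+ y\<in>{s..t}. f y \<partial>lborel) = ennreal (F t - F s)" if st: "s \<le> t" for s t
  proof -
    have "F ` {s..t} = {F s..F t}"
    proof -
      have "y \<in> F ` {s..t}" if y: "y \<in> {F s..F t}" for y
      proof -
        have "s \<le> G y" "G y \<le> t"
          using F1[of "G y" s] F1[of t "G y"] y FG[of y] by (auto intro: leI dest: less_imp_le) 
        then show ?thesis using FG[of y] by (metis atLeastAtMost_iff image_eqI)
      qed
      moreover have "F y \<in> {F s..F t}" if "y \<in> {s..t}" for y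
        using F1[of s y] F1[of y t] that by auto
      ultimately show ?thesis by blast
    qed
    moreover have "F s \<le> F t" using F1[OF st] st by linarith
    moreover have "emeasure (Nonnegative_Lebesgue_Integration.density lborel f) {s..t} = (\<integral>\<^sup>+ y\<in>{s..t}. f y \<partial>lborel)"
      by (simp add: emeasure_density)
    ultimately show ?thesis using em[of "{s..t}"] dens by simp
  qed
  define g where "g = (\<lambda>t. enn2real (f t))"
  have [measurable]: "g \<in> borel_measurable borel" unfolding g_def using f by simp
  have "AE y in lborel. f y * indicator {a..b} y \<noteq> \<infinity>"
    using nn[of a b] ab by (intro nn_integral_noteq_infinite) auto
  then have fin: "AE y in lborel. y \<in> {a..b} \<longrightarrow> ennreal (g y) = f y"
    by eventually_elim (auto simp: g_def less_top)
  have nng: "(\<integral>\<^sup>+ y. ennreal (indicator {a..t} y * g y) \<partial>lborel) = ennreal (F t - F a)" if "t \<in> {a..b}" for t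
  proof -
    have "(\<integral>\<^sup>+ y. ennreal (indicator {a..t} y * g y) \<partial>lborel) = (\<integral>\<^sup>+ y\<in>{a..t}. f y \<partial>lborel)"
      by (intro nn_integral_cong_AE eventually_mono[OF fin]) (use that in \<open>auto simp: indicator_def\<close>)
    then show ?thesis using nn[of a t] that by auto
  qed
  have intg: "set_integrable lborel {a..b} g"
    unfolding set_integrable_def
    by (rule integrableI_nonneg) (use nng[of b] ab in \<open>auto simp: g_def\<close>)
  have Ig: "(LINT y:{a..t}|lborel. g y) = F t - F a" if t: "t \<in> {a..b}" for t
    unfolding set_lebesgue_integral_def
    using nng[OF t] F1[of a t] t
    by (subst integral_eq_nn_integral) (auto simp: g_def)
  define \<gamma>0 where "\<gamma>0 = (\<lambda>t. g t - (L + 1))"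
  have int0: "set_integrable lborel {a..b} \<gamma>0"
    unfolding \<gamma>0_def using intg
    by (intro set_integral_diff) simp_all
  have I0: "(LINT y:{a..t}|lborel. \<gamma>0 y) = c t - c a" if t: "t \<in> {a..b}" for t
  proof -
    have "set_integrable lborel {a..t} g" using intg t by (auto intro: set_integrable_subset)
    then have "(LINT y:{a..t}|lborel. \<gamma>0 y) = F t - F a - (L + 1) * (t - a)"
      using Ig[OF t] t set_integral_const_Icc[of a t "L + 1"] unfolding \<gamma>0_def by (subst set_integral_diff) auto
    then show ?thesis using t ab by (simp add: F_def C_def algebra_simps)
  qed
  have ev: "\<forall>\<^sub>F s in nhds t. s \<in> {a<..<b}" if "t \<in> {a<..<b}" for t
    using that by (intro eventually_nhds_in_open) auto
  have D0: "AE t in lborel. t \<in> {a<..<b} \<longrightarrow> (c has_real_derivative \<gamma>0 t) (at t)"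
    using AE_deriv_integral[OF int0]
  proof eventually_elim
    case (elim t)
    show ?case
    proof
      assume t: "t \<in> {a<..<b}"
      have "((\<lambda>s. (LINT y:{a..s}|lborel. \<gamma>0 y) + c a) has_real_derivative \<gamma>0 t) (at t)"
        using elim t by (auto intro!: derivative_eq_intros)
      then show "(c has_real_derivative \<gamma>0 t) (at t)"
        by (rule has_field_derivative_transform_within_open[where S = "{a<..<b}"])
           (use t I0 in auto)
    qed
  qed
  have bd: "\<bar>d\<bar> \<le> L" if t: "t \<in> {a<..<b}" and D: "(c has_real_derivative d) (at t)" for t d
  proof -
    have "((\<lambda>h. \<bar>(c (t + h) - c t) / h\<bar>) \<longlongrightarrow> \<bar>d\<bar>) (at 0)"
      using D by (intro tendsto_rabs) (simp add: DERIV_def)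
    moreover have "\<forall>\<^sub>F h in at 0. \<bar>(c (t + h) - c t) / h\<bar> \<le> L"
    proof -
      have "\<forall>\<^sub>F h in at 0. h \<noteq> 0 \<and> \<bar>h\<bar> < min (t - a) (b - t)"
        unfolding eventually_at by (rule exI[of _ "min (t - a) (b - t)"]) (use t in auto)
      then show ?thesis
      proof eventually_elim
        case (elim h)
        have "a \<le> t + h" "t + h \<le> b" using t elim by (auto simp: abs_less_iff)
          then have "\<bar>c (t + h) - c t\<bar> \<le> L * \<bar>h\<bar>"
          using lipschitz_onD[OF L, of "t + h" t] t by (auto simp: dist_real_def)
        then show ?case using elim by (simp add: divide_le_eq abs_divide)
      qed
    qed
    ultimately show ?thesis by (intro tendsto_upperbound[of "\<lambda>h. \<bar>(c (t + h) - c t) / h\<bar>"]) auto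
  qed
  \<comment> \<open>truncation changes the density on a null set only, and makes the bound hold everywhere\<close>
  define \<gamma> where "\<gamma> = (\<lambda>t. max (- L) (min L (\<gamma>0 t)))"
  have eq: "AE t in lborel. t \<in> {a<..<b} \<longrightarrow> \<gamma> t = \<gamma>0 t"
    using D0 by eventually_elim (use bd in \<open>fastforce simp: \<gamma>_def abs_le_iff\<close>)
  have eq': "AE t in lborel. t \<in> {a..b} \<longrightarrow> \<gamma> t = \<gamma>0 t"
    using eq AE_lborel_singleton[of a] AE_lborel_singleton[of b] by eventually_elim auto
  have [measurable]: "\<gamma>0 \<in> borel_measurable borel" by (simp add: \<gamma>0_def)
  have m: "\<gamma> \<in> borel_measurable borel" by (simp add: \<gamma>_def)
  show ?thesis
  proof (rule that[OF m])
    show "\<bar>\<gamma> t\<bar> \<le> L" for t using L0 by (auto simp: \<gamma>_def)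
    show "AE t in lborel. t \<in> {a<..<b} \<longrightarrow> (c has_real_derivative \<gamma> t) (at t)"
      using D0 eq by eventually_elim auto
    have "set_integrable lborel {a..b} \<gamma>"
      by (rule set_integrable_bound[OF set_integrable_const_Icc[of a b L]])
         (use m L0 in \<open>auto simp: \<gamma>_def abs_le_iff set_borel_measurable_def\<close>)
    moreover have "(LINT y:{a..t}|lborel. \<gamma> y) = (LINT y:{a..t}|lborel. \<gamma>0 y)" if "t \<in> {a..b}" for t
      by (intro set_lebesgue_integral_cong_AE) (use m that in \<open>auto intro: eventually_mono[OF eq']\<close>)
    ultimately show "primitive_on a b c \<gamma>" using I0 by (simp add: primitive_on_def)
  qed
qed

lemma continuous_on_indefinite_integral:
  fixes f :: "real \<Rightarrow> real"
  assumes f: "set_integrable lborel {a..b} f"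
  shows "continuous_on {a..b} (\<lambda>x. LINT y:{a..x}|lborel. f y)"
proof -
  have c: "continuous_on {a..b} (\<lambda>x. integral {a..x} f)"
    using set_borel_integral_eq_integral(1)[OF f] by (rule indefinite_integral_continuous_1)
  have eq: "integral {a..x} f = (LINT y:{a..x}|lborel. f y)" if "x \<in> {a..b}" for x
    using set_integrable_subset[OF f, of "{a..x}"] that by (intro set_borel_integral_eq_integral(2)[symmetric]) auto
  show ?thesis by (rule continuous_on_eq[OF c eq])
qed

text \<open>
  Rational intervals suffice by continuity of the indefinite integral. This leaves countably many
  conditions, so that they hold simultaneously for almost every value of a parameter.
\<close>

lemma AE_zero_if_integrals_zero:
  fixes f :: "real \<Rightarrow> real"
  assumes f: "set_integrable lborel {a..b} f"
    and z: "\<And>c d. c \<in> \<rat> \<Longrightarrow> d \<in> \<rat> \<Longrightarrow> a < c \<Longrightarrow> c < d \<Longrightarrow> d < b \<Longrightarrow> (LINT y:{c..d}|lborel. f y) = 0"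
  shows "AE t in lborel. t \<in> {a<..<b} \<longrightarrow> f t = 0"
proof (cases "a < b")
  case True
  let ?I = "\<lambda>s. LINT y:{a..s}|lborel. f y"
  have cont: "continuous_on {a<..<b} ?I"
    by (rule continuous_on_subset[OF continuous_on_indefinite_integral[OF f]]) auto
  obtain q where q: "q \<in> \<rat>" "a < q" "q < b" using Rats_dense_in_real[OF True] by blast
  have rat: "?I s = ?I q" if s: "s \<in> \<rat>" "a < s" "s < b" for s
    using set_integrable_interval_split[OF f, of s q] set_integrable_interval_split[OF f, of q s]
      z[of s q] z[of q s] q s by (cases s q rule: linorder_cases) auto
  have const: "?I s = ?I q" if s: "a < s" "s < b" for s
  proof (rule ccontr)
    assume ne: "?I s \<noteq> ?I q"
    have "open ({a<..<b} \<inter> ?I -` (- {?I q}))"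
      by (rule continuous_open_preimage[OF cont]) auto
    moreover have "s \<in> {a<..<b} \<inter> ?I -` (- {?I q})" using s ne by auto
    ultimately obtain e where e: "e > 0" "ball s e \<subseteq> {a<..<b} \<inter> ?I -` (- {?I q})"
      by (meson open_contains_ball)
    obtain p where p: "p \<in> \<rat>" "s < p" "p < s + e" using Rats_dense_in_real[of s "s + e"] e(1) by auto
    then have "p \<in> ball s e" by (auto simp: dist_real_def)
    then have "p \<in> {a<..<b} \<inter> ?I -` (- {?I q})" using e(2) by blast
    then show False using rat[OF p(1)] by auto
  qed
  show ?thesis
    using AE_deriv_integral[OF f]
  proof eventually_elim
    case (elim t)
    show ?case
    proof
      assume t: "t \<in> {a<..<b}"
      then have "((\<lambda>s. ?I q) has_real_derivative f t) (at t)"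
        by (intro has_field_derivative_transform_within_open[OF mp[OF elim t], of "{a<..<b}"]) (use const in auto)
      then show "f t = 0" using DERIV_unique[OF _ DERIV_const] by blast
    qed
  qed
qed auto

lemma primitive_on_integrable: "primitive_on a b f g \<Longrightarrow> set_integrable lborel {a..b} g"
  by (simp add: primitive_on_def)

lemma primitive_on_integral: "primitive_on a b f g \<Longrightarrow> x \<in> {a..b} \<Longrightarrow> (LINT y:{a..x}|lborel. g y) = f x - f a"
  unfolding primitive_on_def by (metis add_diff_cancel_left')

text \<open>
  Fubini's theorem on the triangle \<open>y \<le> z\<close> gives the product rule without any differentiability.
\<close>

lemma primitive_on_mult:
  assumes f: "primitive_on a b f f'" and g: "primitive_on a b g g'"
  shows "primitive_on a b (\<lambda>x. f x * g x) (\<lambda>x. f' x * g x + f x * g' x)"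
proof -
  have if': "set_integrable lborel {a..b} f'" and ig': "set_integrable lborel {a..b} g'"
    using f g primitive_on_integrable by auto
  have cont: "set_integrable lborel {a..b} (\<lambda>x. k' x * h x)"
    if k': "set_integrable lborel {a..b} k'" and h: "primitive_on a b h h'" for h h' k'
  proof -
    have h': "set_integrable lborel {a..b} h'" using h by (rule primitive_on_integrable)
    define B where "B = \<bar>h a\<bar> + (LINT y:{a..b}|lborel. \<bar>h' y\<bar>)"
    have bnd: "\<bar>h x\<bar> \<le> B" if x: "x \<in> {a..b}" for x
    proof -
      have hx: "set_integrable lborel {a..x} h'" using h' x by (auto intro: set_integrable_subset)
      have "\<bar>LINT y:{a..x}|lborel. h' y\<bar> \<le> (LINT y:{a..x}|lborel. \<bar>h' y\<bar>)"
        using set_integral_norm_bound[OF hx] by simp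
      also have "\<dots> \<le> (LINT y:{a..b}|lborel. \<bar>h' y\<bar>)"
        unfolding set_lebesgue_integral_def
        using set_integrable_abs[OF h'] set_integrable_abs[OF hx] x
        by (intro integral_mono) (simp_all add: set_integrable_def indicator_def)
      finally show ?thesis using primitive_on_integral[OF h x] by (simp add: B_def)
    qed
    have "continuous_on {a..b} h"
    proof -
      have ch: "continuous_on {a..b} (\<lambda>x. h a + integral {a..x} h')"
        using set_borel_integral_eq_integral(1)[OF h'] by (intro continuous_intros indefinite_integral_continuous_1)
      have hx: "h a + integral {a..x} h' = h x" if "x \<in> {a..b}" for x
      proof -
        have "set_integrable lborel {a..x} h'" using h' that by (auto intro: set_integrable_subset)
        then show ?thesis using primitive_on_integral[OF h that] set_borel_integral_eq_integral(2)[of "{a..x}" h']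
          by simp
      qed
      show ?thesis by (rule continuous_on_eq[OF ch hx])
    qed
    then have m: "set_borel_measurable lborel {a..b} h"
      using borel_measurable_continuous_on_indicator[of "{a..b}" h] by (simp add: set_borel_measurable_def)
    have "integrable lborel (\<lambda>x. B * (indicator {a..b} x *\<^sub>R k' x))"
      using k' by (auto simp: set_integrable_def)
    then show ?thesis
      unfolding set_integrable_def
    proof (rule Bochner_Integration.integrable_bound)
      have "(\<lambda>x. (indicator {a..b} x *\<^sub>R k' x) * (indicator {a..b} x *\<^sub>R h x)) \<in> borel_measurable lborel"
        using k' m unfolding set_integrable_def set_borel_measurable_def by (intro borel_measurable_times) auto
      also have "(\<lambda>x. (indicator {a..b} x *\<^sub>R k' x) * (indicator {a..b} x *\<^sub>R h x)) = (\<lambda>x. indicator {a..b} x *\<^sub>R (k' x * h x))"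
        by (auto simp: indicator_def)
      finally show "(\<lambda>x. indicator {a..b} x *\<^sub>R (k' x * h x)) \<in> borel_measurable lborel" .
      have "\<bar>k' x * h x\<bar> \<le> \<bar>B * k' x\<bar>" if "x \<in> {a..b}" for x
        using mult_right_mono[OF bnd[OF that], of "\<bar>k' x\<bar>"] bnd[OF that] by (simp add: abs_mult mult.commute)
      then show "AE x in lborel. norm (indicator {a..b} x *\<^sub>R (k' x * h x)) \<le> norm (B * (indicator {a..b} x *\<^sub>R k' x))"
        by (auto simp: indicator_def)
    qed
  qed
  have i1: "set_integrable lborel {a..b} (\<lambda>x. f' x * g x)" by (rule cont[OF if' g])
  have i2: "set_integrable lborel {a..b} (\<lambda>x. f x * g' x)" using cont[OF ig' f] by (simp add: mult.commute)
  have "f x * g x = f a * g a + (LINT y:{a..x}|lborel. f' y * g y + f y * g' y)" if x: "x \<in> {a..b}" for x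
  proof -
    define F where "F = (\<lambda>s. indicator {a..x} s * f' s)"
    define G where "G = (\<lambda>s. indicator {a..x} s * g' s)"
    have F: "integrable lborel F" and G: "integrable lborel G"
      using set_integrable_subset[OF if', of "{a..x}"] set_integrable_subset[OF ig', of "{a..x}"] x
      by (auto simp: F_def G_def set_integrable_def)
    have [measurable]: "F \<in> borel_measurable borel" "G \<in> borel_measurable borel" using F G by auto
    have h: "integrable (lborel \<Otimes>\<^sub>M lborel) (\<lambda>(s,t). F s * G t)"
    proof (rule lborel_pair.Fubini_integrable)
      show "integrable lborel (\<lambda>s. \<integral>t. norm (case (s, t) of (s, t) \<Rightarrow> F s * G t) \<partial>lborel)"
        using F G by (simp add: abs_mult)
    qed (use G in auto)
    have h1: "integrable (lborel \<Otimes>\<^sub>M lborel) (\<lambda>(s,t). if s \<le> t then F s * G t else 0)"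
      by (rule Bochner_Integration.integrable_bound[OF h]) auto
    have h2: "integrable (lborel \<Otimes>\<^sub>M lborel) (\<lambda>(s,t). if t < s then F s * G t else 0)"
      by (rule Bochner_Integration.integrable_bound[OF h]) auto
    have IF: "(LINT s|lborel. (if s \<le> t then F s else 0)) = f t - f a" if t: "t \<in> {a..x}" for t
    proof -
      have "(LINT s|lborel. (if s \<le> t then F s else 0)) = (LINT s:{a..t}|lborel. f' s)"
        unfolding set_lebesgue_integral_def
        by (intro Bochner_Integration.integral_cong) (use t in \<open>auto simp: F_def indicator_def\<close>)
      then show ?thesis using primitive_on_integral[OF f, of t] t x by simp
    qed
    have IG: "(LINT t|lborel. (if t < s then G t else 0)) = g s - g a" if s: "s \<in> {a..x}" for s
    proof -
      have gs: "integrable lborel (\<lambda>t. indicator {a..s} t *\<^sub>R g' t)"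
        using set_integrable_subset[OF ig', of "{a..s}"] s x by (simp add: set_integrable_def)
      have m: "(\<lambda>t. if t < s then G t else 0) \<in> borel_measurable lborel" by measurable
      have "(LINT t|lborel. (if t < s then G t else 0)) = (LINT t:{a..s}|lborel. g' t)"
        unfolding set_lebesgue_integral_def
        by (intro Bochner_Integration.integral_cong_AE borel_measurable_integrable[OF gs] m)
           (use s in \<open>auto simp: G_def indicator_def intro!: eventually_mono[OF AE_lborel_singleton[of s]]\<close>)
      then show ?thesis using primitive_on_integral[OF g, of s] s x by simp
    qed
    have "(LINT s|lborel. F s) * (LINT t|lborel. G t) = (LINT s|lborel. LINT t|lborel. F s * G t)" by simp
    also have "\<dots> = integral\<^sup>L (lborel \<Otimes>\<^sub>M lborel) (\<lambda>(s,t). F s * G t)"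
      using lborel_pair.integral_fst'[OF h] by simp
    also have "\<dots> = integral\<^sup>L (lborel \<Otimes>\<^sub>M lborel) (\<lambda>p. (case p of (s,t) \<Rightarrow> if s \<le> t then F s * G t else 0)
        + (case p of (s,t) \<Rightarrow> if t < s then F s * G t else 0))"
      by (intro Bochner_Integration.integral_cong) auto
    also have "\<dots> = integral\<^sup>L (lborel \<Otimes>\<^sub>M lborel) (\<lambda>(s,t). if s \<le> t then F s * G t else 0)
        + integral\<^sup>L (lborel \<Otimes>\<^sub>M lborel) (\<lambda>(s,t). if t < s then F s * G t else 0)"
      by (rule Bochner_Integration.integral_add[OF h1 h2])
    also have "integral\<^sup>L (lborel \<Otimes>\<^sub>M lborel) (\<lambda>(s,t). if s \<le> t then F s * G t else 0)
        = (LINT t|lborel. LINT s|lborel. (if s \<le> t then F s * G t else 0))"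
      using lborel_pair.integral_snd[OF h1] by simp
    also have "\<dots> = (LINT t|lborel. indicator {a..x} t * ((f t - f a) * g' t))"
    proof (intro Bochner_Integration.integral_cong refl)
      fix t
      have "(LINT s|lborel. (if s \<le> t then F s * G t else 0)) = (LINT s|lborel. (if s \<le> t then F s else 0) * G t)"
        by (intro Bochner_Integration.integral_cong) auto
      also have "\<dots> = (LINT s|lborel. (if s \<le> t then F s else 0)) * G t" by simp
      finally show "(LINT s|lborel. (if s \<le> t then F s * G t else 0)) = indicator {a..x} t * ((f t - f a) * g' t)"
        using IF[of t] by (auto simp: G_def indicator_def)
    qed
    also have "\<dots> = (LINT t:{a..x}|lborel. f t * g' t - f a * g' t)"
      by (simp add: set_lebesgue_integral_def algebra_simps)
    also have "\<dots> = (LINT t:{a..x}|lborel. f t * g' t) - f a * (g x - g a)"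
      using set_integrable_subset[OF ig', of "{a..x}"] set_integrable_subset[OF i2, of "{a..x}"] x primitive_on_integral[OF g x]
      by (subst set_integral_diff) auto
    also have "integral\<^sup>L (lborel \<Otimes>\<^sub>M lborel) (\<lambda>(s,t). if t < s then F s * G t else 0)
        = (LINT s|lborel. LINT t|lborel. (if t < s then F s * G t else 0))"
      using lborel_pair.integral_fst'[OF h2] by simp
    also have "\<dots> = (LINT s|lborel. indicator {a..x} s * (f' s * (g s - g a)))"
    proof (intro Bochner_Integration.integral_cong refl)
      fix s
      have "(LINT t|lborel. (if t < s then F s * G t else 0)) = (LINT t|lborel. F s * (if t < s then G t else 0))"
        by (intro Bochner_Integration.integral_cong) auto
      also have "\<dots> = F s * (LINT t|lborel. (if t < s then G t else 0))" by simp
      finally show "(LINT t|lborel. (if t < s then F s * G t else 0)) = indicator {a..x} s * (f' s * (g s - g a))"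
        using IG[of s] by (auto simp: F_def indicator_def)
    qed
    also have "\<dots> = (LINT s:{a..x}|lborel. f' s * g s - f' s * g a)"
      by (simp add: set_lebesgue_integral_def algebra_simps)
    also have "\<dots> = (LINT s:{a..x}|lborel. f' s * g s) - (f x - f a) * g a"
      using set_integrable_subset[OF if', of "{a..x}"] set_integrable_subset[OF i1, of "{a..x}"] x primitive_on_integral[OF f x]
      by (subst set_integral_diff) auto
    also have "(LINT s|lborel. F s) = f x - f a"
      using primitive_on_integral[OF f x] by (simp add: F_def set_lebesgue_integral_def)
    also have "(LINT s|lborel. G s) = g x - g a"
      using primitive_on_integral[OF g x] by (simp add: G_def set_lebesgue_integral_def)
    finally show ?thesis
      using set_integrable_subset[OF i1, of "{a..x}"] set_integrable_subset[OF i2, of "{a..x}"] x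
      by (subst set_integral_add) (auto simp: algebra_simps)
  qed
  then show ?thesis using i1 i2 unfolding primitive_on_def using set_integral_add(1)[OF i1 i2] by blast
qed

lemma primitive_onI:
  "set_integrable lborel {a..b} g \<Longrightarrow> (\<And>x. x \<in> {a..b} \<Longrightarrow> f x = f a + (LINT y:{a..x}|lborel. g y)) \<Longrightarrow> primitive_on a b f g"
  unfolding primitive_on_def by blast

lemma primitive_on_continuous: assumes "primitive_on a b f g" shows "continuous_on {a..b} f"
proof (rule continuous_on_eq)
  show "continuous_on {a..b} (\<lambda>x. f a + (LINT y:{a..x}|lborel. g y))"
    by (intro continuous_intros continuous_on_indefinite_integral primitive_on_integrable[OF assms])
  show "f a + (LINT y:{a..x}|lborel. g y) = f x" if "x \<in> {a..b}" for x
    using primitive_on_integral[OF assms that] by simp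
qed

lemma primitive_on_indefinite:
  assumes "set_integrable lborel {a..b} g"
  shows "primitive_on a b (\<lambda>x. c + (LINT y:{a..x}|lborel. g y)) g"
proof (rule primitive_onI[OF assms])
  have "(LINT y:{a..a}|lborel. g y) = 0" using set_integral_at_point[of lborel a g] by simp
  then show "c + (LINT y:{a..x}|lborel. g y) = c + (LINT y:{a..a}|lborel. g y) + (LINT y:{a..x}|lborel. g y)" for x
    by simp
qed

lemma primitive_on_const: "primitive_on a b (\<lambda>_. c) (\<lambda>_. 0)"
  by (rule primitive_onI) auto

lemma primitive_on_add:
  assumes "primitive_on a b f f'" "primitive_on a b g g'"
  shows "primitive_on a b (\<lambda>x. f x + g x) (\<lambda>x. f' x + g' x)"
proof (rule primitive_onI)
  have i: "set_integrable lborel {a..b} f'" "set_integrable lborel {a..b} g'"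
    using assms by (auto intro: primitive_on_integrable)
  show "set_integrable lborel {a..b} (\<lambda>x. f' x + g' x)" by (rule set_integral_add(1)[OF i])
  fix x assume x: "x \<in> {a..b}"
  then have "set_integrable lborel {a..x} f'" "set_integrable lborel {a..x} g'"
    by (auto intro: set_integrable_subset[OF i(1)] set_integrable_subset[OF i(2)])
  then have "(LINT y:{a..x}|lborel. f' y + g' y) = (LINT y:{a..x}|lborel. f' y) + (LINT y:{a..x}|lborel. g' y)"
    by (rule set_integral_add(2))
  then show "f x + g x = f a + g a + (LINT y:{a..x}|lborel. f' y + g' y)"
    using primitive_on_integral[OF assms(1) x] primitive_on_integral[OF assms(2) x] by simp
qed

lemma primitive_on_cmult:
  assumes "primitive_on a b f f'" shows "primitive_on a b (\<lambda>x. c * f x) (\<lambda>x. c * f' x)"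
proof (rule primitive_onI)
  show "set_integrable lborel {a..b} (\<lambda>x. c * f' x)" using primitive_on_integrable[OF assms] by simp
  show "c * f x = c * f a + (LINT y:{a..x}|lborel. c * f' y)" if "x \<in> {a..b}" for x
    using primitive_on_integral[OF assms that] by (simp add: right_diff_distrib)
qed

lemma primitive_on_sum:
  "(\<And>i. i \<in> I \<Longrightarrow> primitive_on a b (f i) (f' i)) \<Longrightarrow>
   primitive_on a b (\<lambda>x. \<Sum>i\<in>I. f i x) (\<lambda>x. \<Sum>i\<in>I. f' i x)"
  by (induction I rule: infinite_finite_induct) (auto intro: primitive_on_const primitive_on_add)

lemma primitive_on_cong:
  
  assumes "primitive_on a b f f'" "\<And>x. x \<in> {a..b} \<Longrightarrow> f x = g x" "a \<le> b"
  shows "primitive_on a b g f'"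
proof (rule primitive_onI[OF primitive_on_integrable[OF assms(1)]])
  show "g x = g a + (LINT y:{a..x}|lborel. f' y)" if "x \<in> {a..b}" for x
    using primitive_on_integral[OF assms(1) that] assms(2)[OF that] assms(2)[of a] assms(3) by simp
qed

lemma DERIV_primitive_on:
  assumes "\<And>y. y \<in> {a..b} \<Longrightarrow> (f has_real_derivative f' y) (at y)" "continuous_on {a..b} f'"
  shows "primitive_on a b f f'"
proof (rule primitive_onI)
  show "set_integrable lborel {a..b} f'" by (rule borel_integrable_atLeastAtMost'[OF assms(2)])
  fix x assume x: "x \<in> {a..b}"
  have "(LINT y|lborel. indicator {a..x} y *\<^sub>R f' y) = f x - f a"
    using x assms by (intro integral_FTC_Icc) (auto intro: continuous_on_subset has_field_derivative_at_within simp flip: has_real_derivative_iff_has_vector_derivative)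
  then show "f x = f a + (LINT y:{a..x}|lborel. f' y)" by (simp add: set_lebesgue_integral_def)
qed

section \<open>Smooth cutoff functions\<close>

text \<open>
  Smoothness without the operator \<open>deriv\<close>, so that witnesses for the derivatives can be composed
  and differentiated by rules.
\<close>

primrec differentiable_upto :: "nat \<Rightarrow> (real \<Rightarrow> real) \<Rightarrow> bool" where
  "differentiable_upto 0 f \<longleftrightarrow> True"
| "differentiable_upto (Suc k) f \<longleftrightarrow>
     (\<exists>f'. (\<forall>y. (f has_real_derivative f' y) (at y)) \<and> differentiable_upto k f')"

lemma smooth1_iff: "smooth1 f \<longleftrightarrow> (\<forall>k. differentiable_upto k f)"
proof
  have "\<forall>f. smooth1 f \<longrightarrow> differentiable_upto k f" for k
  proof (induction k)
    case (Suc k)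
    show ?case
    proof (intro allI impI)
      fix f :: "real \<Rightarrow> real" assume f: "smooth1 f"
      then have "smooth1 (deriv f)" unfolding smooth1_def by (metis funpow_Suc_right o_apply)
      moreover have "(f has_real_derivative deriv f y) (at y)" for y
        using f unfolding smooth1_def using DERIV_deriv_iff_field_differentiable by (metis funpow_0)
      ultimately show "differentiable_upto (Suc k) f" using Suc by auto
    qed
  qed auto
  then show "smooth1 f \<Longrightarrow> \<forall>k. differentiable_upto k f" by blast
next
  have *: "\<forall>k. differentiable_upto k ((deriv ^^ j) f)" if "\<forall>k. differentiable_upto k f" for j
  proof (induction j)
    case (Suc j)
    show ?case
    proof
      fix k
      from Suc have "differentiable_upto (Suc k) ((deriv ^^ j) f)" by blast
      then obtain f' where f': "\<And>y. ((deriv ^^ j) f has_real_derivative f' y) (at y)" "differentiable_upto k f'" by auto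
      then have "deriv ((deriv ^^ j) f) = f'" using DERIV_imp_deriv by blast
      then show "differentiable_upto k ((deriv ^^ Suc j) f)" using f'(2) by simp
    qed
  qed (use that in auto)
  assume f: "\<forall>k. differentiable_upto k f"
  show "smooth1 f" unfolding smooth1_def
  proof (intro allI)
    fix k y
    have "differentiable_upto (Suc 0) ((deriv ^^ k) f)" using *[OF f] by blast
    then show "(deriv ^^ k) f field_differentiable at y" by (auto simp: field_differentiable_def)
  qed
qed

lemma smooth1_deriv: "smooth1 f \<Longrightarrow> smooth1 (deriv f)"
  unfolding smooth1_def by (metis funpow_Suc_right o_apply)

lemma smooth1_DERIV: "smooth1 f \<Longrightarrow> (f has_real_derivative deriv f y) (at y)"
  unfolding smooth1_def using DERIV_deriv_iff_field_differentiable by (metis funpow_0)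

lemma smooth1_if_deriv:
  assumes "\<And>y. (f has_real_derivative f' y) (at y)" "smooth1 f'"
  shows "smooth1 f"
  unfolding smooth1_iff
proof
  fix k show "differentiable_upto k f" using assms by (cases k) (auto simp: smooth1_iff)
qed

lemma smooth1_coinduct:
  assumes "S f" and step: "\<And>f. S f \<Longrightarrow> \<exists>f'. S f' \<and> (\<forall>y. (f has_real_derivative f' y) (at y))"
  shows "smooth1 f"
proof -
  have "\<forall>f. S f \<longrightarrow> differentiable_upto k f" for k
    by (induction k) (use step in \<open>auto, blast\<close>)
  then show ?thesis using assms(1) by (auto simp: smooth1_iff)
qed

lemma smooth1_continuous_on: "smooth1 f \<Longrightarrow> continuous_on A f"
  by (rule DERIV_continuous_on) (rule has_field_derivative_at_within, rule smooth1_DERIV)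

lemma smooth1_measurable: "smooth1 f \<Longrightarrow> f \<in> borel_measurable borel"
  by (intro borel_measurable_continuous_onI smooth1_continuous_on)

lemma smooth1_bounded: assumes "smooth1 f" shows "\<exists>B. \<forall>x\<in>{a..b}. \<bar>f x\<bar> \<le> B"
proof -
  have "bounded (f ` {a..b})"
    by (intro compact_imp_bounded compact_continuous_image smooth1_continuous_on assms) auto
  then show ?thesis by (auto simp: bounded_iff)
qed

lemma smooth1_const [intro!, simp]: "smooth1 (\<lambda>_. c)"
proof (rule smooth1_coinduct[of "\<lambda>f. \<exists>c. f = (\<lambda>_. c)"])
  fix f :: "real \<Rightarrow> real" assume "\<exists>c. f = (\<lambda>_. c)"
  then show "\<exists>f'. (\<exists>c. f' = (\<lambda>_. c)) \<and> (\<forall>y. (f has_real_derivative f' y) (at y))"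
    by (intro exI[of _ "\<lambda>_. 0"]) auto
qed blast

lemma smooth1_exp: "smooth1 exp"
  by (rule smooth1_coinduct[of "\<lambda>f. f = exp"]) (auto intro!: derivative_eq_intros)

lemma smooth1_affine [intro!, simp]: "smooth1 (\<lambda>x. c * x + d)"
  by (rule smooth1_if_deriv[of _ "\<lambda>_. c"]) (auto intro!: derivative_eq_intros)

lemma smooth1_cos: "smooth1 cos"
proof (rule smooth1_coinduct[of "\<lambda>f. \<exists>a b. f = (\<lambda>x. a * cos x + b * sin x)"])
  show "\<exists>a b. cos = (\<lambda>x::real. a * cos x + b * sin x)"
    by (intro exI[of _ 1] exI[of _ 0]) simp
  fix f :: "real \<Rightarrow> real" assume "\<exists>a b. f = (\<lambda>x. a * cos x + b * sin x)"
  then obtain a b where f: "f = (\<lambda>x. a * cos x + b * sin x)" by blast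
  let ?f' = "\<lambda>x. b * cos x + (- a) * sin x"
  have "\<forall>y. (f has_real_derivative ?f' y) (at y)"
    unfolding f by (auto intro!: derivative_eq_intros)
  then show "\<exists>f'. (\<exists>a b. f' = (\<lambda>x. a * cos x + b * sin x)) \<and> (\<forall>y. (f has_real_derivative f' y) (at y))"
    by blast
qed

lemma differentiable_upto_Suc: "differentiable_upto (Suc k) f \<Longrightarrow> differentiable_upto k f"
proof (induction k arbitrary: f)
  case (Suc k)
  from Suc.prems obtain f' where
    f': "\<forall>y. (f has_real_derivative f' y) (at y)" "differentiable_upto (Suc k) f'"
    unfolding differentiable_upto.simps(2)[of "Suc k"] by (elim exE conjE)
  show ?case unfolding differentiable_upto.simps(2) using f'(1) Suc.IH[OF f'(2)] by (intro exI[of _ f'] conjI)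
qed simp

lemma differentiable_upto_add:
  "differentiable_upto k f \<Longrightarrow> differentiable_upto k g \<Longrightarrow> differentiable_upto k (\<lambda>x. f x + g x)"
proof (induction k arbitrary: f g)
  case (Suc k)
  then obtain f' g' where
    "\<And>y. (f has_real_derivative f' y) (at y)" "differentiable_upto k f'"
    "\<And>y. (g has_real_derivative g' y) (at y)" "differentiable_upto k g'" by auto
  then show ?case
    using Suc.IH[of f' g'] by (auto intro!: exI[of _ "\<lambda>x. f' x + g' x"] derivative_eq_intros)
qed simp

lemma differentiable_upto_mult:
  "differentiable_upto k f \<Longrightarrow> differentiable_upto k g \<Longrightarrow> differentiable_upto k (\<lambda>x. f x * g x)"
proof (induction k arbitrary: f g)
  case (Suc k)
  then obtain f' g' where *:
    "\<And>y. (f has_real_derivative f' y) (at y)" "differentiable_upto k f'"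
    "\<And>y. (g has_real_derivative g' y) (at y)" "differentiable_upto k g'" by auto
  have "differentiable_upto k f" "differentiable_upto k g" using Suc.prems by (metis differentiable_upto_Suc)+
  then have "differentiable_upto k (\<lambda>x. f' x * g x + f x * g' x)"
    using Suc.IH *(2,4) by (intro differentiable_upto_add) auto
  then show ?case
    using *(1,3) by (auto intro!: exI[of _ "\<lambda>x. f' x * g x + f x * g' x"] derivative_eq_intros)
qed simp

lemma differentiable_upto_compose:
  "differentiable_upto k f \<Longrightarrow> differentiable_upto k g \<Longrightarrow> differentiable_upto k (\<lambda>x. f (g x))"
proof (induction k arbitrary: f g)
  case (Suc k)
  then obtain f' g' where *:
    "\<And>y. (f has_real_derivative f' y) (at y)" "differentiable_upto k f'"
    "\<And>y. (g has_real_derivative g' y) (at y)" "differentiable_upto k g'" by auto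
  have "differentiable_upto k g" using Suc.prems by (metis differentiable_upto_Suc)
  then have "differentiable_upto k (\<lambda>x. f' (g x) * g' x)"
    using Suc.IH *(2,4) by (intro differentiable_upto_mult) auto
  then show ?case
    using DERIV_chain2[OF *(1) *(3)] by (auto intro!: exI[of _ "\<lambda>x. f' (g x) * g' x"])
qed simp

lemma smooth1_add: "smooth1 f \<Longrightarrow> smooth1 g \<Longrightarrow> smooth1 (\<lambda>x. f x + g x)"
  by (simp add: smooth1_iff differentiable_upto_add)

lemma smooth1_mult: "smooth1 f \<Longrightarrow> smooth1 g \<Longrightarrow> smooth1 (\<lambda>x. f x * g x)"
  by (simp add: smooth1_iff differentiable_upto_mult)

lemma smooth1_compose: "smooth1 f \<Longrightarrow> smooth1 g \<Longrightarrow> smooth1 (\<lambda>x. f (g x))"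
  by (simp add: smooth1_iff differentiable_upto_compose)

lemma smooth1_diff: "smooth1 f \<Longrightarrow> smooth1 g \<Longrightarrow> smooth1 (\<lambda>x. f x - g x)"
  using smooth1_add[of f "\<lambda>x. (- 1) * g x"] smooth1_mult[of "\<lambda>_. - 1" g] by simp

text \<open>
  The function \<open>exp (- 1 / t)\<close>, extended by zero to \<open>t \<le> 0\<close>, and its derivatives belong to the
  following family, which is closed under differentiation.
\<close>

definition flat_poly :: "real poly \<Rightarrow> real \<Rightarrow> real" where
  "flat_poly p t = (if t > 0 then poly p (1 / t) * exp (- 1 / t) else 0)"

lemma flat_poly_tendsto_0: "(flat_poly p \<longlongrightarrow> 0) (at_right 0)"
proof -
  have "((\<lambda>s. \<Sum>i\<le>degree p. coeff p i * (s ^ i / exp s)) \<longlongrightarrow> (\<Sum>i\<le>degree p. coeff p i * 0)) at_top"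
    by (intro tendsto_sum tendsto_mult tendsto_const tendsto_power_div_exp_0)
  moreover have "(\<lambda>s. \<Sum>i\<le>degree p. coeff p i * (s ^ i / exp s)) = (\<lambda>s. poly p s * exp (- s))"
    by (auto simp: poly_altdef sum_distrib_right exp_minus divide_inverse mult.assoc)
  ultimately have "((\<lambda>s. poly p s * exp (- s)) \<longlongrightarrow> 0) at_top" by simp
  from filterlim_compose[OF this filterlim_inverse_at_top_right]
  have "((\<lambda>t. poly p (inverse t) * exp (- inverse t)) \<longlongrightarrow> 0) (at_right 0)" .
  then show ?thesis
    by (rule Lim_transform_eventually)
       (auto simp: eventually_at_filter flat_poly_def divide_inverse)
qed

lemma flat_poly_DERIV:
  "(flat_poly p has_real_derivative flat_poly ([:0, 0, 1:] * (p - pderiv p)) t) (at t)"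
proof (cases t "0 :: real" rule: linorder_cases)
  case less
  have "((\<lambda>_. 0) has_real_derivative 0) (at t)" by simp
  then have "(flat_poly p has_real_derivative 0) (at t)"
    by (rule has_field_derivative_transform_within_open[where S = "{..<0}"]) (use less in \<open>auto simp: flat_poly_def\<close>)
  then show ?thesis using less by (simp add: flat_poly_def)
next
  case greater
  have "((\<lambda>t. poly p (1 / t) * exp (- 1 / t)) has_real_derivative flat_poly ([:0, 0, 1:] * (p - pderiv p)) t) (at t)"
    using greater
    by (auto intro!: derivative_eq_intros simp: flat_poly_def field_simps power2_eq_square)
  then show ?thesis
    by (rule has_field_derivative_transform_within_open[where S = "{0<..}"]) (use greater in \<open>auto simp: flat_poly_def\<close>)
next
  case equal
  have "((\<lambda>h. flat_poly p h / h) \<longlongrightarrow> 0) (at 0)"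
    unfolding filterlim_at_split
  proof
    have "((\<lambda>_. 0 :: real) \<longlongrightarrow> 0) (at_left 0)" by simp
    then show "((\<lambda>h. flat_poly p h / h) \<longlongrightarrow> 0) (at_left 0)"
      by (rule Lim_transform_eventually) (auto simp: eventually_at_filter flat_poly_def)
    show "((\<lambda>h. flat_poly p h / h) \<longlongrightarrow> 0) (at_right 0)"
      by (rule Lim_transform_eventually[OF flat_poly_tendsto_0[of "[:0, 1:] * p"]])
         (auto simp: eventually_at_filter flat_poly_def)
  qed
  then show ?thesis using equal by (simp add: DERIV_def flat_poly_def)
qed

definition flat :: "real \<Rightarrow> real" where "flat t = (if t > 0 then exp (- 1 / t) else 0)"

lemma flat_eq: "flat = flat_poly 1" by (auto simp: flat_def flat_poly_def)

lemma smooth1_flat: "smooth1 flat"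
proof (rule smooth1_coinduct[of "\<lambda>f. \<exists>p. f = flat_poly p"])
  show "\<exists>p. flat = flat_poly p" using flat_eq by blast
  fix f assume "\<exists>p. f = flat_poly p"
  then obtain p where "f = flat_poly p" by blast
  then show "\<exists>f'. (\<exists>p. f' = flat_poly p) \<and> (\<forall>y. (f has_real_derivative f' y) (at y))"
    using flat_poly_DERIV[of p] by (intro exI[of _ "flat_poly ([:0, 0, 1:] * (p - pderiv p))"]) blast
qed

lemma flat_deriv_nonneg: "deriv flat t \<ge> 0"
proof -
  have "deriv flat t = flat_poly ([:0, 0, 1:] * (1 - pderiv 1)) t"
    using DERIV_imp_deriv[OF flat_poly_DERIV[of 1 t]] by (simp add: flat_eq)
  then show ?thesis by (simp add: flat_poly_def)
qed

lemma flat_pos: "t > 0 \<Longrightarrow> flat t > 0" and flat_zero: "t \<le> 0 \<Longrightarrow> flat t = 0" and flat_nonneg: "flat t \<ge> 0"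
  by (auto simp: flat_def)

text \<open>
  As \<open>n\<close> grows these functions increase to the indicator of the positive reals; composed with a
  smooth \<open>\<rho>\<close> they approximate the indicator of the open set on which \<open>\<rho>\<close> is positive.
\<close>

definition soft_indicator :: "nat \<Rightarrow> real \<Rightarrow> real" where
  "soft_indicator n z = 1 - exp (- (real n * flat z))"

lemma smooth1_soft_indicator: "smooth1 (soft_indicator n)"
proof -
  have "smooth1 (\<lambda>z. exp (- real n * flat z))"
    by (rule smooth1_compose[OF smooth1_exp smooth1_mult[OF smooth1_const smooth1_flat]])
  then show ?thesis unfolding soft_indicator_def using smooth1_diff[OF smooth1_const] by simp
qed

lemma soft_indicator_nonneg: "soft_indicator n z \<ge> 0"
  and soft_indicator_le_1: "soft_indicator n z \<le> 1"
  and soft_indicator_eq_0: "z \<le> 0 \<Longrightarrow> soft_indicator n z = 0"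
  by (auto simp: soft_indicator_def flat_nonneg flat_zero)

lemma soft_indicator_tendsto: "(\<lambda>n. soft_indicator n z) \<longlonglongrightarrow> (if z > 0 then 1 else 0)"
proof (cases "z > 0")
  case True
  have "filterlim (\<lambda>n. real n * flat z) at_top sequentially"
    using flat_pos[OF True] by (intro filterlim_tendsto_pos_mult_at_top[OF tendsto_const _ filterlim_real_sequentially, THEN filterlim_cong[THEN iffD1, rotated -1]]) (auto simp: mult.commute)
  then have "(\<lambda>n. exp (- (real n * flat z))) \<longlonglongrightarrow> 0"
    by (intro filterlim_compose[OF exp_at_bot]) (simp add: filterlim_uminus_at_bot)
  then have "(\<lambda>n. 1 - exp (- (real n * flat z))) \<longlonglongrightarrow> 1 - 0" by (intro tendsto_diff tendsto_const)
  then show ?thesis using True by (simp add: soft_indicator_def)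
qed (simp add: soft_indicator_eq_0)

lemma soft_indicator_deriv_nonneg: "deriv (soft_indicator n) z \<ge> 0"
proof -
  have "(soft_indicator n has_real_derivative exp (- (real n * flat z)) * (real n * deriv flat z)) (at z)"
    unfolding soft_indicator_def
    by (auto intro!: derivative_eq_intros smooth1_DERIV[OF smooth1_flat])
  then show ?thesis using flat_deriv_nonneg by (simp add: DERIV_imp_deriv)
qed

section \<open>Weak derivatives on the torus\<close>

text \<open>
  The argument of the soft indicator is periodic. On the unit interval it is positive exactly
  between \<open>c\<close> and \<open>d\<close>, because the first cosine is measured from their midpoint.
\<close>

definition torus_bump :: "nat \<Rightarrow> real \<Rightarrow> real \<Rightarrow> real \<Rightarrow> real" where
  "torus_bump n c d x = soft_indicator n (cos (2 * pi * x + - pi * (c + d)) - cos (pi * (d - c)))"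

definition line_bump :: "nat \<Rightarrow> real \<Rightarrow> real \<Rightarrow> real \<Rightarrow> real" where
  "line_bump n c d x = soft_indicator n (x - c) * soft_indicator n (d - x)"

lemma smooth1_torus_bump: "smooth1 (torus_bump n c d)"
  unfolding torus_bump_def
  by (intro smooth1_compose[OF smooth1_soft_indicator] smooth1_diff smooth1_const
        smooth1_compose[OF smooth1_cos] smooth1_affine)

lemma periodic1_torus_bump: "periodic1 (torus_bump n c d)"
proof -
  have "cos (2 * pi * (x + 1) + - pi * (c + d)) = cos (2 * pi * x + - pi * (c + d))" for x
    using cos_periodic[of "2 * pi * x + - pi * (c + d)"] by (simp add: algebra_simps)
  then show ?thesis by (simp add: periodic1_def torus_bump_def)
qed

lemma smooth1_line_bump: "smooth1 (line_bump n c d)"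
proof -
  have "smooth1 (\<lambda>x. soft_indicator n (1 * x + - c) * soft_indicator n ((- 1) * x + d))"
    by (intro smooth1_mult smooth1_compose[OF smooth1_soft_indicator] smooth1_affine)
  then show ?thesis unfolding line_bump_def by (simp add: algebra_simps)
qed

lemma line_bump_eq_0: "x \<notin> {c<..<d} \<Longrightarrow> line_bump n c d x = 0"
  by (auto simp: line_bump_def soft_indicator_eq_0 not_less)

lemma line_bump_bounds: "0 \<le> line_bump n c d x" "line_bump n c d x \<le> 1"
  by (auto simp: line_bump_def soft_indicator_nonneg soft_indicator_le_1 mult_le_one)

lemma torus_bump_bounds: "0 \<le> torus_bump n c d x" "torus_bump n c d x \<le> 1"
  by (auto simp: torus_bump_def soft_indicator_nonneg soft_indicator_le_1)

lemma line_bump_tendsto: "(\<lambda>n. line_bump n c d x) \<longlonglongrightarrow> indicator {c<..<d} x"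
proof -
  have "(\<lambda>n. line_bump n c d x) \<longlonglongrightarrow> (if x - c > 0 then 1 else 0) * (if d - x > 0 then 1 else 0)"
    unfolding line_bump_def by (intro tendsto_mult soft_indicator_tendsto)
  then show ?thesis by (auto simp: indicator_def split: if_splits)
qed

lemma torus_bump_tendsto:
  assumes "0 \<le> c" "c < d" "d \<le> 1" "x \<in> {0..1}"
  shows "(\<lambda>n. torus_bump n c d x) \<longlonglongrightarrow> indicator {c<..<d} x"
proof -
  define r where "r = (d - c) / 2"
  define y where "y = \<bar>x - (c + d) / 2\<bar>"
  have r: "0 < r" "r \<le> 1 / 2" and y: "0 \<le> y" "y \<le> 1 - r"
    using assms by (auto simp: r_def y_def abs_le_iff field_simps)
  have cosy: "cos (2 * pi * x + - pi * (c + d)) = cos (2 * pi * y)"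
  proof -
    have "2 * pi * x + - pi * (c + d) = 2 * pi * y \<or> 2 * pi * x + - pi * (c + d) = - (2 * pi * y)"
      unfolding y_def by (auto simp: abs_if field_simps)
    then show ?thesis by (elim disjE) (simp_all only: cos_minus)
  qed
  have "cos (2 * pi * y) > cos (2 * pi * r) \<longleftrightarrow> y < r"
  proof
    assume "y < r"
    then have "2 * pi * y < 2 * pi * r" "2 * pi * r \<le> pi" using r by auto
    then show "cos (2 * pi * y) > cos (2 * pi * r)" using y by (intro cos_monotone_0_pi) auto
  next
    assume gt: "cos (2 * pi * y) > cos (2 * pi * r)"
    show "y < r"
    proof (rule ccontr)
      assume "\<not> y < r"
      define z where "z = (if y \<le> 1 / 2 then y else 1 - y)"
      have z: "r \<le> z" "z \<le> 1 / 2" using \<open>\<not> y < r\<close> y by (auto simp: z_def)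
      have "cos (2 * pi * z) = cos (2 * pi * y)"
        using cos_2pi_minus[of "2 * pi * y"] by (auto simp: z_def algebra_simps)
      moreover have "cos (2 * pi * z) \<le> cos (2 * pi * r)"
        using z r by (intro cos_monotone_0_pi_le) (auto simp: field_simps)
      ultimately show False using gt by simp
    qed
  qed
  moreover have "y < r \<longleftrightarrow> x \<in> {c<..<d}" by (auto simp: y_def r_def abs_less_iff field_simps)
  moreover have "2 * pi * r = pi * (d - c)" by (simp add: r_def)
  ultimately have "cos (2 * pi * x + - pi * (c + d)) - cos (pi * (d - c)) > 0 \<longleftrightarrow> x \<in> {c<..<d}"
    using cosy by simp
  then show ?thesis
    using soft_indicator_tendsto[of "cos (2 * pi * x + - pi * (c + d)) - cos (pi * (d - c))"]
    by (auto simp: torus_bump_def indicator_def split: if_splits)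
qed

lemma integral_times_approx_indicator:
  fixes K :: "real \<Rightarrow> real"
  assumes K: "set_integrable lborel {a..b} K" and cd: "a \<le> c" "d \<le> b"
    and m: "\<And>n. \<phi> n \<in> borel_measurable borel"
    and bd: "\<And>n x. 0 \<le> \<phi> n x" "\<And>n x. \<phi> n x \<le> (1 :: real)"
    and lim: "\<And>x. x \<in> {a<..<b} \<Longrightarrow> (\<lambda>n. \<phi> n x) \<longlonglongrightarrow> indicator {c<..<d} x"
  shows "(\<lambda>n. LINT x:{a..b}|lborel. K x * \<phi> n x) \<longlonglongrightarrow> (LINT x:{c..d}|lborel. K x)"
proof -
  let ?K = "\<lambda>x. indicator {a..b} x *\<^sub>R K x"
  have iK: "integrable lborel ?K" using K by (simp add: set_integrable_def)
  have "(\<lambda>n. LINT x|lborel. ?K x * \<phi> n x) \<longlonglongrightarrow> (LINT x|lborel. ?K x * indicator {c<..<d} x)"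
  proof (rule integral_dominated_convergence[where w = "\<lambda>x. norm (?K x)"])
    show "AE x in lborel. (\<lambda>n. ?K x * \<phi> n x) \<longlonglongrightarrow> ?K x * indicator {c<..<d} x"
      using AE_lborel_singleton[of a] AE_lborel_singleton[of b]
    proof eventually_elim
      case (elim x)
      then show ?case by (cases "x \<in> {a<..<b}") (intro tendsto_mult_left lim, assumption, auto simp: indicator_def)
    qed
    show "AE x in lborel. norm (?K x * \<phi> n x) \<le> norm (?K x)" for n
      using bd by (auto simp: norm_mult abs_mult intro!: mult_left_le)
  qed (use iK m in \<open>auto intro!: borel_measurable_times borel_measurable_integrable[OF iK]\<close>)
  moreover have "(LINT x|lborel. ?K x * indicator {c<..<d} x) = (LINT x:{c..d}|lborel. K x)"
    unfolding set_lebesgue_integral_def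
  proof (intro Bochner_Integration.integral_cong_AE)
    show "(\<lambda>x. indicator {c..d} x *\<^sub>R K x) \<in> borel_measurable lborel"
      using set_integrable_subset[OF K, of "{c..d}"] cd by (auto simp: set_integrable_def)
    show "AE x in lborel. ?K x * indicator {c<..<d} x = indicator {c..d} x *\<^sub>R K x"
      using AE_lborel_singleton[of c] AE_lborel_singleton[of d]
      by eventually_elim (use cd in \<open>auto simp: indicator_def\<close>)
  qed (use iK in auto)
  ultimately show ?thesis by (simp add: set_lebesgue_integral_def mult.assoc)
qed

text \<open>
  Countably many test functions determine an integrable function: bumps with rational end points
  converge to the indicators of rational intervals.
\<close>

lemma AE_zero_if_torus_moments_zero:
  fixes K :: "real \<Rightarrow> real"
  assumes K: "set_integrable lborel {0..1} K"
    and z: "\<And>n c d. c \<in> \<rat> \<Longrightarrow> d \<in> \<rat> \<Longrightarrow> (LINT x:{0..1}|lborel. K x * torus_bump n c d x) = 0"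
  shows "AE x in lborel. x \<in> {0..1} \<longrightarrow> K x = 0"
proof -
  have "AE x in lborel. x \<in> {0<..<1} \<longrightarrow> K x = 0"
  proof (rule AE_zero_if_integrals_zero[OF K])
    fix c d :: real assume cd: "c \<in> \<rat>" "d \<in> \<rat>" "0 < c" "c < d" "d < 1"
    have "(\<lambda>n. LINT x:{0..1}|lborel. K x * torus_bump n c d x) \<longlonglongrightarrow> (LINT x:{c..d}|lborel. K x)"
      by (rule integral_times_approx_indicator[OF K])
         (use cd torus_bump_bounds torus_bump_tendsto smooth1_measurable[OF smooth1_torus_bump] in auto)
    then show "(LINT x:{c..d}|lborel. K x) = 0"
      using z[OF cd(1,2)] by (simp add: LIMSEQ_const_iff)
  qed
  then show ?thesis
    using AE_lborel_singleton[of 0] AE_lborel_singleton[of 1] by eventually_elim auto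
qed

lemma AE_zero_if_line_moments_zero:
  fixes K :: "real \<Rightarrow> real"
  assumes K: "set_integrable lborel {a..b} K"
    and z: "\<And>n c d. a < c \<Longrightarrow> c < d \<Longrightarrow> d < b \<Longrightarrow> (LINT x:{a..b}|lborel. K x * line_bump n c d x) = 0"
  shows "AE x in lborel. x \<in> {a<..<b} \<longrightarrow> K x = 0"
proof (rule AE_zero_if_integrals_zero[OF K])
  fix c d :: real assume cd: "a < c" "c < d" "d < b"
  have "(\<lambda>n. LINT x:{a..b}|lborel. K x * line_bump n c d x) \<longlonglongrightarrow> (LINT x:{c..d}|lborel. K x)"
    by (rule integral_times_approx_indicator[OF K])
       (use cd line_bump_bounds line_bump_tendsto smooth1_measurable[OF smooth1_line_bump] in auto)
  then show "(LINT x:{c..d}|lborel. K x) = 0"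
    using z[OF cd] by (simp add: LIMSEQ_const_iff)
qed

lemma set_integrable_mult_bounded:
  fixes K :: "real \<Rightarrow> real"
  assumes K: "set_integrable lborel {a..b} K" and m: "set_borel_measurable lborel {a..b} \<phi>"
    and bd: "\<And>x. x \<in> {a..b} \<Longrightarrow> \<bar>\<phi> x\<bar> \<le> B"
  shows "set_integrable lborel {a..b} (\<lambda>x. K x * \<phi> x)"
proof -
  have "integrable lborel (\<lambda>x. B * (indicator {a..b} x *\<^sub>R K x))"
    using K by (auto simp: set_integrable_def)
  then show ?thesis
    unfolding set_integrable_def
  proof (rule Bochner_Integration.integrable_bound)
    have "(\<lambda>x. (indicator {a..b} x *\<^sub>R K x) * (indicator {a..b} x *\<^sub>R \<phi> x)) \<in> borel_measurable lborel"
      using K m unfolding set_integrable_def set_borel_measurable_def by (intro borel_measurable_times) auto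
    also have "(\<lambda>x. (indicator {a..b} x *\<^sub>R K x) * (indicator {a..b} x *\<^sub>R \<phi> x)) = (\<lambda>x. indicator {a..b} x *\<^sub>R (K x * \<phi> x))"
      by (auto simp: indicator_def)
    finally show "(\<lambda>x. indicator {a..b} x *\<^sub>R (K x * \<phi> x)) \<in> borel_measurable lborel" .
    have "\<bar>K x * \<phi> x\<bar> \<le> \<bar>B * K x\<bar>" if "x \<in> {a..b}" for x
      using mult_right_mono[OF bd[OF that], of "\<bar>K x\<bar>"] bd[OF that] by (simp add: abs_mult mult.commute)
    then show "AE x in lborel. norm (indicator {a..b} x *\<^sub>R (K x * \<phi> x)) \<le> norm (B * (indicator {a..b} x *\<^sub>R K x))"
      by (auto simp: indicator_def)
  qed
qed

lemma set_integrable_mult_continuous: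
  fixes K :: "real \<Rightarrow> real"
  assumes "set_integrable lborel {a..b} K" "continuous_on {a..b} \<phi>"
  shows "set_integrable lborel {a..b} (\<lambda>x. K x * \<phi> x)"
proof -
  have "bounded (\<phi> ` {a..b})" by (intro compact_imp_bounded compact_continuous_image assms) auto
  then obtain B where B: "\<forall>x\<in>{a..b}. \<bar>\<phi> x\<bar> \<le> B" by (auto simp: bounded_iff)
  have "set_borel_measurable lborel {a..b} \<phi>"
    using borel_measurable_continuous_on_indicator[of "{a..b}" \<phi>] assms(2) by (simp add: set_borel_measurable_def)
  then show ?thesis using B by (intro set_integrable_mult_bounded[OF assms(1)]) auto
qed

lemma primitive_on_smooth1: "smooth1 \<psi> \<Longrightarrow> primitive_on a b \<psi> (deriv \<psi>)"
  by (intro DERIV_primitive_on smooth1_DERIV smooth1_continuous_on smooth1_deriv)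

lemma primitive_on_by_parts:
  assumes f: "primitive_on a b f f'" and g: "primitive_on a b g g'" and "a \<le> b"
  shows "(LINT x:{a..b}|lborel. f x * g' x) = f b * g b - f a * g a - (LINT x:{a..b}|lborel. f' x * g x)"
proof -
  have "set_integrable lborel {a..b} (\<lambda>x. f' x * g x)"
    by (intro set_integrable_mult_continuous primitive_on_integrable[OF f] primitive_on_continuous[OF g])
  moreover have "set_integrable lborel {a..b} (\<lambda>x. f x * g' x)"
    using set_integrable_mult_continuous[OF primitive_on_integrable[OF g] primitive_on_continuous[OF f]]
    by (simp add: mult.commute)
  ultimately have "(LINT x:{a..b}|lborel. f' x * g x + f x * g' x)
     = (LINT x:{a..b}|lborel. f' x * g x) + (LINT x:{a..b}|lborel. f x * g' x)"
    by (rule set_integral_add(2))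
  then show ?thesis using primitive_on_integral[OF primitive_on_mult[OF f g], of b] assms(3) by simp
qed

lemma smooth_periodic_antiderivative:
  assumes \<phi>: "smooth1 \<phi>" "periodic1 \<phi>" and mean: "(LINT x:{0..1}|lborel. \<phi> x) = 0"
  obtains \<psi> where "smooth1 \<psi>" "periodic1 \<psi>" "deriv \<psi> = \<phi>"
proof -
  have "\<exists>F. \<forall>x::real. (F has_vector_derivative \<phi> x) (at x)"
    using einterval_antiderivative[of "-\<infinity>" "\<infinity>" \<phi>] smooth1_continuous_on[OF \<phi>(1), of UNIV]
    by (auto simp: continuous_on_eq_continuous_at)
  then obtain F where F: "\<And>x. (F has_real_derivative \<phi> x) (at x)"
    by (auto simp: has_real_derivative_iff_has_vector_derivative)
  have sF: "smooth1 F" using smooth1_if_deriv[OF F \<phi>(1)] .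
  have "primitive_on 0 1 F \<phi>" by (intro DERIV_primitive_on F smooth1_continuous_on \<phi>)
  then have F01: "F 1 = F 0" using primitive_on_integral[of 0 1 F \<phi> 1] mean by simp
  have "((\<lambda>x. F (x + 1) - F x) has_real_derivative 0) (at x)" for x
  proof -
    have "((\<lambda>x. F (x + 1)) has_real_derivative \<phi> (x + 1)) (at x)"
      using F[of "x + 1"] by (simp add: DERIV_shift)
    then have "((\<lambda>x. F (x + 1) - F x) has_real_derivative \<phi> (x + 1) - \<phi> x) (at x)"
      by (intro DERIV_diff F)
    then show ?thesis using \<phi>(2) by (simp add: periodic1_def)
  qed
  then have "F (x + 1) - F x = F (0 + 1) - F 0" for x
    using DERIV_isconst_all[of "\<lambda>x. F (x + 1) - F x"] by blast
  then have "periodic1 F" using F01 by (simp add: periodic1_def)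
  moreover have "deriv F = \<phi>" using F DERIV_imp_deriv by blast
  ultimately show ?thesis using that sF by blast
qed

text \<open>
  The lemma of du Bois-Reymond on the torus. A test function minus its mean is the derivative of a
  periodic function.
\<close>

lemma AE_const_if_torus_derivative_moments_zero:
  fixes K :: "real \<Rightarrow> real"
  assumes K: "set_integrable lborel {0..1} K"
    and z: "\<And>\<psi>. smooth1 \<psi> \<Longrightarrow> periodic1 \<psi> \<Longrightarrow> (LINT x:{0..1}|lborel. K x * deriv \<psi> x) = 0"
  shows "AE x in lborel. x \<in> {0..1} \<longrightarrow> K x = (LINT x:{0..1}|lborel. K x)"
proof -
  define \<kappa> where "\<kappa> = (LINT x:{0..1}|lborel. K x)"
  have K': "set_integrable lborel {0..1} (\<lambda>x. K x - \<kappa>)"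
    using K by (intro set_integral_diff) auto
  have "AE x in lborel. x \<in> {0..1} \<longrightarrow> K x - \<kappa> = 0"
  proof (rule AE_zero_if_torus_moments_zero[OF K'])
    fix n c d
    define \<phi> where "\<phi> = torus_bump n c d"
    define \<mu> where "\<mu> = (LINT x:{0..1}|lborel. \<phi> x)"
    have \<phi>: "smooth1 \<phi>" "periodic1 \<phi>" by (simp_all add: \<phi>_def smooth1_torus_bump periodic1_torus_bump)
    have i\<phi>: "set_integrable lborel {0..1} \<phi>"
      by (intro borel_integrable_atLeastAtMost' smooth1_continuous_on \<phi>)
    have "(LINT x:{0..1}|lborel. \<phi> x - \<mu>) = 0"
      using i\<phi> set_integral_const_Icc[of 0 1 \<mu>] by (subst set_integral_diff) (auto simp: \<mu>_def)
    moreover have "smooth1 (\<lambda>x. \<phi> x - \<mu>)" by (intro smooth1_diff \<phi> smooth1_const)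
    moreover have "periodic1 (\<lambda>x. \<phi> x - \<mu>)" using \<phi>(2) by (simp add: periodic1_def)
    ultimately obtain \<psi> where \<psi>: "smooth1 \<psi>" "periodic1 \<psi>" "deriv \<psi> = (\<lambda>x. \<phi> x - \<mu>)"
      using smooth_periodic_antiderivative by metis
    have iK\<phi>: "set_integrable lborel {0..1} (\<lambda>x. K x * \<phi> x)"
      by (intro set_integrable_mult_continuous K smooth1_continuous_on \<phi>)
    have "(LINT x:{0..1}|lborel. K x * \<phi> x) - \<kappa> * \<mu> = (LINT x:{0..1}|lborel. K x * \<phi> x - K x * \<mu>)"
      using iK\<phi> K by (subst set_integral_diff) (auto simp: \<kappa>_def)
    also have "\<dots> = 0" using z[OF \<psi>(1,2)] \<psi>(3) by (simp add: algebra_simps)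
    finally have "(LINT x:{0..1}|lborel. K x * \<phi> x) = \<kappa> * \<mu>" by simp
    moreover have "(LINT x:{0..1}|lborel. K x * \<phi> x - \<kappa> * \<phi> x) = (LINT x:{0..1}|lborel. K x * \<phi> x) - \<kappa> * \<mu>"
      using iK\<phi> i\<phi> by (subst set_integral_diff) (auto simp: \<mu>_def)
    ultimately show "(LINT x:{0..1}|lborel. (K x - \<kappa>) * torus_bump n c d x) = 0"
      by (simp add: algebra_simps flip: \<phi>_def)
  qed
  then show ?thesis by (simp add: \<kappa>_def)
qed

lemma weak_deriv_torus_integrable:
  assumes "weak_deriv_torus f g"
  shows "set_integrable lborel {0..1} f" "set_integrable lborel {0..1} g"
  using assms by (auto simp: weak_deriv_torus_def)

lemma weak_deriv_torus_mean: assumes "weak_deriv_torus f g" shows "(LINT x:{0..1}|lborel. g x) = 0"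
proof -
  have "smooth1 (\<lambda>_. 1) \<and> periodic1 (\<lambda>_::real. 1 :: real)" by (simp add: periodic1_def)
  with assms have "(LINT x:{0..1}|lborel. f x * deriv (\<lambda>_. 1) x) = - (LINT x:{0..1}|lborel. g x * 1)"
    unfolding weak_deriv_torus_def by blast
  then show ?thesis by simp
qed

text \<open>
  The difference of \<open>f\<close> and a primitive of \<open>g\<close> has weak derivative zero. The primitive is
  periodic because a weak derivative has mean zero.
\<close>

lemma weak_deriv_torus_representative:
  assumes fg: "weak_deriv_torus f g"
  obtains \<kappa> where "AE x in lborel. x \<in> {0..1} \<longrightarrow> f x = \<kappa> + (LINT y:{0..x}|lborel. g y)"
proof -
  note i = weak_deriv_torus_integrable[OF fg]
  define P where "P = (\<lambda>x. 0 + (LINT y:{0..x}|lborel. g y))"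
  have P: "primitive_on 0 1 P g" unfolding P_def by (rule primitive_on_indefinite[OF i(2)])
  have P0: "P 0 = 0" "P 1 = 0"
    using weak_deriv_torus_mean[OF fg] set_integral_at_point[of lborel 0 g] by (auto simp: P_def)
  have iP: "set_integrable lborel {0..1} P"
    by (intro borel_integrable_atLeastAtMost' primitive_on_continuous[OF P])
  have "AE x in lborel. x \<in> {0..1} \<longrightarrow> f x - P x = (LINT x:{0..1}|lborel. f x - P x)"
  proof (rule AE_const_if_torus_derivative_moments_zero)
    show "set_integrable lborel {0..1} (\<lambda>x. f x - P x)" by (rule set_integral_diff(1)[OF i(1) iP])
    fix \<psi> :: "real \<Rightarrow> real" assume \<psi>: "smooth1 \<psi>" "periodic1 \<psi>"
    have "(LINT x:{0..1}|lborel. P x * deriv \<psi> x) = - (LINT x:{0..1}|lborel. g x * \<psi> x)"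
      using primitive_on_by_parts[OF P primitive_on_smooth1[OF \<psi>(1)]] P0 by simp
    also have "\<dots> = (LINT x:{0..1}|lborel. f x * deriv \<psi> x)"
      using fg \<psi> by (simp add: weak_deriv_torus_def)
    finally have "(LINT x:{0..1}|lborel. f x * deriv \<psi> x - P x * deriv \<psi> x) = 0"
      by (subst set_integral_diff)
         (auto intro!: set_integrable_mult_continuous i iP smooth1_continuous_on smooth1_deriv \<psi>)
    then show "(LINT x:{0..1}|lborel. (f x - P x) * deriv \<psi> x) = 0" by (simp add: algebra_simps)
  qed
  then have "AE x in lborel. x \<in> {0..1} \<longrightarrow> f x = (LINT x:{0..1}|lborel. f x - P x) + (LINT y:{0..x}|lborel. g y)"
    by eventually_elim (auto simp: P_def)
  then show ?thesis by (rule that)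
qed

text \<open>
  Passing to the absolutely continuous representative extends the integration by parts from smooth
  to absolutely continuous test functions.
\<close>

lemma weak_deriv_torus_test:
  assumes fg: "weak_deriv_torus f g" and \<psi>: "primitive_on 0 1 \<psi> \<gamma>" "\<psi> 1 = \<psi> 0"
  shows "(LINT x:{0..1}|lborel. f x * \<gamma> x) = - (LINT x:{0..1}|lborel. g x * \<psi> x)"
proof -
  obtain \<kappa> where \<kappa>: "AE x in lborel. x \<in> {0..1} \<longrightarrow> f x = \<kappa> + (LINT y:{0..x}|lborel. g y)"
    by (rule weak_deriv_torus_representative[OF fg])
  note i = weak_deriv_torus_integrable[OF fg]
  define P where "P = (\<lambda>x. \<kappa> + (LINT y:{0..x}|lborel. g y))"
  have P: "primitive_on 0 1 P g" unfolding P_def by (rule primitive_on_indefinite[OF i(2)])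
  have P0: "P 1 = P 0"
    using weak_deriv_torus_mean[OF fg] set_integral_at_point[of lborel 0 g] by (auto simp: P_def)
  have iP: "set_integrable lborel {0..1} (\<lambda>x. P x * \<gamma> x)"
    using set_integrable_mult_continuous[OF primitive_on_integrable[OF \<psi>(1)] primitive_on_continuous[OF P]]
    by (simp add: mult.commute)
  have "(LINT x:{0..1}|lborel. f x * \<gamma> x) = (LINT x:{0..1}|lborel. P x * \<gamma> x)"
    unfolding set_lebesgue_integral_def
  proof (rule Bochner_Integration.integral_cong_AE)
    show "(\<lambda>x. indicator {0..1} x *\<^sub>R (P x * \<gamma> x)) \<in> borel_measurable lborel"
      using iP by (auto simp: set_integrable_def)
    have "(\<lambda>x. (indicator {0..1} x *\<^sub>R f x) * (indicator {0..1} x *\<^sub>R \<gamma> x)) \<in> borel_measurable lborel"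
      using i(1) primitive_on_integrable[OF \<psi>(1)]
      by (intro borel_measurable_times) (auto simp: set_integrable_def)
    also have "(\<lambda>x. (indicator {0..1} x *\<^sub>R f x) * (indicator {0..1} x *\<^sub>R \<gamma> x)) = (\<lambda>x. indicator {0..1} x *\<^sub>R (f x * \<gamma> x))"
      by (auto simp: indicator_def)
    finally show "(\<lambda>x. indicator {0..1} x *\<^sub>R (f x * \<gamma> x)) \<in> borel_measurable lborel" .
    show "AE x in lborel. indicator {0..1} x *\<^sub>R (f x * \<gamma> x) = indicator {0..1} x *\<^sub>R (P x * \<gamma> x)"
      using \<kappa> by eventually_elim (auto simp: P_def indicator_def)
  qed
  also have "\<dots> = - (LINT x:{0..1}|lborel. g x * \<psi> x)"
    using primitive_on_by_parts[OF P \<psi>(1)] P0 \<psi>(2) by simp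
  finally show ?thesis .
qed

lemma weak_deriv_torus_unique:
  assumes "weak_deriv_torus f g" "weak_deriv_torus f g'"
  shows "AE x in lborel. x \<in> {0..1} \<longrightarrow> g x = g' x"
proof -
  note i = weak_deriv_torus_integrable(2)[OF assms(1)] weak_deriv_torus_integrable(2)[OF assms(2)]
  have "AE x in lborel. x \<in> {0..1} \<longrightarrow> g x - g' x = 0"
  proof (rule AE_zero_if_torus_moments_zero)
    show "set_integrable lborel {0..1} (\<lambda>x. g x - g' x)" by (rule set_integral_diff(1)[OF i])
    fix n c d
    let ?\<phi> = "torus_bump n c d"
    have "(LINT x:{0..1}|lborel. f x * deriv ?\<phi> x) = - (LINT x:{0..1}|lborel. g x * ?\<phi> x)"
      "(LINT x:{0..1}|lborel. f x * deriv ?\<phi> x) = - (LINT x:{0..1}|lborel. g' x * ?\<phi> x)"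
      using assms smooth1_torus_bump periodic1_torus_bump unfolding weak_deriv_torus_def by blast+
    then have "(LINT x:{0..1}|lborel. g x * ?\<phi> x - g' x * ?\<phi> x) = 0"
      by (subst set_integral_diff)
         (auto intro!: set_integrable_mult_continuous i smooth1_continuous_on smooth1_torus_bump)
    then show "(LINT x:{0..1}|lborel. (g x - g' x) * ?\<phi> x) = 0" by (simp add: algebra_simps)
  qed
  then show ?thesis by simp
qed

lemma weak_deriv_torus_wdx: "weak_deriv_torus f g \<Longrightarrow> weak_deriv_torus f (wdx f)"
  unfolding wdx_def by (rule someI[of "weak_deriv_torus f"])

lemma wdx_AE: "weak_deriv_torus f g \<Longrightarrow> AE x in lborel. x \<in> {0..1} \<longrightarrow> wdx f x = g x"
  using weak_deriv_torus_unique weak_deriv_torus_wdx by blast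

lemma weak_deriv_torus_primitive:
  assumes P: "primitive_on 0 1 P g" "P 1 = P 0" shows "weak_deriv_torus P g"
  unfolding weak_deriv_torus_def
proof (intro conjI allI impI)
  show "set_integrable lborel {0..1} P"
    by (intro borel_integrable_atLeastAtMost' primitive_on_continuous[OF P(1)])
  show "set_integrable lborel {0..1} g" by (rule primitive_on_integrable[OF P(1)])
  fix \<phi> :: "real \<Rightarrow> real" assume \<phi>: "smooth1 \<phi> \<and> periodic1 \<phi>"
  then have "\<phi> (0 + 1) = \<phi> 0" unfolding periodic1_def by blast
  then show "(LINT x:{0..1}|lborel. P x * deriv \<phi> x) = - (LINT x:{0..1}|lborel. g x * \<phi> x)"
    using primitive_on_by_parts[OF P(1) primitive_on_smooth1, of \<phi>] \<phi> P(2) by simp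
qed

lemma weak_deriv_torus_add:
  assumes "weak_deriv_torus f g" "weak_deriv_torus f' g'"
  shows "weak_deriv_torus (\<lambda>x. f x + f' x) (\<lambda>x. g x + g' x)"
  unfolding weak_deriv_torus_def
proof (intro conjI allI impI)
  note i = weak_deriv_torus_integrable[OF assms(1)] weak_deriv_torus_integrable[OF assms(2)]
  show "set_integrable lborel {0..1} (\<lambda>x. f x + f' x)" by (rule set_integral_add(1)[OF i(1,3)])
  show "set_integrable lborel {0..1} (\<lambda>x. g x + g' x)" by (rule set_integral_add(1)[OF i(2,4)])
  fix \<phi> :: "real \<Rightarrow> real" assume \<phi>: "smooth1 \<phi> \<and> periodic1 \<phi>"
  then have c: "continuous_on {0..1} \<phi>" "continuous_on {0..1} (deriv \<phi>)"
    by (auto intro!: smooth1_continuous_on smooth1_deriv)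
  have "(LINT x:{0..1}|lborel. (f x + f' x) * deriv \<phi> x)
      = (LINT x:{0..1}|lborel. f x * deriv \<phi> x) + (LINT x:{0..1}|lborel. f' x * deriv \<phi> x)"
    unfolding distrib_right by (intro set_integral_add(2) set_integrable_mult_continuous i c)
  also have "\<dots> = - ((LINT x:{0..1}|lborel. g x * \<phi> x) + (LINT x:{0..1}|lborel. g' x * \<phi> x))"
    using assms \<phi> unfolding weak_deriv_torus_def by simp
  also have "(LINT x:{0..1}|lborel. g x * \<phi> x) + (LINT x:{0..1}|lborel. g' x * \<phi> x)
      = (LINT x:{0..1}|lborel. (g x + g' x) * \<phi> x)"
    unfolding distrib_right by (intro set_integral_add(2)[symmetric] set_integrable_mult_continuous i c)
  finally show "(LINT x:{0..1}|lborel. (f x + f' x) * deriv \<phi> x) = - (LINT x:{0..1}|lborel. (g x + g' x) * \<phi> x)" .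
qed

lemma weak_deriv_torus_cmult:
  assumes "weak_deriv_torus f g" shows "weak_deriv_torus (\<lambda>x. c * f x) (\<lambda>x. c * g x)"
  using assms by (auto simp: weak_deriv_torus_def mult.assoc)

lemma weak_deriv_torus_diff:
  assumes "weak_deriv_torus f g" "weak_deriv_torus f' g'"
  shows "weak_deriv_torus (\<lambda>x. f x - f' x) (\<lambda>x. g x - g' x)"
  using weak_deriv_torus_add[OF assms(1) weak_deriv_torus_cmult[OF assms(2), of "- 1"]] by simp

lemma set_integral_Ioo_Icc: "(LINT x:{a<..<b}|lborel. f x) = (LINT x:{a..b::real}|lborel. f x :: real)"
  by (rule set_integral_discrete_difference[where X = "{a, b}"]) auto

lemma weak_deriv_on_primitive:
  assumes P: "primitive_on a b P g" and f: "AE x in lborel. x \<in> {a..b} \<longrightarrow> f x = P x"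
    and i_f: "set_integrable lborel {a..b} f" and ab: "a < b"
  shows "weak_deriv_on a b f g"
  unfolding weak_deriv_on_def
proof (intro conjI allI impI)
  fix c d assume cd: "a < c \<and> d < b"
  show "set_integrable lborel {c..d} f" by (rule set_integrable_subset[OF i_f]) (use cd in auto)
  show "set_integrable lborel {c..d} g" by (rule set_integrable_subset[OF primitive_on_integrable[OF P]]) (use cd in auto)
next
  fix \<phi> :: "real \<Rightarrow> real" and c d assume \<phi>: "smooth1 \<phi> \<and> a < c \<and> d < b \<and> (\<forall>x. x \<notin> {c..d} \<longrightarrow> \<phi> x = 0)"
  have z: "\<phi> a = 0" "\<phi> b = 0" using \<phi> by auto
  have iP: "set_integrable lborel {a..b} P"
    by (intro borel_integrable_atLeastAtMost' primitive_on_continuous[OF P])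
  have c: "continuous_on {a..b} (deriv \<phi>)" using \<phi> by (auto intro!: smooth1_continuous_on smooth1_deriv)
  have "(LINT x:{a..b}|lborel. f x * deriv \<phi> x) = (LINT x:{a..b}|lborel. P x * deriv \<phi> x)"
    unfolding set_lebesgue_integral_def
  proof (rule Bochner_Integration.integral_cong_AE)
    show "AE x in lborel. indicator {a..b} x *\<^sub>R (f x * deriv \<phi> x) = indicator {a..b} x *\<^sub>R (P x * deriv \<phi> x)"
      using f by eventually_elim (auto simp: indicator_def)
  qed (use set_integrable_mult_continuous[OF i_f c] set_integrable_mult_continuous[OF iP c] in \<open>simp_all add: set_integrable_def borel_measurable_integrable\<close>)
  also have "\<dots> = - (LINT x:{a..b}|lborel. g x * \<phi> x)"
    using primitive_on_by_parts[OF P primitive_on_smooth1, of \<phi>] \<phi> z ab by simp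
  finally show "(LINT x:{a<..<b}|lborel. f x * deriv \<phi> x) = - (LINT x:{a<..<b}|lborel. g x * \<phi> x)"
    by (simp add: set_integral_Ioo_Icc)
qed

lemma weak_deriv_onD:
  assumes "weak_deriv_on a b f g" "smooth1 \<phi> \<and> a < c \<and> d < b \<and> (\<forall>x. x \<notin> {c..d} \<longrightarrow> \<phi> x = 0)"
  shows "(LINT x:{a<..<b}|lborel. f x * deriv \<phi> x) = - (LINT x:{a<..<b}|lborel. g x * \<phi> x)"
  by (rule mp[OF spec[OF spec[OF spec[OF conjunct2[OF assms(1)[unfolded weak_deriv_on_def]]]]] assms(2)])

text \<open>
  The bumps are supported in smaller intervals, on which both functions are integrable; a countable
  union of these intervals is the whole cell.
\<close>

lemma weak_deriv_on_unique:
  assumes g: "weak_deriv_on a b f g" and g': "weak_deriv_on a b f g'"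
  shows "AE x in lborel. x \<in> {a<..<b} \<longrightarrow> g x = g' x"
proof -
  have main: "AE x in lborel. x \<in> {a'<..<b'} \<longrightarrow> g x - g' x = 0" if ab': "a < a'" "b' < b" for a' b'
  proof (rule AE_zero_if_line_moments_zero)
    have i: "set_integrable lborel {a'..b'} g" "set_integrable lborel {a'..b'} g'"
      using g g' ab' by (auto simp: weak_deriv_on_def)
    show "set_integrable lborel {a'..b'} (\<lambda>x. g x - g' x)" by (rule set_integral_diff(1)[OF i])
    fix n c d assume cd: "a' < c" "c < d" "d < b'"
    let ?\<phi> = "line_bump n c d"
    have supp: "smooth1 ?\<phi> \<and> a < c \<and> d < b \<and> (\<forall>x. x \<notin> {c..d} \<longrightarrow> ?\<phi> x = 0)"
      using cd ab' smooth1_line_bump line_bump_eq_0 by auto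
    have eq: "(LINT x:{a<..<b}|lborel. k x * ?\<phi> x) = (LINT x:{a'..b'}|lborel. k x * ?\<phi> x)" for k :: "real \<Rightarrow> real"
      unfolding set_lebesgue_integral_def
      by (intro Bochner_Integration.integral_cong) (use cd ab' line_bump_eq_0[of _ c d n] in \<open>auto simp: indicator_def\<close>)
    have "(LINT x:{a<..<b}|lborel. g x * ?\<phi> x) = (LINT x:{a<..<b}|lborel. g' x * ?\<phi> x)"
      using weak_deriv_onD[OF g supp] weak_deriv_onD[OF g' supp] by simp
    then have "(LINT x:{a'..b'}|lborel. g x * ?\<phi> x - g' x * ?\<phi> x) = 0"
      unfolding eq by (subst set_integral_diff)
        (auto intro!: set_integrable_mult_continuous i smooth1_continuous_on smooth1_line_bump)
    then show "(LINT x:{a'..b'}|lborel. (g x - g' x) * ?\<phi> x) = 0" by (simp add: algebra_simps)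
  qed
  have "AE x in lborel. \<forall>n::nat. x \<in> {a + 1 / Suc n<..<b - 1 / Suc n} \<longrightarrow> g x - g' x = 0"
    unfolding AE_all_countable by (intro allI main) auto
  then show ?thesis
  proof eventually_elim
    case (elim x)
    show ?case
    proof
      assume x: "x \<in> {a<..<b}"
      then obtain n :: nat where "1 / Suc n < min (x - a) (b - x)"
        using reals_Archimedean[of "min (x - a) (b - x)"] by (auto simp: inverse_eq_divide)
      then have "x \<in> {a + 1 / Suc n<..<b - 1 / Suc n}" using x by auto
      then show "g x = g' x" using elim by auto
    qed
  qed
qed

text \<open>
  A function that agrees almost everywhere with a primitive has its density as weak derivative, and
  the choice made by \<open>wdx_on\<close> can only differ from it on a null set.
\<close>

lemma wdx_on_AE:
  assumes "primitive_on a b P g" "AE x in lborel. x \<in> {a..b} \<longrightarrow> f x = P x"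
    and "set_integrable lborel {a..b} f" "a < b"
  shows "AE x in lborel. x \<in> {a<..<b} \<longrightarrow> wdx_on a b f x = g x"
proof -
  have *: "weak_deriv_on a b f g" by (rule weak_deriv_on_primitive[OF assms])
  have "weak_deriv_on a b f (wdx_on a b f)"
    unfolding wdx_on_def by (rule someI[of "weak_deriv_on a b f", OF *])
  then show ?thesis using weak_deriv_on_unique * by blast
qed

section \<open>Traces\<close>

text \<open>
  An essential limit is unique because the filter of almost every point near \<open>x\<close> is not trivial.
\<close>

lemma AE_nontrivial:
  fixes a b :: real
  assumes "AE x in lborel. x \<in> {a<..<b} \<longrightarrow> P x" "a < b" shows "\<exists>x\<in>{a<..<b}. P x"
proof (rule ccontr)
  assume "\<not> ?thesis"
  then have imp: "(x \<in> {a<..<b} \<longrightarrow> P x) \<Longrightarrow> x \<notin> {a<..<b}" for x by blast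
  have "AE x in lborel. x \<notin> {a<..<b}" by (rule eventually_mono[OF assms(1) imp])
  then have "{a<..<b} \<in> null_sets lborel" by (subst (asm) AE_iff_null_sets[symmetric]) auto
  then show False using assms(2) by (auto simp: null_sets_def)
qed

lemma tr_left_eq:
  fixes f :: "real \<Rightarrow> 'a::t2_space"
  assumes lim: "(F \<longlongrightarrow> l) (at_left x)" and ax: "a < x"
    and eq: "AE y in lborel. y \<in> {a<..<x} \<longrightarrow> f y = F y"
  shows "tr_left f x = l"
proof -
  let ?G = "inf (at_left x) (ae_filter lborel)"
  have "?G \<noteq> bot"
  proof
    assume "?G = bot"
    then have "eventually (\<lambda>_. False) ?G" by simp
    then obtain Q R where Q: "eventually Q (at_left x)" and R: "AE y in lborel. R y" and QR: "\<And>y. Q y \<Longrightarrow> R y \<Longrightarrow> False"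
      unfolding eventually_inf by blast
    obtain b where b: "b < x" "\<And>y. b < y \<Longrightarrow> y < x \<Longrightarrow> Q y"
      using Q unfolding eventually_at_left_field by blast
    have "\<exists>y\<in>{b<..<x}. R y" using R b(1) by (intro AE_nontrivial) auto
    then obtain y where "y \<in> {b<..<x}" "R y" by blast
    then show False using QR[of y] b(2)[of y] by auto
  qed
  moreover have "(f \<longlongrightarrow> l) ?G"
  proof (rule Lim_transform_eventually)
    show "(F \<longlongrightarrow> l) ?G" using lim by (rule tendsto_mono[rotated]) simp
    have ev: "eventually (\<lambda>y. y \<in> {a<..<x}) (at_left x)"
      using ax by (auto simp: eventually_at_left_field)
    show "eventually (\<lambda>y. F y = f y) ?G"
      unfolding eventually_inf
      by (intro exI conjI allI impI, rule ev, rule eq) simp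
  qed
  ultimately show ?thesis unfolding tr_left_def by (intro tendsto_Lim)
qed

lemma tr_right_eq:
  fixes f :: "real \<Rightarrow> 'a::t2_space"
  assumes lim: "(F \<longlongrightarrow> l) (at_right x)" and ax: "x < b"
    and eq: "AE y in lborel. y \<in> {x<..<b} \<longrightarrow> f y = F y"
  shows "tr_right f x = l"
proof -
  let ?G = "inf (at_right x) (ae_filter lborel)"
  have "?G \<noteq> bot"
  proof
    assume "?G = bot"
    then have "eventually (\<lambda>_. False) ?G" by simp
    then obtain Q R where Q: "eventually Q (at_right x)" and R: "AE y in lborel. R y" and QR: "\<And>y. Q y \<Longrightarrow> R y \<Longrightarrow> False"
      unfolding eventually_inf by blast
    obtain b where b: "x < b" "\<And>y. x < y \<Longrightarrow> y < b \<Longrightarrow> Q y"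
      using Q unfolding eventually_at_right_field by blast
    have "\<exists>y\<in>{x<..<b}. R y" using R b(1) by (intro AE_nontrivial) auto
    then obtain y where "y \<in> {x<..<b}" "R y" by blast
    then show False using QR[of y] b(2)[of y] by auto
  qed
  moreover have "(f \<longlongrightarrow> l) ?G"
  proof (rule Lim_transform_eventually)
    show "(F \<longlongrightarrow> l) ?G" using lim by (rule tendsto_mono[rotated]) simp
    have ev: "eventually (\<lambda>y. y \<in> {x<..<b}) (at_right x)"
      using ax by (auto simp: eventually_at_right_field)
    show "eventually (\<lambda>y. F y = f y) ?G"
      unfolding eventually_inf
      by (intro exI conjI allI impI, rule ev, rule eq) simp
  qed
  ultimately show ?thesis unfolding tr_right_def by (intro tendsto_Lim)
qed

section \<open>Integrals over the space-time cylinder\<close>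

lemma set_integrable_Ioo_Icc:
  "set_integrable lborel {a<..<b} f \<longleftrightarrow> set_integrable lborel {a..b::real} (f :: real \<Rightarrow> real)"
  by (rule set_integrable_discrete_difference[where X = "{a, b}"]) auto

lemma in_L1_cyl_iff:
  "in_L1_cyl T f \<longleftrightarrow> integrable (lborel \<Otimes>\<^sub>M lborel)
     (\<lambda>(t, x). indicator {0<..<T} t * (indicator {0<..<1} x * f t x))"
  unfolding in_L1_cyl_def set_integrable_def cyl_def lborel_prod
  by (simp add: indicator_times case_prod_unfold mult.assoc)

lemma in_L1_cyl_slice_AE:
  assumes "in_L1_cyl T f"
  shows "AE t in lborel. t \<in> {0<..<T} \<longrightarrow> set_integrable lborel {0..1} (f t)"
  using lborel_pair.AE_integrable_fst[OF assms[unfolded in_L1_cyl_iff]]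
  unfolding set_integrable_Ioo_Icc[symmetric]
  by eventually_elim (auto simp: set_integrable_def)

text \<open>
  Fubini's theorem for the cylinder, with the time integral outside; null sets allow the passage
  from open to closed intervals.
\<close>

lemma in_L1_cyl_time:
  assumes "in_L1_cyl T f"
  shows "set_integrable lborel {0..T} (\<lambda>t. LINT x:{0..1}|lborel. f t x)"
    and "int_cyl T f = (LINT t:{0..T}|lborel. LINT x:{0..1}|lborel. f t x)"
proof -
  let ?f = "\<lambda>t x. indicator {0<..<T} t * (indicator {0<..<1} x * f t x)"
  note i = assms[unfolded in_L1_cyl_iff]
  have eq: "(LINT x|lborel. ?f t x) = indicator {0<..<T} t * (LINT x:{0..1}|lborel. f t x)" for t
    unfolding set_integral_Ioo_Icc[symmetric] by (simp add: set_lebesgue_integral_def)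
  show "set_integrable lborel {0..T} (\<lambda>t. LINT x:{0..1}|lborel. f t x)"
    using lborel_pair.integrable_fst[OF i] unfolding eq set_integrable_Ioo_Icc[symmetric]
    by (simp add: set_integrable_def)
  have "int_cyl T f = integral\<^sup>L (lborel \<Otimes>\<^sub>M lborel) (\<lambda>(t, x). ?f t x)"
    unfolding int_cyl_def set_lebesgue_integral_def cyl_def lborel_prod
    by (simp add: indicator_times case_prod_unfold mult.assoc)
  also have "\<dots> = (LINT t|lborel. indicator {0<..<T} t * (LINT x:{0..1}|lborel. f t x))"
    using lborel_pair.integral_fst[OF i] unfolding eq by simp
  also have "\<dots> = (LINT t:{0<..<T}|lborel. LINT x:{0..1}|lborel. f t x)"
    by (simp add: set_lebesgue_integral_def)
  finally show "int_cyl T f = (LINT t:{0..T}|lborel. LINT x:{0..1}|lborel. f t x)"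
    by (simp add: set_integral_Ioo_Icc)
qed

lemma in_L1_cyl_space:
  assumes "in_L1_cyl T f"
  shows "set_integrable lborel {0..1} (\<lambda>x. LINT t:{0..T}|lborel. f t x)"
    and "int_cyl T f = (LINT x:{0..1}|lborel. LINT t:{0..T}|lborel. f t x)"
proof -
  let ?f = "\<lambda>t x. indicator {0<..<T} t * (indicator {0<..<1} x * f t x)"
  note i = assms[unfolded in_L1_cyl_iff]
  have eq: "(LINT t|lborel. ?f t x) = indicator {0<..<1} x * (LINT t:{0..T}|lborel. f t x)" for x
    unfolding set_integral_Ioo_Icc[symmetric]
    by (cases "x \<in> {0<..<1}") (simp_all add: set_lebesgue_integral_def)
  show "set_integrable lborel {0..1} (\<lambda>x. LINT t:{0..T}|lborel. f t x)"
    using lborel_pair.integrable_snd[OF i] unfolding eq set_integrable_Ioo_Icc[symmetric]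
    by (simp add: set_integrable_def)
  have "int_cyl T f = integral\<^sup>L (lborel \<Otimes>\<^sub>M lborel) (\<lambda>(t, x). ?f t x)"
    unfolding int_cyl_def set_lebesgue_integral_def cyl_def lborel_prod
    by (simp add: indicator_times case_prod_unfold mult.assoc)
  also have "\<dots> = (LINT x|lborel. indicator {0<..<1} x * (LINT t:{0..T}|lborel. f t x))"
    using lborel_pair.integral_snd[OF i] unfolding eq by simp
  also have "\<dots> = (LINT x:{0<..<1}|lborel. LINT t:{0..T}|lborel. f t x)"
    by (simp add: set_lebesgue_integral_def)
  finally show "int_cyl T f = (LINT x:{0..1}|lborel. LINT t:{0..T}|lborel. f t x)"
    by (simp add: set_integral_Ioo_Icc)
qed

lemma cyl_measurable [measurable]: "cyl T \<in> sets borel"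
  unfolding cyl_def by (intro borel_open open_Times) auto

lemma in_L1_cyl_subset: "in_L1_cyl T f \<Longrightarrow> s \<le> T \<Longrightarrow> in_L1_cyl s f"
  unfolding in_L1_cyl_def by (erule set_integrable_subset) (simp_all, auto simp: cyl_def)

lemma in_L1_cyl_measurable: "in_L1_cyl T f \<Longrightarrow> measurable_cyl T f"
  by (auto simp: in_L1_cyl_def measurable_cyl_def set_integrable_def set_borel_measurable_def)

lemma measurable_cyl_mult:
  assumes "measurable_cyl T f" "measurable_cyl T g"
  shows "measurable_cyl T (\<lambda>t x. f t x * g t x)"
proof -
  have "(\<lambda>z. (indicator (cyl T) z *\<^sub>R f (fst z) (snd z)) * (indicator (cyl T) z *\<^sub>R g (fst z) (snd z))) \<in> borel_measurable lborel"
    using assms by (intro borel_measurable_times) (auto simp: measurable_cyl_def set_borel_measurable_def)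
  also have "(\<lambda>z. (indicator (cyl T) z *\<^sub>R f (fst z) (snd z)) * (indicator (cyl T) z *\<^sub>R g (fst z) (snd z)))
      = (\<lambda>z. indicator (cyl T) z *\<^sub>R (f (fst z) (snd z) * g (fst z) (snd z)))"
    by (auto simp: indicator_def)
  finally show ?thesis by (simp add: measurable_cyl_def set_borel_measurable_def)
qed

lemma in_L1_cyl_mult_bounded:
  assumes f: "in_L1_cyl T f" and g: "measurable_cyl T g"
    and bd: "AE z in lborel. z \<in> cyl T \<longrightarrow> \<bar>g (fst z) (snd z)\<bar> \<le> B"
  shows "in_L1_cyl T (\<lambda>t x. f t x * g t x)"
proof -
  have "integrable lborel (\<lambda>z. B * (indicator (cyl T) z *\<^sub>R f (fst z) (snd z)))"
    using f by (auto simp: in_L1_cyl_def set_integrable_def)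
  then show ?thesis
    unfolding in_L1_cyl_def set_integrable_def
  proof (rule Bochner_Integration.integrable_bound)
    show "(\<lambda>z. indicator (cyl T) z *\<^sub>R (f (fst z) (snd z) * g (fst z) (snd z))) \<in> borel_measurable lborel"
      using measurable_cyl_mult[OF in_L1_cyl_measurable[OF f] g] by (simp add: measurable_cyl_def set_borel_measurable_def)
    show "AE z in lborel. norm (indicator (cyl T) z *\<^sub>R (f (fst z) (snd z) * g (fst z) (snd z))) \<le> norm (B * (indicator (cyl T) z *\<^sub>R f (fst z) (snd z)))"
      using bd
    proof eventually_elim
      case (elim z)
      show ?case
      proof (cases "z \<in> cyl T")
        case True
        then have "\<bar>g (fst z) (snd z)\<bar> \<le> \<bar>B\<bar>" using elim by auto
        then show ?thesis using True mult_right_mono[of "\<bar>g (fst z) (snd z)\<bar>" "\<bar>B\<bar>" "\<bar>f (fst z) (snd z)\<bar>"]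
          by (simp add: abs_mult mult.commute)
      qed simp
    qed
  qed
qed

lemma in_L1_cyl_const: "in_L1_cyl T (\<lambda>_ _. k)"
proof -
  have "emeasure lborel (cyl T) < \<infinity>"
  proof -
    have "bounded (cyl T)" unfolding cyl_def by (intro bounded_Times) auto
    then show ?thesis by (rule emeasure_bounded_finite)
  qed
  then show ?thesis
    unfolding in_L1_cyl_def set_integrable_def
    by (simp add: integrable_indicator_iff)
qed

lemma in_L1_cyl_bounded:
  assumes "measurable_cyl T g" "AE z in lborel. z \<in> cyl T \<longrightarrow> \<bar>g (fst z) (snd z)\<bar> \<le> B"
  shows "in_L1_cyl T g"
  using in_L1_cyl_mult_bounded[OF in_L1_cyl_const[of T 1] assms] by simp

lemma in_L1_cyl_add: "in_L1_cyl T f \<Longrightarrow> in_L1_cyl T g \<Longrightarrow> in_L1_cyl T (\<lambda>t x. f t x + g t x)"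
  unfolding in_L1_cyl_def by (rule set_integral_add(1))

lemma in_L1_cyl_diff: "in_L1_cyl T f \<Longrightarrow> in_L1_cyl T g \<Longrightarrow> in_L1_cyl T (\<lambda>t x. f t x - g t x)"
  unfolding in_L1_cyl_def by (rule set_integral_diff(1))

lemma in_L1_cyl_cmult: "in_L1_cyl T f \<Longrightarrow> in_L1_cyl T (\<lambda>t x. k * f t x)"
  unfolding in_L1_cyl_def by simp

lemma in_L1_cyl_sum: "(\<And>i. i \<in> I \<Longrightarrow> in_L1_cyl T (f i)) \<Longrightarrow> in_L1_cyl T (\<lambda>t x. \<Sum>i\<in>I. f i t x)"
  by (induction I rule: infinite_finite_induct) (auto intro: in_L1_cyl_const in_L1_cyl_add)

lemma int_cyl_add: "in_L1_cyl T f \<Longrightarrow> in_L1_cyl T g \<Longrightarrow> int_cyl T (\<lambda>t x. f t x + g t x) = int_cyl T f + int_cyl T g"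
  unfolding in_L1_cyl_def int_cyl_def by (rule set_integral_add(2))

lemma int_cyl_diff: "in_L1_cyl T f \<Longrightarrow> in_L1_cyl T g \<Longrightarrow> int_cyl T (\<lambda>t x. f t x - g t x) = int_cyl T f - int_cyl T g"
  unfolding in_L1_cyl_def int_cyl_def by (rule set_integral_diff(2))

lemma measurable_cyl_tensor:
  assumes "set_borel_measurable lborel {0..T} \<theta>" "set_borel_measurable lborel {0..1} \<psi>"
  shows "measurable_cyl T (\<lambda>t x. \<theta> t * \<psi> x)"
proof -
  define f where "f = (\<lambda>t. indicator {0..T} t * \<theta> t)"
  define g where "g = (\<lambda>x. indicator {0..1} x * \<psi> x)"
  have [measurable]: "f \<in> borel_measurable borel" "g \<in> borel_measurable borel"
    using assms by (auto simp: set_borel_measurable_def f_def g_def)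
  have "(\<lambda>z :: real \<times> real. indicator (cyl T) z * (f (fst z) * g (snd z))) \<in> borel_measurable (borel \<Otimes>\<^sub>M borel)"
    unfolding cyl_def by measurable
  also have "(\<lambda>z :: real \<times> real. indicator (cyl T) z * (f (fst z) * g (snd z)))
     = (\<lambda>z. indicator (cyl T) z *\<^sub>R (\<theta> (fst z) * \<psi> (snd z)))"
    by (auto simp: indicator_def cyl_def f_def g_def)
  finally show ?thesis by (simp add: measurable_cyl_def set_borel_measurable_def borel_prod)
qed

section \<open>Test functions\<close>

lemma Ck2_tensor: "smooth1 \<theta> \<Longrightarrow> smooth1 \<psi> \<Longrightarrow> Ck2 k (\<lambda>t x. \<theta> t * \<psi> x)"
proof (induction k arbitrary: \<theta> \<psi>)
  case 0
  have "continuous_on UNIV (\<lambda>z. \<theta> (fst z) * \<psi> (snd z))"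
    by (intro continuous_intros continuous_on_compose2[OF smooth1_continuous_on[OF 0(1), of UNIV]]
        continuous_on_compose2[OF smooth1_continuous_on[OF 0(2), of UNIV]]) auto
  then show ?case by simp
next
  case (Suc k)
  show ?case
    unfolding Ck2.simps
    by (intro exI[of _ "\<lambda>t x. deriv \<theta> t * \<psi> x"] exI[of _ "\<lambda>t x. \<theta> t * deriv \<psi> x"] conjI allI Suc.IH
          smooth1_deriv Suc.prems)
       (auto intro!: derivative_eq_intros smooth1_DERIV Suc.prems)
qed

lemma test_fun_tensor:
  assumes "smooth1 \<theta>" "smooth1 \<psi>" "periodic1 \<psi>" "\<tau> < T" "\<And>t. \<tau> \<le> t \<Longrightarrow> \<theta> t = 0"
  shows "test_fun T (\<lambda>t x. \<theta> t * \<psi> x)"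
  using assms Ck2_tensor unfolding test_fun_def smooth2_def periodic1_def by auto

lemma tensor_derivs:
  assumes "smooth1 \<theta>" "smooth1 \<psi>"
  shows "deriv (\<lambda>s. \<theta> s * \<psi> x) t = deriv \<theta> t * \<psi> x" "deriv (\<lambda>y. \<theta> t * \<psi> y) x = \<theta> t * deriv \<psi> x"
  by (auto intro!: DERIV_imp_deriv derivative_eq_intros smooth1_DERIV assms)

text \<open>
  A smooth approximation, from inside, of the indicator of the times before \<open>s\<close>.
\<close>

definition cutoff :: "nat \<Rightarrow> real \<Rightarrow> real \<Rightarrow> real" where
  "cutoff n s t = soft_indicator n (s - t)"

lemma smooth1_cutoff: "smooth1 (cutoff n s)"
  using smooth1_compose[OF smooth1_soft_indicator smooth1_affine[of "-1" s], of n]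
  by (simp add: cutoff_def[abs_def] add.commute)

lemma cutoff_eq_0: "s \<le> t \<Longrightarrow> cutoff n s t = 0"
  and cutoff_nonneg: "0 \<le> cutoff n s t" and cutoff_le_1: "cutoff n s t \<le> 1"
  by (auto simp: cutoff_def soft_indicator_eq_0 soft_indicator_nonneg soft_indicator_le_1)

lemma cutoff_tendsto: "t < s \<Longrightarrow> (\<lambda>n. cutoff n s t) \<longlonglongrightarrow> 1"
  using soft_indicator_tendsto[of "s - t"] by (simp add: cutoff_def)

lemma cutoff_deriv_nonpos: "deriv (cutoff n s) t \<le> 0"
proof -
  have "(cutoff n s has_real_derivative deriv (soft_indicator n) (s - t) * (-1)) (at t)"
    unfolding cutoff_def[abs_def]
    by (rule DERIV_chain2[OF smooth1_DERIV[OF smooth1_soft_indicator]]) (auto intro!: derivative_eq_intros)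
  then show ?thesis using soft_indicator_deriv_nonneg[of n "s - t"] by (simp add: DERIV_imp_deriv)
qed

lemma cutoff_deriv_eq_0: assumes "s < t" shows "deriv (cutoff n s) t = 0"
proof -
  have "((\<lambda>_. 0) has_real_derivative 0) (at t)" by simp
  then have "(cutoff n s has_real_derivative 0) (at t)"
    by (rule has_field_derivative_transform_within_open[where S = "{s<..}"])
       (use assms in \<open>auto simp: cutoff_eq_0\<close>)
  then show ?thesis by (rule DERIV_imp_deriv)
qed

lemma cutoff_deriv_integral:
  assumes "a \<le> b" shows "(LINT t:{a..b}|lborel. deriv (cutoff n s) t) = cutoff n s b - cutoff n s a"
  using primitive_on_integral[OF primitive_on_smooth1[OF smooth1_cutoff], of b a b n s] assms by simp

text \<open>
  The derivative of the cutoff is minus an approximate identity that concentrates at \<open>s\<close> from the left.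
\<close>

lemma cutoff_deriv_approximate_identity:
  assumes A: "continuous_on {0..T} A" and s: "0 < s" "s < T"
  shows "(\<lambda>n. LINT t:{0..T}|lborel. deriv (cutoff n s) t * A t) \<longlonglongrightarrow> - A s"
proof -
  have cont': "continuous_on X (deriv (cutoff n s))" for n X
    by (intro smooth1_continuous_on smooth1_deriv smooth1_cutoff)
  define B where "B = (\<lambda>t. A t - A s)"
  have contB: "continuous_on {0..T} B" unfolding B_def by (intro continuous_intros A)
  have "bounded (B ` {0..T})" by (intro compact_imp_bounded compact_continuous_image contB) auto
  then obtain C where C: "\<forall>t\<in>{0..T}. \<bar>B t\<bar> \<le> C" by (auto simp: bounded_iff)
  have C0: "C \<ge> 0" using C s by force
  have iB: "set_integrable lborel {0..T} (\<lambda>t. deriv (cutoff n s) t * B t)" for n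
    by (intro borel_integrable_atLeastAtMost' continuous_intros cont' contB)
  have "(\<lambda>n. LINT t:{0..T}|lborel. deriv (cutoff n s) t * B t) \<longlonglongrightarrow> 0"
  proof (rule LIMSEQ_I)
    fix e :: real assume e: "e > 0"
    obtain \<delta> where \<delta>: "\<delta> > 0" "\<And>t. t \<in> {0..T} \<Longrightarrow> dist t s < \<delta> \<Longrightarrow> dist (A t) (A s) < e / 2"
      using A[unfolded continuous_on_iff, rule_format, of s "e / 2"] s e by auto
    define r where "r = max 0 (s - \<delta> / 2)"
    have r: "0 \<le> r" "r < s" "s - r < \<delta>" using s \<delta>(1) by (auto simp: r_def)
    have near: "\<bar>B t\<bar> \<le> e / 2" if "t \<in> {r..s}" for t
      using \<delta>(2)[of t] that r s by (auto simp: dist_real_def B_def)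
    have "(\<lambda>n. C * (cutoff n s 0 - cutoff n s r)) \<longlonglongrightarrow> C * (1 - 1)"
      using s r by (intro tendsto_intros cutoff_tendsto) auto
    then obtain N where N: "\<And>n. n \<ge> N \<Longrightarrow> \<bar>C * (cutoff n s 0 - cutoff n s r)\<bar> < e / 2"
      using LIMSEQ_D[of _ 0 "e / 2"] e by fastforce
    have "\<bar>LINT t:{0..T}|lborel. deriv (cutoff n s) t * B t\<bar> < e" if n: "n \<ge> N" for n
    proof -
      let ?w = "\<lambda>t. if t \<le> r then - C * deriv (cutoff n s) t else - (e / 2) * deriv (cutoff n s) t"
      have iw1: "set_integrable lborel {0..r} (\<lambda>t. - C * deriv (cutoff n s) t)"
        "set_integrable lborel {r..T} (\<lambda>t. - (e / 2) * deriv (cutoff n s) t)"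
        by (intro borel_integrable_atLeastAtMost' continuous_intros cont')+
      have i1: "set_integrable lborel {0..r} (\<lambda>t. deriv (cutoff n s) t * B t)"
        "set_integrable lborel {r..T} (\<lambda>t. deriv (cutoff n s) t * B t)"
        using r s by (auto intro: set_integrable_subset[OF iB[of n]])
      have "\<bar>LINT t:{0..r}|lborel. deriv (cutoff n s) t * B t\<bar> \<le> (LINT t:{0..r}|lborel. - C * deriv (cutoff n s) t)"
      proof -
        have "\<bar>LINT t:{0..r}|lborel. deriv (cutoff n s) t * B t\<bar> \<le> (LINT t:{0..r}|lborel. \<bar>deriv (cutoff n s) t * B t\<bar>)"
          using set_integral_norm_bound[OF i1(1)] by simp
        also have "\<dots> \<le> (LINT t:{0..r}|lborel. - C * deriv (cutoff n s) t)"
        proof (rule set_integral_mono[OF set_integrable_abs[OF i1(1)] iw1(1)])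
          fix t assume "t \<in> {0..r}"
          then have "\<bar>B t\<bar> \<le> C" using C r s by auto
          then have "\<bar>deriv (cutoff n s) t\<bar> * \<bar>B t\<bar> \<le> \<bar>deriv (cutoff n s) t\<bar> * C" by (intro mult_left_mono) auto
          then show "\<bar>deriv (cutoff n s) t * B t\<bar> \<le> - C * deriv (cutoff n s) t"
            using cutoff_deriv_nonpos[of n s t] by (simp add: abs_mult mult.commute)
        qed
        finally show ?thesis .
      qed
      also have "(LINT t:{0..r}|lborel. - C * deriv (cutoff n s) t) = C * (cutoff n s 0 - cutoff n s r)"
        by (subst set_integral_mult_right, subst cutoff_deriv_integral) (use r in \<open>auto simp: algebra_simps\<close>)
      finally have b1: "\<bar>LINT t:{0..r}|lborel. deriv (cutoff n s) t * B t\<bar> < e / 2" using N[OF n] by linarith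
      have "\<bar>LINT t:{r..T}|lborel. deriv (cutoff n s) t * B t\<bar> \<le> (LINT t:{r..T}|lborel. - (e / 2) * deriv (cutoff n s) t)"
      proof -
        have "\<bar>LINT t:{r..T}|lborel. deriv (cutoff n s) t * B t\<bar> \<le> (LINT t:{r..T}|lborel. \<bar>deriv (cutoff n s) t * B t\<bar>)"
          using set_integral_norm_bound[OF i1(2)] by simp
        also have "\<dots> \<le> (LINT t:{r..T}|lborel. - (e / 2) * deriv (cutoff n s) t)"
        proof (rule set_integral_mono[OF set_integrable_abs[OF i1(2)] iw1(2)])
          fix t assume t: "t \<in> {r..T}"
          show "\<bar>deriv (cutoff n s) t * B t\<bar> \<le> - (e / 2) * deriv (cutoff n s) t"
          proof (cases "t \<le> s")
            case True
            then have "\<bar>B t\<bar> \<le> e / 2" using near t by auto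
            then have "\<bar>deriv (cutoff n s) t\<bar> * \<bar>B t\<bar> \<le> \<bar>deriv (cutoff n s) t\<bar> * (e / 2)" by (intro mult_left_mono) auto
            then show ?thesis using cutoff_deriv_nonpos[of n s t] by (simp add: abs_mult mult.commute)
          qed (simp add: cutoff_deriv_eq_0)
        qed
        finally show ?thesis .
      qed
      also have "(LINT t:{r..T}|lborel. - (e / 2) * deriv (cutoff n s) t) = e / 2 * (cutoff n s r - cutoff n s T)"
        by (subst set_integral_mult_right, subst cutoff_deriv_integral) (use r s in \<open>auto simp: algebra_simps\<close>)
      also have "\<dots> \<le> e / 2 * 1"
        using cutoff_le_1[of n s r] cutoff_nonneg[of n s T] e by (intro mult_left_mono) auto
      finally have b2: "\<bar>LINT t:{r..T}|lborel. deriv (cutoff n s) t * B t\<bar> \<le> e / 2" by simp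
      show ?thesis using b1 b2 set_integrable_interval_split[OF iB[of n], of r T] r s by auto
    qed
    then show "\<exists>N. \<forall>n\<ge>N. norm ((LINT t:{0..T}|lborel. deriv (cutoff n s) t * B t) - 0) < e" by auto
  qed
  moreover have "(\<lambda>n. A s * (cutoff n s T - cutoff n s 0)) \<longlonglongrightarrow> A s * (0 - 1)"
    using s by (intro tendsto_intros cutoff_tendsto) (simp_all add: cutoff_eq_0)
  ultimately have "(\<lambda>n. (LINT t:{0..T}|lborel. deriv (cutoff n s) t * B t) + A s * (cutoff n s T - cutoff n s 0)) \<longlonglongrightarrow> 0 + A s * (0 - 1)"
    by (rule tendsto_add)
  moreover have "(LINT t:{0..T}|lborel. deriv (cutoff n s) t * A t)
      = (LINT t:{0..T}|lborel. deriv (cutoff n s) t * B t) + A s * (cutoff n s T - cutoff n s 0)" for n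
  proof -
    have i': "set_integrable lborel {0..T} (\<lambda>t. A s * deriv (cutoff n s) t)"
      by (intro borel_integrable_atLeastAtMost' continuous_intros cont')
    have "(LINT t:{0..T}|lborel. deriv (cutoff n s) t * B t) + A s * (cutoff n s T - cutoff n s 0)
        = (LINT t:{0..T}|lborel. deriv (cutoff n s) t * B t) + (LINT t:{0..T}|lborel. A s * deriv (cutoff n s) t)"
      using cutoff_deriv_integral[of 0 T n s] s by simp
    also have "\<dots> = (LINT t:{0..T}|lborel. deriv (cutoff n s) t * B t + A s * deriv (cutoff n s) t)"
      by (rule set_integral_add(2)[symmetric, OF iB i'])
    finally show ?thesis by (simp add: B_def algebra_simps)
  qed
  ultimately show ?thesis by simp
qed

section \<open>Square integrable functions\<close>

lemma set_borel_measurable_mult: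
  fixes f g :: "real \<Rightarrow> real"
  assumes "set_borel_measurable lborel A f" "set_borel_measurable lborel A g"
  shows "set_borel_measurable lborel A (\<lambda>x. f x * g x)"
proof -
  have "(\<lambda>x. (indicator A x *\<^sub>R f x) * (indicator A x *\<^sub>R g x)) \<in> borel_measurable lborel"
    using assms unfolding set_borel_measurable_def by (intro borel_measurable_times)
  also have "(\<lambda>x. (indicator A x *\<^sub>R f x) * (indicator A x *\<^sub>R g x)) = (\<lambda>x. indicator A x *\<^sub>R (f x * g x))"
    by (auto simp: indicator_def)
  finally show ?thesis by (simp add: set_borel_measurable_def)
qed

lemma set_borel_measurable_add:
  fixes f g :: "real \<Rightarrow> real"
  assumes "set_borel_measurable lborel A f" "set_borel_measurable lborel A g"
  shows "set_borel_measurable lborel A (\<lambda>x. f x + g x)"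
  using assms unfolding set_borel_measurable_def by (simp add: distrib_left borel_measurable_add)

lemma L2sq_eq_nn: "L2sq f = (\<integral>\<^sup>+ x. ennreal (indicator {0..1} x * (f x)\<^sup>2) \<partial>lborel)" for f :: "real \<Rightarrow> real"
  unfolding L2sq_on_def by (intro nn_integral_cong) (auto simp: indicator_def)

lemma in_L2_integrable_sq: "in_L2 f \<longleftrightarrow> set_borel_measurable lborel {0..1} f \<and> set_integrable lborel {0..1} (\<lambda>x. (f x)\<^sup>2)"
proof
  assume f: "in_L2 f"
  then have m: "set_borel_measurable lborel {0..1} (\<lambda>x. (f x)\<^sup>2)"
    using set_borel_measurable_mult[of "{0..1}" f f] by (auto simp: in_L2_def power2_eq_square)
  have "set_integrable lborel {0..1} (\<lambda>x. (f x)\<^sup>2)"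
    unfolding set_integrable_def real_scaleR_def
  proof (rule integrableI_nonneg)
    show "(\<integral>\<^sup>+ x. ennreal (indicator {0..1} x * (f x)\<^sup>2) \<partial>lborel) < \<infinity>"
      using f unfolding in_L2_def L2sq_eq_nn by simp
  qed (use m in \<open>auto simp: set_borel_measurable_def\<close>)
  then show "set_borel_measurable lborel {0..1} f \<and> set_integrable lborel {0..1} (\<lambda>x. (f x)\<^sup>2)"
    using f by (simp add: in_L2_def)
next
  assume f: "set_borel_measurable lborel {0..1} f \<and> set_integrable lborel {0..1} (\<lambda>x. (f x)\<^sup>2)"
  then have "integrable lborel (\<lambda>x. indicator {0..1} x * (f x)\<^sup>2)" by (simp add: set_integrable_def)
  then have "L2sq f < \<infinity>" unfolding L2sq_eq_nn by (subst nn_integral_eq_integral) auto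
  then show "in_L2 f" using f by (simp add: in_L2_def)
qed

lemma L2sq_eq: "in_L2 f \<Longrightarrow> L2sq f = ennreal (LINT x:{0..1}|lborel. (f x)\<^sup>2)"
  unfolding L2sq_eq_nn set_lebesgue_integral_def
  by (subst nn_integral_eq_integral) (auto simp: in_L2_integrable_sq set_integrable_def)

lemma in_L2_mult:
  assumes "in_L2 f" "in_L2 g" shows "set_integrable lborel {0..1} (\<lambda>x. f x * g x)"
proof (rule set_integrable_bound)
  show "set_integrable lborel {0..1} (\<lambda>x. (f x)\<^sup>2 + (g x)\<^sup>2)"
    using assms by (intro set_integral_add(1)) (auto simp: in_L2_integrable_sq)
  show "set_borel_measurable lborel {0..1} (\<lambda>x. f x * g x)"
    using assms by (intro set_borel_measurable_mult) (auto simp: in_L2_def)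
  have "\<bar>f x * g x\<bar> \<le> (f x)\<^sup>2 + (g x)\<^sup>2" for x
  proof -
    have "2 * (\<bar>f x\<bar> * \<bar>g x\<bar>) \<le> (f x)\<^sup>2 + (g x)\<^sup>2"
      using sum_squares_bound[of "\<bar>f x\<bar>" "\<bar>g x\<bar>"] by simp
    moreover have "0 \<le> \<bar>f x\<bar> * \<bar>g x\<bar>" by simp
    ultimately show ?thesis unfolding abs_mult by linarith
  qed
  then show "AE x in lborel. x \<in> {0..1} \<longrightarrow> norm (f x * g x) \<le> norm ((f x)\<^sup>2 + (g x)\<^sup>2)" by simp
qed

lemma in_L2_cmult: "in_L2 f \<Longrightarrow> in_L2 (\<lambda>x. c * f x)"
  using set_borel_measurable_mult[of "{0..1}" "\<lambda>_. c" f]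
  by (auto simp: in_L2_integrable_sq power_mult_distrib set_borel_measurable_def)

lemma in_L2_add: assumes "in_L2 f" "in_L2 g" shows "in_L2 (\<lambda>x. f x + g x)"
proof -
  have "set_integrable lborel {0..1} (\<lambda>x. ((f x)\<^sup>2 + (g x)\<^sup>2) + 2 * (f x * g x))"
    using assms in_L2_mult[OF assms] by (intro set_integral_add(1)) (auto simp: in_L2_integrable_sq)
  moreover have "(\<lambda>x. ((f x)\<^sup>2 + (g x)\<^sup>2) + 2 * (f x * g x)) = (\<lambda>x. (f x + g x)\<^sup>2)"
    by (auto simp: power2_sum)
  ultimately show ?thesis
    using assms set_borel_measurable_add[of "{0..1}" f g] by (simp add: in_L2_integrable_sq)
qed

lemma in_L2_diff: "in_L2 f \<Longrightarrow> in_L2 g \<Longrightarrow> in_L2 (\<lambda>x. f x - g x)"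
  using in_L2_add[OF _ in_L2_cmult[of g "-1"], of f] by simp

lemma in_L2_continuous: "continuous_on {0..1} f \<Longrightarrow> in_L2 f"
  using borel_measurable_continuous_on_indicator[of "{0..1}" f]
  by (auto simp: in_L2_integrable_sq set_borel_measurable_def intro!: borel_integrable_atLeastAtMost' continuous_intros)

lemma in_L2_integrable: "in_L2 f \<Longrightarrow> set_integrable lborel {0..1} f"
  using in_L2_mult[of f "\<lambda>_. 1"] in_L2_continuous[of "\<lambda>_. 1"] by simp

lemma in_L2_bounded:
  assumes "set_borel_measurable lborel {0..1} f" "\<And>x. x \<in> {0..1} \<Longrightarrow> \<bar>f x\<bar> \<le> B"
  shows "in_L2 f"
proof -
  have "set_integrable lborel {0..1} (\<lambda>x. (f x)\<^sup>2)"
  proof (rule set_integrable_bound)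
    show "set_integrable lborel {0..1} (\<lambda>x::real. B\<^sup>2)" by simp
    show "set_borel_measurable lborel {0..1} (\<lambda>x. (f x)\<^sup>2)"
      using set_borel_measurable_mult[OF assms(1,1)] by (simp add: power2_eq_square)
    have "(f x)\<^sup>2 \<le> B\<^sup>2" if "x \<in> {0..1}" for x
      using power_mono[OF assms(2)[OF that], of 2] by simp
    then show "AE x in lborel. x \<in> {0..1} \<longrightarrow> norm ((f x)\<^sup>2) \<le> norm (B\<^sup>2)" by auto
  qed
  then show ?thesis using assms(1) by (simp add: in_L2_integrable_sq)
qed

section \<open>Conservation laws integrated in time\<close>

lemma continuous_on_closed_interval_eq_0:
  fixes Z :: "real \<Rightarrow> real"
  assumes "0 < T" "continuous_on {0..T} Z" "\<And>s. 0 < s \<Longrightarrow> s < T \<Longrightarrow> Z s = 0" "s \<in> {0..T}"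
  shows "Z s = 0"
  using continuous_constant_on_closure[of "{0<..<T}" Z 0 s] assms by (simp add: closure_greaterThanLessThan)

lemma continuous_on_closed_interval_le:
  fixes Z :: "real \<Rightarrow> real"
  assumes "0 < T" "continuous_on {0..T} Z" "\<And>s. 0 < s \<Longrightarrow> s < T \<Longrightarrow> Z s \<le> c" "s \<in> {0..T}"
  shows "Z s \<le> c"
  using continuous_le_on_closure[of "{0<..<T}" Z s c] assms by (simp add: closure_greaterThanLessThan)

lemma measurable_cyl_smooth_tensor:
  "smooth1 \<theta> \<Longrightarrow> smooth1 \<psi> \<Longrightarrow> measurable_cyl T (\<lambda>t x. \<theta> t * \<psi> x)"
  by (intro measurable_cyl_tensor) (auto simp: set_borel_measurable_def dest!: smooth1_measurable)

lemma in_L1_cyl_times_tensor: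
  assumes f: "in_L1_cyl T f" and "smooth1 \<theta>" "smooth1 \<psi>"
  shows "in_L1_cyl T (\<lambda>t x. \<theta> t * \<psi> x * f t x)"
proof -
  obtain B where B: "\<forall>t\<in>{0..T}. \<bar>\<theta> t\<bar> \<le> B" using smooth1_bounded[OF assms(2)] by blast
  obtain C where C: "\<forall>x\<in>{0..1}. \<bar>\<psi> x\<bar> \<le> C" using smooth1_bounded[OF assms(3)] by blast
  have "in_L1_cyl T (\<lambda>t x. f t x * (\<theta> t * \<psi> x))"
  proof (rule in_L1_cyl_mult_bounded[OF f measurable_cyl_smooth_tensor[OF assms(2,3)]])
    have "\<bar>\<theta> t * \<psi> x\<bar> \<le> B * C" if "(t, x) \<in> cyl T" for t x
    proof -
      have "\<bar>\<theta> t\<bar> \<le> B" "\<bar>\<psi> x\<bar> \<le> C" using that B C by (auto simp: cyl_def)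
      then show ?thesis unfolding abs_mult by (intro mult_mono) auto
    qed
    then show "AE z in lborel. z \<in> cyl T \<longrightarrow> \<bar>\<theta> (fst z) * \<psi> (snd z)\<bar> \<le> B * C" by (auto simp: prod_eq_iff)
  qed
  then show ?thesis by (simp add: mult.commute)
qed

lemma int_cyl_tensor:
  assumes "in_L1_cyl T f" "smooth1 \<theta>" "smooth1 \<psi>"
  shows "int_cyl T (\<lambda>t x. \<theta> t * \<psi> x * f t x) = (LINT t:{0..T}|lborel. \<theta> t * (LINT x:{0..1}|lborel. f t x * \<psi> x))"
proof -
  have "(LINT x:{0..1}|lborel. \<theta> t * \<psi> x * f t x) = \<theta> t * (LINT x:{0..1}|lborel. f t x * \<psi> x)" for t
    by (subst set_integral_mult_right[symmetric]) (simp add: ac_simps)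
  then show ?thesis using in_L1_cyl_time(2)[OF in_L1_cyl_times_tensor[OF assms]] by simp
qed

lemma time_integrable_smooth:
  assumes "in_L1_cyl T f" "smooth1 \<psi>"
  shows "set_integrable lborel {0..T} (\<lambda>t. LINT x:{0..1}|lborel. f t x * \<psi> x)"
proof -
  have "in_L1_cyl T (\<lambda>t x. f t x * \<psi> x)"
    using in_L1_cyl_times_tensor[OF assms(1) smooth1_const[of 1] assms(2)] by (simp add: mult.commute)
  then show ?thesis by (rule in_L1_cyl_time(1))
qed

lemma cutoff_integral_tendsto:
  assumes K: "set_integrable lborel {0..T} K" and s: "0 < s" "s < T"
  shows "(\<lambda>n. LINT t:{0..T}|lborel. cutoff n s t * K t) \<longlonglongrightarrow> (LINT t:{0..s}|lborel. K t)"
proof -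
  have "(\<lambda>n. LINT t:{0..T}|lborel. K t * cutoff n s t) \<longlonglongrightarrow> (LINT t:{0..s}|lborel. K t)"
  proof (rule integral_times_approx_indicator[OF K])
    fix t assume "t \<in> {0<..<T}"
    then show "(\<lambda>n. cutoff n s t) \<longlonglongrightarrow> indicator {0<..<s} t"
      using cutoff_tendsto[of t s] cutoff_eq_0[of s t] by (cases "t < s") auto
  qed (use s cutoff_nonneg cutoff_le_1 smooth1_measurable[OF smooth1_cutoff] in auto)
  then show ?thesis by (simp add: mult.commute)
qed

text \<open>
  Testing with a cutoff in time times a spatial function, and letting the cutoff approach the
  indicator of the times before \<open>s\<close>, evaluates the weakly continuous density \<open>a\<close> at time \<open>s\<close>.
  The end points \<open>s = 0\<close> and \<open>s = T\<close> follow by weak continuity.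
\<close>

lemma conservation_law_integrated:
  assumes T: "0 < T" and a: "in_L1_cyl T a" "weakly_continuous_L2 T a" and f: "in_L1_cyl T f"
    and a0: "in_L2 a0"
    and weak: "\<And>\<phi>. test_fun T \<phi> \<Longrightarrow>
          int_cyl T (\<lambda>t x. dt \<phi> t x * a t x - dx \<phi> t x * f t x) + (LINT x:{0..1}|lborel. a0 x * \<phi> 0 x) = 0"
    and s: "s \<in> {0..T}"
  shows "weak_deriv_torus (\<lambda>x. LINT t:{0..s}|lborel. f t x) (\<lambda>x. a s x - a0 x)"
  unfolding weak_deriv_torus_def
proof (intro conjI allI impI)
  have as: "in_L2 (a t)" if "t \<in> {0..T}" for t using a(2) that by (simp add: weakly_continuous_L2_def)
  show "set_integrable lborel {0..1} (\<lambda>x. a s x - a0 x)"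
    by (intro in_L2_integrable in_L2_diff as s a0)
  have fs: "in_L1_cyl r f" if "r \<in> {0..T}" for r using in_L1_cyl_subset[OF f] that by auto
  show "set_integrable lborel {0..1} (\<lambda>x. LINT t:{0..s}|lborel. f t x)"
    by (rule in_L1_cyl_space(1)[OF fs[OF s]])
  fix \<psi> :: "real \<Rightarrow> real" assume "smooth1 \<psi> \<and> periodic1 \<psi>"
  then have \<psi>: "smooth1 \<psi>" "periodic1 \<psi>" "smooth1 (deriv \<psi>)" by (auto intro: smooth1_deriv)
  have L2\<psi>: "in_L2 \<psi>" by (intro in_L2_continuous smooth1_continuous_on \<psi>)
  define A where "A = (\<lambda>t. LINT x:{0..1}|lborel. a t x * \<psi> x)"
  define K where "K = (\<lambda>t. LINT x:{0..1}|lborel. f t x * deriv \<psi> x)"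
  define A0 where "A0 = (LINT x:{0..1}|lborel. a0 x * \<psi> x)"
  have contA: "continuous_on {0..T} A"
    using a(2) L2\<psi> by (simp add: weakly_continuous_L2_def A_def)
  have iK: "set_integrable lborel {0..T} K" unfolding K_def by (rule time_integrable_smooth[OF f \<psi>(3)])
  have inner: "A r + (LINT t:{0..r}|lborel. K t) - A0 = 0" if r: "0 < r" "r < T" for r
  proof -
    have eq: "(LINT t:{0..T}|lborel. deriv (cutoff n r) t * A t) - (LINT t:{0..T}|lborel. cutoff n r t * K t)
        + cutoff n r 0 * A0 = 0" for n
    proof -
      have sm: "smooth1 (cutoff n r)" "smooth1 (deriv (cutoff n r))"
        by (auto intro: smooth1_cutoff smooth1_deriv)
      have "test_fun T (\<lambda>t x. cutoff n r t * \<psi> x)"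
        by (rule test_fun_tensor[OF sm(1) \<psi>(1,2) r(2)]) (simp add: cutoff_eq_0)
      from weak[OF this] have "int_cyl T (\<lambda>t x. deriv (cutoff n r) t * \<psi> x * a t x - cutoff n r t * deriv \<psi> x * f t x)
          + (LINT x:{0..1}|lborel. a0 x * (cutoff n r 0 * \<psi> x)) = 0"
        by (simp add: tensor_derivs[OF sm(1) \<psi>(1)])
      also have "(LINT x:{0..1}|lborel. a0 x * (cutoff n r 0 * \<psi> x)) = cutoff n r 0 * A0"
        unfolding A0_def by (subst set_integral_mult_right[symmetric]) (simp add: ac_simps)
      also have "int_cyl T (\<lambda>t x. deriv (cutoff n r) t * \<psi> x * a t x - cutoff n r t * deriv \<psi> x * f t x)
          = (LINT t:{0..T}|lborel. deriv (cutoff n r) t * A t) - (LINT t:{0..T}|lborel. cutoff n r t * K t)"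
        unfolding A_def K_def
        by (subst int_cyl_diff) (auto intro!: in_L1_cyl_times_tensor a f sm \<psi> simp: int_cyl_tensor a f sm \<psi>)
      finally show ?thesis .
    qed
    have "(\<lambda>n. (LINT t:{0..T}|lborel. deriv (cutoff n r) t * A t) - (LINT t:{0..T}|lborel. cutoff n r t * K t)
        + cutoff n r 0 * A0) \<longlonglongrightarrow> - A r - (LINT t:{0..r}|lborel. K t) + 1 * A0"
      by (intro tendsto_intros cutoff_deriv_approximate_identity[OF contA r] cutoff_integral_tendsto[OF iK r]
          cutoff_tendsto r)
    then have "- A r - (LINT t:{0..r}|lborel. K t) + 1 * A0 = 0"
      unfolding eq by (simp add: LIMSEQ_const_iff)
    then show ?thesis by simp
  qed
  have "A s + (LINT t:{0..s}|lborel. K t) - A0 = 0"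
    by (rule continuous_on_closed_interval_eq_0[OF T _ inner s])
       (intro continuous_intros contA continuous_on_indefinite_integral[OF iK])
  moreover have "(LINT t:{0..s}|lborel. K t) = (LINT x:{0..1}|lborel. (LINT t:{0..s}|lborel. f t x) * deriv \<psi> x)"
  proof -
    have i: "in_L1_cyl s (\<lambda>t x. f t x * deriv \<psi> x)"
      using in_L1_cyl_times_tensor[OF fs[OF s] smooth1_const[of 1] \<psi>(3)] by (simp add: mult.commute)
    have "(LINT t:{0..s}|lborel. K t) = int_cyl s (\<lambda>t x. f t x * deriv \<psi> x)"
      unfolding K_def by (rule in_L1_cyl_time(2)[OF i, symmetric])
    also have "\<dots> = (LINT x:{0..1}|lborel. LINT t:{0..s}|lborel. f t x * deriv \<psi> x)"
      by (rule in_L1_cyl_space(2)[OF i])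
    finally show ?thesis by simp
  qed
  moreover have "(LINT x:{0..1}|lborel. (a s x - a0 x) * \<psi> x) = A s - A0"
    unfolding A_def A0_def left_diff_distrib
    by (intro set_integral_diff(2) in_L2_mult as s a0 L2\<psi>)
  ultimately show "(LINT x:{0..1}|lborel. (LINT t:{0..s}|lborel. f t x) * deriv \<psi> x)
      = - (LINT x:{0..1}|lborel. (a s x - a0 x) * \<psi> x)" by simp
qed

text \<open>
  At time zero the time-integrated flux vanishes, and so does its weak derivative.
\<close>

lemma conservation_law_initial_value:
  assumes "0 < T" "in_L1_cyl T a" "weakly_continuous_L2 T a" "in_L1_cyl T f" "in_L2 a0"
    and "\<And>\<phi>. test_fun T \<phi> \<Longrightarrow>
          int_cyl T (\<lambda>t x. dt \<phi> t x * a t x - dx \<phi> t x * f t x) + (LINT x:{0..1}|lborel. a0 x * \<phi> 0 x) = 0"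
  shows "AE x in lborel. x \<in> {0..1} \<longrightarrow> a 0 x = a0 x"
proof -
  have "(LINT t:{0..0}|lborel. f t x) = 0" for x :: real using set_integral_at_point[of lborel 0] by auto
  then have "weak_deriv_torus (\<lambda>x. 0) (\<lambda>x. a 0 x - a0 x)"
    using conservation_law_integrated[OF assms, of 0] assms(1) by simp
  moreover have "weak_deriv_torus (\<lambda>x. 0) (\<lambda>x. 0)" by (simp add: weak_deriv_torus_def)
  ultimately show ?thesis using weak_deriv_torus_unique by fastforce
qed

section \<open>Energy and dissipation of entropy solutions\<close>

lemma set_integral_eq_AE:
  fixes f g :: "real \<Rightarrow> real"
  assumes "set_integrable lborel A f" "set_integrable lborel A g" "AE x in lborel. x \<in> A \<longrightarrow> f x = g x"
  shows "(LINT x:A|lborel. f x) = (LINT x:A|lborel. g x)"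
  unfolding set_lebesgue_integral_def
proof (rule Bochner_Integration.integral_cong_AE)
  show "AE x in lborel. indicator A x *\<^sub>R f x = indicator A x *\<^sub>R g x"
    using assms(3) by eventually_elim (auto simp: indicator_def)
qed (use assms(1,2) in \<open>auto simp: set_integrable_def\<close>)

text \<open>
  An entropy solution with a fixed choice \<open>vx\<close> of its distributional derivative, in its weakly
  continuous representative.
\<close>

locale entropy_solution_rep =
  fixes T \<epsilon> :: real and u v vx :: "real \<Rightarrow> real \<Rightarrow> real" and u0 v0 :: "real \<Rightarrow> real"
  assumes T: "0 < T" and eps: "0 \<le> \<epsilon>"
    and Linf: "in_Linf_cyl T u" "in_Linf_cyl T v"
    and vx_weak: "\<epsilon> > 0 \<Longrightarrow> test_fun_open T \<phi> \<Longrightarrow>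
          int_cyl T (\<lambda>t x. v t x * dx \<phi> t x) = - int_cyl T (\<lambda>t x. vx t x * \<phi> t x)"
    and vx_L1: "in_L1_cyl T (\<lambda>t x. \<epsilon> * vx t x)"
    and weak_u: "test_fun T \<phi> \<Longrightarrow>
          int_cyl T (\<lambda>t x. dt \<phi> t x * u t x - dx \<phi> t x * v t x)
            + (LINT x:{0..1}|lborel. u0 x * \<phi> 0 x) = 0"
    and weak_v: "test_fun T \<phi> \<Longrightarrow>
          int_cyl T (\<lambda>t x. dt \<phi> t x * v t x - dx \<phi> t x * (u t x + \<epsilon> * vx t x))
            + (LINT x:{0..1}|lborel. v0 x * \<phi> 0 x) = 0"
    and entropy: "test_fun T \<Phi> \<Longrightarrow> \<forall>t\<ge>0. \<forall>x. \<Phi> t x \<ge> 0 \<Longrightarrow>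
          in_L1_cyl T (\<lambda>t x. \<epsilon> * \<Phi> t x * (vx t x)\<^sup>2) \<and>
          int_cyl T (\<lambda>t x. dt \<Phi> t x * eta (u t x) (v t x)
                        + dx \<Phi> t x * (- u t x * v t x - \<epsilon> * v t x * vx t x)
                        - \<epsilon> * \<Phi> t x * (vx t x)\<^sup>2)
            + (LINT x:{0..1}|lborel. \<Phi> 0 x * eta (u0 x) (v0 x)) \<ge> 0"
    and init: "in_L2 u0" "in_L2 v0"
    and wc: "weakly_continuous_L2 T u" "weakly_continuous_L2 T v"
    and v_H1: "\<epsilon> > 0 \<Longrightarrow> AE t in lborel. t \<in> {0<..<T} \<longrightarrow> in_H1 (v t)"
begin

lemma L2: "t \<in> {0..T} \<Longrightarrow> in_L2 (u t)" "t \<in> {0..T} \<Longrightarrow> in_L2 (v t)"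
  using wc by (auto simp: weakly_continuous_L2_def)

lemma v_measurable: "measurable_cyl T v"
  using Linf by (auto simp: in_Linf_cyl_def)

lemma u_L1: "in_L1_cyl T u" and v_L1: "in_L1_cyl T v"
  using Linf in_L1_cyl_bounded by (auto simp: in_Linf_cyl_def)

lemma times_u_L1: "in_L1_cyl T f \<Longrightarrow> in_L1_cyl T (\<lambda>t x. f t x * u t x)"
  and times_v_L1: "in_L1_cyl T f \<Longrightarrow> in_L1_cyl T (\<lambda>t x. f t x * v t x)"
  using Linf in_L1_cyl_mult_bounded by (auto simp: in_Linf_cyl_def)

lemma eta_L1: "in_L1_cyl T (\<lambda>t x. eta (u t x) (v t x))"
proof -
  have "in_L1_cyl T (\<lambda>t x. (1 / 2) * (u t x * u t x) + (1 / 2) * (v t x * v t x))"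
    by (intro in_L1_cyl_add in_L1_cyl_cmult times_u_L1 times_v_L1 u_L1 v_L1)
  then show ?thesis by (simp add: eta_def power2_eq_square)
qed

lemma flux_L1: "in_L1_cyl T (\<lambda>t x. u t x + \<epsilon> * vx t x)"
  by (intro in_L1_cyl_add u_L1 vx_L1)

lemma initial_values:
  "AE x in lborel. x \<in> {0..1} \<longrightarrow> u 0 x = u0 x" "AE x in lborel. x \<in> {0..1} \<longrightarrow> v 0 x = v0 x"
  by (rule conservation_law_initial_value[OF T u_L1 wc(1) v_L1 init(1) weak_u], assumption,
      rule conservation_law_initial_value[OF T v_L1 wc(2) flux_L1 init(2) weak_v], assumption)

lemma integrated_laws:
  assumes "s \<in> {0..T}"
  shows "weak_deriv_torus (\<lambda>x. LINT t:{0..s}|lborel. v t x) (\<lambda>x. u s x - u0 x)"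
    and "weak_deriv_torus (\<lambda>x. LINT t:{0..s}|lborel. u t x + \<epsilon> * vx t x) (\<lambda>x. v s x - v0 x)"
  by (rule conservation_law_integrated[OF T u_L1 wc(1) v_L1 init(1) weak_u assms], assumption,
      rule conservation_law_integrated[OF T v_L1 wc(2) flux_L1 init(2) weak_v assms], assumption)

definition energy :: "real \<Rightarrow> real" where
  "energy t = (LINT x:{0..1}|lborel. eta (u t x) (v t x))"

definition energy0 :: real where
  "energy0 = (LINT x:{0..1}|lborel. eta (u0 x) (v0 x))"

text \<open>
  The energy is convex, so it lies above its tangent at time \<open>s\<close>. The tangent is continuous in
  time by weak continuity, although the energy itself need not be; this permits pointwise evaluation
  in the limit of the cutoffs.
\<close>

definition energy_tangent :: "real \<Rightarrow> real \<Rightarrow> real" where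
  "energy_tangent s t = (LINT x:{0..1}|lborel. u t x * u s x) + (LINT x:{0..1}|lborel. v t x * v s x) - energy s"

lemma eta_L2: "in_L2 f \<Longrightarrow> in_L2 g \<Longrightarrow> set_integrable lborel {0..1} (\<lambda>x. eta (f x) (g x))"
  unfolding eta_def by (intro set_integral_add(1)) (auto simp: in_L2_integrable_sq)

lemma energy_tangent_continuous: "s \<in> {0..T} \<Longrightarrow> continuous_on {0..T} (energy_tangent s)"
  using wc L2 unfolding energy_tangent_def[abs_def] weakly_continuous_L2_def
  by (intro continuous_intros) auto

lemma energy_tangent_le:
  assumes "s \<in> {0..T}" "t \<in> {0..T}" shows "energy_tangent s t \<le> energy t"
proof -
  have iu: "set_integrable lborel {0..1} (\<lambda>x. u t x * u s x)" and iv: "set_integrable lborel {0..1} (\<lambda>x. v t x * v s x)"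
    by (intro in_L2_mult L2 assms)+
  have es: "set_integrable lborel {0..1} (\<lambda>x. eta (u s x) (v s x))" and et: "set_integrable lborel {0..1} (\<lambda>x. eta (u t x) (v t x))"
    by (intro eta_L2 L2 assms)+
  have "energy_tangent s t = (LINT x:{0..1}|lborel. u t x * u s x + v t x * v s x - eta (u s x) (v s x))"
    unfolding energy_tangent_def energy_def
    by (subst set_integral_diff(2)[OF set_integral_add(1)[OF iu iv] es], subst set_integral_add(2)[OF iu iv]) simp
  also have "\<dots> \<le> energy t"
    unfolding energy_def
  proof (rule set_integral_mono[OF set_integral_diff(1)[OF set_integral_add(1)[OF iu iv] es] et])
    fix x
    show "u t x * u s x + v t x * v s x - eta (u s x) (v s x) \<le> eta (u t x) (v t x)"
      using zero_le_power2[of "u t x - u s x"] zero_le_power2[of "v t x - v s x"]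
      unfolding eta_def power2_diff by simp
  qed
  finally show ?thesis .
qed

lemma energy_tangent_self: "s \<in> {0..T} \<Longrightarrow> energy_tangent s s = energy s"
proof -
  assume s: "s \<in> {0..T}"
  have "energy s = (LINT x:{0..1}|lborel. (1 / 2) * (u s x * u s x) + (1 / 2) * (v s x * v s x))"
    by (simp add: energy_def eta_def power2_eq_square)
  also have "\<dots> = (1 / 2) * (LINT x:{0..1}|lborel. u s x * u s x) + (1 / 2) * (LINT x:{0..1}|lborel. v s x * v s x)"
    using in_L2_mult[OF L2(1)[OF s] L2(1)[OF s]] in_L2_mult[OF L2(2)[OF s] L2(2)[OF s]]
    by (subst set_integral_add(2)) auto
  finally show ?thesis by (simp add: energy_tangent_def)
qed

lemma energy_nonneg: "energy t \<ge> 0"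
  unfolding energy_def set_lebesgue_integral_def by (rule integral_nonneg_AE) (auto simp: eta_def)

definition dissip :: "real \<Rightarrow> real \<Rightarrow> real" where "dissip t x = \<epsilon> * (vx t x)\<^sup>2"

lemma dissip_nonneg: "dissip t x \<ge> 0" using eps by (simp add: dissip_def)

text \<open>
  The entropy inequality with a test function that is constant in space: the entropy flux drops out.
\<close>

lemma cutoff_dissip_L1: "r < T \<Longrightarrow> in_L1_cyl T (\<lambda>t x. cutoff n r t * dissip t x)"
  and cutoff_energy_inequality: "r < T \<Longrightarrow>
    int_cyl T (\<lambda>t x. cutoff n r t * dissip t x)
      \<le> (LINT t:{0..T}|lborel. deriv (cutoff n r) t * energy t) + cutoff n r 0 * energy0"
proof -
  assume r: "r < T"
  have sm: "smooth1 (cutoff n r)" "smooth1 (deriv (cutoff n r))" "smooth1 (\<lambda>_. 1)"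
    by (auto intro: smooth1_cutoff smooth1_deriv)
  have p: "periodic1 (\<lambda>_::real. 1::real)" by (simp add: periodic1_def)
  have t: "test_fun T (\<lambda>t x. cutoff n r t * 1)"
    by (rule test_fun_tensor[OF sm(1,3) p r]) (simp add: cutoff_eq_0)
  have nn: "\<forall>t\<ge>0. \<forall>x::real. 0 \<le> cutoff n r t * 1" by (simp add: cutoff_nonneg)
  have i: "in_L1_cyl T (\<lambda>t x. \<epsilon> * (cutoff n r t * 1) * (vx t x)\<^sup>2)"
    and le: "int_cyl T (\<lambda>t x. deriv (cutoff n r) t * 1 * eta (u t x) (v t x) - \<epsilon> * (cutoff n r t * 1) * (vx t x)\<^sup>2)
            + (LINT x:{0..1}|lborel. cutoff n r 0 * 1 * eta (u0 x) (v0 x)) \<ge> 0"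
    using entropy[OF t nn] by (simp_all add: tensor_derivs[OF sm(1,3)])
  show i': "in_L1_cyl T (\<lambda>t x. cutoff n r t * dissip t x)" using i by (simp add: dissip_def mult_ac)
  have "int_cyl T (\<lambda>t x. deriv (cutoff n r) t * 1 * eta (u t x) (v t x) - \<epsilon> * (cutoff n r t * 1) * (vx t x)\<^sup>2)
     = int_cyl T (\<lambda>t x. deriv (cutoff n r) t * 1 * eta (u t x) (v t x)) - int_cyl T (\<lambda>t x. cutoff n r t * dissip t x)"
    using int_cyl_diff[OF in_L1_cyl_times_tensor[OF eta_L1 sm(2,3)] i] by (simp add: dissip_def mult_ac)
  moreover have "int_cyl T (\<lambda>t x. deriv (cutoff n r) t * 1 * eta (u t x) (v t x)) = (LINT t:{0..T}|lborel. deriv (cutoff n r) t * energy t)"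
    using int_cyl_tensor[OF eta_L1 sm(2,3)] by (simp add: energy_def)
  ultimately show "int_cyl T (\<lambda>t x. cutoff n r t * dissip t x)
      \<le> (LINT t:{0..T}|lborel. deriv (cutoff n r) t * energy t) + cutoff n r 0 * energy0"
    using le by (simp add: energy0_def)
qed

lemma in_L1_cyl_cong: "in_L1_cyl S f \<Longrightarrow> (\<And>t x. (t, x) \<in> cyl S \<Longrightarrow> f t x = g t x) \<Longrightarrow> in_L1_cyl S g"
  unfolding in_L1_cyl_def by (subst set_integrable_cong[where f' = "\<lambda>z. f (fst z) (snd z)"]) auto

text \<open>
  On the times before \<open>r\<close> a cutoff that vanishes only after some later time is bounded away from
  zero and can be divided out.
\<close>

lemma dissip_L1_interior: assumes r: "0 < r" "r < T" shows "in_L1_cyl r dissip"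
proof -
  define r' where "r' = (r + T) / 2"
  have r': "r < r'" "r' < T" using r by (auto simp: r'_def)
  have pos: "cutoff 1 r' t > 0" if "t \<le> r" for t
    using that r' flat_pos[of "r' - t"] by (simp add: cutoff_def soft_indicator_def)
  have c: "continuous_on {0..r} (\<lambda>t. inverse (cutoff 1 r' t))"
    using pos by (intro continuous_intros smooth1_continuous_on smooth1_cutoff) (auto simp: less_le)
  have m: "set_borel_measurable lborel {0..r} (\<lambda>t. inverse (cutoff 1 r' t))"
    using borel_measurable_continuous_on_indicator[OF _ c] by (simp add: set_borel_measurable_def)
  have "bounded ((\<lambda>t. inverse (cutoff 1 r' t)) ` {0..r})"
    by (intro compact_imp_bounded compact_continuous_image c) auto
  then obtain B where B: "\<forall>t\<in>{0..r}. \<bar>inverse (cutoff 1 r' t)\<bar> \<le> B" by (auto simp: bounded_iff)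
  have "in_L1_cyl r (\<lambda>t x. cutoff 1 r' t * dissip t x)"
    by (rule in_L1_cyl_subset[OF cutoff_dissip_L1[OF r'(2)]]) (use r in auto)
  then have "in_L1_cyl r (\<lambda>t x. (cutoff 1 r' t * dissip t x) * (inverse (cutoff 1 r' t) * 1))"
    by (rule in_L1_cyl_mult_bounded[OF _ measurable_cyl_tensor[OF m], where B = B])
       (use B in \<open>auto simp: set_borel_measurable_def cyl_def\<close>)
  then show ?thesis
  proof (rule in_L1_cyl_cong)
    fix t x assume "(t, x) \<in> cyl r"
    then have "cutoff 1 r' t \<noteq> 0" using pos[of t] by (auto simp: cyl_def less_le)
    then show "(cutoff 1 r' t * dissip t x) * (inverse (cutoff 1 r' t) * 1) = dissip t x" by (simp add: field_simps)
  qed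
qed

text \<open>
  The derivative of the cutoff is nonpositive, so replacing the energy by its tangent below
  increases the right-hand side, which then converges.
\<close>

lemma energy_tangent_dissipation:
  assumes s: "s \<in> {0..T}" and r: "0 < r" "r < T"
  shows "energy_tangent s r + int_cyl r dissip \<le> energy0"
proof -
  define r' where "r' = (r + T) / 2"
  have r': "r < r'" "r' < T" "0 < r'" using r by (auto simp: r'_def)
  define K where "K = (\<lambda>t. LINT x:{0..1}|lborel. dissip t x)"
  note iD = dissip_L1_interior[OF r'(3,2)]
  have iK: "set_integrable lborel {0..r'} K" unfolding K_def by (rule in_L1_cyl_time(1)[OF iD])
  have cont: "continuous_on {0..T} (deriv (cutoff n r))" for n
    by (intro smooth1_continuous_on smooth1_deriv smooth1_cutoff)
  have le: "(LINT t:{0..r'}|lborel. cutoff n r t * K t)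
      \<le> (LINT t:{0..T}|lborel. deriv (cutoff n r) t * energy_tangent s t) + cutoff n r 0 * energy0" for n
  proof -
    have sm: "smooth1 (cutoff n r)" by (rule smooth1_cutoff)
    have lt: "t < r'" "t < T" if "cutoff n r t \<noteq> 0" for t
      using that cutoff_eq_0[of r t n] r' by (meson less_trans not_less)+
    have "(LINT t:{0..r'}|lborel. cutoff n r t * K t) = int_cyl r' (\<lambda>t x. cutoff n r t * 1 * dissip t x)"
      using int_cyl_tensor[OF iD sm smooth1_const[of 1]] by (simp add: K_def)
    also have "\<dots> = int_cyl T (\<lambda>t x. cutoff n r t * dissip t x)"
      unfolding int_cyl_def set_lebesgue_integral_def
      by (intro Bochner_Integration.integral_cong)
         (use r' lt in \<open>auto simp: indicator_def cyl_def\<close>)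
    also have "\<dots> \<le> (LINT t:{0..T}|lborel. deriv (cutoff n r) t * energy t) + cutoff n r 0 * energy0"
      by (rule cutoff_energy_inequality[OF r(2)])
    also have "(LINT t:{0..T}|lborel. deriv (cutoff n r) t * energy t)
        \<le> (LINT t:{0..T}|lborel. deriv (cutoff n r) t * energy_tangent s t)"
    proof (rule set_integral_mono)
      show "set_integrable lborel {0..T} (\<lambda>t. deriv (cutoff n r) t * energy t)"
        using set_integrable_mult_continuous[OF in_L1_cyl_time(1)[OF eta_L1] cont[of n]]
        by (simp add: energy_def mult.commute)
      show "set_integrable lborel {0..T} (\<lambda>t. deriv (cutoff n r) t * energy_tangent s t)"
        by (intro borel_integrable_atLeastAtMost' continuous_intros cont energy_tangent_continuous s)
      show "deriv (cutoff n r) t * energy t \<le> deriv (cutoff n r) t * energy_tangent s t" if "t \<in> {0..T}" for t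
        by (intro mult_left_mono_neg energy_tangent_le s that cutoff_deriv_nonpos)
    qed
    finally show ?thesis by simp
  qed
  have "(LINT t:{0..r}|lborel. K t) \<le> - energy_tangent s r + 1 * energy0"
  proof (rule LIMSEQ_le)
    show "(\<lambda>n. LINT t:{0..r'}|lborel. cutoff n r t * K t) \<longlonglongrightarrow> (LINT t:{0..r}|lborel. K t)"
      by (rule cutoff_integral_tendsto[OF iK r(1) r'(1)])
    show "(\<lambda>n. (LINT t:{0..T}|lborel. deriv (cutoff n r) t * energy_tangent s t) + cutoff n r 0 * energy0)
        \<longlonglongrightarrow> - energy_tangent s r + 1 * energy0"
      by (intro tendsto_intros cutoff_deriv_approximate_identity energy_tangent_continuous s r cutoff_tendsto)
  qed (use le in auto)
  then show ?thesis
    using in_L1_cyl_time(2)[OF dissip_L1_interior[OF r]] by (simp add: K_def)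
qed

text \<open>
  The dissipation up to any earlier time is bounded by the initial energy; monotone convergence
  extends the bound to \<open>T\<close>.
\<close>

lemma dissip_L1: "in_L1_cyl T dissip"
proof -
  define r where "r = (\<lambda>i::nat. T - T / real (i + 2))"
  have "T * (1 / real (i + 2)) < T * 1" for i
    using T by (intro mult_strict_left_mono) auto
  then have r: "0 < r i" "r i < T" for i
    using T by (auto simp: r_def)
  have mono_r: "r i \<le> r j" if "i \<le> j" for i j
    using T that by (auto simp: r_def intro!: divide_left_mono)
  have lim_r: "r \<longlonglongrightarrow> T - 0"
    unfolding r_def by (intro tendsto_intros LIMSEQ_ignore_initial_segment[OF lim_const_over_n])
  let ?f = "\<lambda>i z. indicator (cyl (r i)) z *\<^sub>R dissip (fst z) (snd z)"
  have int: "integrable lborel (?f i)" for i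
    using dissip_L1_interior[OF r] by (simp add: in_L1_cyl_def set_integrable_def)
  have bd: "integral\<^sup>L lborel (?f i) \<le> energy0" for i
  proof -
    have "energy_tangent (r i) (r i) + int_cyl (r i) dissip \<le> energy0"
      using r[of i] by (intro energy_tangent_dissipation) auto
    then show ?thesis using energy_tangent_self[of "r i"] energy_nonneg[of "r i"] r[of i]
      by (simp add: int_cyl_def set_lebesgue_integral_def)
  qed
  have mono_f: "?f i z \<le> ?f j z" if "i \<le> j" for i j z
    using mono_r[OF that] dissip_nonneg by (auto simp: indicator_def cyl_def)
  have "incseq (\<lambda>i. integral\<^sup>L lborel (?f i))"
    by (intro incseq_SucI integral_mono int mono_f) auto
  then obtain L where L: "(\<lambda>i. integral\<^sup>L lborel (?f i)) \<longlonglongrightarrow> L"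
    using incseq_convergent[of _ energy0] bd by blast
  have ptw: "(\<lambda>i. ?f i z) \<longlonglongrightarrow> indicator (cyl T) z *\<^sub>R dissip (fst z) (snd z)" for z
  proof (cases "z \<in> cyl T")
    case True
    then have "\<forall>\<^sub>F i in sequentially. fst z < r i"
      using lim_r by (intro order_tendstoD(1)[of _ T]) (auto simp: cyl_def)
    then have "\<forall>\<^sub>F i in sequentially. ?f i z = indicator (cyl T) z *\<^sub>R dissip (fst z) (snd z)"
      by eventually_elim (use True in \<open>auto simp: cyl_def indicator_def\<close>)
    then show ?thesis by (rule tendsto_eventually)
  next
    case False
    then have z0: "?f i z = 0" for i using r[of i] by (auto simp: cyl_def indicator_def)
    show ?thesis unfolding z0 using False by simp
  qed
  have meas: "(\<lambda>z. indicator (cyl T) z *\<^sub>R dissip (fst z) (snd z)) \<in> borel_measurable lborel"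
    by (rule borel_measurable_LIMSEQ_real[OF ptw]) (use int in auto)
  show ?thesis
    unfolding in_L1_cyl_def set_integrable_def
    by (rule integrable_monotone_convergence[OF int _ _ L meas])
       (use mono_f ptw in \<open>auto simp: mono_def incseq_def\<close>)
qed

lemma energy_dissipation:
  assumes s: "s \<in> {0..T}"
  shows "energy s + int_cyl s dissip \<le> energy0"
proof -
  define K where "K = (\<lambda>t. LINT x:{0..1}|lborel. dissip t x)"
  have K: "int_cyl r dissip = (LINT t:{0..r}|lborel. K t)" if "r \<le> T" for r
    unfolding K_def by (rule in_L1_cyl_time(2)[OF in_L1_cyl_subset[OF dissip_L1 that]])
  have iK: "set_integrable lborel {0..T} K" unfolding K_def by (rule in_L1_cyl_time(1)[OF dissip_L1])
  have "energy_tangent s s + (LINT t:{0..s}|lborel. K t) \<le> energy0"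
  proof (rule continuous_on_closed_interval_le[of T "\<lambda>r. energy_tangent s r + (LINT t:{0..r}|lborel. K t)", OF T _ _ s])
    show "continuous_on {0..T} (\<lambda>r. energy_tangent s r + (LINT t:{0..r}|lborel. K t))"
      by (intro continuous_intros energy_tangent_continuous s continuous_on_indefinite_integral iK)
    show "energy_tangent s r + (LINT t:{0..r}|lborel. K t) \<le> energy0" if "0 < r" "r < T" for r
      using energy_tangent_dissipation[OF s that] K[of r] that by simp
  qed
  then show ?thesis using K[of s] s energy_tangent_self[OF s] by simp
qed

text \<open>
  The distributional derivative on the cylinder is the weak derivative on almost every time slice.
  For a single test function of \<open>x\<close> this follows by varying the temporal factor; countably many
  test functions share one null set of times, and they identify \<open>vx t\<close> with the weak derivative
  that \<open>v t\<close> has as an element of \<open>H\<^sup>1\<close>.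
\<close>

lemma vx_is_weak_derivative:
  assumes "\<epsilon> > 0"
  shows "AE t in lborel. t \<in> {0<..<T} \<longrightarrow> weak_deriv_torus (v t) (vx t)"
proof -
  have vxL1: "in_L1_cyl T vx"
    using in_L1_cyl_cmult[OF vx_L1, of "1 / \<epsilon>"] assms by simp
  have slice: "AE t in lborel. t \<in> {0<..<T} \<longrightarrow>
      (LINT x:{0..1}|lborel. v t x * deriv \<psi> x) + (LINT x:{0..1}|lborel. vx t x * \<psi> x) = 0"
    if \<psi>: "smooth1 \<psi>" "periodic1 \<psi>" for \<psi>
  proof -
    define V where "V = (\<lambda>t. LINT x:{0..1}|lborel. v t x * deriv \<psi> x)"
    define W where "W = (\<lambda>t. LINT x:{0..1}|lborel. vx t x * \<psi> x)"
    have iV: "set_integrable lborel {0..T} V" unfolding V_def by (intro time_integrable_smooth v_L1 smooth1_deriv \<psi>)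
    have iW: "set_integrable lborel {0..T} W" unfolding W_def by (intro time_integrable_smooth vxL1 \<psi>)
    have "AE t in lborel. t \<in> {0<..<T} \<longrightarrow> V t + W t = 0"
    proof (rule AE_zero_if_line_moments_zero)
      show "set_integrable lborel {0..T} (\<lambda>t. V t + W t)" by (rule set_integral_add(1)[OF iV iW])
      fix n c d assume cd: "0 < c" "c < d" "d < T"
      let ?\<theta> = "line_bump n c d"
      have sm: "smooth1 ?\<theta>" by (rule smooth1_line_bump)
      have "test_fun T (\<lambda>t x. ?\<theta> t * \<psi> x)"
        by (rule test_fun_tensor[OF sm \<psi> cd(3)]) (simp add: line_bump_eq_0)
      then have "test_fun_open T (\<lambda>t x. ?\<theta> t * \<psi> x)"
        unfolding test_fun_open_def using cd(1) line_bump_eq_0[of _ c d n] by (auto intro!: exI[of _ c])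
      from vx_weak[OF assms this]
      have "int_cyl T (\<lambda>t x. v t x * (?\<theta> t * deriv \<psi> x)) = - int_cyl T (\<lambda>t x. vx t x * (?\<theta> t * \<psi> x))"
        by (simp only: tensor_derivs[OF sm \<psi>(1)])
      then have "int_cyl T (\<lambda>t x. ?\<theta> t * deriv \<psi> x * v t x) = - int_cyl T (\<lambda>t x. ?\<theta> t * \<psi> x * vx t x)"
        by (simp only: mult.commute mult.left_commute mult.assoc)
      then have "(LINT t:{0..T}|lborel. ?\<theta> t * V t) = - (LINT t:{0..T}|lborel. ?\<theta> t * W t)"
        by (simp only: int_cyl_tensor[OF v_L1 sm smooth1_deriv[OF \<psi>(1)]] int_cyl_tensor[OF vxL1 sm \<psi>(1)] V_def W_def)
      then have "(LINT t:{0..T}|lborel. V t * ?\<theta> t) + (LINT t:{0..T}|lborel. W t * ?\<theta> t) = 0"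
        by (simp add: mult.commute)
      then show "(LINT t:{0..T}|lborel. (V t + W t) * ?\<theta> t) = 0"
        unfolding distrib_right
        by (subst set_integral_add(2)) (auto intro!: set_integrable_mult_continuous iV iW smooth1_continuous_on sm)
    qed
    then show ?thesis by (simp add: V_def W_def)
  qed
  have "AE t in lborel. \<forall>n. \<forall>c\<in>\<rat>. \<forall>d\<in>\<rat>. t \<in> {0<..<T} \<longrightarrow>
      (LINT x:{0..1}|lborel. v t x * deriv (torus_bump n c d) x) + (LINT x:{0..1}|lborel. vx t x * torus_bump n c d x) = 0"
    unfolding AE_all_countable AE_ball_countable[OF countable_rat]
    by (intro allI ballI slice smooth1_torus_bump periodic1_torus_bump)
  then show ?thesis
    using v_H1[OF assms] in_L1_cyl_slice_AE[OF vxL1]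
  proof eventually_elim
    case (elim t)
    show ?case
    proof
      assume t: "t \<in> {0<..<T}"
      then obtain g where g: "weak_deriv_torus (v t) g" using elim(2) by (auto simp: in_H1_def)
      have iv: "set_integrable lborel {0..1} (vx t)" using elim(3) t by blast
      note ig = weak_deriv_torus_integrable(2)[OF g]
      have "AE x in lborel. x \<in> {0..1} \<longrightarrow> vx t x - g x = 0"
      proof (rule AE_zero_if_torus_moments_zero)
        show "set_integrable lborel {0..1} (\<lambda>x. vx t x - g x)" by (rule set_integral_diff(1)[OF iv ig])
        fix n and c d :: real assume cd: "c \<in> \<rat>" "d \<in> \<rat>"
        let ?\<phi> = "torus_bump n c d"
        have "(LINT x:{0..1}|lborel. v t x * deriv ?\<phi> x) = - (LINT x:{0..1}|lborel. g x * ?\<phi> x)"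
          using g smooth1_torus_bump periodic1_torus_bump unfolding weak_deriv_torus_def by blast
        moreover have "(LINT x:{0..1}|lborel. v t x * deriv ?\<phi> x) + (LINT x:{0..1}|lborel. vx t x * ?\<phi> x) = 0"
          using elim(1) cd t by blast
        ultimately show "(LINT x:{0..1}|lborel. (vx t x - g x) * ?\<phi> x) = 0"
          unfolding left_diff_distrib
          by (subst set_integral_diff(2)) (auto intro!: set_integrable_mult_continuous iv ig smooth1_continuous_on smooth1_torus_bump)
      qed
      then have eq: "AE x in lborel. x \<in> {0..1} \<longrightarrow> g x = vx t x" by eventually_elim simp
      show "weak_deriv_torus (v t) (vx t)"
        unfolding weak_deriv_torus_def
      proof (intro conjI allI impI)
        fix \<phi> :: "real \<Rightarrow> real" assume \<phi>: "smooth1 \<phi> \<and> periodic1 \<phi>"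
        have "(LINT x:{0..1}|lborel. g x * \<phi> x) = (LINT x:{0..1}|lborel. vx t x * \<phi> x)"
          by (rule set_integral_eq_AE)
             (use \<phi> eq in \<open>auto intro!: set_integrable_mult_continuous ig iv smooth1_continuous_on elim: eventually_mono\<close>)
        then show "(LINT x:{0..1}|lborel. v t x * deriv \<phi> x) = - (LINT x:{0..1}|lborel. vx t x * \<phi> x)"
          using g \<phi> unfolding weak_deriv_torus_def by simp
      qed (use weak_deriv_torus_integrable[OF g] iv in auto)
    qed
  qed
qed

end

section \<open>Relative energy of an approximation\<close>

text \<open>
  Derivatives of Lipschitz functions have a version in this class; together with products of one
  function of time and one of space it makes all pairings with the solution integrable.
\<close>

definition bounded_measurable_on :: "real \<Rightarrow> real \<Rightarrow> (real \<Rightarrow> real) \<Rightarrow> bool" where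
  "bounded_measurable_on a b f \<longleftrightarrow> set_borel_measurable lborel {a..b} f \<and> (\<exists>C. \<forall>x\<in>{a..b}. \<bar>f x\<bar> \<le> C)"

definition bounded_measurable_cyl :: "real \<Rightarrow> (real \<Rightarrow> real \<Rightarrow> real) \<Rightarrow> bool" where
  "bounded_measurable_cyl T f \<longleftrightarrow> measurable_cyl T f \<and> (\<exists>C. \<forall>t x. (t, x) \<in> cyl T \<longrightarrow> \<bar>f t x\<bar> \<le> C)"

lemma bounded_measurable_on_continuous:
  assumes "continuous_on {a..b} f" shows "bounded_measurable_on a b f"
proof -
  have "bounded (f ` {a..b})" by (intro compact_imp_bounded compact_continuous_image assms) auto
  then show ?thesis
    using borel_measurable_continuous_on_indicator[of "{a..b}" f] assms
    by (auto simp: bounded_measurable_on_def bounded_iff set_borel_measurable_def)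
qed

lemma bounded_measurable_cyl_tensor:
  assumes "bounded_measurable_on 0 T \<theta>" "bounded_measurable_on 0 1 \<psi>"
  shows "bounded_measurable_cyl T (\<lambda>t x. \<theta> t * \<psi> x)"
proof -
  obtain B C where "\<forall>t\<in>{0..T}. \<bar>\<theta> t\<bar> \<le> B" "\<forall>x\<in>{0..1}. \<bar>\<psi> x\<bar> \<le> C"
    using assms by (auto simp: bounded_measurable_on_def)
  note BC = this
  have "\<bar>\<theta> t * \<psi> x\<bar> \<le> B * C" if "(t, x) \<in> cyl T" for t x
  proof -
    have "\<bar>\<theta> t\<bar> \<le> B" "\<bar>\<psi> x\<bar> \<le> C" using that BC by (auto simp: cyl_def)
    then show ?thesis unfolding abs_mult by (intro mult_mono) auto
  qed
  then show ?thesis using assms measurable_cyl_tensor[of T \<theta> \<psi>]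
    unfolding bounded_measurable_cyl_def bounded_measurable_on_def by blast
qed

lemma bounded_measurable_cyl_add:
  assumes "bounded_measurable_cyl T f" "bounded_measurable_cyl T g"
  shows "bounded_measurable_cyl T (\<lambda>t x. f t x + g t x)"
proof -
  obtain B C where BC: "\<And>t x. (t, x) \<in> cyl T \<Longrightarrow> \<bar>f t x\<bar> \<le> B" "\<And>t x. (t, x) \<in> cyl T \<Longrightarrow> \<bar>g t x\<bar> \<le> C"
    using assms by (auto simp: bounded_measurable_cyl_def)
  have "\<bar>f t x + g t x\<bar> \<le> B + C" if "(t, x) \<in> cyl T" for t x
    using BC[OF that] by linarith
  moreover have "measurable_cyl T (\<lambda>t x. f t x + g t x)"
    using assms borel_measurable_add
    by (auto simp: bounded_measurable_cyl_def measurable_cyl_def set_borel_measurable_def distrib_left)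
  ultimately show ?thesis unfolding bounded_measurable_cyl_def by blast
qed

lemma bounded_measurable_cyl_const: "bounded_measurable_cyl T (\<lambda>_ _. k)"
  using bounded_measurable_cyl_tensor[of T "\<lambda>_. k" "\<lambda>_. 1"] by (simp add: bounded_measurable_on_continuous)

lemma bounded_measurable_cyl_sum:
  "(\<And>i. i \<in> I \<Longrightarrow> bounded_measurable_cyl T (f i)) \<Longrightarrow> bounded_measurable_cyl T (\<lambda>t x. \<Sum>i\<in>I. f i t x)"
  by (induction I rule: infinite_finite_induct)
     (auto intro: bounded_measurable_cyl_const bounded_measurable_cyl_add)

lemma bounded_measurable_cyl_mult:
  assumes "bounded_measurable_cyl T f" "bounded_measurable_cyl T g"
  shows "bounded_measurable_cyl T (\<lambda>t x. f t x * g t x)"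
proof -
  obtain B C where BC: "\<And>t x. (t, x) \<in> cyl T \<Longrightarrow> \<bar>f t x\<bar> \<le> B" "\<And>t x. (t, x) \<in> cyl T \<Longrightarrow> \<bar>g t x\<bar> \<le> C"
    using assms by (auto simp: bounded_measurable_cyl_def)
  have "\<bar>f t x * g t x\<bar> \<le> B * C" if "(t, x) \<in> cyl T" for t x
    using BC[OF that] unfolding abs_mult by (intro mult_mono) auto
  then show ?thesis using assms measurable_cyl_mult unfolding bounded_measurable_cyl_def by blast
qed

lemma bounded_measurable_cyl_diff:
  assumes "bounded_measurable_cyl T f" "bounded_measurable_cyl T g"
  shows "bounded_measurable_cyl T (\<lambda>t x. f t x - g t x)"
  using bounded_measurable_cyl_add[OF assms(1) bounded_measurable_cyl_mult[OF bounded_measurable_cyl_const[of T "-1"] assms(2)]]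
  by simp

lemma in_L1_cyl_times:
  assumes "in_L1_cyl T f" "bounded_measurable_cyl T g"
  shows "in_L1_cyl T (\<lambda>t x. f t x * g t x)"
proof -
  obtain C where C: "\<And>t x. (t, x) \<in> cyl T \<Longrightarrow> \<bar>g t x\<bar> \<le> C"
    using assms(2) by (auto simp: bounded_measurable_cyl_def)
  show ?thesis
    by (rule in_L1_cyl_mult_bounded[OF assms(1), of _ C])
       (use C assms(2) in \<open>auto simp: bounded_measurable_cyl_def\<close>)
qed

lemma bounded_measurable_cyl_L1: "bounded_measurable_cyl T g \<Longrightarrow> in_L1_cyl T g"
  using in_L1_cyl_times[OF in_L1_cyl_const[of T 1], of g] by simp

lemma in_L2_bounded_measurable_on: "bounded_measurable_on 0 1 f \<Longrightarrow> in_L2 f"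
  unfolding bounded_measurable_on_def by (auto intro: in_L2_bounded)

text \<open>
  Testing the integrated law with an absolutely continuous function of \<open>x\<close> shows that the
  resulting moment is absolutely continuous in time, so the product rule applies to its product with
  a coefficient that is merely Lipschitz in time.
\<close>

lemma conservation_law_product_rule:
  assumes T: "0 < T" and a: "in_L1_cyl T a" "weakly_continuous_L2 T a" and f: "in_L1_cyl T f"
    and law: "\<And>s. s \<in> {0..T} \<Longrightarrow> weak_deriv_torus (\<lambda>x. LINT t:{0..s}|lborel. f t x) (\<lambda>x. a s x - a0 x)"
    and a0: "in_L2 a0"
    and \<psi>: "primitive_on 0 1 \<psi> g" "\<psi> 1 = \<psi> 0" "bounded_measurable_on 0 1 g"
    and c: "primitive_on 0 T c c'" "bounded_measurable_on 0 T c'"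
    and s: "s \<in> {0..T}"
  shows "c s * (LINT x:{0..1}|lborel. a s x * \<psi> x) - c 0 * (LINT x:{0..1}|lborel. a0 x * \<psi> x)
     = int_cyl s (\<lambda>t x. a t x * (c' t * \<psi> x) - f t x * (c t * g x))"
proof -
  note L2\<psi> = in_L2_continuous[OF primitive_on_continuous[OF \<psi>(1)]]
  have L2a: "in_L2 (a t)" if "t \<in> {0..T}" for t using a(2) that by (simp add: weakly_continuous_L2_def)
  define A where "A = (\<lambda>t. LINT x:{0..1}|lborel. a t x * \<psi> x)"
  define A0 where "A0 = (LINT x:{0..1}|lborel. a0 x * \<psi> x)"
  define K where "K = (\<lambda>t. LINT x:{0..1}|lborel. f t x * g x)"
  have bg: "bounded_measurable_cyl S (\<lambda>t x. g x)" for S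
    using bounded_measurable_cyl_tensor[of S "\<lambda>_. 1" g] \<psi>(3) by (simp add: bounded_measurable_on_continuous)
  have fg: "in_L1_cyl r (\<lambda>t x. f t x * g x)" if "r \<in> {0..T}" for r
    by (rule in_L1_cyl_times[OF in_L1_cyl_subset[OF f] bg]) (use that in auto)
  have iK: "set_integrable lborel {0..T} K"
    unfolding K_def by (rule in_L1_cyl_time(1)[OF fg]) (use T in auto)
  have Ar: "A r = A0 - (LINT t:{0..r}|lborel. K t)" if r: "r \<in> {0..T}" for r
  proof -
    have "(LINT t:{0..r}|lborel. K t) = int_cyl r (\<lambda>t x. f t x * g x)"
      unfolding K_def by (rule in_L1_cyl_time(2)[OF fg[OF r], symmetric])
    also have "\<dots> = (LINT x:{0..1}|lborel. LINT t:{0..r}|lborel. f t x * g x)"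
      by (rule in_L1_cyl_space(2)[OF fg[OF r]])
    also have "\<dots> = (LINT x:{0..1}|lborel. (LINT t:{0..r}|lborel. f t x) * g x)" by simp
    also have "\<dots> = - (LINT x:{0..1}|lborel. (a r x - a0 x) * \<psi> x)"
      by (rule weak_deriv_torus_test[OF law[OF r] \<psi>(1,2)])
    also have "(LINT x:{0..1}|lborel. (a r x - a0 x) * \<psi> x) = A r - A0"
      unfolding A_def A0_def left_diff_distrib
      by (intro set_integral_diff(2) in_L2_mult L2a r a0 L2\<psi>)
    finally show ?thesis by simp
  qed
  have A_0: "A 0 = A0"
    using Ar[of 0] T set_integral_at_point[of lborel 0 K] by simp
  have primA: "primitive_on 0 T A (\<lambda>t. (- 1) * K t)"
  proof (rule primitive_onI)
    show "set_integrable lborel {0..T} (\<lambda>t. (- 1) * K t)" using iK by (intro set_integrable_mult_right) auto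
    show "A r = A 0 + (LINT t:{0..r}|lborel. (- 1) * K t)" if "r \<in> {0..T}" for r
      unfolding Ar[OF that] A_0 by (subst set_integral_mult_right) simp
  qed
  have bc: "bounded_measurable_on 0 T c"
    by (intro bounded_measurable_on_continuous primitive_on_continuous[OF c(1)])
  have b\<psi>: "bounded_measurable_on 0 1 \<psi>"
    by (intro bounded_measurable_on_continuous primitive_on_continuous[OF \<psi>(1)])
  have i1: "in_L1_cyl T (\<lambda>t x. a t x * (c' t * \<psi> x))"
    by (intro in_L1_cyl_times a bounded_measurable_cyl_tensor c b\<psi>)
  have i2: "in_L1_cyl T (\<lambda>t x. f t x * (c t * g x))"
    by (intro in_L1_cyl_times f bounded_measurable_cyl_tensor bc \<psi>)
  have "c s * A s - c 0 * A 0 = (LINT t:{0..s}|lborel. c' t * A t + c t * ((- 1) * K t))"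
    using primitive_on_integral[OF primitive_on_mult[OF c(1) primA] s] by simp
  also have "\<dots> = (LINT t:{0..s}|lborel. (LINT x:{0..1}|lborel. a t x * (c' t * \<psi> x)) - (LINT x:{0..1}|lborel. f t x * (c t * g x)))"
  proof (intro set_lebesgue_integral_cong ballI allI impI)
    fix t
    have "(LINT x:{0..1}|lborel. a t x * (c' t * \<psi> x)) = c' t * A t"
      unfolding A_def by (subst set_integral_mult_right[symmetric]) (simp add: ac_simps)
    moreover have "(LINT x:{0..1}|lborel. f t x * (c t * g x)) = c t * K t"
      unfolding K_def by (subst set_integral_mult_right[symmetric]) (simp add: ac_simps)
    ultimately show "c' t * A t + c t * ((- 1) * K t)
      = (LINT x:{0..1}|lborel. a t x * (c' t * \<psi> x)) - (LINT x:{0..1}|lborel. f t x * (c t * g x))" by simp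
  qed simp
  also have "\<dots> = int_cyl s (\<lambda>t x. a t x * (c' t * \<psi> x)) - int_cyl s (\<lambda>t x. f t x * (c t * g x))"
  proof -
    have s1: "in_L1_cyl s (\<lambda>t x. a t x * (c' t * \<psi> x))" "in_L1_cyl s (\<lambda>t x. f t x * (c t * g x))"
      using in_L1_cyl_subset[OF i1] in_L1_cyl_subset[OF i2] s by auto
    show ?thesis
      unfolding in_L1_cyl_time(2)[OF s1(1)] in_L1_cyl_time(2)[OF s1(2)]
      by (rule set_integral_diff(2)[OF in_L1_cyl_time(1)[OF s1(1)] in_L1_cyl_time(1)[OF s1(2)]])
  qed
  also have "\<dots> = int_cyl s (\<lambda>t x. a t x * (c' t * \<psi> x) - f t x * (c t * g x))"
    by (rule int_cyl_diff[symmetric]) (use in_L1_cyl_subset[OF i1] in_L1_cyl_subset[OF i2] s in auto)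
  finally show ?thesis by (simp add: A_def A_0[unfolded A_def] A0_def)
qed

lemma L2_sq_diff:
  assumes "in_L2 f" "in_L2 k"
  shows "(LINT x:{0..1}|lborel. (f x - k x)\<^sup>2) = (LINT x:{0..1}|lborel. (f x)\<^sup>2)
      - 2 * (LINT x:{0..1}|lborel. f x * k x) + (LINT x:{0..1}|lborel. (k x)\<^sup>2)"
proof -
  have i: "set_integrable lborel {0..1} (\<lambda>x. (f x)\<^sup>2)" "set_integrable lborel {0..1} (\<lambda>x. 2 * (f x * k x))"
    "set_integrable lborel {0..1} (\<lambda>x. (k x)\<^sup>2)"
    using assms in_L2_mult[OF assms] by (auto simp: in_L2_integrable_sq)
  have "(LINT x:{0..1}|lborel. (f x - k x)\<^sup>2) = (LINT x:{0..1}|lborel. (f x)\<^sup>2 - 2 * (f x * k x) + (k x)\<^sup>2)"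
    by (simp add: power2_diff algebra_simps)
  also have "\<dots> = (LINT x:{0..1}|lborel. (f x)\<^sup>2) - (LINT x:{0..1}|lborel. 2 * (f x * k x)) + (LINT x:{0..1}|lborel. (k x)\<^sup>2)"
    unfolding set_integral_add(2)[OF set_integral_diff(1)[OF i(1,2)] i(3)] set_integral_diff(2)[OF i(1,2)] ..
  finally show ?thesis by simp
qed

lemma eta_integral:
  assumes "in_L2 f" "in_L2 k"
  shows "(LINT x:{0..1}|lborel. eta (f x) (k x)) = (LINT x:{0..1}|lborel. (f x)\<^sup>2) / 2 + (LINT x:{0..1}|lborel. (k x)\<^sup>2) / 2"
  using assms unfolding eta_def by (subst set_integral_add(2)) (auto simp: in_L2_integrable_sq)

text \<open>
  An approximation of the solution by finite sums of products of a Lipschitz coefficient in time and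
  a periodic Lipschitz function in space, with derivatives \<open>c'\<close>, \<open>d'\<close> and \<open>g\<close>. The function
  \<open>P\<close> stands for the discrete diffusion, including the factor \<open>\<epsilon>\<close>.
\<close>

locale entropy_solution_approximation = entropy_solution_rep +
  fixes B :: "'i set" and \<psi> g c c' d d' :: "'i \<Rightarrow> real \<Rightarrow> real" and P :: "real \<Rightarrow> real \<Rightarrow> real"
  assumes \<psi>: "b \<in> B \<Longrightarrow> primitive_on 0 1 (\<psi> b) (g b)" "b \<in> B \<Longrightarrow> \<psi> b 1 = \<psi> b 0"
    "b \<in> B \<Longrightarrow> bounded_measurable_on 0 1 (g b)"
    and c: "b \<in> B \<Longrightarrow> primitive_on 0 T (c b) (c' b)" "b \<in> B \<Longrightarrow> bounded_measurable_on 0 T (c' b)"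
    and d: "b \<in> B \<Longrightarrow> primitive_on 0 T (d b) (d' b)" "b \<in> B \<Longrightarrow> bounded_measurable_on 0 T (d' b)"
    and P: "bounded_measurable_cyl T P"
    and P_slice: "t \<in> {0..T} \<Longrightarrow> bounded_measurable_on 0 1 (P t)"
begin

definition uh :: "real \<Rightarrow> real \<Rightarrow> real" where "uh t x = (\<Sum>b\<in>B. c b t * \<psi> b x)"
definition vh :: "real \<Rightarrow> real \<Rightarrow> real" where "vh t x = (\<Sum>b\<in>B. d b t * \<psi> b x)"
definition uht :: "real \<Rightarrow> real \<Rightarrow> real" where "uht t x = (\<Sum>b\<in>B. c' b t * \<psi> b x)"
definition vht :: "real \<Rightarrow> real \<Rightarrow> real" where "vht t x = (\<Sum>b\<in>B. d' b t * \<psi> b x)"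
definition uhx :: "real \<Rightarrow> real \<Rightarrow> real" where "uhx t x = (\<Sum>b\<in>B. c b t * g b x)"
definition vhx :: "real \<Rightarrow> real \<Rightarrow> real" where "vhx t x = (\<Sum>b\<in>B. d b t * g b x)"

lemma psi_bm: "b \<in> B \<Longrightarrow> bounded_measurable_on 0 1 (\<psi> b)"
  using primitive_on_continuous[OF \<psi>(1)] by (intro bounded_measurable_on_continuous)

lemma c_bm: "b \<in> B \<Longrightarrow> bounded_measurable_on 0 T (c b)" and d_bm: "b \<in> B \<Longrightarrow> bounded_measurable_on 0 T (d b)"
  by (auto intro!: bounded_measurable_on_continuous intro: primitive_on_continuous c(1) d(1))

lemma bounded_measurable:
  "bounded_measurable_cyl T uh" "bounded_measurable_cyl T vh" "bounded_measurable_cyl T uht"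
  "bounded_measurable_cyl T vht" "bounded_measurable_cyl T uhx" "bounded_measurable_cyl T vhx"
  unfolding uh_def[abs_def] vh_def[abs_def] uht_def[abs_def] vht_def[abs_def] uhx_def[abs_def] vhx_def[abs_def]
  by (intro bounded_measurable_cyl_sum bounded_measurable_cyl_tensor psi_bm c_bm d_bm \<psi> c d; assumption)+

lemma primitive_slices:
  "primitive_on 0 1 (uh t) (uhx t)" "uh t 1 = uh t 0" "primitive_on 0 1 (vh t) (vhx t)" "vh t 1 = vh t 0"
  unfolding uh_def[abs_def] vh_def[abs_def] uhx_def[abs_def] vhx_def[abs_def]
  by (auto intro!: primitive_on_sum primitive_on_cmult \<psi> sum.cong)

lemma bounded_measurable_on_sum:
  "(\<And>b. b \<in> B \<Longrightarrow> bounded_measurable_on 0 1 (f b)) \<Longrightarrow> bounded_measurable_on 0 1 (\<lambda>x. \<Sum>b\<in>B. k b * f b x)"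
proof (induction B rule: infinite_finite_induct)
  case (insert b B)
  then obtain C D where "\<forall>x\<in>{0..1}. \<bar>f b x\<bar> \<le> C" "\<forall>x\<in>{0..1}. \<bar>\<Sum>b\<in>B. k b * f b x\<bar> \<le> D"
    unfolding bounded_measurable_on_def by (metis insertI1 insertI2)
  note CD = this
  have "\<bar>k b * f b x + (\<Sum>b\<in>B. k b * f b x)\<bar> \<le> \<bar>k b\<bar> * C + D" if "x \<in> {0..1}" for x
  proof -
    have "\<bar>k b * f b x\<bar> \<le> \<bar>k b\<bar> * C" unfolding abs_mult using CD that by (intro mult_left_mono) auto
    moreover have "\<bar>\<Sum>b\<in>B. k b * f b x\<bar> \<le> D" using CD that by blast
    ultimately show ?thesis by linarith
  qed
  moreover have "set_borel_measurable lborel {0..1} (\<lambda>x. k b * f b x + (\<Sum>b\<in>B. k b * f b x))"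
    using insert
    by (intro set_borel_measurable_add set_borel_measurable_mult)
       (auto simp: bounded_measurable_on_def set_borel_measurable_def)
  ultimately have "bounded_measurable_on 0 1 (\<lambda>x. k b * f b x + (\<Sum>b\<in>B. k b * f b x))"
    unfolding bounded_measurable_on_def by blast
  then show ?case using insert(1,2) by simp
qed (auto simp: bounded_measurable_on_continuous)

lemma slices_L2: "in_L2 (uh t)" "in_L2 (vh t)" "in_L2 (uht t)" "in_L2 (vht t)" "in_L2 (uhx t)" "in_L2 (vhx t)"
  unfolding uh_def[abs_def] vh_def[abs_def] uht_def[abs_def] vht_def[abs_def] uhx_def[abs_def] vhx_def[abs_def]
  by (intro in_L2_bounded_measurable_on bounded_measurable_on_sum psi_bm \<psi>(3); assumption)+

lemma sum_slice_integral:
  assumes "in_L2 f"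
  shows "(LINT x:{0..1}|lborel. f x * (\<Sum>b\<in>B. k b * \<psi> b x)) = (\<Sum>b\<in>B. k b * (LINT x:{0..1}|lborel. f x * \<psi> b x))"
proof -
  have i: "set_integrable lborel {0..1} (\<lambda>x. f x * \<psi> b x)" if "b \<in> B" for b
    by (intro in_L2_mult assms in_L2_bounded_measurable_on psi_bm that)
  have "(LINT x:{0..1}|lborel. f x * (\<Sum>b\<in>B. k b * \<psi> b x)) = (LINT x|lborel. (\<Sum>b\<in>B. k b * (indicator {0..1} x * (f x * \<psi> b x))))"
    unfolding set_lebesgue_integral_def by (simp add: sum_distrib_left ac_simps)
  also have "\<dots> = (\<Sum>b\<in>B. LINT x|lborel. k b * (indicator {0..1} x * (f x * \<psi> b x)))"
    using i by (intro Bochner_Integration.integral_sum integrable_mult_right) (auto simp: set_integrable_def)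
  finally show ?thesis by (simp add: set_lebesgue_integral_def)
qed

lemma int_cyl_sum:
  assumes "\<And>b. b \<in> I \<Longrightarrow> in_L1_cyl S (f b)"
  shows "int_cyl S (\<lambda>t x. \<Sum>b\<in>I. f b t x) = (\<Sum>b\<in>I. int_cyl S (f b))"
  using assms
proof (induction I rule: infinite_finite_induct)
  case (insert b I)
  then show ?case by (simp add: int_cyl_add in_L1_cyl_sum)
qed (simp_all add: int_cyl_def)

lemma cross_term:
  assumes a: "in_L1_cyl T a" "weakly_continuous_L2 T a" and f: "in_L1_cyl T f" and a0: "in_L2 a0"
    and law: "\<And>s. s \<in> {0..T} \<Longrightarrow> weak_deriv_torus (\<lambda>x. LINT t:{0..s}|lborel. f t x) (\<lambda>x. a s x - a0 x)"
    and k: "\<And>b. b \<in> B \<Longrightarrow> primitive_on 0 T (k b) (k' b)" "\<And>b. b \<in> B \<Longrightarrow> bounded_measurable_on 0 T (k' b)"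
    and s: "s \<in> {0..T}"
  shows "(LINT x:{0..1}|lborel. a s x * (\<Sum>b\<in>B. k b s * \<psi> b x)) - (LINT x:{0..1}|lborel. a0 x * (\<Sum>b\<in>B. k b 0 * \<psi> b x))
    = int_cyl s (\<lambda>t x. a t x * (\<Sum>b\<in>B. k' b t * \<psi> b x) - f t x * (\<Sum>b\<in>B. k b t * g b x))"
proof -
  have as: "in_L2 (a s)" using a(2) s by (simp add: weakly_continuous_L2_def)
  have kb: "bounded_measurable_on 0 T (k b)" if "b \<in> B" for b
    using primitive_on_continuous[OF k(1)[OF that]] by (rule bounded_measurable_on_continuous)
  have L1: "in_L1_cyl s (\<lambda>t x. a t x * (k' b t * \<psi> b x) - f t x * (k b t * g b x))" if b: "b \<in> B" for b
    by (rule in_L1_cyl_subset[of T])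
       (use s in \<open>auto intro!: in_L1_cyl_diff in_L1_cyl_times a f bounded_measurable_cyl_tensor k kb psi_bm \<psi>(3) b\<close>)
  have "(LINT x:{0..1}|lborel. a s x * (\<Sum>b\<in>B. k b s * \<psi> b x)) - (LINT x:{0..1}|lborel. a0 x * (\<Sum>b\<in>B. k b 0 * \<psi> b x))
    = (\<Sum>b\<in>B. k b s * (LINT x:{0..1}|lborel. a s x * \<psi> b x) - k b 0 * (LINT x:{0..1}|lborel. a0 x * \<psi> b x))"
    by (simp add: sum_slice_integral as a0 sum_subtractf)
  also have "\<dots> = (\<Sum>b\<in>B. int_cyl s (\<lambda>t x. a t x * (k' b t * \<psi> b x) - f t x * (k b t * g b x)))"
    by (intro sum.cong refl conservation_law_product_rule[OF T a f law a0] \<psi> k s)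
  also have "\<dots> = int_cyl s (\<lambda>t x. \<Sum>b\<in>B. a t x * (k' b t * \<psi> b x) - f t x * (k b t * g b x))"
    by (rule int_cyl_sum[OF L1, symmetric])
  finally show ?thesis by (simp add: sum_subtractf sum_distrib_left)
qed

lemma self_term:
  assumes k: "\<And>b. b \<in> B \<Longrightarrow> primitive_on 0 T (k b) (k' b)" "\<And>b. b \<in> B \<Longrightarrow> bounded_measurable_on 0 T (k' b)"
    and w: "\<And>t x. w t x = (\<Sum>b\<in>B. k b t * \<psi> b x)" "\<And>t x. w' t x = (\<Sum>b\<in>B. k' b t * \<psi> b x)"
    and s: "s \<in> {0..T}"
  shows "(LINT x:{0..1}|lborel. (w s x)\<^sup>2) - (LINT x:{0..1}|lborel. (w 0 x)\<^sup>2) = 2 * int_cyl s (\<lambda>t x. w t x * w' t x)"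
proof -
  have kb: "bounded_measurable_on 0 T (k b)" if "b \<in> B" for b
    using primitive_on_continuous[OF k(1)[OF that]] by (rule bounded_measurable_on_continuous)
  have bw: "bounded_measurable_cyl T w" "bounded_measurable_cyl T w'"
    unfolding w[abs_def] by (intro bounded_measurable_cyl_sum bounded_measurable_cyl_tensor psi_bm kb k; assumption)+
  have L1: "in_L1_cyl s (\<lambda>t x. w t x * w' t x)"
    by (rule in_L1_cyl_subset[of T]) (use s bw in \<open>auto intro!: bounded_measurable_cyl_L1 bounded_measurable_cyl_mult\<close>)
  have w2: "in_L2 (w t)" for t
    unfolding w(1)[abs_def] by (intro in_L2_bounded_measurable_on bounded_measurable_on_sum psi_bm)
  have "(w s x)\<^sup>2 - (w 0 x)\<^sup>2 = 2 * (LINT t:{0..s}|lborel. w t x * w' t x)" for x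
  proof -
    have "primitive_on 0 T (\<lambda>t. w t x) (\<lambda>t. w' t x)"
      unfolding w using primitive_on_sum[of B 0 T "\<lambda>b t. \<psi> b x * k b t" "\<lambda>b t. \<psi> b x * k' b t"] primitive_on_cmult[OF k(1)]
      by (simp add: mult.commute)
    note * = primitive_on_mult[OF this this]
    have "(w s x)\<^sup>2 - (w 0 x)\<^sup>2 = (LINT t:{0..s}|lborel. 2 * (w t x * w' t x))"
      using primitive_on_integral[OF * s] by (simp add: power2_eq_square mult.commute)
    then show ?thesis by simp
  qed
  then have "(LINT x:{0..1}|lborel. (w s x)\<^sup>2 - (w 0 x)\<^sup>2) = 2 * int_cyl s (\<lambda>t x. w t x * w' t x)"
    using in_L1_cyl_space(2)[OF L1] by simp
  then show ?thesis using w2 by (subst (asm) set_integral_diff(2)) (auto simp: in_L2_integrable_sq)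
qed

text \<open>
  Twice the relative energy of the solution with respect to the approximation.
\<close>

definition rel :: "real \<Rightarrow> real" where
  "rel t = (LINT x:{0..1}|lborel. (u t x - uh t x)\<^sup>2) + (LINT x:{0..1}|lborel. (v t x - vh t x)\<^sup>2)"

definition ru :: "real \<Rightarrow> real \<Rightarrow> real" where "ru t x = uht t x - vhx t x"
definition r1 :: "real \<Rightarrow> real \<Rightarrow> real" where "r1 t x = vht t x - uhx t x - P t x"

definition residual_work :: "real \<Rightarrow> real" where
  "residual_work t = (LINT x:{0..1}|lborel. (u t x - uh t x) * ru t x + (v t x - vh t x) * r1 t x)"

text \<open>
  The dissipation of the solution, corrected by the terms in which the discrete diffusion enters;
  for \<open>P = \<epsilon> A\<close> it is computed in \<open>viscous_work_eq\<close> below.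
\<close>

definition viscous_work :: "real \<Rightarrow> real" where
  "viscous_work t = (LINT x:{0..1}|lborel. dissip t x - \<epsilon> * vx t x * vhx t x + (v t x - vh t x) * P t x)"

lemma e_L1: "in_L1_cyl T (\<lambda>t x. u t x - uh t x)" "in_L1_cyl T (\<lambda>t x. v t x - vh t x)"
  by (intro in_L1_cyl_diff u_L1 v_L1 bounded_measurable_cyl_L1 bounded_measurable)+

lemma residual_bm: "bounded_measurable_cyl T ru" "bounded_measurable_cyl T r1"
  unfolding ru_def[abs_def] r1_def[abs_def] by (intro bounded_measurable_cyl_diff bounded_measurable P)+

lemma residual_work_L1: "in_L1_cyl T (\<lambda>t x. (u t x - uh t x) * ru t x + (v t x - vh t x) * r1 t x)"
  by (intro in_L1_cyl_add in_L1_cyl_times e_L1 residual_bm)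

lemma viscous_work_L1: "in_L1_cyl T (\<lambda>t x. dissip t x - \<epsilon> * vx t x * vhx t x + (v t x - vh t x) * P t x)"
  by (intro in_L1_cyl_add in_L1_cyl_diff in_L1_cyl_times e_L1 dissip_L1 vx_L1 bounded_measurable P)

text \<open>
  The integrand is the \<open>x\<close>-derivative of the periodic function \<open>uh * vh\<close>.
\<close>

lemma transport_term:
  assumes s: "s \<in> {0..T}"
  shows "int_cyl s (\<lambda>t x. uhx t x * vh t x + uh t x * vhx t x) = 0"
proof -
  have "in_L1_cyl T (\<lambda>t x. uhx t x * vh t x + uh t x * vhx t x)"
    by (intro bounded_measurable_cyl_L1 bounded_measurable_cyl_add bounded_measurable_cyl_mult bounded_measurable)
  then have "in_L1_cyl s (\<lambda>t x. uhx t x * vh t x + uh t x * vhx t x)"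
    by (rule in_L1_cyl_subset) (use s in auto)
  moreover have "(LINT x:{0..1}|lborel. uhx t x * vh t x + uh t x * vhx t x) = 0" for t
    using primitive_on_integral[OF primitive_on_mult[OF primitive_slices(1,3)], of 1 t] primitive_slices(2,4)[of t] by simp
  ultimately show ?thesis using in_L1_cyl_time(2) by simp
qed

text \<open>
  Energy inequality minus the tested weak forms plus the energy identity of the approximation: the
  integrands on the dissipated side add up pointwise to the work of the residuals plus the viscous
  work minus the \<open>x\<close>-derivative of \<open>uh * vh\<close>.
\<close>

lemma relative_energy:
  assumes s: "s \<in> {0..T}"
  shows "rel s / 2 + (LINT t:{0..s}|lborel. viscous_work t) \<le> rel 0 / 2 - (LINT t:{0..s}|lborel. residual_work t)"
proof -
  have T0: "(0::real) \<in> {0..T}" using T by simp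
  \<comment> \<open>\<open>X1\<close> and \<open>X2\<close> come from testing the two laws, \<open>X3\<close> and \<open>X4\<close> from the approximation itself\<close>
  define X1 where "X1 = (\<lambda>t x. u t x * uht t x - v t x * uhx t x)"
  define X2 where "X2 = (\<lambda>t x. v t x * vht t x - (u t x + \<epsilon> * vx t x) * vhx t x)"
  define X3 where "X3 = (\<lambda>t x. uh t x * uht t x)"
  define X4 where "X4 = (\<lambda>t x. vh t x * vht t x)"
  define Y where "Y = (\<lambda>t x. uhx t x * vh t x + uh t x * vhx t x)"
  define Z where "Z = (\<lambda>t x. (u t x - uh t x) * ru t x + (v t x - vh t x) * r1 t x)"
  define W where "W = (\<lambda>t x. dissip t x - \<epsilon> * vx t x * vhx t x + (v t x - vh t x) * P t x)"
  have LT: "in_L1_cyl T X1" "in_L1_cyl T X2"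
    unfolding X1_def X2_def by (intro in_L1_cyl_diff in_L1_cyl_times u_L1 v_L1 flux_L1 bounded_measurable)+
  have LT': "in_L1_cyl T X3" "in_L1_cyl T X4" "in_L1_cyl T Y"
    unfolding X3_def X4_def Y_def
    by (intro bounded_measurable_cyl_L1 bounded_measurable_cyl_add bounded_measurable_cyl_mult bounded_measurable)+
  have LT'': "in_L1_cyl T Z" "in_L1_cyl T W"
    unfolding Z_def W_def by (rule residual_work_L1, rule viscous_work_L1)
  have sT: "s \<le> T" using s by simp
  note L1 = in_L1_cyl_subset[OF dissip_L1 sT] LT[THEN in_L1_cyl_subset, OF sT] LT'[THEN in_L1_cyl_subset, OF sT]
    LT''[THEN in_L1_cyl_subset, OF sT]
  have I0: "energy s + int_cyl s dissip \<le> energy0" by (rule energy_dissipation[OF s])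
  have I1: "(LINT x:{0..1}|lborel. u s x * uh s x) - (LINT x:{0..1}|lborel. u0 x * uh 0 x) = int_cyl s X1"
    unfolding uh_def uht_def uhx_def X1_def
    by (rule cross_term[OF u_L1 wc(1) v_L1 init(1) integrated_laws(1) c s])
  have I2: "(LINT x:{0..1}|lborel. v s x * vh s x) - (LINT x:{0..1}|lborel. v0 x * vh 0 x) = int_cyl s X2"
    unfolding vh_def vht_def vhx_def X2_def
    by (rule cross_term[OF v_L1 wc(2) flux_L1 init(2) integrated_laws(2) d s])
  have I3: "(LINT x:{0..1}|lborel. (uh s x)\<^sup>2) - (LINT x:{0..1}|lborel. (uh 0 x)\<^sup>2) = 2 * int_cyl s X3"
    unfolding X3_def by (rule self_term[OF c uh_def uht_def s])
  have I4: "(LINT x:{0..1}|lborel. (vh s x)\<^sup>2) - (LINT x:{0..1}|lborel. (vh 0 x)\<^sup>2) = 2 * int_cyl s X4"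
    unfolding X4_def by (rule self_term[OF d vh_def vht_def s])
  have rs: "rel s / 2 = energy s - (LINT x:{0..1}|lborel. u s x * uh s x) - (LINT x:{0..1}|lborel. v s x * vh s x)
      + (LINT x:{0..1}|lborel. (uh s x)\<^sup>2) / 2 + (LINT x:{0..1}|lborel. (vh s x)\<^sup>2) / 2"
    unfolding rel_def energy_def eta_integral[OF L2[OF s]]
      L2_sq_diff[OF L2(1)[OF s] slices_L2(1)] L2_sq_diff[OF L2(2)[OF s] slices_L2(2)]
    by (simp add: field_simps)
  have r0: "rel 0 / 2 = energy0 - (LINT x:{0..1}|lborel. u0 x * uh 0 x) - (LINT x:{0..1}|lborel. v0 x * vh 0 x)
      + (LINT x:{0..1}|lborel. (uh 0 x)\<^sup>2) / 2 + (LINT x:{0..1}|lborel. (vh 0 x)\<^sup>2) / 2"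
  proof -
    have "(LINT x:{0..1}|lborel. (u 0 x - uh 0 x)\<^sup>2) = (LINT x:{0..1}|lborel. (u0 x - uh 0 x)\<^sup>2)"
      using in_L2_diff[OF L2(1)[OF T0] slices_L2(1)] in_L2_diff[OF init(1) slices_L2(1)]
      by (intro set_integral_eq_AE) (auto simp: in_L2_integrable_sq intro: eventually_mono[OF initial_values(1)])
    moreover have "(LINT x:{0..1}|lborel. (v 0 x - vh 0 x)\<^sup>2) = (LINT x:{0..1}|lborel. (v0 x - vh 0 x)\<^sup>2)"
      using in_L2_diff[OF L2(2)[OF T0] slices_L2(2)] in_L2_diff[OF init(2) slices_L2(2)]
      by (intro set_integral_eq_AE) (auto simp: in_L2_integrable_sq intro: eventually_mono[OF initial_values(2)])
    ultimately show ?thesis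
      unfolding rel_def energy0_def eta_integral[OF init]
        L2_sq_diff[OF init(1) slices_L2(1)] L2_sq_diff[OF init(2) slices_L2(2)]
      by (simp add: L2_sq_diff[OF init(1) slices_L2(1)] L2_sq_diff[OF init(2) slices_L2(2)] field_simps)
  qed
  have "int_cyl s dissip + int_cyl s X1 + int_cyl s X2 - int_cyl s X3 - int_cyl s X4
      = int_cyl s (\<lambda>t x. dissip t x + X1 t x + X2 t x - X3 t x - X4 t x)"
    by (simp add: int_cyl_add int_cyl_diff in_L1_cyl_add in_L1_cyl_diff L1)
  also have "(\<lambda>t x. dissip t x + X1 t x + X2 t x - X3 t x - X4 t x) = (\<lambda>t x. Z t x + W t x - Y t x)"
    unfolding X1_def X2_def X3_def X4_def Y_def Z_def W_def ru_def r1_def by (simp add: algebra_simps)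
  also have "int_cyl s (\<lambda>t x. Z t x + W t x - Y t x) = int_cyl s Z + int_cyl s W - int_cyl s Y"
    by (simp add: int_cyl_add int_cyl_diff in_L1_cyl_add L1)
  also have "int_cyl s Z = (LINT t:{0..s}|lborel. residual_work t)"
    unfolding residual_work_def using in_L1_cyl_time(2)[OF L1(7)] by (simp add: Z_def)
  also have "int_cyl s W = (LINT t:{0..s}|lborel. viscous_work t)"
    unfolding viscous_work_def using in_L1_cyl_time(2)[OF L1(8)] by (simp add: W_def)
  also have "int_cyl s Y = 0" unfolding Y_def by (rule transport_term[OF s])
  finally show ?thesis using I0 I1 I2 I3 I4 rs r0 by linarith
qed

end

section \<open>The error estimate for an abstract approximation\<close>

lemma L2_pair_Cauchy_Schwarz:
  assumes "in_L2 f" "in_L2 f'" "in_L2 k" "in_L2 k'"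
  shows "(LINT x:{0..1}|lborel. f x * k x + f' x * k' x)
    \<le> sqrt ((LINT x:{0..1}|lborel. (f x)\<^sup>2) + (LINT x:{0..1}|lborel. (f' x)\<^sup>2))
     * sqrt ((LINT x:{0..1}|lborel. (k x)\<^sup>2) + (LINT x:{0..1}|lborel. (k' x)\<^sup>2))"
proof -
  define a where "a = (LINT x:{0..1}|lborel. (f x)\<^sup>2) + (LINT x:{0..1}|lborel. (f' x)\<^sup>2)"
  define b where "b = (LINT x:{0..1}|lborel. (k x)\<^sup>2) + (LINT x:{0..1}|lborel. (k' x)\<^sup>2)"
  define m where "m = (LINT x:{0..1}|lborel. f x * k x) + (LINT x:{0..1}|lborel. f' x * k' x)"
  have nn: "(LINT x:{0..1}|lborel. (h x)\<^sup>2) \<ge> 0" for h :: "real \<Rightarrow> real"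
    unfolding set_lebesgue_integral_def by (rule integral_nonneg_AE) auto
  have ab: "a \<ge> 0" "b \<ge> 0" unfolding a_def b_def by (auto intro!: add_nonneg_nonneg nn)
  have quad: "2 * m * r \<le> a + b * r\<^sup>2" for r
  proof -
    have "0 \<le> (LINT x:{0..1}|lborel. (f x - r * k x)\<^sup>2) + (LINT x:{0..1}|lborel. (f' x - r * k' x)\<^sup>2)"
      by (intro add_nonneg_nonneg nn)
    also have "\<dots> = a - 2 * r * m + r\<^sup>2 * b"
      using L2_sq_diff[OF assms(1) in_L2_cmult[OF assms(3), of r]] L2_sq_diff[OF assms(2) in_L2_cmult[OF assms(4), of r]]
      by (simp add: a_def b_def m_def power_mult_distrib algebra_simps)
    finally show ?thesis by (simp add: algebra_simps)
  qed
  have "m \<le> sqrt a * sqrt b"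
  proof (cases "b = 0")
    case True
    show ?thesis
    proof (rule ccontr)
      assume "\<not> ?thesis"
      then have "m > 0" using True by simp
      then show False using quad[of "(a + 1) / (2 * m)"] True by (simp add: field_simps)
    qed
  next
    case False
    show ?thesis
    proof (rule ccontr)
      assume n: "\<not> ?thesis"
      have "sqrt a * sqrt b \<ge> 0" using ab by simp
      then have "m > 0" using n by linarith
      have "2 * m * (m / b) \<le> a + b * (m / b)\<^sup>2" by (rule quad)
      also have "b * (m / b)\<^sup>2 = m\<^sup>2 / b" using False by (simp add: power2_eq_square)
      finally have "m\<^sup>2 / b \<le> a" by (simp add: power2_eq_square)
      then have "m\<^sup>2 \<le> a * b" using False ab by (simp add: field_simps)
      then have "m \<le> sqrt (a * b)" by (rule real_le_rsqrt)
      then show False using n by (simp add: real_sqrt_mult)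
    qed
  qed
  moreover have "(LINT x:{0..1}|lborel. f x * k x + f' x * k' x) = m"
    unfolding m_def by (intro set_integral_add(2) in_L2_mult assms)
  ultimately show ?thesis by (simp add: a_def b_def)
qed

text \<open>
  The residual enters linearly in the error, so the supremum of the error can be factored out of the
  time integral; the resulting quadratic inequality is solved by Young. Applying the estimate at the
  final time again keeps the dissipation \<open>\<delta>\<close>.
\<close>

lemma sup_absorption:
  fixes N \<delta> :: "real \<Rightarrow> real"
  assumes s: "0 \<le> s" and bdd: "\<And>t. t \<in> {0..s} \<Longrightarrow> N t \<le> C" and N0: "\<And>t. t \<in> {0..s} \<Longrightarrow> 0 \<le> N t" and R: "0 \<le> R"
    and \<delta>: "\<And>t. 0 \<le> \<delta> t"
    and est: "\<And>E t. 0 \<le> E \<Longrightarrow> (\<And>r. r \<in> {0..s} \<Longrightarrow> N r \<le> E\<^sup>2) \<Longrightarrow> t \<in> {0..s} \<Longrightarrow>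
       N t + \<delta> t \<le> a + 2 * (E * R)"
  shows "N s + \<delta> s \<le> 2 * a + 4 * R\<^sup>2"
proof -
  define m where "m = (SUP t\<in>{0..s}. N t)"
  have ba: "bdd_above (N ` {0..s})" using bdd by (intro bdd_aboveI2)
  have ne: "{0..s} \<noteq> {}" using s by simp
  have le: "N t \<le> m" if "t \<in> {0..s}" for t unfolding m_def by (rule cSUP_upper[OF that ba])
  have m0: "m \<ge> 0" using le[of 0] N0[of 0] s by simp
  define E where "E = sqrt m"
  have E: "E \<ge> 0" "E\<^sup>2 = m" using m0 by (auto simp: E_def)
  have e: "N t + \<delta> t \<le> a + 2 * (E * R)" if "t \<in> {0..s}" for t
    by (rule est[OF E(1) _ that]) (use le E in auto)
  have "N t \<le> a + 2 * (E * R)" if "t \<in> {0..s}" for t using e[OF that] \<delta>[of t] by linarith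
  then have "m \<le> a + 2 * (E * R)" unfolding m_def by (intro cSUP_least ne)
  \<comment> \<open>half of the supremum is absorbed\<close>
  moreover have "2 * (E * R) \<le> E\<^sup>2 / 2 + 2 * R\<^sup>2"
    using zero_le_power2[of "E - 2 * R"] by (simp add: power2_diff power_mult_distrib)
  ultimately show ?thesis using e[of s] s E by simp
qed

lemma L2norm_pair:
  assumes "in_L2 f" "in_L2 k"
  shows "L2norm (\<lambda>x. (f x, k x)) = ennreal (sqrt ((LINT x:{0..1}|lborel. (f x)\<^sup>2) + (LINT x:{0..1}|lborel. (k x)\<^sup>2)))"
    and "L2sq (\<lambda>x. (f x, k x)) = ennreal ((LINT x:{0..1}|lborel. (f x)\<^sup>2) + (LINT x:{0..1}|lborel. (k x)\<^sup>2))"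
proof -
  have i: "set_integrable lborel {0..1} (\<lambda>x. (f x)\<^sup>2)" "set_integrable lborel {0..1} (\<lambda>x. (k x)\<^sup>2)"
    using assms by (auto simp: in_L2_integrable_sq)
  have "L2sq (\<lambda>x. (f x, k x)) = (\<integral>\<^sup>+ x. ennreal (indicator {0..1} x * ((f x)\<^sup>2 + (k x)\<^sup>2)) \<partial>lborel)"
    unfolding L2sq_on_def by (intro nn_integral_cong) (auto simp: indicator_def norm_Pair)
  also have "\<dots> = ennreal (LINT x:{0..1}|lborel. (f x)\<^sup>2 + (k x)\<^sup>2)"
    unfolding set_lebesgue_integral_def using set_integral_add(1)[OF i]
    by (subst nn_integral_eq_integral) (auto simp: set_integrable_def)
  finally show *: "L2sq (\<lambda>x. (f x, k x)) = ennreal ((LINT x:{0..1}|lborel. (f x)\<^sup>2) + (LINT x:{0..1}|lborel. (k x)\<^sup>2))"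
    using set_integral_add(2)[OF i] by simp
  have "(LINT x:{0..1}|lborel. (f x)\<^sup>2) + (LINT x:{0..1}|lborel. (k x)\<^sup>2) \<ge> 0"
    unfolding set_lebesgue_integral_def by (intro add_nonneg_nonneg integral_nonneg_AE) auto
  then show "L2norm (\<lambda>x. (f x, k x)) = ennreal (sqrt ((LINT x:{0..1}|lborel. (f x)\<^sup>2) + (LINT x:{0..1}|lborel. (k x)\<^sup>2)))"
    unfolding L2norm_def * sqrt_ennreal_def by simp
qed

context entropy_solution_approximation begin

definition residual_norm :: "real \<Rightarrow> real" where
  "residual_norm t = sqrt ((LINT x:{0..1}|lborel. (ru t x)\<^sup>2) + (LINT x:{0..1}|lborel. (r1 t x)\<^sup>2))"

lemma P_L2: "t \<in> {0..T} \<Longrightarrow> in_L2 (P t)"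
  by (intro in_L2_bounded_measurable_on P_slice)

lemma residual_L2: "t \<in> {0..T} \<Longrightarrow> in_L2 (ru t)" "t \<in> {0..T} \<Longrightarrow> in_L2 (r1 t)"
  unfolding ru_def[abs_def] r1_def[abs_def] by (auto intro!: in_L2_diff slices_L2 P_L2)

lemma e_L2: "t \<in> {0..T} \<Longrightarrow> in_L2 (\<lambda>x. u t x - uh t x)" "t \<in> {0..T} \<Longrightarrow> in_L2 (\<lambda>x. v t x - vh t x)"
  by (auto intro!: in_L2_diff slices_L2 L2)

lemma residual_norm_integrable: "set_integrable lborel {0..T} residual_norm"
proof -
  define \<rho>2 where "\<rho>2 = (\<lambda>t. (LINT x:{0..1}|lborel. (ru t x)\<^sup>2) + (LINT x:{0..1}|lborel. (r1 t x)\<^sup>2))"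
  have i1: "in_L1_cyl T (\<lambda>t x. ru t x * ru t x)" and i2: "in_L1_cyl T (\<lambda>t x. r1 t x * r1 t x)"
    by (intro bounded_measurable_cyl_L1 bounded_measurable_cyl_mult residual_bm)+
  have i: "set_integrable lborel {0..T} \<rho>2"
    using set_integral_add(1)[OF in_L1_cyl_time(1)[OF i1] in_L1_cyl_time(1)[OF i2]]
    by (simp add: \<rho>2_def power2_eq_square)
  have nn: "\<rho>2 t \<ge> 0" for t
    unfolding \<rho>2_def set_lebesgue_integral_def by (intro add_nonneg_nonneg integral_nonneg_AE) auto
  have "set_integrable lborel {0..T} (\<lambda>t. sqrt (\<rho>2 t))"
  proof (rule set_integrable_bound)
    show "set_integrable lborel {0..T} (\<lambda>t. 1 + \<rho>2 t)" using i by (intro set_integral_add(1)) auto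
    have "(\<lambda>t. sqrt (indicator {0..T} t * \<rho>2 t)) \<in> borel_measurable lborel"
      using i by (auto simp: set_integrable_def)
    also have "(\<lambda>t. sqrt (indicator {0..T} t * \<rho>2 t)) = (\<lambda>t. indicator {0..T} t * sqrt (\<rho>2 t))"
      by (auto simp: indicator_def)
    finally show "set_borel_measurable lborel {0..T} (\<lambda>t. sqrt (\<rho>2 t))" by (simp add: set_borel_measurable_def)
    have "sqrt (\<rho>2 t) \<le> 1 + \<rho>2 t" for t
    proof (rule real_le_lsqrt)
      show "\<rho>2 t \<le> (1 + \<rho>2 t)\<^sup>2" using nn[of t] by (simp add: power2_sum)
    qed (use nn[of t] in auto)
    then show "AE t in lborel. t \<in> {0..T} \<longrightarrow> norm (sqrt (\<rho>2 t)) \<le> norm (1 + \<rho>2 t)" using nn by auto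
  qed
  then show ?thesis by (simp add: \<rho>2_def residual_norm_def[abs_def])
qed

lemma rel_nonneg: "rel t \<ge> 0"
  unfolding rel_def set_lebesgue_integral_def by (intro add_nonneg_nonneg integral_nonneg_AE) auto

lemma residual_work_integrable: "set_integrable lborel {0..T} residual_work"
  unfolding residual_work_def[abs_def] by (rule in_L1_cyl_time(1)[OF residual_work_L1])

lemma viscous_work_integrable: "set_integrable lborel {0..T} viscous_work"
  unfolding viscous_work_def[abs_def] by (rule in_L1_cyl_time(1)[OF viscous_work_L1])

text \<open>
  Boundedness is needed before the supremum can be absorbed; the relative energy is below a
  continuous function of time.
\<close>

lemma rel_bounded: "\<exists>C. \<forall>s\<in>{0..T}. rel s \<le> C"
proof -
  let ?Z = "\<lambda>s. rel 0 - 2 * (LINT t:{0..s}|lborel. residual_work t) - 2 * (LINT t:{0..s}|lborel. viscous_work t)"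
  have "continuous_on {0..T} ?Z"
    by (intro continuous_intros continuous_on_indefinite_integral residual_work_integrable viscous_work_integrable)
  then have "bounded (?Z ` {0..T})" by (intro compact_imp_bounded compact_continuous_image) auto
  then obtain C where C: "\<forall>s\<in>{0..T}. \<bar>?Z s\<bar> \<le> C" by (auto simp: bounded_iff)
  have "rel s \<le> C" if "s \<in> {0..T}" for s
    using relative_energy[OF that] C that by fastforce
  then show ?thesis by blast
qed

lemma residual_work_bound:
  assumes s: "s \<in> {0..T}" and t: "t \<in> {0..s}" and E: "0 \<le> E" "\<And>r. r \<in> {0..s} \<Longrightarrow> rel r \<le> E\<^sup>2"
  shows "- (LINT r:{0..t}|lborel. residual_work r) \<le> E * (LINT r:{0..s}|lborel. residual_norm r)"
proof -
  have iw: "set_integrable lborel {0..t} residual_work"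
    by (rule set_integrable_subset[OF residual_work_integrable]) (use s t in auto)
  have inn: "set_integrable lborel {0..r} residual_norm" if "r \<le> s" for r
    by (rule set_integrable_subset[OF residual_norm_integrable]) (use s that in auto)
  have "- (LINT r:{0..t}|lborel. residual_work r) = (LINT r:{0..t}|lborel. (- 1) * residual_work r)"
    by (subst set_integral_mult_right) simp
  also have "\<dots> \<le> (LINT r:{0..t}|lborel. E * residual_norm r)"
  proof (rule set_integral_mono)
    show "set_integrable lborel {0..t} (\<lambda>r. (- 1) * residual_work r)" using iw by (intro set_integrable_mult_right) auto
    show "set_integrable lborel {0..t} (\<lambda>r. E * residual_norm r)" using inn[of t] t by (intro set_integrable_mult_right) auto
    fix r assume r: "r \<in> {0..t}"
    then have rT: "r \<in> {0..T}" "r \<in> {0..s}" using s t by auto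
    let ?e = "\<lambda>x. (- 1) * (u r x - uh r x)" and ?e' = "\<lambda>x. (- 1) * (v r x - vh r x)"
    have "(- 1) * residual_work r = (LINT x:{0..1}|lborel. ?e x * ru r x + ?e' x * r1 r x)"
      unfolding residual_work_def
      by (subst set_integral_mult_right[symmetric]) (simp add: algebra_simps)
    also have "\<dots> \<le> sqrt ((LINT x:{0..1}|lborel. (?e x)\<^sup>2) + (LINT x:{0..1}|lborel. (?e' x)\<^sup>2)) * residual_norm r"
      unfolding residual_norm_def
      by (intro L2_pair_Cauchy_Schwarz in_L2_cmult e_L2 residual_L2 rT)
    also have "(LINT x:{0..1}|lborel. (?e x)\<^sup>2) + (LINT x:{0..1}|lborel. (?e' x)\<^sup>2) = rel r"
      by (simp add: rel_def power2_commute)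
    also have "sqrt (rel r) * residual_norm r \<le> E * residual_norm r"
    proof (rule mult_right_mono)
      show "sqrt (rel r) \<le> E" using E(1) E(2)[OF rT(2)] by (intro real_le_lsqrt) (auto simp: rel_nonneg)
      show "0 \<le> residual_norm r"
        unfolding residual_norm_def set_lebesgue_integral_def
        by (intro real_sqrt_ge_zero add_nonneg_nonneg integral_nonneg_AE) auto
    qed
    finally show "(- 1) * residual_work r \<le> E * residual_norm r" .
  qed
  also have "\<dots> = E * (LINT r:{0..t}|lborel. residual_norm r)" by simp
  also have "\<dots> \<le> E * (LINT r:{0..s}|lborel. residual_norm r)"
  proof (rule mult_left_mono[OF _ E(1)])
    have "0 \<le> (LINT r:{t..s}|lborel. residual_norm r)"
      unfolding set_lebesgue_integral_def residual_norm_def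
      by (intro integral_nonneg_AE AE_I2 scaleR_nonneg_nonneg real_sqrt_ge_zero add_nonneg_nonneg) auto
    then show "(LINT r:{0..t}|lborel. residual_norm r) \<le> (LINT r:{0..s}|lborel. residual_norm r)"
      using set_integrable_interval_split[OF inn[of s], of t s] t by simp
  qed
  finally show ?thesis .
qed

definition dxe_sq :: "real \<Rightarrow> real" where
  "dxe_sq t = (LINT x:{0..1}|lborel. (vx t x - vhx t x)\<^sup>2)"

text \<open>
  The third residual \<open>A - \<partial>\<^sub>x\<^sub>x vh\<close> paired with the error in \<open>v\<close>; the second
  derivative is integrated by parts.
\<close>

definition diffusion_residual :: "(real \<Rightarrow> real \<Rightarrow> real) \<Rightarrow> real \<Rightarrow> real" where
  "diffusion_residual A t = (LINT x:{0..1}|lborel. A t x * (v t x - vh t x)) + (LINT x:{0..1}|lborel. vhx t x * (vx t x - vhx t x))"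

lemma dxe_sq_nonneg: "dxe_sq t \<ge> 0"
  unfolding dxe_sq_def set_lebesgue_integral_def by (rule integral_nonneg_AE) auto

lemma vx_slice_L2:
  assumes "\<epsilon> > 0" shows "AE t in lborel. t \<in> {0<..<T} \<longrightarrow> in_L2 (vx t)"
proof -
  have vxL1: "in_L1_cyl T vx"
    using in_L1_cyl_cmult[OF vx_L1, of "1 / \<epsilon>"] assms by simp
  show ?thesis
    using in_L1_cyl_slice_AE[OF vxL1] in_L1_cyl_slice_AE[OF dissip_L1]
  proof eventually_elim
    case (elim t)
    show ?case
    proof
      assume "t \<in> {0<..<T}"
      then have i: "set_integrable lborel {0..1} (vx t)" "set_integrable lborel {0..1} (dissip t)" using elim by blast+
      have "set_integrable lborel {0..1} (\<lambda>x. (1 / \<epsilon>) * dissip t x)" using i(2) by (rule set_integrable_mult_right)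
      moreover have "(\<lambda>x. (1 / \<epsilon>) * dissip t x) = (\<lambda>x. (vx t x)\<^sup>2)" using assms by (simp add: dissip_def)
      moreover have "set_borel_measurable lborel {0..1} (vx t)"
        using i(1) unfolding set_integrable_def set_borel_measurable_def by (rule borel_measurable_integrable)
      ultimately show "in_L2 (vx t)" by (simp add: in_L2_integrable_sq)
    qed
  qed
qed

lemma dxe_sq_integrable:
  assumes "\<epsilon> > 0" shows "set_integrable lborel {0..T} dxe_sq"
proof -
  have "in_L1_cyl T (\<lambda>t x. (1 / \<epsilon>) * (dissip t x - 2 * (\<epsilon> * vx t x * vhx t x) + \<epsilon> * (vhx t x * vhx t x)))"
    by (intro in_L1_cyl_cmult in_L1_cyl_add in_L1_cyl_diff dissip_L1 in_L1_cyl_times vx_L1 bounded_measurable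
        bounded_measurable_cyl_L1 bounded_measurable_cyl_mult)
  moreover have "(\<lambda>t x. (1 / \<epsilon>) * (dissip t x - 2 * (\<epsilon> * vx t x * vhx t x) + \<epsilon> * (vhx t x * vhx t x)))
     = (\<lambda>t x. (vx t x - vhx t x)\<^sup>2)"
    using assms by (auto simp: fun_eq_iff dissip_def power2_diff power2_eq_square field_simps)
  ultimately have "in_L1_cyl T (\<lambda>t x. (vx t x - vhx t x)\<^sup>2)" by (simp only:)
  then show ?thesis unfolding dxe_sq_def[abs_def] by (rule in_L1_cyl_time(1))
qed

lemma viscous_work_eq:
  assumes eps: "\<epsilon> > 0" and A: "\<And>t x. P t x = \<epsilon> * A t x"
  shows "AE t in lborel. t \<in> {0<..<T} \<longrightarrow> viscous_work t = \<epsilon> * (dxe_sq t + diffusion_residual A t)"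
  using vx_slice_L2[OF eps]
proof eventually_elim
  case (elim t)
  show ?case
  proof
    assume t: "t \<in> {0<..<T}"
    then have vx: "in_L2 (vx t)" and tT: "t \<in> {0..T}" using elim by auto
    have "A t = (\<lambda>x. (1 / \<epsilon>) * P t x)" using A eps by auto
    then have "in_L2 (A t)" using in_L2_cmult[OF P_L2[OF tT], of "1 / \<epsilon>"] by simp
    then have i1: "set_integrable lborel {0..1} (\<lambda>x. A t x * (v t x - vh t x))" by (intro in_L2_mult e_L2 tT)
    have dL2: "in_L2 (\<lambda>x. vx t x - vhx t x)" by (intro in_L2_diff vx slices_L2)
    then have i2: "set_integrable lborel {0..1} (\<lambda>x. (vx t x - vhx t x)\<^sup>2)" by (simp add: in_L2_integrable_sq)
    have i3: "set_integrable lborel {0..1} (\<lambda>x. vhx t x * (vx t x - vhx t x))" by (intro in_L2_mult slices_L2 dL2)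
    have "dxe_sq t + diffusion_residual A t = (LINT x:{0..1}|lborel. (vx t x - vhx t x)\<^sup>2
        + (A t x * (v t x - vh t x) + vhx t x * (vx t x - vhx t x)))"
      unfolding dxe_sq_def diffusion_residual_def
      by (simp only: set_integral_add(2)[OF i2 set_integral_add(1)[OF i1 i3]] set_integral_add(2)[OF i1 i3])
    then have "\<epsilon> * (dxe_sq t + diffusion_residual A t) = (LINT x:{0..1}|lborel. \<epsilon> * ((vx t x - vhx t x)\<^sup>2
        + (A t x * (v t x - vh t x) + vhx t x * (vx t x - vhx t x))))" by simp
    also have "\<dots> = viscous_work t"
      unfolding viscous_work_def
      by (simp add: dissip_def A power2_eq_square algebra_simps)
    finally show "viscous_work t = \<epsilon> * (dxe_sq t + diffusion_residual A t)" by simp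
  qed
qed

lemma nn_integral_set_real:
  assumes "set_integrable lborel {a..b} f" "\<And>x. f x \<ge> 0"
  shows "(\<integral>\<^sup>+ x\<in>{a..b}. ennreal (f x) \<partial>lborel) = ennreal (LINT x:{a..b}|lborel. f x)"
proof -
  have "(\<integral>\<^sup>+ x\<in>{a..b}. ennreal (f x) \<partial>lborel) = (\<integral>\<^sup>+ x. ennreal (indicator {a..b} x * f x) \<partial>lborel)"
    by (intro nn_integral_cong) (auto simp: indicator_def)
  then show ?thesis
    unfolding set_lebesgue_integral_def using assms by (simp add: nn_integral_eq_integral set_integrable_def)
qed

text \<open>
  The bound \<open>H\<close> enters only through its time integral, as a nonnegative extended real function
  that may fail to be measurable. Therefore the comparison is made for the positive part of \<open>W\<close>,
  whose integral is monotone under extension from \<open>{0..t}\<close> to \<open>{0..s}\<close>.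
\<close>

lemma viscous_work_bound:
  assumes eps: "\<epsilon> > 0" and A: "\<And>t x. P t x = \<epsilon> * A t x" and s: "s \<in> {0..T}" and t: "t \<in> {0..s}"
    and H: "AE t in lborel. t \<in> {0<..<s} \<longrightarrow> ennreal (- 2 * diffusion_residual A t - dxe_sq t) \<le> H t"
    and fin: "(\<integral>\<^sup>+ t\<in>{0..s}. H t \<partial>lborel) = ennreal h" and h: "h \<ge> 0"
  shows "\<epsilon> * (LINT r:{0..t}|lborel. dxe_sq r) \<le> 2 * (LINT r:{0..t}|lborel. viscous_work r) + \<epsilon> * h"
proof -
  define W where "W = (\<lambda>t. dxe_sq t - (2 / \<epsilon>) * viscous_work t)"
  have iD: "set_integrable lborel {0..r} dxe_sq" and iV: "set_integrable lborel {0..r} viscous_work" if "r \<le> T" for r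
    by (rule set_integrable_subset[OF dxe_sq_integrable[OF eps]] set_integrable_subset[OF viscous_work_integrable]; use that in auto)+
  have iW: "set_integrable lborel {0..r} W" if "r \<le> T" for r
    unfolding W_def using iD[OF that] iV[OF that] by (intro set_integral_diff(1) set_integrable_mult_right) auto
  have st: "t \<le> T" "s \<le> T" "0 \<le> t" "t \<le> s" using s t by auto
  have iW': "set_integrable lborel {0..s} (\<lambda>r. max 0 (W r))"
  proof (rule set_integrable_bound[OF iW[OF st(2)]])
    have "(\<lambda>r. max 0 (indicator {0..s} r * W r)) \<in> borel_measurable lborel"
      using iW[OF st(2)] by (auto simp: set_integrable_def)
    also have "(\<lambda>r. max 0 (indicator {0..s} r * W r)) = (\<lambda>r. indicator {0..s} r * max 0 (W r))"
      by (auto simp: indicator_def)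
    finally show "set_borel_measurable lborel {0..s} (\<lambda>r. max 0 (W r))" by (simp add: set_borel_measurable_def)
  qed auto
  have iW'': "set_integrable lborel {0..t} (\<lambda>r. max 0 (W r))"
    by (rule set_integrable_subset[OF iW']) (use st in auto)
  have "ennreal (LINT r:{0..s}|lborel. max 0 (W r)) = (\<integral>\<^sup>+ r\<in>{0..s}. ennreal (max 0 (W r)) \<partial>lborel)"
    by (rule nn_integral_set_real[OF iW', symmetric]) simp
  also have "\<dots> \<le> (\<integral>\<^sup>+ r\<in>{0..s}. H r \<partial>lborel)"
  proof (rule nn_integral_mono_AE)
    show "AE r in lborel. ennreal (max 0 (W r)) * indicator {0..s} r \<le> H r * indicator {0..s} r"
      using H viscous_work_eq[OF eps A] AE_lborel_singleton[of 0] AE_lborel_singleton[of s]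
    proof eventually_elim
      case (elim r)
      show ?case
      proof (cases "r \<in> {0<..<s}")
        case True
        then have "W r = - 2 * diffusion_residual A r - dxe_sq r"
          using elim(2) st eps by (simp add: W_def field_simps)
        moreover have "ennreal (max 0 y) = ennreal y" for y by (auto simp: max_def ennreal_neg)
        ultimately show ?thesis using elim(1) True by (simp add: mult_right_mono)
      next
        case False
        then have "r \<notin> {0..s}" using elim(3,4) by auto
        then show ?thesis by simp
      qed
    qed
  qed
  also have "\<dots> = ennreal h" by (rule fin)
  finally have le: "(LINT r:{0..s}|lborel. max 0 (W r)) \<le> h" using h by simp
  have "(LINT r:{0..t}|lborel. W r) \<le> (LINT r:{0..t}|lborel. max 0 (W r))"
    by (rule set_integral_mono[OF iW[OF st(1)] iW'']) simp
  also have "\<dots> \<le> (LINT r:{0..s}|lborel. max 0 (W r))"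
  proof -
    have "0 \<le> (LINT r:{t..s}|lborel. max 0 (W r))"
      unfolding set_lebesgue_integral_def by (intro integral_nonneg_AE) auto
    then show ?thesis using set_integrable_interval_split[OF iW', of t s] st by simp
  qed
  finally have "(LINT r:{0..t}|lborel. W r) \<le> h" using le by simp
  moreover have "(LINT r:{0..t}|lborel. W r) = (LINT r:{0..t}|lborel. dxe_sq r) - (2 / \<epsilon>) * (LINT r:{0..t}|lborel. viscous_work r)"
    unfolding W_def using iD[OF st(1)] iV[OF st(1)]
    by (subst set_integral_diff(2)) (auto intro!: set_integrable_mult_right)
  ultimately show ?thesis using eps by (simp add: field_simps)
qed

text \<open>
  If the integral of \<open>H\<close> is infinite and \<open>\<epsilon>\<close> is positive, then the right-hand side is infinite;
  for \<open>\<epsilon> = 0\<close> the viscous work vanishes. Otherwise the viscous work bound supplies the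
  dissipation in \<open>sup_absorption\<close>.
\<close>

lemma error_estimate:
  assumes s: "s \<in> {0..T}" and A: "\<And>t x. P t x = \<epsilon> * A t x"
    and H: "\<epsilon> > 0 \<Longrightarrow> AE t in lborel. t \<in> {0<..<s} \<longrightarrow> ennreal (- 2 * diffusion_residual A t - dxe_sq t) \<le> H t"
  shows "ennreal (rel s) + ennreal \<epsilon> * (\<integral>\<^sup>+ t\<in>{0..s}. ennreal (dxe_sq t) \<partial>lborel)
    \<le> 2 * ennreal (rel 0) + 4 * (\<integral>\<^sup>+ t\<in>{0..s}. L2norm (\<lambda>x. (ru t x, r1 t x)) \<partial>lborel)\<^sup>2
      + 2 * (ennreal \<epsilon> * (\<integral>\<^sup>+ t\<in>{0..s}. H t \<partial>lborel))"
proof -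
  define R where "R = (LINT t:{0..s}|lborel. residual_norm t)"
  have inn: "set_integrable lborel {0..s} residual_norm"
    by (rule set_integrable_subset[OF residual_norm_integrable]) (use s in auto)
  have rn: "residual_norm t \<ge> 0" for t
    unfolding residual_norm_def set_lebesgue_integral_def
    by (intro real_sqrt_ge_zero add_nonneg_nonneg integral_nonneg_AE) auto
  have R0: "R \<ge> 0" unfolding R_def set_lebesgue_integral_def using rn by (intro integral_nonneg_AE) auto
  have Rnn: "(\<integral>\<^sup>+ t\<in>{0..s}. L2norm (\<lambda>x. (ru t x, r1 t x)) \<partial>lborel) = ennreal R"
  proof -
    have "(\<integral>\<^sup>+ t\<in>{0..s}. L2norm (\<lambda>x. (ru t x, r1 t x)) \<partial>lborel) = (\<integral>\<^sup>+ t\<in>{0..s}. ennreal (residual_norm t) \<partial>lborel)"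
    proof (rule nn_integral_cong)
      fix t
      show "L2norm (\<lambda>x. (ru t x, r1 t x)) * indicator {0..s} t = ennreal (residual_norm t) * indicator {0..s} t"
        using L2norm_pair(1)[OF residual_L2, of t] s by (auto simp: indicator_def residual_norm_def)
    qed
    then show ?thesis using nn_integral_set_real[OF inn rn] by (simp add: R_def)
  qed
  obtain C where C: "\<forall>s\<in>{0..T}. rel s \<le> C" using rel_bounded by blast
  have main: "rel s + \<delta> s \<le> 2 * (rel 0 + k) + 4 * R\<^sup>2"
    if \<delta>: "\<And>t. 0 \<le> \<delta> t" and est: "\<And>t. t \<in> {0..s} \<Longrightarrow> \<delta> t \<le> 2 * (LINT r:{0..t}|lborel. viscous_work r) + k" for \<delta> k
  proof (rule sup_absorption[of s rel C R \<delta> "rel 0 + k"])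
    fix E t assume E: "0 \<le> E" "\<And>r. r \<in> {0..s} \<Longrightarrow> rel r \<le> E\<^sup>2" and t: "t \<in> {0..s}"
    have "t \<in> {0..T}" using t s by auto
    from relative_energy[OF this] est[OF t] residual_work_bound[OF s t E]
    show "rel t + \<delta> t \<le> (rel 0 + k) + 2 * (E * R)" unfolding R_def by linarith
  qed (use s C R0 \<delta> rel_nonneg in auto)
  have lhs: "ennreal (rel s) + ennreal D \<le> 2 * ennreal (rel 0) + 4 * (ennreal R)\<^sup>2 + 2 * ennreal k"
    if "rel s + D \<le> 2 * (rel 0 + k) + 4 * R\<^sup>2" "0 \<le> D" "0 \<le> k" for D k
  proof -
    have "ennreal (rel s) + ennreal D = ennreal (rel s + D)" using that rel_nonneg by (simp add: ennreal_plus)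
    also have "\<dots> \<le> ennreal (2 * rel 0 + 4 * R\<^sup>2 + 2 * k)" using that by (intro ennreal_leI) simp
    also have "\<dots> = 2 * ennreal (rel 0) + 4 * (ennreal R)\<^sup>2 + 2 * ennreal k"
      using that rel_nonneg[of 0] R0 by (simp add: ennreal_plus ennreal_mult ennreal_power)
    finally show ?thesis .
  qed
  show ?thesis
  proof (cases "\<epsilon> > 0")
    case False
    then have "\<epsilon> = 0" using eps by simp
    then have vw: "viscous_work t = 0" for t unfolding viscous_work_def dissip_def A using \<open>\<epsilon> = 0\<close> by simp
    have "rel s + 0 \<le> 2 * (rel 0 + 0) + 4 * R\<^sup>2" by (rule main[of "\<lambda>_. 0" 0]) (simp_all add: vw)
    from lhs[OF this] show ?thesis using \<open>\<epsilon> = 0\<close> by (simp add: Rnn)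
  next
    case True
    show ?thesis
    proof (cases "(\<integral>\<^sup>+ t\<in>{0..s}. H t \<partial>lborel) = \<infinity>")
      case inf: True
      then show ?thesis using True by (simp add: ennreal_mult_top)
    next
      case fin: False
      then obtain h where h: "h \<ge> 0" "(\<integral>\<^sup>+ t\<in>{0..s}. H t \<partial>lborel) = ennreal h"
        by (metis ennreal_cases infinity_ennreal_def)
      define \<delta> where "\<delta> = (\<lambda>t. \<epsilon> * (LINT r:{0..t}|lborel. dxe_sq r))"
      have \<delta>0: "0 \<le> \<delta> t" for t
        unfolding \<delta>_def set_lebesgue_integral_def
        using dxe_sq_nonneg eps by (intro mult_nonneg_nonneg integral_nonneg_AE) auto
      have est: "\<delta> t \<le> 2 * (LINT r:{0..t}|lborel. viscous_work r) + \<epsilon> * h" if "t \<in> {0..s}" for t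
        unfolding \<delta>_def by (rule viscous_work_bound[OF True A s that H[OF True] h(2,1)])
      from lhs[OF main[of \<delta> "\<epsilon> * h", OF \<delta>0 est] \<delta>0] have
        "ennreal (rel s) + ennreal (\<delta> s) \<le> 2 * ennreal (rel 0) + 4 * (ennreal R)\<^sup>2 + 2 * ennreal (\<epsilon> * h)"
        using h eps by simp
      moreover have "ennreal (\<delta> s) = ennreal \<epsilon> * (\<integral>\<^sup>+ t\<in>{0..s}. ennreal (dxe_sq t) \<partial>lborel)"
        using set_integrable_subset[OF dxe_sq_integrable[OF True], of "{0..s}"] s eps
        by (subst nn_integral_set_real) (auto simp: \<delta>_def dxe_sq_nonneg ennreal_mult')
      ultimately show ?thesis using h eps by (simp add: Rnn ennreal_mult')
    qed
  qed
qed

end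

section \<open>Polynomials of bounded degree are controlled by separating functionals\<close>

text \<open>
  An injective linear map on a finite-dimensional space has a bounded inverse. Gaussian elimination
  on the last coefficient gives an induction on the number of coefficients.
\<close>

lemma coefficients_bounded_by_functionals:
  fixes a :: "'i \<Rightarrow> nat \<Rightarrow> real"
  assumes "finite I" and "\<And>c. (\<forall>i\<in>I. (\<Sum>k<n. a i k * c k) = 0) \<Longrightarrow> (\<forall>k<n. c k = 0)"
  shows "\<exists>C\<ge>0. \<forall>c. \<forall>k<n. \<bar>c k\<bar> \<le> C * (\<Sum>i\<in>I. \<bar>\<Sum>k<n. a i k * c k\<bar>)"
  using assms(2)
proof (induction n arbitrary: a)
  case 0
  show ?case by (intro exI[of _ 0]) simp
next
  case (Suc n)
  define l where "l = (\<lambda>i c. \<Sum>k<Suc n. a i k * c k)"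
  have "\<exists>i\<in>I. a i n \<noteq> 0"
  proof (rule ccontr)
    assume "\<not> ?thesis"
    then have "\<forall>i\<in>I. (\<Sum>k<Suc n. a i k * (if k = n then 1 else 0)) = 0"
      by (auto intro!: sum.neutral simp: less_Suc_eq)
    from Suc.prems[OF this] show False by (metis lessI zero_neq_one)
  qed
  \<comment> \<open>pivot row\<close>
  then obtain i0 where i0: "i0 \<in> I" "a i0 n \<noteq> 0" by blast
  define r where "r = (\<lambda>i. a i n / a i0 n)"
  define a' where "a' = (\<lambda>i k. a i k - r i * a i0 k)"
  have elim: "(\<Sum>k<n. a' i k * c k) = l i c - r i * l i0 c" for i c
  proof -
    have "(\<Sum>k<n. a' i k * c k) = (\<Sum>k<n. a i k * c k) - r i * (\<Sum>k<n. a i0 k * c k)"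
      by (simp add: a'_def left_diff_distrib sum_subtractf sum_distrib_left mult.assoc)
    moreover have "a i n = r i * a i0 n" using i0(2) by (simp add: r_def)
    ultimately show ?thesis by (simp add: l_def algebra_simps)
  qed
  have "\<forall>k<n. c k = 0" if c: "\<forall>i\<in>I. (\<Sum>k<n. a' i k * c k) = 0" for c
  proof -
    define c' where "c' = c(n := - (\<Sum>k<n. a i0 k * c k) / a i0 n)"
    have same: "(\<Sum>k<n. b k * c' k) = (\<Sum>k<n. b k * c k)" for b :: "nat \<Rightarrow> real"
      by (intro sum.cong) (auto simp: c'_def)
    have cn: "c' n = - (\<Sum>k<n. a i0 k * c k) / a i0 n" by (simp add: c'_def)
    have l0: "l i0 c' = 0" unfolding l_def sum.lessThan_Suc same cn using i0(2) by simp
    have "l i c' = 0" if "i \<in> I" for i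
    proof -
      have "(\<Sum>k<n. a' i k * c' k) = 0" unfolding same using c that by blast
      then show ?thesis unfolding elim l0 by simp
    qed
    then have "\<forall>i\<in>I. (\<Sum>k<Suc n. a i k * c' k) = 0" unfolding l_def by blast
    from Suc.prems[OF this] have z: "\<forall>k<Suc n. c' k = 0" .
    show ?thesis
    proof (intro allI impI)
      fix k assume "k < n"
      then show "c k = 0" using z[rule_format, of k] by (simp add: c'_def)
    qed
  qed
  from Suc.IH[OF this] obtain C where C: "C \<ge> 0"
    "\<And>c k. k < n \<Longrightarrow> \<bar>c k\<bar> \<le> C * (\<Sum>i\<in>I. \<bar>\<Sum>k<n. a' i k * c k\<bar>)" by blast
  define S where "S = (\<lambda>c. \<Sum>i\<in>I. \<bar>l i c\<bar>)"
  define \<rho> where "\<rho> = 1 + (\<Sum>i\<in>I. \<bar>r i\<bar>)"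
  have \<rho>: "\<rho> \<ge> 1" unfolding \<rho>_def by (simp add: sum_nonneg)
  have S0: "\<bar>l i0 c\<bar> \<le> S c" for c
    unfolding S_def by (rule member_le_sum[OF i0(1)]) (auto intro: assms(1))
  have Snn: "S c \<ge> 0" for c unfolding S_def by (simp add: sum_nonneg)
  have low: "\<bar>c k\<bar> \<le> (C * \<rho>) * S c" if "k < n" for c k
  proof -
    have "(\<Sum>i\<in>I. \<bar>\<Sum>k<n. a' i k * c k\<bar>) \<le> (\<Sum>i\<in>I. \<bar>l i c\<bar> + \<bar>r i\<bar> * S c)"
    proof (rule sum_mono)
      fix i assume "i \<in> I"
      have "\<bar>r i * l i0 c\<bar> \<le> \<bar>r i\<bar> * S c" unfolding abs_mult by (intro mult_left_mono S0) auto
      then show "\<bar>\<Sum>k<n. a' i k * c k\<bar> \<le> \<bar>l i c\<bar> + \<bar>r i\<bar> * S c" unfolding elim by linarith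
    qed
    also have "\<dots> = (\<Sum>i\<in>I. \<bar>l i c\<bar>) + (\<Sum>i\<in>I. \<bar>r i\<bar>) * S c" by (simp add: sum.distrib sum_distrib_right)
    also have "\<dots> = \<rho> * S c" unfolding S_def \<rho>_def by (simp add: distrib_right)
    finally have "C * (\<Sum>i\<in>I. \<bar>\<Sum>k<n. a' i k * c k\<bar>) \<le> C * (\<rho> * S c)" by (rule mult_left_mono[OF _ C(1)])
    then show ?thesis using C(2)[OF that, of c] unfolding mult.assoc by linarith
  qed
  define A where "A = (\<Sum>k<n. \<bar>a i0 k\<bar>)"
  have top: "\<bar>c n\<bar> \<le> ((1 + A * (C * \<rho>)) / \<bar>a i0 n\<bar>) * S c" for c
  proof -
    have "a i0 n * c n = l i0 c - (\<Sum>k<n. a i0 k * c k)" by (simp add: l_def)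
    then have "\<bar>a i0 n\<bar> * \<bar>c n\<bar> \<le> \<bar>l i0 c\<bar> + \<bar>\<Sum>k<n. a i0 k * c k\<bar>"
      unfolding abs_mult[symmetric] by linarith
    also have "\<bar>\<Sum>k<n. a i0 k * c k\<bar> \<le> (\<Sum>k<n. \<bar>a i0 k\<bar> * ((C * \<rho>) * S c))"
      using low by (intro order_trans[OF sum_abs] sum_mono) (auto simp: abs_mult intro!: mult_left_mono)
    also have "\<dots> = A * (C * \<rho>) * S c" by (simp add: A_def sum_distrib_right mult.assoc)
    finally have "\<bar>a i0 n\<bar> * \<bar>c n\<bar> \<le> (1 + A * (C * \<rho>)) * S c" using S0[of c] by (simp add: algebra_simps)
    then show ?thesis using i0(2) by (simp add: field_simps)
  qed
  define D where "D = C * \<rho> + (1 + A * (C * \<rho>)) / \<bar>a i0 n\<bar>"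
  have A0: "A \<ge> 0" by (simp add: A_def sum_nonneg)
  have D1: "0 \<le> C * \<rho>" "0 \<le> (1 + A * (C * \<rho>)) / \<bar>a i0 n\<bar>"
    using C(1) \<rho> A0 by (auto intro!: divide_nonneg_nonneg add_nonneg_nonneg mult_nonneg_nonneg)
  have "\<bar>c k\<bar> \<le> D * S c" if "k < Suc n" for c k
  proof (cases "k = n")
    case True
    have "\<bar>c n\<bar> \<le> ((1 + A * (C * \<rho>)) / \<bar>a i0 n\<bar>) * S c" by (rule top)
    also have "\<dots> \<le> D * S c" using D1 Snn by (intro mult_right_mono) (auto simp: D_def)
    finally show ?thesis using True by simp
  next
    case False
    then have "\<bar>c k\<bar> \<le> (C * \<rho>) * S c" using that by (intro low) simp
    also have "\<dots> \<le> D * S c" using D1 Snn by (intro mult_right_mono) (auto simp: D_def)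
    finally show ?thesis .
  qed
  then show ?case using D1 by (intro exI[of _ D]) (auto simp: D_def S_def l_def)
qed

lemma poly_bounded_by_functionals:
  fixes l :: "'i \<Rightarrow> real poly \<Rightarrow> real"
  assumes "finite I"
    and lin: "\<And>i p. i \<in> I \<Longrightarrow> degree p \<le> n \<Longrightarrow> l i p = (\<Sum>k\<le>n. coeff p k * l i (monom 1 k))"
    and inj: "\<And>p. degree p \<le> n \<Longrightarrow> (\<And>i. i \<in> I \<Longrightarrow> l i p = 0) \<Longrightarrow> p = 0"
  shows "\<exists>C\<ge>0. \<forall>p. degree p \<le> n \<longrightarrow> (\<forall>k. \<bar>coeff p k\<bar> \<le> C * (\<Sum>i\<in>I. \<bar>l i p\<bar>))"
proof -
  have l: "l i p = (\<Sum>k<Suc n. l i (monom 1 k) * coeff p k)" if "i \<in> I" "degree p \<le> n" for i p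
    using lin[OF that] by (simp add: lessThan_Suc_atMost mult.commute)
  have "\<exists>C\<ge>0. \<forall>c. \<forall>k<Suc n. \<bar>c k\<bar> \<le> C * (\<Sum>i\<in>I. \<bar>\<Sum>k<Suc n. l i (monom 1 k) * c k\<bar>)"
  proof (rule coefficients_bounded_by_functionals[OF assms(1)])
    fix c :: "nat \<Rightarrow> real" assume c: "\<forall>i\<in>I. (\<Sum>k<Suc n. l i (monom 1 k) * c k) = 0"
    define p where "p = (\<Sum>k\<le>n. monom (c k) k)"
    have cf: "coeff p k = (if k \<le> n then c k else 0)" for k
      by (simp add: p_def coeff_sum)
    then have deg: "degree p \<le> n" by (intro degree_le) auto
    have "l i p = 0" if "i \<in> I" for i
      using l[OF that deg] c that by (simp add: cf)
    then have "p = 0" using inj[OF deg] by blast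
    then show "\<forall>k<Suc n. c k = 0" using cf by (metis coeff_0 less_Suc_eq_le)
  qed
  then obtain C where C: "C \<ge> 0" "\<And>c k. k < Suc n \<Longrightarrow> \<bar>c k\<bar> \<le> C * (\<Sum>i\<in>I. \<bar>\<Sum>k<Suc n. l i (monom 1 k) * c k\<bar>)" by blast
  have "\<bar>coeff p k\<bar> \<le> C * (\<Sum>i\<in>I. \<bar>l i p\<bar>)" if deg: "degree p \<le> n" for p k
  proof (cases "k < Suc n")
    case True
    from C(2)[OF this, of "coeff p"] show ?thesis using l[OF _ deg] by simp
  next
    case False
    then have "coeff p k = 0" using deg by (intro coeff_eq_0) simp
    then show ?thesis using C(1) by (simp add: sum_nonneg)
  qed
  then show ?thesis using C(1) by blast
qed

lemma poly_eq_0_if_AE: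
  fixes p :: "real poly"
  assumes "AE y in lborel. y \<in> {a<..<b} \<longrightarrow> poly p y = 0" "a < b" shows "p = 0"
proof (rule ccontr)
  assume "p \<noteq> 0"
  then have "finite {y. poly p y = 0}" by (rule poly_roots_finite)
  then have "AE y in lborel. y \<notin> {y. poly p y = 0}"
    by (intro AE_not_in) (simp add: finite_imp_null_set_lborel)
  then have "AE y in lborel. y \<in> {a<..<b} \<longrightarrow> False" using assms(1) by eventually_elim simp
  from AE_nontrivial[OF this assms(2)] show False by simp
qed

lemma poly_integrable: "set_integrable lborel {a..b} (poly p)" for p :: "real poly"
  by (intro borel_integrable_atLeastAtMost' continuous_intros)

definition moment :: "real \<Rightarrow> real \<Rightarrow> real poly \<Rightarrow> nat \<Rightarrow> real" where
  "moment a b p i = (LINT y:{a..b}|lborel. poly p y * y ^ i)"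

lemma set_integral_sum:
  fixes f :: "'i \<Rightarrow> real \<Rightarrow> real"
  assumes "\<And>i. i \<in> I \<Longrightarrow> set_integrable lborel A (f i)"
  shows "(LINT y:A|lborel. (\<Sum>i\<in>I. f i y)) = (\<Sum>i\<in>I. LINT y:A|lborel. f i y)"
  unfolding set_lebesgue_integral_def scaleR_sum_right
  by (rule Bochner_Integration.integral_sum) (use assms in \<open>auto simp: set_integrable_def\<close>)

lemma poly_eq_sum:
  fixes p :: "real poly"
  assumes "degree p \<le> n" shows "poly p y = (\<Sum>i\<le>n. coeff p i * y ^ i)"
  unfolding poly_altdef by (rule sum.mono_neutral_left) (use assms in \<open>auto simp: coeff_eq_0\<close>)

lemma integral_poly_mult:
  fixes p r :: "real poly"
  assumes "degree r \<le> n"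
  shows "(LINT y:{a..b}|lborel. poly p y * poly r y) = (\<Sum>i\<le>n. coeff r i * moment a b p i)"
proof -
  have "(LINT y:{a..b}|lborel. poly p y * poly r y) = (LINT y:{a..b}|lborel. (\<Sum>i\<le>n. coeff r i * (poly p y * y ^ i)))"
    by (simp add: poly_eq_sum[OF assms] sum_distrib_left mult.left_commute)
  also have "\<dots> = (\<Sum>i\<le>n. LINT y:{a..b}|lborel. coeff r i * (poly p y * y ^ i))"
    by (rule set_integral_sum) (intro borel_integrable_atLeastAtMost' continuous_intros)
  finally show ?thesis by (simp add: moment_def)
qed

lemma moment_linear:
  assumes "degree p \<le> n" shows "moment a b p i = (\<Sum>k\<le>n. coeff p k * moment a b (monom 1 k) i)"
proof -
  have "moment a b p i = (LINT y:{a..b}|lborel. poly (monom 1 i) y * poly p y)"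
    by (simp add: moment_def poly_monom mult.commute)
  also have "\<dots> = (\<Sum>k\<le>n. coeff p k * moment a b (monom 1 i) k)" by (rule integral_poly_mult[OF assms])
  finally show ?thesis by (simp add: moment_def poly_monom mult.commute)
qed

lemma integral_zero_imp_poly_zero:
  fixes p :: "real poly"
  assumes "a < b" "(LINT y:{a..b}|lborel. poly p y) = 0" "\<And>y. y \<in> {a..b} \<Longrightarrow> poly p y \<ge> 0"
  shows "p = 0"
proof -
  have "integrable lborel (\<lambda>y. indicator {a..b} y *\<^sub>R poly p y)" using poly_integrable[of a b p] by (simp add: set_integrable_def)
  moreover have "AE y in lborel. 0 \<le> indicator {a..b} y *\<^sub>R poly p y"
    using assms(3) by (intro AE_I2) (auto simp: indicator_def)
  ultimately have "AE y in lborel. indicator {a..b} y *\<^sub>R poly p y = 0"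
    using integral_nonneg_eq_0_iff_AE assms(2) unfolding set_lebesgue_integral_def by blast
  then have "AE y in lborel. y \<in> {a<..<b} \<longrightarrow> poly p y = 0"
    by eventually_elim (auto simp: indicator_def)
  then show ?thesis by (rule poly_eq_0_if_AE[OF _ assms(1)])
qed

text \<open>
  If all moments up to the degree vanish, then \<open>p\<close> is orthogonal to itself.
\<close>

lemma coefficients_bounded_by_moments:
  assumes "a < b"
  shows "\<exists>C\<ge>0. \<forall>p. degree p \<le> n \<longrightarrow> (\<forall>k. \<bar>coeff p k\<bar> \<le> C * (\<Sum>i\<le>n. \<bar>moment a b p i\<bar>))"
proof (rule poly_bounded_by_functionals)
  fix p :: "real poly" assume p: "degree p \<le> n" "\<And>i. i \<in> {..n} \<Longrightarrow> moment a b p i = 0"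
  have "(LINT y:{a..b}|lborel. poly (p * p) y) = 0"
    using integral_poly_mult[OF p(1), of a b p] p(2) by simp
  then have "p * p = 0" by (rule integral_zero_imp_poly_zero[OF assms]) simp
  then show "p = 0" by simp
qed (auto intro: moment_linear)

text \<open>
  The functionals of the reconstruction are unisolvent: a polynomial that vanishes at both ends of
  the cell is \<open>(y - a) (y - b)\<close> times a polynomial \<open>r\<close> of degree two less, and orthogonality to \<open>r\<close> itself
  forces \<open>r = 0\<close> because \<open>(y - a) (y - b)\<close> has a sign on the cell.
\<close>

lemma coefficients_bounded_by_reconstruction_data:
  assumes ab: "a < b" and q: "q \<ge> 1"
  shows "\<exists>C\<ge>0. \<forall>p. degree p \<le> q + 1 \<longrightarrow>
    (\<forall>k. \<bar>coeff p k\<bar> \<le> C * (\<bar>poly p a\<bar> + \<bar>poly p b\<bar> + (\<Sum>i\<le>q-1. \<bar>moment a b p i\<bar>)))"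
proof -
  define l where "l = (\<lambda>i p. case i of None \<Rightarrow> poly p a | Some None \<Rightarrow> poly p b | Some (Some i) \<Rightarrow> moment a b p i)"
  define I where "I = insert None (insert (Some None) ((Some \<circ> Some) ` {..q-1}))"
  have "\<exists>C\<ge>0. \<forall>p. degree p \<le> q + 1 \<longrightarrow> (\<forall>k. \<bar>coeff p k\<bar> \<le> C * (\<Sum>i\<in>I. \<bar>l i p\<bar>))"
  proof (rule poly_bounded_by_functionals)
    show "finite I" by (simp add: I_def)
    show "l i p = (\<Sum>k\<le>q + 1. coeff p k * l i (monom 1 k))" if "degree p \<le> q + 1" for i p
    proof -
      have "poly p y = (\<Sum>k\<le>q + 1. coeff p k * poly (monom 1 k) y)" for y
        using poly_eq_sum[OF that] by (simp only: poly_monom mult_1_left)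
      then show ?thesis using moment_linear[OF that] unfolding l_def by (auto simp del: sum.atMost_Suc split: option.split)
    qed
    fix p assume deg: "degree p \<le> q + 1" and z: "\<And>i. i \<in> I \<Longrightarrow> l i p = 0"
    have pa: "poly p a = 0" and pb: "poly p b = 0" and mom: "\<And>i. i \<le> q - 1 \<Longrightarrow> moment a b p i = 0"
      using z[of None] z[of "Some None"] z[of "Some (Some _)"] by (auto simp: l_def I_def)
    obtain r1 where r1: "p = [:- a, 1:] * r1" using pa by (auto simp: poly_eq_0_iff_dvd dvd_def)
    have "poly r1 b = 0" using pb ab by (simp add: r1)
    then obtain r where r: "r1 = [:- b, 1:] * r" by (auto simp: poly_eq_0_iff_dvd dvd_def)
    have p: "p = ([:- a, 1:] * [:- b, 1:]) * r" by (simp only: r1 r mult.assoc)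
    show "p = 0"
    proof (rule ccontr)
      assume "p \<noteq> 0"
      then have "r \<noteq> 0" using p by auto
      then have "degree p = 2 + degree r" unfolding p by (subst degree_mult_eq) (auto simp: degree_mult_eq)
      then have degr: "degree r \<le> q - 1" using deg by simp
      have "(LINT y:{a..b}|lborel. poly p y * poly r y) = 0"
        using integral_poly_mult[OF degr, of a b p] mom by simp
      then have "(LINT y:{a..b}|lborel. poly (- (p * r)) y) = 0"
        using set_integral_uminus[OF poly_integrable[of a b "p * r"]] by simp
      moreover have "poly (- (p * r)) y \<ge> 0" if "y \<in> {a..b}" for y
      proof -
        have "poly (- (p * r)) y = (y - a) * (b - y) * (poly r y)\<^sup>2"
          by (simp add: p power2_eq_square algebra_simps)
        then show ?thesis using that by simp
      qed
      ultimately have "- (p * r) = 0" by (rule integral_zero_imp_poly_zero[OF ab])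
      then show False using \<open>p \<noteq> 0\<close> \<open>r \<noteq> 0\<close> by simp
    qed
  qed
  moreover have "(\<Sum>i\<in>I. \<bar>l i p\<bar>) = \<bar>poly p a\<bar> + \<bar>poly p b\<bar> + (\<Sum>i\<le>q-1. \<bar>moment a b p i\<bar>)" for p
    unfolding I_def
    by (subst sum.insert, simp, force, subst sum.insert, simp, force, subst sum.reindex)
       (auto simp: l_def inj_on_def)
  ultimately show ?thesis by simp
qed

section \<open>Piecewise polynomials\<close>

lemma poly_unique_on_interval:
  fixes p r :: "real poly"
  assumes "a < b" "\<And>y. y \<in> {a<..<b} \<Longrightarrow> poly p y = poly r y" shows "p = r"
proof -
  have "p - r = 0" by (rule poly_eq_0_if_AE[OF _ assms(1)]) (use assms(2) in auto)
  then show ?thesis by simp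
qed

lemma tr_right_continuous:
  fixes w F :: "real \<Rightarrow> 'a::t2_space"
  assumes "a < b" "\<And>y. y \<in> {a<..<b} \<Longrightarrow> w y = F y" "isCont F a" shows "tr_right w a = F a"
  by (rule tr_right_eq[OF _ assms(1)])
     (use assms(2,3) in \<open>auto simp: isCont_def filterlim_at_split\<close>)

lemma tr_left_continuous:
  fixes w F :: "real \<Rightarrow> 'a::t2_space"
  assumes "a < b" "\<And>y. y \<in> {a<..<b} \<Longrightarrow> w y = F y" "isCont F b" shows "tr_left w b = F b"
  by (rule tr_left_eq[OF _ assms(1)])
     (use assms(2,3) in \<open>auto simp: isCont_def filterlim_at_split\<close>)

definition cell_poly :: "(nat \<Rightarrow> real) \<Rightarrow> nat \<Rightarrow> (real \<Rightarrow> real) \<Rightarrow> nat \<Rightarrow> real poly" where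
  "cell_poly x q w j = (SOME p. degree p \<le> q \<and> (\<forall>y\<in>{x j..<x (Suc j)}. w y = poly p y))"

locale mesh =
  fixes x :: "nat \<Rightarrow> real" and M :: nat
  assumes periodic_mesh: "periodic_mesh x M"
begin

lemma mesh_simps: "M \<ge> 1" "x 0 = 0" "x M = 1" "j < M \<Longrightarrow> x j < x (Suc j)"
  using periodic_mesh by (auto simp: periodic_mesh_def)

lemma mesh_mono: "i \<le> j \<Longrightarrow> j \<le> M \<Longrightarrow> x i \<le> x j"
proof (induction j)
  case (Suc j)
  then show ?case using mesh_simps(4)[of j] by (cases "i = Suc j") (auto simp: le_Suc_eq)
qed simp

lemma mesh_range: "j \<le> M \<Longrightarrow> 0 \<le> x j" "j \<le> M \<Longrightarrow> x j \<le> 1"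
  using mesh_mono[of 0 j] mesh_mono[of j M] mesh_simps by auto

lemma mesh_cell:
  assumes "y \<in> {0..<1}" obtains j where "j < M" "y \<in> {x j..<x (Suc j)}"
proof -
  define j where "j = (LEAST k. y < x (Suc k))"
  have ex: "y < x (Suc (M - 1))" using assms mesh_simps(1,3) by simp
  have j1: "y < x (Suc j)" unfolding j_def by (rule LeastI[of _ "M - 1"]) (rule ex)
  have j2: "j \<le> M - 1" unfolding j_def by (rule Least_le) (rule ex)
  have "x j \<le> y"
  proof (cases j)
    case 0 then show ?thesis using assms mesh_simps by simp
  next
    case (Suc k)
    then have "\<not> y < x (Suc k)" using not_less_Least[of k "\<lambda>k. y < x (Suc k)"] by (simp add: j_def)
    then show ?thesis using Suc by simp
  qed
  then show ?thesis using that[of j] j1 j2 mesh_simps(1) by auto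
qed

lemma mesh_cell_unique:
  assumes "i < M" "j < M" "y \<in> {x i..<x (Suc i)}" "y \<in> {x j..<x (Suc j)}" shows "i = j"
proof (rule ccontr)
  assume "i \<noteq> j"
  then consider "i < j" | "j < i" by linarith
  then show False
    using mesh_mono[of "Suc i" j] mesh_mono[of "Suc j" i] assms by cases auto
qed

lemma cell_poly:
  assumes w: "w \<in> dg_space x M q" and j: "j < M"
  shows "degree (cell_poly x q w j) \<le> q" "\<And>y. y \<in> {x j..<x (Suc j)} \<Longrightarrow> w y = poly (cell_poly x q w j) y"
proof -
  have "\<exists>p. degree p \<le> q \<and> (\<forall>y\<in>{x j..<x (Suc j)}. w y = poly p y)"
    using w j by (simp add: dg_space_def)
  from someI_ex[OF this] show "degree (cell_poly x q w j) \<le> q"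
    "\<And>y. y \<in> {x j..<x (Suc j)} \<Longrightarrow> w y = poly (cell_poly x q w j) y"
    unfolding cell_poly_def by auto
qed

lemma cell_poly_eqI:
  assumes w: "w \<in> dg_space x M q" and j: "j < M" and p: "\<And>y. y \<in> {x j<..<x (Suc j)} \<Longrightarrow> w y = poly p y"
  shows "cell_poly x q w j = p"
proof (rule poly_unique_on_interval[OF mesh_simps(4)[OF j]])
  fix y assume "y \<in> {x j<..<x (Suc j)}"
  then show "poly (cell_poly x q w j) y = poly p y" using cell_poly(2)[OF w j, of y] p[of y] by auto
qed

lemma dg_periodic: "w \<in> dg_space x M q \<Longrightarrow> w (y + 1) = w y"
  by (simp add: dg_space_def periodic1_def)

text \<open>Traces at the nodes; the node \<open>0\<close> is reached from the left through the last cell.\<close>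

lemma dg2_traces:
  fixes w :: "real \<Rightarrow> state" and q :: nat
  assumes w: "w \<in> dg_space2 x M q" and j: "j < M"
  defines "p \<equiv> cell_poly x q (\<lambda>y. fst (w y))" and "r \<equiv> cell_poly x q (\<lambda>y. snd (w y))"
  shows "tr_right w (x j) = (poly (p j) (x j), poly (r j) (x j))"
    and "tr_left w (x (Suc j)) = (poly (p j) (x (Suc j)), poly (r j) (x (Suc j)))"
    and "tr_left w (x 0) = (poly (p (M - 1)) 1, poly (r (M - 1)) 1)"
    and "tr_right w (x M) = (poly (p 0) 0, poly (r 0) 0)"
proof -
  have w12: "(\<lambda>y. fst (w y)) \<in> dg_space x M q" "(\<lambda>y. snd (w y)) \<in> dg_space x M q"
    using w by (auto simp: dg_space2_def)
  have eq: "w y = (poly (p i) y, poly (r i) y)" if "i < M" "y \<in> {x i<..<x (Suc i)}" for i y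
    using cell_poly(2)[OF w12(1) that(1), of y] cell_poly(2)[OF w12(2) that(1), of y] that(2)
    by (intro prod_eqI) (auto simp: p_def r_def)
  have per: "w (y + 1) = w y" for y
    using dg_periodic[OF w12(1), of y] dg_periodic[OF w12(2), of y] by (intro prod_eqI)
  have M: "M - 1 < M" "Suc (M - 1) = M" using mesh_simps(1) by auto
  show "tr_right w (x j) = (poly (p j) (x j), poly (r j) (x j))"
    by (rule tr_right_continuous[OF mesh_simps(4)[OF j], where F = "\<lambda>y. (poly (p j) y, poly (r j) y)"])
       (use eq[OF j] in \<open>auto intro!: continuous_intros\<close>)
  show "tr_left w (x (Suc j)) = (poly (p j) (x (Suc j)), poly (r j) (x (Suc j)))"
    by (rule tr_left_continuous[OF mesh_simps(4)[OF j], where F = "\<lambda>y. (poly (p j) y, poly (r j) y)"])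
       (use eq[OF j] in \<open>auto intro!: continuous_intros\<close>)
  have "tr_left w 0 = (poly (p (M - 1)) (0 + 1), poly (r (M - 1)) (0 + 1))"
  proof (rule tr_left_continuous[of "x (M - 1) - 1" 0 w "\<lambda>y. (poly (p (M - 1)) (y + 1), poly (r (M - 1)) (y + 1))"])
    show "x (M - 1) - 1 < 0" using mesh_simps(4)[OF M(1)] M mesh_simps(3) by simp
    show "w y = (poly (p (M - 1)) (y + 1), poly (r (M - 1)) (y + 1))" if "y \<in> {x (M - 1) - 1<..<0}" for y
      using eq[OF M(1), of "y + 1"] per[of y] that M mesh_simps(3) by auto
  qed (auto intro!: continuous_intros)
  then show "tr_left w (x 0) = (poly (p (M - 1)) 1, poly (r (M - 1)) 1)" using mesh_simps(2) by simp
  have "tr_right w 1 = (poly (p 0) (1 - 1), poly (r 0) (1 - 1))"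
  proof (rule tr_right_continuous[of 1 "x 1 + 1" w "\<lambda>y. (poly (p 0) (y - 1), poly (r 0) (y - 1))"])
    show "1 < x 1 + 1" using mesh_simps(4)[of 0] mesh_simps by simp
    show "w y = (poly (p 0) (y - 1), poly (r 0) (y - 1))" if "y \<in> {1<..<x 1 + 1}" for y
      using eq[of 0 "y - 1"] per[of "y - 1"] that mesh_simps(1,2) by auto
  qed (auto intro!: continuous_intros)
  then show "tr_right w (x M) = (poly (p 0) 0, poly (r 0) 0)" using mesh_simps(3) by simp
qed

text \<open>
  Test functions supported in one cell turn the global orthogonality relations into conditions on
  each cell. The fractional part makes them periodic.
\<close>

lemma dg_space_single_cell:
  assumes j: "j < M" and "degree p \<le> q"
  shows "(\<lambda>y. if frac y \<in> {x j..<x (Suc j)} then poly p (frac y) else 0) \<in> dg_space x M q"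
proof -
  have "\<exists>p'. degree p' \<le> q \<and> (\<forall>y\<in>{x i..<x (Suc i)}. (if frac y \<in> {x j..<x (Suc j)} then poly p (frac y) else 0) = poly p' y)"
    if i: "i < M" for i
  proof -
    have fr: "frac y = y" if "y \<in> {x i..<x (Suc i)}" for y
      using that mesh_range(1)[of i] mesh_range(2)[of "Suc i"] i by (subst frac_eq) auto
    show ?thesis
    proof (intro exI[of _ "if i = j then p else 0"] conjI ballI)
      show "degree (if i = j then p else 0) \<le> q" using assms(2) by simp
      fix y assume y: "y \<in> {x i..<x (Suc i)}"
      show "(if frac y \<in> {x j..<x (Suc j)} then poly p (frac y) else 0) = poly (if i = j then p else 0) y"
        unfolding fr[OF y] using y mesh_cell_unique[OF i j y] by (cases "i = j") (auto simp del: atLeastLessThan_iff)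
    qed
  qed
  moreover have "periodic1 (\<lambda>y. if frac y \<in> {x j..<x (Suc j)} then poly p (frac y) else 0)"
    by (simp add: periodic1_def frac_1_eq)
  ultimately show ?thesis by (simp add: dg_space_def)
qed

lemma dg_set_integral_cell:
  fixes w :: "real \<Rightarrow> real"
  assumes w: "w \<in> dg_space x M q" and j: "j < M"
  shows "(LINT y:{0..1}|lborel. w y * (if frac y \<in> {x j..<x (Suc j)} then poly p (frac y) else 0))
    = (LINT y:{x j..x (Suc j)}|lborel. poly (cell_poly x q w j) y * poly p y)"
proof -
  have r: "0 \<le> x j" "x (Suc j) \<le> 1" using mesh_range[of j] mesh_range[of "Suc j"] j by auto
  have "(LINT y:{0..1}|lborel. w y * (if frac y \<in> {x j..<x (Suc j)} then poly p (frac y) else 0))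
    = (LINT y:{0<..<1}|lborel. w y * (if frac y \<in> {x j..<x (Suc j)} then poly p (frac y) else 0))"
    by (simp add: set_integral_Ioo_Icc)
  also have "\<dots> = (LINT y:{x j<..<x (Suc j)}|lborel. poly (cell_poly x q w j) y * poly p y)"
    unfolding set_lebesgue_integral_def
  proof (rule integral_discrete_difference[where X = "{x j}"])
    fix y assume y: "y \<in> space lborel" "y \<notin> {x j}"
    have fr: "frac y = y" if "y \<in> {0<..<1}" using that by (subst frac_eq) auto
    show "indicator {0<..<1} y *\<^sub>R (w y * (if frac y \<in> {x j..<x (Suc j)} then poly p (frac y) else 0))
      = indicator {x j<..<x (Suc j)} y *\<^sub>R (poly (cell_poly x q w j) y * poly p y)"
      using fr y(2) r cell_poly(2)[OF w j, of y] by (auto simp: indicator_def)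
  qed auto
  finally show ?thesis by (simp add: set_integral_Ioo_Icc)
qed

lemma dg_bounded_measurable:
  assumes w: "w \<in> dg_space x M q" shows "bounded_measurable_on 0 1 w"
proof -
  let ?p = "cell_poly x q w"
  have eq: "indicator {0..1} y * w y = (\<Sum>j<M. indicator {x j..<x (Suc j)} y * poly (?p j) y) + indicator {1} y * w 1" for y
  proof (cases "y \<in> {0..<1}")
    case True
    then obtain j where j: "j < M" "y \<in> {x j..<x (Suc j)}" by (rule mesh_cell)
    have "indicator {x i..<x (Suc i)} y * poly (?p i) y = (if i = j then w y else 0)" if "i \<in> {..<M}" for i
    proof (cases "i = j")
      case True
      then show ?thesis using cell_poly(2)[OF w j] j(2) by simp
    next
      case False
      then have "y \<notin> {x i..<x (Suc i)}" using mesh_cell_unique[OF _ j(1) _ j(2)] that by blast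
      then show ?thesis using False by simp
    qed
    then have "(\<Sum>i<M. indicator {x i..<x (Suc i)} y * poly (?p i) y) = (\<Sum>i<M. if i = j then w y else 0)"
      by (intro sum.cong refl)
    then show ?thesis using True j(1) by (simp add: indicator_def)
  next
    case False
    have "y \<notin> {x j..<x (Suc j)}" if "j < M" for j
      using False mesh_range[of j] mesh_range[of "Suc j"] that by auto
    then have "(\<Sum>i<M. indicator {x i..<x (Suc i)} y * poly (?p i) y) = 0" by (intro sum.neutral) simp
    then show ?thesis using False by (auto simp: indicator_def)
  qed
  have [measurable]: "poly p \<in> borel_measurable borel" for p :: "real poly"
    by (intro borel_measurable_continuous_onI continuous_intros)
  have "set_borel_measurable lborel {0..1} w"
    unfolding set_borel_measurable_def real_scaleR_def eq by measurable
  moreover have "\<exists>C. \<forall>y\<in>{x j..<x (Suc j)}. \<bar>w y\<bar> \<le> C" if "j < M" for j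
  proof -
    have "bounded (poly (?p j) ` {x j..x (Suc j)})"
      by (intro compact_imp_bounded compact_continuous_image continuous_intros) auto
    then obtain C where "\<forall>y\<in>{x j..x (Suc j)}. \<bar>poly (?p j) y\<bar> \<le> C" by (auto simp: bounded_iff)
    then have "\<forall>y\<in>{x j..<x (Suc j)}. \<bar>w y\<bar> \<le> C" using cell_poly(2)[OF w that] by auto
    then show ?thesis by blast
  qed
  then obtain C where C: "\<And>j y. j < M \<Longrightarrow> y \<in> {x j..<x (Suc j)} \<Longrightarrow> \<bar>w y\<bar> \<le> C j" by metis
  have "\<bar>w y\<bar> \<le> (\<Sum>j<M. \<bar>C j\<bar>) + \<bar>w 1\<bar>" if "y \<in> {0..1}" for y
  proof (cases "y = 1")
    case False
    then have "y \<in> {0..<1}" using that by auto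
    then obtain j where j: "j < M" "y \<in> {x j..<x (Suc j)}" by (rule mesh_cell)
    have "\<bar>w y\<bar> \<le> \<bar>C j\<bar>" using C[OF j] by linarith
    also have "\<dots> \<le> (\<Sum>j<M. \<bar>C j\<bar>)" by (rule member_le_sum) (use j in auto)
    finally show ?thesis by simp
  qed (simp add: sum_nonneg)
  ultimately show ?thesis unfolding bounded_measurable_on_def by blast
qed

end

section \<open>Lipschitz families of polynomials\<close>

definition lipschitz_real :: "real \<Rightarrow> (real \<Rightarrow> 'a::metric_space) \<Rightarrow> bool" where
  "lipschitz_real T f \<longleftrightarrow> (\<exists>L. L-lipschitz_on {0..T} f)"

lemma lipschitz_real_const: "lipschitz_real T (\<lambda>_. c)"
  unfolding lipschitz_real_def using lipschitz_on_constant by blast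

lemma lipschitz_real_add:
  fixes f g :: "real \<Rightarrow> real"
  shows "lipschitz_real T f \<Longrightarrow> lipschitz_real T g \<Longrightarrow> lipschitz_real T (\<lambda>t. f t + g t)"
  unfolding lipschitz_real_def using lipschitz_on_add by blast

lemma lipschitz_real_cmult:
  fixes f :: "real \<Rightarrow> real"
  shows "lipschitz_real T f \<Longrightarrow> lipschitz_real T (\<lambda>t. c * f t)"
  unfolding lipschitz_real_def using lipschitz_on_cmult_real by blast

lemma lipschitz_real_sum:
  fixes f :: "'i \<Rightarrow> real \<Rightarrow> real"
  shows "(\<And>i. i \<in> I \<Longrightarrow> lipschitz_real T (f i)) \<Longrightarrow> lipschitz_real T (\<lambda>t. \<Sum>i\<in>I. f i t)"
  by (induction I rule: infinite_finite_induct) (auto intro: lipschitz_real_const lipschitz_real_add)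

lemma lipschitz_real_Pair:
  assumes "lipschitz_real T f" "lipschitz_real T g" shows "lipschitz_real T (\<lambda>t. (f t, g t))"
proof -
  obtain L L' where "L-lipschitz_on {0..T} f" "L'-lipschitz_on {0..T} g"
    using assms unfolding lipschitz_real_def by blast
  from lipschitz_on_Pair[OF this] show ?thesis unfolding lipschitz_real_def by blast
qed

lemma lipschitz_real_fst: "lipschitz_real T f \<Longrightarrow> lipschitz_real T (\<lambda>t. fst (f t))"
  and lipschitz_real_snd: "lipschitz_real T f \<Longrightarrow> lipschitz_real T (\<lambda>t. snd (f t))"
  unfolding lipschitz_real_def lipschitz_on_def
  using dist_fst_le dist_snd_le by (meson order_trans)+

lemma lipschitz_real_continuous: "lipschitz_real T f \<Longrightarrow> continuous_on {0..T} f"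
  unfolding lipschitz_real_def using lipschitz_on_continuous_on by blast

lemma lipschitz_real_cong:
  "lipschitz_real T f \<Longrightarrow> (\<And>t. t \<in> {0..T} \<Longrightarrow> f t = g t) \<Longrightarrow> lipschitz_real T g"
  unfolding lipschitz_real_def lipschitz_on_def by simp

lemma lipschitz_on_grid:
  assumes grid: "time_grid tt N T" and loc: "\<And>n. n < N \<Longrightarrow> \<exists>L. L-lipschitz_on {tt n..tt (Suc n)} f"
  shows "lipschitz_real T f"
proof -
  have "\<exists>L. L-lipschitz_on {tt 0..tt n} f" if "n \<le> N" for n
    using that
  proof (induction n)
    case 0
    then show ?case by (intro exI[of _ 0]) (auto intro: lipschitz_intros)
  next
    case (Suc n)
    then obtain L L' where "L-lipschitz_on {tt 0..tt n} f" "L'-lipschitz_on {tt n..tt (Suc n)} f"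
      using loc[of n] by auto
    from lipschitz_on_concat_max[OF this refl] show ?case by auto
  qed
  then show ?thesis using grid unfolding lipschitz_real_def time_grid_def by force
qed

lemma time_grid_mono:
  assumes "time_grid tt N T" "i \<le> j" "j \<le> N" shows "tt i \<le> tt j"
  using assms(2,3)
proof (induction j)
  case (Suc j)
  then show ?case using assms(1) by (cases "i = Suc j") (auto simp: time_grid_def le_Suc_eq less_imp_le intro: order_trans)
qed simp

lemma time_grid_cell:
  assumes "time_grid tt N T" "0 < T" "t \<in> {0..T}" obtains n where "n < N" "t \<in> {tt n..tt (Suc n)}"
proof -
  have N: "N > 0" using assms(1,2) by (cases N) (auto simp: time_grid_def)
  define n where "n = (LEAST k. t \<le> tt (Suc k))"
  have ex: "t \<le> tt (Suc (N - 1))" using assms N by (auto simp: time_grid_def)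
  have n1: "t \<le> tt (Suc n)" unfolding n_def by (rule LeastI[of _ "N - 1"]) (rule ex)
  have n2: "n \<le> N - 1" unfolding n_def by (rule Least_le) (rule ex)
  have "tt n \<le> t"
  proof (cases n)
    case 0 then show ?thesis using assms by (auto simp: time_grid_def)
  next
    case (Suc k)
    then have "\<not> t \<le> tt (Suc k)" using not_less_Least[of k "\<lambda>k. t \<le> tt (Suc k)"] by (simp add: n_def)
    then show ?thesis using Suc by simp
  qed
  then show ?thesis using that[of n] n1 n2 N by auto
qed

text \<open>
  Only a compact set of values of \<open>f\<close> matters, and on a compact set local Lipschitz bounds combine
  to a global one.
\<close>

lemma locally_lipschitz_compose:
  fixes f :: "real \<Rightarrow> 'a::metric_space" and w :: "'a \<Rightarrow> 'b::metric_space"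
  assumes f: "lipschitz_real T f" and w: "\<And>z. \<exists>r>0. \<exists>L. L-lipschitz_on (ball z r) w"
  shows "lipschitz_real T (\<lambda>t. w (f t))"
proof -
  obtain K where K: "K-lipschitz_on {0..T} f" using f by (auto simp: lipschitz_real_def)
  have K0: "K \<ge> 0" using K by (rule lipschitz_on_nonneg)
  have loc: "\<exists>u>0. \<exists>L. L-lipschitz_on (cball t u \<inter> {0..T}) (\<lambda>t. w (f t))" if t: "t \<in> {0..T}" for t
  proof -
    obtain r L where r: "r > 0" "L-lipschitz_on (ball (f t) r) w" using w by blast
    define u where "u = r / (2 * (K + 1))"
    have u: "u > 0" using r K0 by (simp add: u_def)
    have Ku: "K * u < r" using r K0 by (simp add: u_def field_simps add_strict_increasing2)
    have in_ball: "f y \<in> ball (f t) r" if y: "y \<in> cball t u \<inter> {0..T}" for y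
    proof -
      have "dist (f t) (f y) \<le> K * dist t y" by (rule lipschitz_onD[OF K t]) (use y in auto)
      also have "\<dots> \<le> K * u" using y K0 by (intro mult_left_mono) auto
      also note Ku
      finally show ?thesis by simp
    qed
    have "K-lipschitz_on (cball t u \<inter> {0..T}) f" by (rule lipschitz_on_subset[OF K]) auto
    moreover have "L-lipschitz_on (f ` (cball t u \<inter> {0..T})) w"
      by (rule lipschitz_on_subset[OF r(2)]) (use in_ball in blast)
    ultimately have "(L * K)-lipschitz_on (cball t u \<inter> {0..T}) (\<lambda>t. w (f t))"
      by (rule lipschitz_on_compose2)
    then show ?thesis using u by blast
  qed
  have ll: "local_lipschitz {0::real} {0..T} (\<lambda>_ t. w (f t))"
  proof (rule local_lipschitzI)
    fix s t :: real assume "t \<in> {0..T}"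
    from loc[OF this] show "\<exists>u>0. \<exists>L. \<forall>t'\<in>cball s u \<inter> {0}. L-lipschitz_on (cball t u \<inter> {0..T}) (\<lambda>t. w (f t))"
      by blast
  qed
  have ct: "continuous_on {0::real} (\<lambda>_. w (f t))" for t by simp
  obtain L where L: "\<And>s. s \<in> {0::real} \<Longrightarrow> L-lipschitz_on {0..T} (\<lambda>t. w (f t))"
    by (rule local_lipschitz_compact_implies_lipschitz[OF ll compact_Icc finite_imp_compact[OF finite.intros(2)[OF finite.intros(1)]] ct]) blast
  from L[of 0] show ?thesis by (auto simp: lipschitz_real_def)
qed

lemma lipschitz_real_poly_eval:
  assumes "\<And>k. lipschitz_real T (\<lambda>t. coeff (p t) k)" "\<And>t. t \<in> {0..T} \<Longrightarrow> degree (p t) \<le> n"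
  shows "lipschitz_real T (\<lambda>t. poly (p t) (y::real))"
proof (rule lipschitz_real_cong)
  show "lipschitz_real T (\<lambda>t. \<Sum>i\<le>n. y ^ i * coeff (p t) i)"
    by (intro lipschitz_real_sum lipschitz_real_cmult assms(1))
  show "(\<Sum>i\<le>n. y ^ i * coeff (p t) i) = poly (p t) y" if "t \<in> {0..T}" for t
    by (simp add: poly_eq_sum[OF assms(2)[OF that]] mult.commute)
qed

lemma lipschitz_real_moment:
  assumes "\<And>k. lipschitz_real T (\<lambda>t. coeff (p t) k)" "\<And>t. t \<in> {0..T} \<Longrightarrow> degree (p t) \<le> n"
  shows "lipschitz_real T (\<lambda>t. moment a b (p t) i)"
proof (rule lipschitz_real_cong)
  show "lipschitz_real T (\<lambda>t. \<Sum>k\<le>n. moment a b (monom 1 k) i * coeff (p t) k)"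
    by (intro lipschitz_real_sum lipschitz_real_cmult assms(1))
  show "(\<Sum>k\<le>n. moment a b (monom 1 k) i * coeff (p t) k) = moment a b (p t) i" if "t \<in> {0..T}" for t
    using moment_linear[OF assms(2)[OF that], of a b i] by (simp add: mult.commute)
qed

text \<open>
  Stability estimates of the form proved for polynomials transfer Lipschitz continuity from the data
  to the coefficients.
\<close>

lemma lipschitz_real_if_bounded_by:
  fixes f :: "real \<Rightarrow> real" and h :: "'i \<Rightarrow> real \<Rightarrow> real"
  assumes "finite I" "\<And>i. i \<in> I \<Longrightarrow> lipschitz_real T (h i)" "C \<ge> 0"
    and le: "\<And>s t. s \<in> {0..T} \<Longrightarrow> t \<in> {0..T} \<Longrightarrow> \<bar>f s - f t\<bar> \<le> C * (\<Sum>i\<in>I. \<bar>h i s - h i t\<bar>)"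
  shows "lipschitz_real T f"
proof -
  obtain L where L: "\<And>i. i \<in> I \<Longrightarrow> (L i)-lipschitz_on {0..T} (h i)"
    using assms(2) unfolding lipschitz_real_def by metis
  have "(C * (\<Sum>i\<in>I. L i))-lipschitz_on {0..T} f"
  proof (rule lipschitz_onI)
    show "0 \<le> C * (\<Sum>i\<in>I. L i)" using assms(3) L lipschitz_on_nonneg by (intro mult_nonneg_nonneg sum_nonneg) blast+
    fix s t assume st: "s \<in> {0..T}" "t \<in> {0..T}"
    have "\<bar>f s - f t\<bar> \<le> C * (\<Sum>i\<in>I. L i * dist s t)"
      using lipschitz_onD[OF L st]
      by (intro order_trans[OF le[OF st]] mult_left_mono[OF _ assms(3)] sum_mono) (auto simp: dist_real_def)
    then show "dist (f s) (f t) \<le> C * (\<Sum>i\<in>I. L i) * dist s t" by (simp add: dist_real_def sum_distrib_right mult.assoc)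
  qed
  then show ?thesis unfolding lipschitz_real_def by blast
qed

section \<open>Lipschitz dependence of the reconstructions on time\<close>

lemma poly_lipschitz: "\<exists>L. L-lipschitz_on {a..b} (poly p)" for p :: "real poly"
proof -
  have "bounded (poly (pderiv p) ` {a..b})"
    by (intro compact_imp_bounded compact_continuous_image continuous_intros) auto
  then obtain C where C: "\<forall>y\<in>{a..b}. \<bar>poly (pderiv p) y\<bar> \<le> C" by (auto simp: bounded_iff)
  have "(max 0 C)-lipschitz_on {a..b} (poly p)"
  proof (rule bounded_derivative_imp_lipschitz)
    show "(poly p has_derivative (\<lambda>h. poly (pderiv p) y * h)) (at y within {a..b})" for y
      using poly_DERIV[of p y] by (auto simp: has_field_derivative_def intro: has_derivative_at_withinI)
    show "onorm (\<lambda>h. poly (pderiv p) y * h) \<le> max 0 C" if "y \<in> {a..b}" for y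
    proof (rule onorm_bound)
      show "norm (poly (pderiv p) y * h) \<le> max 0 C * norm h" for h
      proof -
        have "\<bar>poly (pderiv p) y\<bar> \<le> max 0 C" using C[rule_format, OF that] by simp
        then show ?thesis by (simp add: abs_mult mult_right_mono)
      qed
    qed simp
  qed auto
  then show ?thesis by blast
qed

lemma option_sum:
  "(\<Sum>i\<in>insert None (insert (Some None) ((Some \<circ> Some) ` {..n::nat})). f i)
    = f None + (f (Some None) + (\<Sum>i\<le>n. f (Some (Some i))) :: real)"
  by (subst sum.insert, simp, force, subst sum.insert, simp, force, subst sum.reindex) (auto simp: inj_on_def)

text \<open>
  The hypotheses on the scheme that concern the two reconstructions of the discrete solution.
\<close>

locale dg_reconstruction = mesh x M for x M +
  fixes T \<epsilon> :: real and q :: nat and w :: "state \<Rightarrow> state \<Rightarrow> state"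
    and fh Ah :: "(real \<Rightarrow> state) \<Rightarrow> (real \<Rightarrow> state)" and tt :: "nat \<Rightarrow> real" and N :: nat
    and U :: "nat \<Rightarrow> real \<Rightarrow> state" and ut uts :: "real \<Rightarrow> real \<Rightarrow> state"
  assumes T0: "0 < T" and eps0: "0 \<le> \<epsilon>" and q: "q \<ge> 1"
    and w_lip: "\<And>z. \<exists>r>0. \<exists>L. L-lipschitz_on (ball z r) (\<lambda>(a, b). w a b)"
    and fh_dg: "\<And>\<phi>. \<phi> \<in> dg_space2 x M q \<Longrightarrow> fh \<phi> \<in> dg_space2 x M q"
    and diff: "diffusion_operator x M q Ah"
    and semi: "semidiscrete_lipschitz x M q fh Ah"
    and grid: "time_grid tt N T"
    and tempo: "temporal_reconstruction x M q fh Ah \<epsilon> tt N U ut"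
    and spacetime: "space_time_reconstruction x M q w T ut uts"
begin

lemma dg2_component: "f \<in> dg_space2 x M r \<Longrightarrow> sel \<in> {fst, snd} \<Longrightarrow> (\<lambda>y. sel (f y)) \<in> dg_space x M r"
  by (auto simp: dg_space2_def)

lemma sel_linear:
  assumes "sel \<in> {fst, snd :: state \<Rightarrow> real}"
  shows "sel (\<Sum>k\<in>I. r k *\<^sub>R f k) = (\<Sum>k\<in>I. r k * sel (f k))" "sel (a - b) = sel a - sel b"
  using assms by (auto simp: fst_sum snd_sum)

lemma slab:
  assumes "n < N"
  obtains c where "\<And>k. k \<le> 3 \<Longrightarrow> c k \<in> dg_space2 x M q"
    "\<And>t y. t \<in> {tt n..tt (Suc n)} \<Longrightarrow> ut t y = (\<Sum>k\<le>(3::nat). t ^ k *\<^sub>R c k y)"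
  using tempo assms unfolding temporal_reconstruction_def by blast

text \<open>
  On a time step the cell polynomials have degree at most three in time.
\<close>

lemma slab_cells:
  assumes n: "n < N"
  obtains P where "\<And>t. t \<in> {tt n..tt (Suc n)} \<Longrightarrow> ut t \<in> dg_space2 x M q"
    "\<And>sel t j. sel \<in> {fst, snd} \<Longrightarrow> t \<in> {tt n..tt (Suc n)} \<Longrightarrow> j < M \<Longrightarrow>
       cell_poly x q (\<lambda>y. sel (ut t y)) j = (\<Sum>k\<le>(3::nat). smult (t ^ k) (P sel j k))"
proof -
  obtain c where c: "\<And>k. k \<le> 3 \<Longrightarrow> c k \<in> dg_space2 x M q"
    "\<And>t y. t \<in> {tt n..tt (Suc n)} \<Longrightarrow> ut t y = (\<Sum>k\<le>(3::nat). t ^ k *\<^sub>R c k y)" using slab[OF n] by blast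
  define P where "P = (\<lambda>sel j k. cell_poly x q (\<lambda>y. sel (c k y)) j)"
  have comp: "(\<lambda>y. sel (c k y)) \<in> dg_space x M q" if "sel \<in> {fst, snd}" "k \<le> 3" for sel k
    by (rule dg2_component[OF c(1)[OF that(2)] that(1)])
  have eq: "sel (ut t y) = poly (\<Sum>k\<le>(3::nat). smult (t ^ k) (P sel j k)) y"
    if sel: "sel \<in> {fst, snd}" and t: "t \<in> {tt n..tt (Suc n)}" and j: "j < M" and y: "y \<in> {x j..<x (Suc j)}" for sel t j y
  proof -
    have "sel (ut t y) = (\<Sum>k\<le>(3::nat). t ^ k * sel (c k y))" unfolding c(2)[OF t] by (rule sel_linear(1)[OF sel])
    also have "\<dots> = (\<Sum>k\<le>(3::nat). t ^ k * poly (P sel j k) y)"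
      unfolding P_def using cell_poly(2)[OF comp[OF sel] j y] by (intro sum.cong refl) auto
    finally show ?thesis by (simp add: poly_sum)
  qed
  have deg: "degree (\<Sum>k\<le>(3::nat). smult (t ^ k) (P sel j k)) \<le> q" if sel: "sel \<in> {fst, snd}" and j: "j < M" for sel t j
    unfolding P_def
    by (intro degree_sum_le order_trans[OF degree_smult_le cell_poly(1)[OF comp[OF sel] j]]) auto
  have per: "sel (ut t (y + 1)) = sel (ut t y)" if sel: "sel \<in> {fst, snd}" and t: "t \<in> {tt n..tt (Suc n)}" for sel t y
    unfolding c(2)[OF t] sel_linear(1)[OF sel]
    by (intro sum.cong refl) (use dg_periodic[OF comp[OF sel]] in auto)
  have comp_ut: "(\<lambda>y. sel (ut t y)) \<in> dg_space x M q" if sel: "sel \<in> {fst, snd}" and t: "t \<in> {tt n..tt (Suc n)}" for sel t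
    unfolding dg_space_def periodic1_def using per[OF sel t] deg[OF sel] eq[OF sel t] by blast
  show ?thesis
  proof (rule that)
    show "ut t \<in> dg_space2 x M q" if "t \<in> {tt n..tt (Suc n)}" for t
      using comp_ut[OF _ that, of fst] comp_ut[OF _ that, of snd] by (simp add: dg_space2_def)
    show "cell_poly x q (\<lambda>y. sel (ut t y)) j = (\<Sum>k\<le>(3::nat). smult (t ^ k) (P sel j k))"
      if "sel \<in> {fst, snd}" "t \<in> {tt n..tt (Suc n)}" "j < M" for sel t j
      by (rule cell_poly_eqI[OF comp_ut[OF that(1,2)] that(3)]) (use eq[OF that] in auto)
  qed
qed

lemma ut_dg: assumes "t \<in> {0..T}" shows "ut t \<in> dg_space2 x M q"
proof -
  obtain n where "n < N" "t \<in> {tt n..tt (Suc n)}" by (rule time_grid_cell[OF grid T0 assms])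
  then show ?thesis using slab_cells[of n] by metis
qed

lemma uts_dg: "t \<in> {0..T} \<Longrightarrow> uts t \<in> dg_space2 x M (q + 1)"
  using spacetime by (simp add: space_time_reconstruction_def)

text \<open>
  Cell polynomials of the temporal reconstruction (\<open>pc\<close>) and of the space-time reconstruction
  (\<open>Pc\<close>). The selector \<open>fst\<close> or \<open>snd\<close> treats both components of the state at once.
\<close>

definition pc :: "(state \<Rightarrow> real) \<Rightarrow> real \<Rightarrow> nat \<Rightarrow> real poly" where
  "pc sel t = cell_poly x q (\<lambda>y. sel (ut t y))"

definition Pc :: "(state \<Rightarrow> real) \<Rightarrow> real \<Rightarrow> nat \<Rightarrow> real poly" where
  "Pc sel t = cell_poly x (q + 1) (\<lambda>y. sel (uts t y))"

lemma pc_degree: "sel \<in> {fst, snd} \<Longrightarrow> t \<in> {0..T} \<Longrightarrow> j < M \<Longrightarrow> degree (pc sel t j) \<le> q"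
  unfolding pc_def by (intro cell_poly(1) dg2_component ut_dg)

lemma Pc_degree: "sel \<in> {fst, snd} \<Longrightarrow> t \<in> {0..T} \<Longrightarrow> j < M \<Longrightarrow> degree (Pc sel t j) \<le> q + 1"
  unfolding Pc_def by (intro cell_poly(1) dg2_component uts_dg)

lemma pc_lipschitz:
  assumes sel: "sel \<in> {fst, snd}" and j: "j < M"
  shows "lipschitz_real T (\<lambda>t. coeff (pc sel t j) k)"
proof (rule lipschitz_on_grid[OF grid])
  fix n assume n: "n < N"
  obtain P where P: "\<And>sel t j. sel \<in> {fst, snd} \<Longrightarrow> t \<in> {tt n..tt (Suc n)} \<Longrightarrow> j < M \<Longrightarrow>
       cell_poly x q (\<lambda>y. sel (ut t y)) j = (\<Sum>k\<le>(3::nat). smult (t ^ k) (P sel j k))"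
    by (rule slab_cells[OF n]) blast
  define r where "r = (\<Sum>l\<le>(3::nat). monom (coeff (P sel j l) k) l)"
  obtain L where L: "L-lipschitz_on {tt n..tt (Suc n)} (poly r)" using poly_lipschitz by blast
  have "poly r t = coeff (pc sel t j) k" if t: "t \<in> {tt n..tt (Suc n)}" for t
    unfolding pc_def P[OF sel t j] r_def by (simp add: poly_sum poly_monom coeff_sum mult.commute)
  then have "L-lipschitz_on {tt n..tt (Suc n)} (\<lambda>t. coeff (pc sel t j) k)"
    using L unfolding lipschitz_on_def by simp
  then show "\<exists>L. L-lipschitz_on {tt n..tt (Suc n)} (\<lambda>t. coeff (pc sel t j) k)" by blast
qed

text \<open>
  The common nodal value of the space-time reconstruction.
\<close>

definition W :: "real \<Rightarrow> nat \<Rightarrow> state" where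
  "W t k = w (tr_left (ut t) (x k)) (tr_right (ut t) (x k))"

lemma pc_eval_lipschitz:
  assumes "j < M" shows "lipschitz_real T (\<lambda>t. (poly (pc fst t j) y, poly (pc snd t j) y))"
  by (intro lipschitz_real_Pair lipschitz_real_poly_eval[of _ _ q] pc_lipschitz pc_degree assms) auto

lemma W_lipschitz:
  assumes k: "k \<le> M" shows "lipschitz_real T (\<lambda>t. W t k)"
proof -
  have M: "M - 1 < M" "0 < M" using mesh_simps(1) by auto
  have L: "lipschitz_real T (\<lambda>t. tr_left (ut t) (x k))"
  proof (cases k)
    case 0
    show ?thesis
      by (rule lipschitz_real_cong[OF pc_eval_lipschitz[OF M(1), of 1]])
         (use dg2_traces(3)[OF ut_dg M(1)] 0 in \<open>simp add: pc_def\<close>)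
  next
    case (Suc j)
    then have j: "j < M" using k by simp
    show ?thesis
      by (rule lipschitz_real_cong[OF pc_eval_lipschitz[OF j, of "x (Suc j)"]])
         (use dg2_traces(2)[OF ut_dg j] Suc in \<open>simp add: pc_def\<close>)
  qed
  have R: "lipschitz_real T (\<lambda>t. tr_right (ut t) (x k))"
  proof (cases "k < M")
    case True
    show ?thesis
      by (rule lipschitz_real_cong[OF pc_eval_lipschitz[OF True, of "x k"]])
         (use dg2_traces(1)[OF ut_dg True] in \<open>simp add: pc_def\<close>)
  next
    case False
    then have "k = M" using k by simp
    then show ?thesis
      by (intro lipschitz_real_cong[OF pc_eval_lipschitz[OF M(2), of 0]])
         (use dg2_traces(4)[OF ut_dg M(2)] in \<open>simp add: pc_def\<close>)
  qed
  have "lipschitz_real T (\<lambda>t. (\<lambda>(a, b). w a b) (tr_left (ut t) (x k), tr_right (ut t) (x k)))"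
    by (rule locally_lipschitz_compose[OF lipschitz_real_Pair[OF L R] w_lip])
  then show ?thesis by (simp add: W_def)
qed

lemma W_periodic: assumes t: "t \<in> {0..T}" shows "W t M = W t 0"
proof -
  have M: "0 < M" "M - 1 < M" "Suc (M - 1) = M" using mesh_simps(1) by auto
  have "tr_left (ut t) (x M) = tr_left (ut t) (x 0)"
    using dg2_traces(2)[OF ut_dg[OF t] M(2)] dg2_traces(3)[OF ut_dg[OF t] M(2)] M(3) mesh_simps(3) by simp
  moreover have "tr_right (ut t) (x M) = tr_right (ut t) (x 0)"
    using dg2_traces(1)[OF ut_dg[OF t] M(1)] dg2_traces(4)[OF ut_dg[OF t] M(1)] mesh_simps(2) by simp
  ultimately show ?thesis by (simp add: W_def)
qed

lemma Pc_nodes: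
  assumes sel: "sel \<in> {fst, snd}" and t: "t \<in> {0..T}" and j: "j < M"
  shows "poly (Pc sel t j) (x j) = sel (W t j)" "poly (Pc sel t j) (x (Suc j)) = sel (W t (Suc j))"
proof -
  have "tr_right (uts t) (x j) = W t j" "tr_left (uts t) (x (Suc j)) = W t (Suc j)"
    using spacetime t j by (auto simp: space_time_reconstruction_def W_def)
  then have "W t j = (poly (Pc fst t j) (x j), poly (Pc snd t j) (x j))"
    "W t (Suc j) = (poly (Pc fst t j) (x (Suc j)), poly (Pc snd t j) (x (Suc j)))"
    using dg2_traces(1,2)[OF uts_dg[OF t] j] by (simp_all add: Pc_def)
  then show "poly (Pc sel t j) (x j) = sel (W t j)" "poly (Pc sel t j) (x (Suc j)) = sel (W t (Suc j))"
    using sel by auto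
qed

lemma component_L2: "f \<in> dg_space x M r \<Longrightarrow> in_L2 f"
  by (intro in_L2_bounded_measurable_on dg_bounded_measurable)

lemma Pc_moments:
  assumes sel: "sel \<in> {fst, snd}" and t: "t \<in> {0..T}" and j: "j < M" and i: "i \<le> q - 1"
  shows "moment (x j) (x (Suc j)) (Pc sel t j) i = moment (x j) (x (Suc j)) (pc sel t j) i"
proof -
  define b where "b = (\<lambda>y. if frac y \<in> {x j..<x (Suc j)} then poly (monom 1 i) (frac y) else 0)"
  have b: "b \<in> dg_space x M (q - 1)"
    unfolding b_def by (rule dg_space_single_cell[OF j]) (use i in \<open>simp add: degree_monom_eq\<close>)
  have zero: "(\<lambda>y. 0) \<in> dg_space x M (q - 1)"
    unfolding dg_space_def periodic1_def by (auto intro!: exI[of _ 0])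
  define \<psi> where "\<psi> = (\<lambda>y. if sel = fst then (b y, 0) else (0, b y))"
  have "\<psi> \<in> dg_space2 x M (q - 1)" using b zero by (cases "sel = fst") (auto simp: dg_space2_def \<psi>_def)
  then have "int_inner (\<lambda>y. uts t y - ut t y) \<psi> = 0"
    using spacetime t unfolding space_time_reconstruction_def by blast
  moreover have "(uts t y - ut t y) \<bullet> \<psi> y = sel (uts t y) * b y - sel (ut t y) * b y" for y
    using sel by (auto simp: \<psi>_def inner_prod_def algebra_simps)
  ultimately have z: "(LINT y:{0..1}|lborel. sel (uts t y) * b y - sel (ut t y) * b y) = 0"
    by (simp add: int_inner_def)
  note c1 = dg2_component[OF uts_dg[OF t] sel] and c2 = dg2_component[OF ut_dg[OF t] sel]
  have "(LINT y:{0..1}|lborel. sel (uts t y) * b y) = (LINT y:{0..1}|lborel. sel (ut t y) * b y)"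
    using z set_integral_diff(2)[OF in_L2_mult[OF component_L2[OF c1] component_L2[OF b]] in_L2_mult[OF component_L2[OF c2] component_L2[OF b]]]
    by simp
  then show ?thesis
    unfolding b_def dg_set_integral_cell[OF c1 j] dg_set_integral_cell[OF c2 j]
    by (simp add: moment_def Pc_def pc_def poly_monom)
qed

text \<open>
  The nodal values are Lipschitz because \<open>w\<close> is locally Lipschitz, and the low moments are those
  of the temporal reconstruction. These data control all coefficients.
\<close>

lemma Pc_lipschitz:
  assumes sel: "sel \<in> {fst, snd}" and j: "j < M"
  shows "lipschitz_real T (\<lambda>t. coeff (Pc sel t j) k)"
proof -
  let ?a = "x j" and ?b = "x (Suc j)"
  obtain C where C: "C \<ge> 0" "\<And>p k. degree p \<le> q + 1 \<Longrightarrow>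
      \<bar>coeff p k\<bar> \<le> C * (\<bar>poly p ?a\<bar> + \<bar>poly p ?b\<bar> + (\<Sum>i\<le>q-1. \<bar>moment ?a ?b p i\<bar>))"
    using coefficients_bounded_by_reconstruction_data[OF mesh_simps(4)[OF j] q] by blast
  define h where "h = (\<lambda>i t. case i of None \<Rightarrow> sel (W t j) | Some None \<Rightarrow> sel (W t (Suc j))
    | Some (Some i) \<Rightarrow> moment ?a ?b (pc sel t j) i)"
  define I where "I = insert None (insert (Some None) ((Some \<circ> Some) ` {..q-1}))"
  have selW: "lipschitz_real T (\<lambda>t. sel (W t i))" if "i \<le> M" for i
    using sel lipschitz_real_fst[OF W_lipschitz[OF that]] lipschitz_real_snd[OF W_lipschitz[OF that]] by auto
  show ?thesis
  proof (rule lipschitz_real_if_bounded_by[OF _ _ C(1)])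
    show "finite I" by (simp add: I_def)
    show "lipschitz_real T (h i)" for i
    proof -
      have "lipschitz_real T (\<lambda>t. moment ?a ?b (pc sel t j) l)" for l
        by (rule lipschitz_real_moment[of _ _ q]) (use pc_lipschitz[OF sel j] pc_degree[OF sel _ j] in auto)
      then show ?thesis using selW[of j] selW[of "Suc j"] j
      proof (cases i)
        case (Some i')
        then show ?thesis using \<open>\<And>l. lipschitz_real T (\<lambda>t. moment ?a ?b (pc sel t j) l)\<close> selW[of "Suc j"] j
          by (cases i') (auto simp: h_def)
      qed (auto simp: h_def)
    qed
    fix s t assume s: "s \<in> {0..T}" and t: "t \<in> {0..T}"
    have mom: "moment ?a ?b (Pc sel s j - Pc sel t j) i = moment ?a ?b (pc sel s j) i - moment ?a ?b (pc sel t j) i"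
      if "i \<le> q - 1" for i
    proof -
      have "moment ?a ?b (Pc sel s j - Pc sel t j) i = moment ?a ?b (Pc sel s j) i - moment ?a ?b (Pc sel t j) i"
        unfolding moment_def poly_diff left_diff_distrib
        by (intro set_integral_diff(2) borel_integrable_atLeastAtMost' continuous_intros)
      then show ?thesis using Pc_moments[OF sel s j that] Pc_moments[OF sel t j that] by simp
    qed
    have "\<bar>coeff (Pc sel s j) k - coeff (Pc sel t j) k\<bar> = \<bar>coeff (Pc sel s j - Pc sel t j) k\<bar>" by simp
    also have "\<dots> \<le> C * (\<bar>poly (Pc sel s j - Pc sel t j) ?a\<bar> + \<bar>poly (Pc sel s j - Pc sel t j) ?b\<bar>
        + (\<Sum>i\<le>q-1. \<bar>moment ?a ?b (Pc sel s j - Pc sel t j) i\<bar>))"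
      by (rule C(2)) (intro degree_diff_le Pc_degree sel s t j)
    also have "\<dots> = C * (\<Sum>i\<in>I. \<bar>h i s - h i t\<bar>)"
      unfolding I_def option_sum using Pc_nodes[OF sel s j] Pc_nodes[OF sel t j] mom
      by (simp add: h_def)
    finally show "\<bar>coeff (Pc sel s j) k - coeff (Pc sel t j) k\<bar> \<le> C * (\<Sum>i\<in>I. \<bar>h i s - h i t\<bar>)" .
  qed
qed

end

section \<open>Expansion of the reconstruction in a fixed basis\<close>

lemma primitive_on_concat:
  assumes f: "primitive_on a b f g" "primitive_on b c f g" and abc: "a \<le> b" "b \<le> c"
  shows "primitive_on a c f g"
proof (rule primitive_onI)
  have "{a..c} = {a..b} \<union> {b..c}" using abc by auto
  then show i: "set_integrable lborel {a..c} g"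
    using set_integrable_Un[OF primitive_on_integrable[OF f(1)] primitive_on_integrable[OF f(2)]] by simp
  fix y assume y: "y \<in> {a..c}"
  show "f y = f a + (LINT z:{a..y}|lborel. g z)"
  proof (cases "y \<le> b")
    case True
    then show ?thesis using primitive_on_integral[OF f(1), of y] y by simp
  next
    case False
    then have "(LINT z:{a..y}|lborel. g z) = (f b - f a) + (f y - f b)"
      using set_integrable_interval_split[OF i, of b y] primitive_on_integral[OF f(1), of b]
        primitive_on_integral[OF f(2), of y] y abc by simp
    then show ?thesis by simp
  qed
qed

lemma primitive_on_cong_density:
  assumes f: "primitive_on a b f g" and eq: "\<And>y. y \<in> {a<..<b} \<Longrightarrow> g y = g' y"
  shows "primitive_on a b f g'"
proof (rule primitive_onI)
  have "set_integrable lborel {a<..<b} g' = set_integrable lborel {a<..<b} g"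
    by (rule set_integrable_cong) (use eq in auto)
  then show "set_integrable lborel {a..b} g'"
    using primitive_on_integrable[OF f] by (simp add: set_integrable_Ioo_Icc)
  fix y assume y: "y \<in> {a..b}"
  have "(LINT z:{a<..<y}|lborel. g' z) = (LINT z:{a<..<y}|lborel. g z)"
    by (rule set_lebesgue_integral_cong) (use eq y in auto)
  then show "f y = f a + (LINT z:{a..y}|lborel. g' z)"
    using primitive_on_integral[OF f y] by (simp add: set_integral_Ioo_Icc)
qed

lemma bounded_measurable_on_cmult:
  assumes "bounded_measurable_on a b f" shows "bounded_measurable_on a b (\<lambda>y. k * f y)"
proof -
  obtain C where C: "\<forall>y\<in>{a..b}. \<bar>f y\<bar> \<le> C" using assms by (auto simp: bounded_measurable_on_def)
  have "\<forall>y\<in>{a..b}. \<bar>k * f y\<bar> \<le> \<bar>k\<bar> * C" using C by (auto simp: abs_mult intro!: mult_left_mono)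
  moreover have "set_borel_measurable lborel {a..b} (\<lambda>y. k * f y)"
    using assms by (intro set_borel_measurable_mult) (auto simp: bounded_measurable_on_def set_borel_measurable_def)
  ultimately show ?thesis unfolding bounded_measurable_on_def by blast
qed

context dg_reconstruction begin

text \<open>
  A continuous piecewise polynomial is determined by its value at \<open>0\<close> and its derivative, which is a
  combination of monomials on cells. Subtracting the means, which cancel in the combination, makes
  every primitive periodic on its own.
\<close>

definition cell_mono :: "nat \<Rightarrow> nat \<Rightarrow> real \<Rightarrow> real" where
  "cell_mono j k y = indicator {x j..<x (Suc j)} y * (real k * y ^ (k - 1))"

definition cell_mean :: "nat \<Rightarrow> nat \<Rightarrow> real" where
  "cell_mean j k = (LINT y:{0..1}|lborel. cell_mono j k y)"

definition basis :: "(nat \<times> nat) option set" where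
  "basis = insert None (Some ` ({..<M} \<times> {..q + 1}))"

fun basis_dx :: "(nat \<times> nat) option \<Rightarrow> real \<Rightarrow> real" where
  "basis_dx None y = 0"
| "basis_dx (Some (j, k)) y = cell_mono j k y - cell_mean j k"

definition basis_fun :: "(nat \<times> nat) option \<Rightarrow> real \<Rightarrow> real" where
  "basis_fun b y = (if b = None then 1 else 0) + (LINT z:{0..y}|lborel. basis_dx b z)"

fun basis_coeff :: "(state \<Rightarrow> real) \<Rightarrow> (nat \<times> nat) option \<Rightarrow> real \<Rightarrow> real" where
  "basis_coeff sel None t = sel (W t 0)"
| "basis_coeff sel (Some (j, k)) t = coeff (Pc sel t j) k"

lemma finite_basis: "finite basis" by (simp add: basis_def)

lemma sum_basis: "(\<Sum>b\<in>basis. f b) = f None + (\<Sum>j<M. \<Sum>k\<le>q + 1. f (Some (j, k)))" for f :: "_ \<Rightarrow> real"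
proof -
  have "(\<Sum>b\<in>basis. f b) = f None + (\<Sum>b\<in>Some ` ({..<M} \<times> {..q + 1}). f b)"
    unfolding basis_def by (rule sum.insert) auto
  also have "(\<Sum>b\<in>Some ` ({..<M} \<times> {..q + 1}). f b) = (\<Sum>p\<in>{..<M} \<times> {..q + 1}. f (Some p))"
    by (subst sum.reindex) auto
  also have "\<dots> = (\<Sum>j<M. \<Sum>k\<le>q + 1. f (Some (j, k)))" by (simp add: sum.cartesian_product case_prod_unfold del: sum.atMost_Suc)
  finally show ?thesis .
qed

lemma cell_mono_measurable: "cell_mono j k \<in> borel_measurable borel"
  unfolding cell_mono_def[abs_def] by (intro borel_measurable_times borel_measurable_indicator) auto

lemma cell_mono_bounded: "y \<in> {0..1} \<Longrightarrow> \<bar>cell_mono j k y\<bar> \<le> real k"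
  by (auto simp: cell_mono_def indicator_def abs_mult power_abs intro!: mult_left_le power_le_one)

lemma basis_dx_bounded_measurable: "bounded_measurable_on 0 1 (basis_dx b)"
proof (cases b)
  case (Some p)
  obtain j k where b: "b = Some (j, k)" using Some by (cases p) auto
  have "\<bar>basis_dx b y\<bar> \<le> real k + \<bar>cell_mean j k\<bar>" if "y \<in> {0..1}" for y
    using cell_mono_bounded[OF that, of j k] unfolding b by simp
  moreover have "set_borel_measurable lborel {0..1} (basis_dx b)"
    unfolding b set_borel_measurable_def basis_dx.simps using cell_mono_measurable
    by (intro borel_measurable_scaleR borel_measurable_diff) auto
  ultimately show ?thesis unfolding bounded_measurable_on_def by blast
qed (simp add: bounded_measurable_on_continuous)

lemma basis_dx_integrable: "set_integrable lborel {0..1} (basis_dx b)"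
  by (intro in_L2_integrable in_L2_bounded_measurable_on basis_dx_bounded_measurable)

lemma cell_mono_integrable: "set_integrable lborel {0..1} (cell_mono j k)"
proof (rule set_integrable_bound[OF set_integrable_const_Icc[of 0 1 "real k"]])
  show "set_borel_measurable lborel {0..1} (cell_mono j k)"
    using cell_mono_measurable by (simp add: set_borel_measurable_def)
qed (use cell_mono_bounded in auto)

lemma basis_fun_primitive: "primitive_on 0 1 (basis_fun b) (basis_dx b)"
  unfolding basis_fun_def[abs_def] by (rule primitive_on_indefinite[OF basis_dx_integrable])

lemma basis_fun_periodic: "basis_fun b 1 = basis_fun b 0"
proof -
  have "(LINT z:{0..1}|lborel. basis_dx b z) = 0"
  proof (cases b)
    case (Some p)
    obtain j k where b: "b = Some (j, k)" using Some by (cases p) auto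
    have "(LINT z:{0..1}|lborel. cell_mono j k z - cell_mean j k)
      = (LINT z:{0..1}|lborel. cell_mono j k z) - (LINT z:{0..1::real}|lborel. cell_mean j k)"
      by (rule set_integral_diff(2)[of lborel "{0..1}" "cell_mono j k" "\<lambda>_. cell_mean j k"])
         (auto intro: cell_mono_integrable)
    also have "\<dots> = 0" using set_integral_const_Icc[of 0 1 "cell_mean j k"] by (simp add: cell_mean_def)
    finally show ?thesis by (simp add: b)
  qed simp
  then show ?thesis
    using primitive_on_integral[OF basis_fun_primitive, of 1 b] by simp
qed

text \<open>
  The derivative of the space-time reconstruction, with the value from the right at the nodes.
\<close>

definition Pc_dx :: "(state \<Rightarrow> real) \<Rightarrow> real \<Rightarrow> real \<Rightarrow> real" where
  "Pc_dx sel t y = (\<Sum>j<M. \<Sum>k\<le>q + 1. coeff (Pc sel t j) k * cell_mono j k y)"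

lemma Pc_dx_cell:
  assumes sel: "sel \<in> {fst, snd}" and t: "t \<in> {0..T}" and j: "j < M" and y: "y \<in> {x j..<x (Suc j)}"
  shows "Pc_dx sel t y = poly (pderiv (Pc sel t j)) y"
proof -
  have cell: "cell_mono i k y = (if i = j then real k * y ^ (k - 1) else 0)" if "i < M" for i k
  proof (cases "i = j")
    case False
    then have "y \<notin> {x i..<x (Suc i)}" using mesh_cell_unique[OF that j _ y] by blast
    then show ?thesis using False by (simp add: cell_mono_def)
  qed (use y in \<open>simp add: cell_mono_def\<close>)
  have "Pc_dx sel t y = (\<Sum>i<M. if i = j then (\<Sum>k\<le>q + 1. coeff (Pc sel t j) k * (real k * y ^ (k - 1))) else 0)"
    unfolding Pc_dx_def
    by (intro sum.cong refl) (simp add: cell del: sum.atMost_Suc)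
  also have "\<dots> = (\<Sum>k\<le>q + 1. coeff (Pc sel t j) k * (real k * y ^ (k - 1)))" using j by simp
  also have "\<dots> = (\<Sum>k\<le>q. coeff (pderiv (Pc sel t j)) k * y ^ k)"
    unfolding Suc_eq_plus1[symmetric] sum.atMost_Suc_shift by (simp add: coeff_pderiv mult_ac)
  also have "\<dots> = poly (pderiv (Pc sel t j)) y"
    by (rule poly_eq_sum[symmetric]) (use Pc_degree[OF sel t j] in \<open>simp add: degree_pderiv\<close>)
  finally show ?thesis .
qed

text \<open>
  At the right end point of a cell the reconstruction takes its value from the next cell; it is the
  common nodal value.
\<close>

lemma uts_cell:
  assumes sel: "sel \<in> {fst, snd}" and t: "t \<in> {0..T}" and j: "j < M" and y: "y \<in> {x j..x (Suc j)}"
  shows "sel (uts t y) = poly (Pc sel t j) y"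
proof (cases "y < x (Suc j)")
  case True
  then show ?thesis using cell_poly(2)[OF dg2_component[OF uts_dg[OF t] sel] j, of y] y by (simp add: Pc_def)
next
  case False
  then have y: "y = x (Suc j)" using y by simp
  show ?thesis
  proof (cases "Suc j < M")
    case True
    have "sel (uts t (x (Suc j))) = poly (Pc sel t (Suc j)) (x (Suc j))"
      using cell_poly(2)[OF dg2_component[OF uts_dg[OF t] sel] True, of "x (Suc j)"] mesh_simps(4)[OF True]
      by (simp add: Pc_def)
    then show ?thesis using Pc_nodes(2)[OF sel t j] Pc_nodes(1)[OF sel t True] y by simp
  next
    case False
    then have jM: "Suc j = M" using j by simp
    have M0: "0 < M" using mesh_simps(1) by simp
    have "sel (uts t (0 + 1)) = sel (uts t 0)" by (rule dg_periodic[OF dg2_component[OF uts_dg[OF t] sel]])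
    also have "\<dots> = poly (Pc sel t 0) (x 0)"
      using cell_poly(2)[OF dg2_component[OF uts_dg[OF t] sel] M0, of "x 0"] mesh_simps(4)[OF M0] mesh_simps(2)
      by (simp add: Pc_def)
    also have "\<dots> = sel (W t M)" using Pc_nodes(1)[OF sel t M0] W_periodic[OF t] by simp
    also have "\<dots> = poly (Pc sel t j) (x (Suc j))" using Pc_nodes(2)[OF sel t j] jM by simp
    finally show ?thesis using y jM mesh_simps(3) by simp
  qed
qed

lemma uts_primitive:
  assumes sel: "sel \<in> {fst, snd}" and t: "t \<in> {0..T}"
  shows "primitive_on 0 1 (\<lambda>y. sel (uts t y)) (Pc_dx sel t)"
proof -
  have "primitive_on 0 (x j) (\<lambda>y. sel (uts t y)) (Pc_dx sel t)" if "j \<le> M" for j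
    using that
  proof (induction j)
    case 0
    show ?case
    proof (rule primitive_onI)
      have "set_integrable lborel {0..0} (Pc_dx sel t) = set_integrable lborel {0..0::real} (\<lambda>_. Pc_dx sel t 0)"
        by (rule set_integrable_cong) auto
      then show "set_integrable lborel {0..x 0} (Pc_dx sel t)" by (simp only: mesh_simps(2) set_integrable_const_Icc)
      fix y assume "y \<in> {0..x 0}"
      then have "y = 0" by (simp add: mesh_simps)
      then show "sel (uts t y) = sel (uts t 0) + (LINT z:{0..y}|lborel. Pc_dx sel t z)"
        using set_integral_at_point[of lborel 0 "Pc_dx sel t"] by simp
    qed
  next
    case (Suc j)
    then have j: "j < M" by simp
    have "primitive_on (x j) (x (Suc j)) (poly (Pc sel t j)) (poly (pderiv (Pc sel t j)))"
      by (rule DERIV_primitive_on[OF poly_DERIV]) (intro continuous_intros)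
    then have "primitive_on (x j) (x (Suc j)) (poly (Pc sel t j)) (Pc_dx sel t)"
      by (rule primitive_on_cong_density) (use Pc_dx_cell[OF sel t j] in auto)
    then have "primitive_on (x j) (x (Suc j)) (\<lambda>y. sel (uts t y)) (Pc_dx sel t)"
      by (rule primitive_on_cong) (use uts_cell[OF sel t j] mesh_simps(4)[OF j] in auto)
    from primitive_on_concat[OF Suc.IH[OF less_imp_le[OF j]] this] show ?case
      using mesh_range(1)[of j] mesh_simps(4)[OF j] j by simp
  qed
  from this[of M] show ?thesis using mesh_simps(3) by simp
qed

lemma uts_basis:
  assumes sel: "sel \<in> {fst, snd}" and t: "t \<in> {0..T}"
  shows "y \<in> {0..1} \<Longrightarrow> sel (uts t y) = (\<Sum>b\<in>basis. basis_coeff sel b t * basis_fun b y)"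
    and "Pc_dx sel t y = (\<Sum>b\<in>basis. basis_coeff sel b t * basis_dx b y)"
proof -
  have M0: "0 < M" using mesh_simps(1) by simp
  let ?c = "\<lambda>j k. coeff (Pc sel t j) k"
  have F0: "sel (uts t 0) = sel (W t 0)"
    using uts_cell[OF sel t M0, of 0] Pc_nodes(1)[OF sel t M0] mesh_simps(2) mesh_simps(4)[OF M0] by simp
  have int: "(LINT z:{0..y}|lborel. Pc_dx sel t z) = (\<Sum>j<M. \<Sum>k\<le>q + 1. ?c j k * (LINT z:{0..y}|lborel. cell_mono j k z))"
    if "y \<in> {0..1}" for y
  proof -
    have "set_integrable lborel {0..y} (\<lambda>z. ?c j k * cell_mono j k z)" for j k
      by (rule set_integrable_mult_right, rule set_integrable_subset[OF cell_mono_integrable]) (use that in auto)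
    note i = this
    have i2: "set_integrable lborel {0..y} (\<lambda>z. \<Sum>k\<le>q + 1. ?c j k * cell_mono j k z)" for j
      using Bochner_Integration.integrable_sum[of "{..q+1}" lborel "\<lambda>k z. indicator {0..y} z *\<^sub>R (?c j k * cell_mono j k z)"] i
      by (simp add: set_integrable_def scaleR_sum_right sum_distrib_left del: sum.atMost_Suc)
    show ?thesis
      unfolding Pc_dx_def
      by (subst set_integral_sum[OF i2], subst set_integral_sum[OF i]) (simp del: sum.atMost_Suc)
  qed
  \<comment> \<open>the means cancel because the reconstruction is periodic\<close>
  have mean0: "(\<Sum>j<M. \<Sum>k\<le>q + 1. ?c j k * cell_mean j k) = 0"
  proof -
    have "sel (uts t (0 + 1)) = sel (uts t 0)" by (rule dg_periodic[OF dg2_component[OF uts_dg[OF t] sel]])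
    then show ?thesis
      using primitive_on_integral[OF uts_primitive[OF sel t], of 1] int[of 1] by (simp add: cell_mean_def del: sum.atMost_Suc)
  qed
  show "Pc_dx sel t y = (\<Sum>b\<in>basis. basis_coeff sel b t * basis_dx b y)"
    using mean0 by (simp add: sum_basis Pc_dx_def right_diff_distrib sum_subtractf del: sum.atMost_Suc)
  assume y: "y \<in> {0..1}"
  have bf: "basis_fun (Some (j, k)) y = (LINT z:{0..y}|lborel. cell_mono j k z) - y * cell_mean j k" for j k
  proof -
    have "set_integrable lborel {0..y} (cell_mono j k)"
      by (rule set_integrable_subset[OF cell_mono_integrable]) (use y in auto)
    from set_integral_diff(2)[OF this set_integrable_const_Icc[of 0 y "cell_mean j k"]]
    show ?thesis using set_integral_const_Icc[of 0 y "cell_mean j k"] y by (simp add: basis_fun_def)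
  qed
  have "sel (uts t y) = sel (W t 0) + (LINT z:{0..y}|lborel. Pc_dx sel t z)"
    using primitive_on_integral[OF uts_primitive[OF sel t] y] F0 by simp
  also have "\<dots> = sel (W t 0) + ((\<Sum>j<M. \<Sum>k\<le>q + 1. ?c j k * (LINT z:{0..y}|lborel. cell_mono j k z))
     - y * (\<Sum>j<M. \<Sum>k\<le>q + 1. ?c j k * cell_mean j k))"
    using int[OF y] mean0 by simp
  also have "\<dots> = (\<Sum>b\<in>basis. basis_coeff sel b t * basis_fun b y)"
    unfolding sum_basis basis_coeff.simps bf
    by (simp add: basis_fun_def right_diff_distrib sum_subtractf sum_distrib_left mult_ac del: sum.atMost_Suc)
  finally show "sel (uts t y) = (\<Sum>b\<in>basis. basis_coeff sel b t * basis_fun b y)" .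
qed

lemma uts_dx:
  assumes sel: "sel \<in> {fst, snd}" and t: "t \<in> {0..T}" and j: "j < M" and y: "y \<in> {x j<..<x (Suc j)}"
  shows "((\<lambda>y. sel (uts t y)) has_real_derivative Pc_dx sel t y) (at y)"
proof -
  have "Pc_dx sel t y = poly (pderiv (Pc sel t j)) y" using Pc_dx_cell[OF sel t j, of y] y by auto
  then have "(poly (Pc sel t j) has_real_derivative Pc_dx sel t y) (at y)" using poly_DERIV by simp
  then show ?thesis
    by (rule has_field_derivative_transform_within_open[where S = "{x j<..<x (Suc j)}"])
       (use uts_cell[OF sel t j] y in auto)
qed

lemma AE_mesh_cell: "AE y in lborel. y \<in> {0..1} \<longrightarrow> (\<exists>j<M. y \<in> {x j<..<x (Suc j)})"
proof -
  have "AE y in lborel. \<forall>j\<in>{..M}. y \<noteq> x j"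
    by (intro AE_finite_allI AE_lborel_singleton) simp
  then show ?thesis
  proof eventually_elim
    case (elim y)
    show ?case
    proof
      assume "y \<in> {0..1}"
      moreover have "y \<noteq> 1" using elim mesh_simps(3) by (metis atMost_iff order_refl)
      ultimately have "y \<in> {0..<1}" by auto
      then obtain j where j: "j < M" "y \<in> {x j..<x (Suc j)}" by (rule mesh_cell)
      then show "\<exists>j<M. y \<in> {x j<..<x (Suc j)}" using elim by (intro exI[of _ j]) (auto simp: less_le)
    qed
  qed
qed

lemma basis_coeff_lipschitz:
  assumes sel: "sel \<in> {fst, snd}" and b: "b \<in> basis"
  shows "lipschitz_real T (basis_coeff sel b)"
proof (cases b)
  case None
  have "lipschitz_real T (\<lambda>t. sel (W t 0))"
    using sel lipschitz_real_fst[OF W_lipschitz[of 0]] lipschitz_real_snd[OF W_lipschitz[of 0]] by auto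
  moreover have "basis_coeff sel None = (\<lambda>t. sel (W t 0))" by (simp add: fun_eq_iff)
  ultimately show ?thesis using None by simp
next
  case (Some p)
  then obtain j k where "b = Some (j, k)" "j < M" using b by (cases p) (auto simp: basis_def)
  moreover have "basis_coeff sel (Some (j, k)) = (\<lambda>t. coeff (Pc sel t j) k)" by (simp add: fun_eq_iff)
  ultimately show ?thesis using Pc_lipschitz[OF sel, of j k] by simp
qed

text \<open>
  The almost everywhere derivative of a Lipschitz coefficient, in a version that is bounded and
  measurable.
\<close>

definition basis_coeff_dt :: "(state \<Rightarrow> real) \<Rightarrow> (nat \<times> nat) option \<Rightarrow> real \<Rightarrow> real" where
  "basis_coeff_dt sel b = (SOME \<gamma>. bounded_measurable_on 0 T \<gamma> \<and> primitive_on 0 T (basis_coeff sel b) \<gamma> \<and>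
     (AE t in lborel. t \<in> {0<..<T} \<longrightarrow> (basis_coeff sel b has_real_derivative \<gamma> t) (at t)))"

lemma basis_coeff_dt:
  assumes sel: "sel \<in> {fst, snd}" and b: "b \<in> basis"
  shows "bounded_measurable_on 0 T (basis_coeff_dt sel b)"
    "primitive_on 0 T (basis_coeff sel b) (basis_coeff_dt sel b)"
    "AE t in lborel. t \<in> {0<..<T} \<longrightarrow> (basis_coeff sel b has_real_derivative basis_coeff_dt sel b t) (at t)"
proof -
  obtain L where "L-lipschitz_on {0..T} (basis_coeff sel b)"
    using basis_coeff_lipschitz[OF assms] by (auto simp: lipschitz_real_def)
  then obtain \<gamma> where \<gamma>: "\<gamma> \<in> borel_measurable borel" "\<And>t. \<bar>\<gamma> t\<bar> \<le> L" "primitive_on 0 T (basis_coeff sel b) \<gamma>"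
    "AE t in lborel. t \<in> {0<..<T} \<longrightarrow> (basis_coeff sel b has_real_derivative \<gamma> t) (at t)"
    by (rule lipschitz_primitive[OF T0]) blast
  have "bounded_measurable_on 0 T \<gamma>"
    using \<gamma>(1,2) by (auto simp: bounded_measurable_on_def set_borel_measurable_def)
  with \<gamma>(3,4) have "\<exists>\<gamma>. bounded_measurable_on 0 T \<gamma> \<and> primitive_on 0 T (basis_coeff sel b) \<gamma> \<and>
     (AE t in lborel. t \<in> {0<..<T} \<longrightarrow> (basis_coeff sel b has_real_derivative \<gamma> t) (at t))" by blast
  from someI_ex[OF this]
  show "bounded_measurable_on 0 T (basis_coeff_dt sel b)"
    "primitive_on 0 T (basis_coeff sel b) (basis_coeff_dt sel b)"
    "AE t in lborel. t \<in> {0<..<T} \<longrightarrow> (basis_coeff sel b has_real_derivative basis_coeff_dt sel b t) (at t)"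
    unfolding basis_coeff_dt_def by blast+
qed

text \<open>
  One null set of times serves all points \<open>y\<close>, since only finitely many coefficients occur.
\<close>

lemma uts_dt:
  assumes sel: "sel \<in> {fst, snd}"
  shows "AE t in lborel. t \<in> {0<..<T} \<longrightarrow> (\<forall>y\<in>{0..1}.
     ((\<lambda>t. sel (uts t y)) has_real_derivative (\<Sum>b\<in>basis. basis_coeff_dt sel b t * basis_fun b y)) (at t))"
proof -
  have "AE t in lborel. \<forall>b\<in>basis. t \<in> {0<..<T} \<longrightarrow> (basis_coeff sel b has_real_derivative basis_coeff_dt sel b t) (at t)"
    by (intro AE_finite_allI finite_basis basis_coeff_dt(3)[OF sel])
  then show ?thesis
  proof eventually_elim
    case (elim t)
    show ?case
    proof (intro impI ballI)
      fix y :: real assume t: "t \<in> {0<..<T}" and y: "y \<in> {0..1}"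
      have "((\<lambda>t. \<Sum>b\<in>basis. basis_coeff sel b t * basis_fun b y) has_real_derivative
          (\<Sum>b\<in>basis. basis_coeff_dt sel b t * basis_fun b y)) (at t)"
        by (intro DERIV_sum DERIV_cmult_right) (use elim t in auto)
      then show "((\<lambda>t. sel (uts t y)) has_real_derivative (\<Sum>b\<in>basis. basis_coeff_dt sel b t * basis_fun b y)) (at t)"
        by (rule has_field_derivative_transform_within_open[where S = "{0<..<T}"])
           (use t uts_basis(1)[OF sel _ y] in auto)
    qed
  qed
qed

end

section \<open>Time dependence of the discrete diffusion\<close>

lemma sqrt_ennreal_mono: "a \<le> b \<Longrightarrow> sqrt_ennreal a \<le> sqrt_ennreal b"
  unfolding sqrt_ennreal_def
  by (auto intro!: ennreal_leI enn2real_mono simp: top_unique less_top)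

lemma L2norm_le_bound:
  fixes f :: "real \<Rightarrow> 'a::real_normed_vector"
  assumes "m \<ge> 0" "\<And>y. y \<in> {0..1} \<Longrightarrow> norm (f y) \<le> m"
  shows "L2norm f \<le> ennreal m"
proof -
  have "L2sq f \<le> (\<integral>\<^sup>+ y. ennreal (m\<^sup>2) * indicator {0..1::real} y \<partial>lborel)"
    unfolding L2sq_on_def
    by (intro nn_integral_mono) (use assms in \<open>auto simp: indicator_def intro!: ennreal_leI power_mono\<close>)
  also have "\<dots> = ennreal (m\<^sup>2)" by (simp add: nn_integral_cmult)
  finally have "sqrt_ennreal (L2sq f) \<le> sqrt_ennreal (ennreal (m\<^sup>2))" by (rule sqrt_ennreal_mono)
  then show ?thesis using assms(1) by (simp add: L2norm_def sqrt_ennreal_def)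
qed

lemma integral_abs_snd_le_L2norm:
  fixes f :: "real \<Rightarrow> state"
  assumes f: "in_L2 (\<lambda>y. fst (f y))" "in_L2 (\<lambda>y. snd (f y))" and m: "L2norm f \<le> ennreal m" "m \<ge> 0"
  shows "(LINT y:{0..1}|lborel. \<bar>snd (f y)\<bar>) \<le> m"
proof -
  let ?a = "(LINT y:{0..1}|lborel. (fst (f y))\<^sup>2)" and ?b = "(LINT y:{0..1}|lborel. (snd (f y))\<^sup>2)"
  have nn: "0 \<le> ?a" "0 \<le> ?b"
    unfolding set_lebesgue_integral_def by (auto intro!: integral_nonneg_AE)
  have abs2: "in_L2 (\<lambda>y. \<bar>snd (f y)\<bar>)"
    using f(2) set_integrable_abs[OF in_L2_integrable[OF f(2)]]
    unfolding in_L2_integrable_sq by (auto simp: set_integrable_def set_borel_measurable_def)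
  have z: "in_L2 (\<lambda>y. 0)" by (rule in_L2_continuous) simp
  have o: "in_L2 (\<lambda>y. 1)" by (rule in_L2_continuous) simp
  have "(LINT y:{0..1}|lborel. \<bar>snd (f y)\<bar>) = (LINT y:{0..1}|lborel. \<bar>snd (f y)\<bar> * 1 + 0 * 0)" by simp
  also have "\<dots> \<le> sqrt (?b + (LINT y:{0..1::real}|lborel. 0\<^sup>2)) * sqrt ((LINT y:{0..1::real}|lborel. 1\<^sup>2) + (LINT y:{0..1::real}|lborel. 0\<^sup>2))"
    using L2_pair_Cauchy_Schwarz[OF abs2 z o z] by simp
  also have "\<dots> = sqrt ?b" using set_integral_const_Icc[of 0 1 1] by simp
  also have "\<dots> \<le> sqrt (?a + ?b)" using nn by simp
  also have "\<dots> \<le> m"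
    using m L2norm_pair(1)[OF f] nn by (simp add: ennreal_le_iff)
  finally show ?thesis .
qed

context dg_reconstruction begin

lemma poly_abs_le_coeffs:
  fixes p :: "real poly"
  assumes "degree p \<le> n" "y \<in> {0..1}" shows "\<bar>poly p y\<bar> \<le> (\<Sum>k\<le>n. \<bar>coeff p k\<bar>)"
proof -
  have "\<bar>poly p y\<bar> \<le> (\<Sum>k\<le>n. \<bar>coeff p k * y ^ k\<bar>)" unfolding poly_eq_sum[OF assms(1)] by (rule sum_abs)
  also have "\<dots> \<le> (\<Sum>k\<le>n. \<bar>coeff p k\<bar>)"
    using assms(2) by (intro sum_mono) (auto simp: abs_mult power_abs intro!: mult_left_le power_le_one)
  finally show ?thesis .
qed

text \<open>
  Evaluation on the unit interval is bounded by the sum of the absolute values of the coefficients,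
  each of which is Lipschitz in time.
\<close>

lemma ut_uniformly_lipschitz:
  obtains K where "K \<ge> 0" "\<And>s t y. s \<in> {0..T} \<Longrightarrow> t \<in> {0..T} \<Longrightarrow> y \<in> {0..1} \<Longrightarrow> norm (ut s y - ut t y) \<le> K * \<bar>s - t\<bar>"
proof -
  have "\<forall>sel\<in>{fst, snd}. \<forall>j\<in>{..<M}. \<forall>k. \<exists>L. L-lipschitz_on {0..T} (\<lambda>t. coeff (pc sel t j) k)"
    using pc_lipschitz by (auto simp: lipschitz_real_def)
  then obtain L where L: "\<And>sel j k. sel \<in> {fst, snd} \<Longrightarrow> j < M \<Longrightarrow> (L sel j k)-lipschitz_on {0..T} (\<lambda>t. coeff (pc sel t j) k)"
    by (metis lessThan_iff)
  have Lnn: "0 \<le> L sel j k" if "sel \<in> {fst, snd}" "j < M" for sel j k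
    using lipschitz_on_nonneg[OF L[OF that]] .
  define K0 where "K0 = (\<lambda>sel. \<Sum>j<M. \<Sum>k\<le>q. L sel j k)"
  have K0nn: "0 \<le> K0 sel" if "sel \<in> {fst, snd}" for sel
    unfolding K0_def by (intro sum_nonneg Lnn that) auto
  have cell: "\<bar>sel (ut s y) - sel (ut t y)\<bar> \<le> K0 sel * \<bar>s - t\<bar>"
    if sel: "sel \<in> {fst, snd}" and s: "s \<in> {0..T}" and t: "t \<in> {0..T}" and y: "y \<in> {0..<1}" for sel s t y
  proof -
    obtain j where j: "j < M" "y \<in> {x j..<x (Suc j)}" by (rule mesh_cell[OF y])
    have eq: "sel (ut r y) = poly (pc sel r j) y" if "r \<in> {0..T}" for r
      using cell_poly(2)[OF dg2_component[OF ut_dg[OF that] sel] j] by (simp add: pc_def)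
    have "\<bar>sel (ut s y) - sel (ut t y)\<bar> = \<bar>poly (pc sel s j - pc sel t j) y\<bar>"
      unfolding eq[OF s] eq[OF t] by simp
    also have "\<dots> \<le> (\<Sum>k\<le>q. \<bar>coeff (pc sel s j - pc sel t j) k\<bar>)"
      by (rule poly_abs_le_coeffs) (use y in \<open>auto intro!: degree_diff_le pc_degree sel s t j\<close>)
    also have "\<dots> \<le> (\<Sum>k\<le>q. L sel j k * \<bar>s - t\<bar>)"
      using lipschitz_onD[OF L[OF sel j(1)] s t] by (intro sum_mono) (simp add: dist_real_def)
    also have "\<dots> = (\<Sum>k\<le>q. L sel j k) * \<bar>s - t\<bar>" by (simp add: sum_distrib_right)
    also have "\<dots> \<le> K0 sel * \<bar>s - t\<bar>"
    proof (rule mult_right_mono)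
      have "(\<Sum>k\<le>q. L sel j k) \<le> (\<Sum>j<M. \<Sum>k\<le>q. L sel j k)"
        by (rule member_le_sum[of j "{..<M}" "\<lambda>j. \<Sum>k\<le>q. L sel j k"]) (use j Lnn[OF sel] in \<open>auto intro!: sum_nonneg\<close>)
      then show "(\<Sum>k\<le>q. L sel j k) \<le> K0 sel" by (simp add: K0_def)
    qed simp
    finally show ?thesis .
  qed
  have nrm: "norm (ut s y - ut t y) \<le> (K0 fst + K0 snd) * \<bar>s - t\<bar>"
    if s: "s \<in> {0..T}" and t: "t \<in> {0..T}" and y: "y \<in> {0..<1}" for s t y
  proof -
    have "ut s y - ut t y = (fst (ut s y) - fst (ut t y), snd (ut s y) - snd (ut t y))" by (simp add: prod_eq_iff)
    then have "norm (ut s y - ut t y) \<le> \<bar>fst (ut s y) - fst (ut t y)\<bar> + \<bar>snd (ut s y) - snd (ut t y)\<bar>"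
      using norm_Pair_le[of "fst (ut s y) - fst (ut t y)" "snd (ut s y) - snd (ut t y)"] by simp
    also have "\<dots> \<le> K0 fst * \<bar>s - t\<bar> + K0 snd * \<bar>s - t\<bar>"
      using cell[of fst, OF _ s t y] cell[of snd, OF _ s t y] by (intro add_mono) auto
    finally show ?thesis by (simp add: algebra_simps)
  qed
  show ?thesis
  proof (rule that[of "K0 fst + K0 snd"])
    show "0 \<le> K0 fst + K0 snd" using K0nn by simp
    fix s t y assume st: "s \<in> {0..T}" "t \<in> {0..T}" and y: "y \<in> {0..(1::real)}"
    have per: "ut r 1 = ut r 0" if "r \<in> {0..T}" for r
      using dg_periodic[OF dg2_component[OF ut_dg[OF that], of fst], of 0]
        dg_periodic[OF dg2_component[OF ut_dg[OF that], of snd], of 0] by (intro prod_eqI) auto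
    show "norm (ut s y - ut t y) \<le> (K0 fst + K0 snd) * \<bar>s - t\<bar>"
    proof (cases "y = 1")
      case True
      then show ?thesis using nrm[OF st, of 0] per st by simp
    next
      case False
      then show ?thesis using y by (intro nrm st) auto
    qed
  qed
qed

lemma ut_bounded: obtains R where "R \<ge> 0" "\<And>t. t \<in> {0..T} \<Longrightarrow> L2norm (ut t) \<le> ennreal R"
proof -
  obtain K where K: "K \<ge> 0" "\<And>s t y. s \<in> {0..T} \<Longrightarrow> t \<in> {0..T} \<Longrightarrow> y \<in> {0..1} \<Longrightarrow> norm (ut s y - ut t y) \<le> K * \<bar>s - t\<bar>"
    by (rule ut_uniformly_lipschitz) blast
  have T00: "0 \<in> {0..T}" using T0 by simp
  obtain C D where CD: "\<forall>y\<in>{0..1}. \<bar>fst (ut 0 y)\<bar> \<le> C" "\<forall>y\<in>{0..1}. \<bar>snd (ut 0 y)\<bar> \<le> D"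
    using dg_bounded_measurable[OF dg2_component[OF ut_dg[OF T00], of fst]]
      dg_bounded_measurable[OF dg2_component[OF ut_dg[OF T00], of snd]]
    by (auto simp: bounded_measurable_on_def)
  have C0: "0 \<le> C" "0 \<le> D" using CD by (force dest: bspec[of _ _ 0])+
  have "norm (ut t y) \<le> C + D + K * T" if "t \<in> {0..T}" "y \<in> {0..1}" for t y
  proof -
    have "norm (ut t y) \<le> norm (ut 0 y) + norm (ut t y - ut 0 y)" using norm_triangle_ineq[of "ut 0 y" "ut t y - ut 0 y"] by simp
    also have "norm (ut 0 y) \<le> C + D"
      using norm_Pair_le[of "fst (ut 0 y)" "snd (ut 0 y)"] CD that(2) by fastforce
    also have "norm (ut t y - ut 0 y) \<le> K * T"
      using K(2)[OF that(1) T00 that(2)] mult_left_mono[of "\<bar>t - 0\<bar>" T K] K(1) that(1) by auto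
    finally show ?thesis by simp
  qed
  then have "L2norm (ut t) \<le> ennreal (C + D + K * T)" if "t \<in> {0..T}" for t
    using that C0 K(1) T0 by (intro L2norm_le_bound) auto
  then show ?thesis using that[of "C + D + K * T"] C0 K(1) T0 by simp
qed

lemma Ah_dg: "t \<in> {0..T} \<Longrightarrow> Ah (ut t) \<in> dg_space2 x M q"
  using diff ut_dg by (simp add: diffusion_operator_def)

text \<open>
  Cell polynomials of the discrete diffusion. Their Lipschitz dependence on time yields the
  measurability in time that integrating the residuals requires.
\<close>

definition Ac :: "real \<Rightarrow> nat \<Rightarrow> real poly" where
  "Ac t = cell_poly x q (\<lambda>y. snd (Ah (ut t) y))"

lemma Ac_degree: "t \<in> {0..T} \<Longrightarrow> j < M \<Longrightarrow> degree (Ac t j) \<le> q"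
  unfolding Ac_def by (intro cell_poly(1) dg2_component Ah_dg) auto

text \<open>
  The Lipschitz bound of the semi-discrete right-hand side, taken once with the given \<open>\<epsilon>\<close> and once with
  \<open>\<epsilon> = 0\<close>, bounds the difference of the two, which is the diffusion operator alone.
\<close>

lemma Ah_lipschitz_L1:
  assumes "\<epsilon> > 0"
  obtains K where "K \<ge> 0" "\<And>s t. s \<in> {0..T} \<Longrightarrow> t \<in> {0..T} \<Longrightarrow>
    (LINT y:{0..1}|lborel. \<bar>snd (Ah (ut s) y) - snd (Ah (ut t) y)\<bar>) \<le> K * \<bar>s - t\<bar>"
proof -
  obtain K where K: "K \<ge> 0" "\<And>s t y. s \<in> {0..T} \<Longrightarrow> t \<in> {0..T} \<Longrightarrow> y \<in> {0..1} \<Longrightarrow> norm (ut s y - ut t y) \<le> K * \<bar>s - t\<bar>"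
    by (rule ut_uniformly_lipschitz) blast
  obtain R where R: "\<And>t. t \<in> {0..T} \<Longrightarrow> L2norm (ut t) \<le> ennreal R" by (rule ut_bounded) blast
  \<comment> \<open>increments of the right-hand side for an arbitrary viscosity \<open>e\<close>\<close>
  define D where "D = (\<lambda>e s t y. (- fh (ut s) y + e *\<^sub>R Ah (ut s) y) - (- fh (ut t) y + e *\<^sub>R Ah (ut t) y))"
  obtain C where C: "\<And>e s t. e \<ge> 0 \<Longrightarrow> s \<in> {0..T} \<Longrightarrow> t \<in> {0..T} \<Longrightarrow>
     L2norm (D e s t) \<le> ennreal (C * (1 / mesh_size x M + e / (mesh_size x M)\<^sup>2)) * L2norm (\<lambda>y. ut s y - ut t y)"
    using semi[unfolded semidiscrete_lipschitz_def, rule_format, of R] R ut_dg unfolding D_def by blast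
  define m where "m = (\<lambda>e. max 0 (C * (1 / mesh_size x M + e / (mesh_size x M)\<^sup>2)) * K)"
  have m0: "0 \<le> m e" for e using K(1) by (simp add: m_def)
  have Dm: "L2norm (D e s t) \<le> ennreal (m e * \<bar>s - t\<bar>)" if "e \<ge> 0" "s \<in> {0..T}" "t \<in> {0..T}" for e s t
  proof -
    let ?c = "C * (1 / mesh_size x M + e / (mesh_size x M)\<^sup>2)"
    have "L2norm (\<lambda>y. ut s y - ut t y) \<le> ennreal (K * \<bar>s - t\<bar>)"
      using K that by (intro L2norm_le_bound) auto
    then have "L2norm (D e s t) \<le> ennreal ?c * ennreal (K * \<bar>s - t\<bar>)"
      using C[OF that] by (meson mult_left_mono order_trans zero_le)
    also have "ennreal ?c = ennreal (max 0 ?c)" by (auto simp: max_def ennreal_neg)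
    also have "ennreal (max 0 ?c) * ennreal (K * \<bar>s - t\<bar>) = ennreal (m e * \<bar>s - t\<bar>)"
      using K(1) by (simp add: m_def ennreal_mult[symmetric] mult.assoc)
    finally show ?thesis .
  qed
  have comp: "in_L2 (\<lambda>y. sel (D e s t y))" if "sel \<in> {fst, snd}" "s \<in> {0..T}" "t \<in> {0..T}" for sel e s t
  proof -
    have "in_L2 (\<lambda>y. sel (fh (ut r) y))" "in_L2 (\<lambda>y. sel (Ah (ut r) y))" if "r \<in> {0..T}" for r
      by (intro component_L2[of _ q] dg2_component fh_dg Ah_dg ut_dg that \<open>sel \<in> {fst, snd}\<close>)+
    note c = this
    have "in_L2 (\<lambda>y. ((- 1) * sel (fh (ut s) y) + e * sel (Ah (ut s) y)) - ((- 1) * sel (fh (ut t) y) + e * sel (Ah (ut t) y)))"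
      by (intro in_L2_diff in_L2_add in_L2_cmult c that)
    moreover have "sel (D e s t y) = ((- 1) * sel (fh (ut s) y) + e * sel (Ah (ut s) y)) - ((- 1) * sel (fh (ut t) y) + e * sel (Ah (ut t) y))" for y
      using that(1) by (auto simp: D_def)
    ultimately show ?thesis by simp
  qed
  have bound: "(LINT y:{0..1}|lborel. \<bar>snd (D e s t y)\<bar>) \<le> m e * \<bar>s - t\<bar>" if "e \<ge> 0" "s \<in> {0..T}" "t \<in> {0..T}" for e s t
    by (rule integral_abs_snd_le_L2norm[OF comp comp Dm]) (use that m0 in auto)
  show ?thesis
  proof (rule that[of "(m \<epsilon> + m 0) / \<epsilon>"])
    show "0 \<le> (m \<epsilon> + m 0) / \<epsilon>" using m0[of \<epsilon>] m0[of 0] assms by simp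
    fix s t assume st: "s \<in> {0..T}" "t \<in> {0..T}"
    have absint: "set_integrable lborel {0..1} (\<lambda>y. \<bar>snd (D e s t y)\<bar>)" for e
      by (intro set_integrable_abs in_L2_integrable comp st) auto
    have "\<epsilon> * (LINT y:{0..1}|lborel. \<bar>snd (Ah (ut s) y) - snd (Ah (ut t) y)\<bar>)
      = (LINT y:{0..1}|lborel. \<bar>snd (D \<epsilon> s t y) - snd (D 0 s t y)\<bar>)"
    proof -
      have "\<bar>snd (D \<epsilon> s t y) - snd (D 0 s t y)\<bar> = \<epsilon> * \<bar>snd (Ah (ut s) y) - snd (Ah (ut t) y)\<bar>" for y
        using assms by (simp add: D_def abs_mult right_diff_distrib[symmetric])
      then show ?thesis by simp
    qed
    also have "\<dots> \<le> (LINT y:{0..1}|lborel. \<bar>snd (D \<epsilon> s t y)\<bar> + \<bar>snd (D 0 s t y)\<bar>)"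
    proof (rule set_integral_mono)
      show "set_integrable lborel {0..1} (\<lambda>y. \<bar>snd (D \<epsilon> s t y) - snd (D 0 s t y)\<bar>)"
        by (intro set_integrable_abs in_L2_integrable in_L2_diff comp st) auto
      show "set_integrable lborel {0..1} (\<lambda>y. \<bar>snd (D \<epsilon> s t y)\<bar> + \<bar>snd (D 0 s t y)\<bar>)"
        by (rule set_integral_add(1)[OF absint absint])
    qed auto
    also have "\<dots> = (LINT y:{0..1}|lborel. \<bar>snd (D \<epsilon> s t y)\<bar>) + (LINT y:{0..1}|lborel. \<bar>snd (D 0 s t y)\<bar>)"
      by (rule set_integral_add(2)[OF absint absint])
    also have "\<dots> \<le> (m \<epsilon> + m 0) * \<bar>s - t\<bar>"
      using bound[of \<epsilon> s t] bound[of 0 s t] st assms by (simp add: distrib_right)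
    finally show "(LINT y:{0..1}|lborel. \<bar>snd (Ah (ut s) y) - snd (Ah (ut t) y)\<bar>) \<le> (m \<epsilon> + m 0) / \<epsilon> * \<bar>s - t\<bar>"
      using assms by (simp add: field_simps)
  qed
qed

text \<open>
  The moments on a cell are integrals of the discrete diffusion against bounded functions, hence
  Lipschitz in time by the bound in \<open>L\<^sup>1\<close>, and they determine the coefficients.
\<close>

lemma Ac_lipschitz:
  assumes eps: "\<epsilon> > 0" and j: "j < M"
  shows "lipschitz_real T (\<lambda>t. coeff (Ac t j) k)"
proof -
  obtain K where K: "K \<ge> 0" "\<And>s t. s \<in> {0..T} \<Longrightarrow> t \<in> {0..T} \<Longrightarrow>
    (LINT y:{0..1}|lborel. \<bar>snd (Ah (ut s) y) - snd (Ah (ut t) y)\<bar>) \<le> K * \<bar>s - t\<bar>"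
    by (rule Ah_lipschitz_L1[OF eps]) blast
  let ?a = "x j" and ?b = "x (Suc j)"
  have dg: "(\<lambda>y. snd (Ah (ut t) y)) \<in> dg_space x M q" if "t \<in> {0..T}" for t
    by (intro dg2_component Ah_dg that) auto
  have mom: "lipschitz_real T (\<lambda>t. moment ?a ?b (Ac t j) i)" for i
  proof -
    define b where "b = (\<lambda>y. if frac y \<in> {x j..<x (Suc j)} then poly (monom 1 i) (frac y) else 0)"
    have bL2: "in_L2 b"
      unfolding b_def by (rule component_L2[OF dg_space_single_cell[OF j, of _ i]]) (simp add: degree_monom_eq)
    have b1: "\<bar>b y\<bar> \<le> 1" for y
    proof -
      have "0 \<le> frac y" "frac y \<le> 1" using frac_ge_0 frac_lt_1[of y] by auto
      then show ?thesis by (simp add: b_def poly_monom power_le_one)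
    qed
    have eq: "moment ?a ?b (Ac t j) i = (LINT y:{0..1}|lborel. snd (Ah (ut t) y) * b y)" if "t \<in> {0..T}" for t
      unfolding b_def dg_set_integral_cell[OF dg[OF that] j] by (simp add: moment_def Ac_def poly_monom)
    have "K-lipschitz_on {0..T} (\<lambda>t. moment ?a ?b (Ac t j) i)"
    proof (rule lipschitz_onI[OF _ K(1)])
      fix s t assume st: "s \<in> {0..T}" "t \<in> {0..T}"
      note L2s = component_L2[OF dg[OF st(1)]] component_L2[OF dg[OF st(2)]]
      have i: "set_integrable lborel {0..1} (\<lambda>y. (snd (Ah (ut s) y) - snd (Ah (ut t) y)) * b y)"
        by (intro in_L2_mult in_L2_diff L2s bL2)
      have "moment ?a ?b (Ac s j) i - moment ?a ?b (Ac t j) i = (LINT y:{0..1}|lborel. (snd (Ah (ut s) y) - snd (Ah (ut t) y)) * b y)"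
        unfolding eq[OF st(1)] eq[OF st(2)] left_diff_distrib
        by (rule set_integral_diff(2)[symmetric]) (intro in_L2_mult L2s bL2)+
      then have "\<bar>moment ?a ?b (Ac s j) i - moment ?a ?b (Ac t j) i\<bar> \<le> (LINT y:{0..1}|lborel. \<bar>(snd (Ah (ut s) y) - snd (Ah (ut t) y)) * b y\<bar>)"
        using set_integral_norm_bound[OF i] by simp
      also have "\<dots> \<le> (LINT y:{0..1}|lborel. \<bar>snd (Ah (ut s) y) - snd (Ah (ut t) y)\<bar>)"
        by (rule set_integral_mono[OF set_integrable_abs[OF i] set_integrable_abs[OF in_L2_integrable[OF in_L2_diff[OF L2s]]]])
           (use b1 in \<open>auto simp: abs_mult mult_left_le\<close>)
      also have "\<dots> \<le> K * \<bar>s - t\<bar>" by (rule K(2)[OF st])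
      finally show "dist (moment ?a ?b (Ac s j) i) (moment ?a ?b (Ac t j) i) \<le> K * dist s t" by (simp add: dist_real_def)
    qed
    then show ?thesis by (auto simp: lipschitz_real_def)
  qed
  obtain C where C: "C \<ge> 0" "\<And>p k. degree p \<le> q \<Longrightarrow> \<bar>coeff p k\<bar> \<le> C * (\<Sum>i\<le>q. \<bar>moment ?a ?b p i\<bar>)"
    using coefficients_bounded_by_moments[OF mesh_simps(4)[OF j], of q] by blast
  show ?thesis
  proof (rule lipschitz_real_if_bounded_by[OF _ mom C(1)])
    show "finite {..q}" by simp
    fix s t assume s: "s \<in> {0..T}" and t: "t \<in> {0..T}"
    have d: "moment ?a ?b (Ac s j - Ac t j) i = moment ?a ?b (Ac s j) i - moment ?a ?b (Ac t j) i" for i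
      unfolding moment_def poly_diff left_diff_distrib
      by (intro set_integral_diff(2) borel_integrable_atLeastAtMost' continuous_intros)
    have "\<bar>coeff (Ac s j - Ac t j) k\<bar> \<le> C * (\<Sum>i\<le>q. \<bar>moment ?a ?b (Ac s j - Ac t j) i\<bar>)"
      by (rule C(2)) (intro degree_diff_le Ac_degree s t j)
    then show "\<bar>coeff (Ac s j) k - coeff (Ac t j) k\<bar> \<le> C * (\<Sum>i\<in>{..q}. \<bar>moment ?a ?b (Ac s j) i - moment ?a ?b (Ac t j) i\<bar>)"
      by (simp add: d)
  qed
qed

definition P :: "real \<Rightarrow> real \<Rightarrow> real" where "P t y = \<epsilon> * snd (Ah (ut t) y)"

lemma P_slice: "t \<in> {0..T} \<Longrightarrow> bounded_measurable_on 0 1 (P t)"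
  unfolding P_def[abs_def] by (intro bounded_measurable_on_cmult dg_bounded_measurable[of _ q] dg2_component Ah_dg) auto

lemma P_bounded_measurable: "bounded_measurable_cyl T P"
proof (cases "\<epsilon> > 0")
  case False
  then have e: "\<epsilon> = 0" using eps0 by simp
  have "P = (\<lambda>_ _. 0)"
  proof (rule ext, rule ext)
    fix t y
    have "P t y = \<epsilon> * snd (Ah (ut t) y)" by (rule P_def)
    also have "\<dots> = 0" by (simp add: e)
    finally show "P t y = 0" .
  qed
  then show ?thesis by (simp add: bounded_measurable_cyl_const)
next
  case True
  define S where "S = (\<lambda>t y. \<Sum>j<M. \<Sum>k\<le>q. (\<epsilon> * coeff (Ac t j) k) * (indicator {x j..<x (Suc j)} y * y ^ k))"
  have "bounded_measurable_cyl T S"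
    unfolding S_def
  proof (intro bounded_measurable_cyl_sum bounded_measurable_cyl_tensor)
    fix j k assume "j \<in> {..<M}"
    then show "bounded_measurable_on 0 T (\<lambda>t. \<epsilon> * coeff (Ac t j) k)"
      by (intro bounded_measurable_on_cmult bounded_measurable_on_continuous lipschitz_real_continuous Ac_lipschitz True) simp
    show "bounded_measurable_on 0 1 (\<lambda>y. indicator {x j..<x (Suc j)} y * y ^ k)"
      unfolding bounded_measurable_on_def
    proof
      have "(\<lambda>y::real. indicator {x j..<x (Suc j)} y * y ^ k) \<in> borel_measurable borel"
        by (intro borel_measurable_times borel_measurable_indicator) auto
      then show "set_borel_measurable lborel {0..1} (\<lambda>y. indicator {x j..<x (Suc j)} y * y ^ k)"
        by (simp add: set_borel_measurable_def)
      show "\<exists>C. \<forall>y\<in>{0..1}. \<bar>indicator {x j..<x (Suc j)} y * y ^ k :: real\<bar> \<le> C"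
        by (intro exI[of _ 1]) (auto simp: indicator_def power_abs power_le_one)
    qed
  qed
  moreover have eq: "P t y = S t y" if ty: "(t, y) \<in> cyl T" for t y
  proof -
    have t: "t \<in> {0..T}" and y: "y \<in> {0..<1}" using ty by (auto simp: cyl_def)
    obtain j where j: "j < M" "y \<in> {x j..<x (Suc j)}" by (rule mesh_cell[OF y])
    have ind: "indicator {x i..<x (Suc i)} y = (if i = j then 1 else 0 :: real)" if "i < M" for i
    proof (cases "i = j")
      case True
      then show ?thesis using j(2) by simp
    next
      case False
      then have "y \<notin> {x i..<x (Suc i)}" using mesh_cell_unique[OF that j(1) _ j(2)] by blast
      then show ?thesis using False by (simp del: atLeastLessThan_iff)
    qed
    have "S t y = (\<Sum>i<M. if i = j then (\<Sum>k\<le>q. (\<epsilon> * coeff (Ac t j) k) * y ^ k) else 0)"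
      unfolding S_def by (intro sum.cong refl) (simp add: ind)
    also have "\<dots> = \<epsilon> * poly (Ac t j) y"
      using j(1) by (simp add: poly_eq_sum[OF Ac_degree[OF t j(1)]] sum_distrib_left mult.assoc)
    also have "\<dots> = P t y"
      using cell_poly(2)[OF dg2_component[OF Ah_dg[OF t], of snd] j] by (simp add: P_def Ac_def)
    finally show ?thesis by simp
  qed
  moreover have "measurable_cyl T P = measurable_cyl T S"
    unfolding measurable_cyl_def set_borel_measurable_def
    by (intro arg_cong2[where f = "\<lambda>a b. a \<in> borel_measurable b"] ext refl) (use eq in \<open>auto simp: indicator_def\<close>)
  ultimately show ?thesis unfolding bounded_measurable_cyl_def by auto
qed

end

section \<open>Dual norms, cellwise derivatives and traces\<close>

lemma L2sq_on_cong_AE: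
  "(AE y in lborel. y \<in> S \<longrightarrow> f y = g y) \<Longrightarrow> L2sq_on S f = L2sq_on S g"
  unfolding L2sq_on_def by (rule nn_integral_cong_AE) (auto elim!: eventually_mono simp: indicator_def)

text \<open>
  The inequality for squares of norms, so that no square root of extended reals appears.
\<close>

lemma L2sq_on_add_le:
  fixes f g :: "real \<Rightarrow> 'a::{real_normed_vector, second_countable_topology}"
  assumes "set_borel_measurable lborel S f" "set_borel_measurable lborel S g"
  shows "L2sq_on S (\<lambda>y. f y + g y) \<le> 2 * L2sq_on S f + 2 * L2sq_on S g"
proof -
  have eq: "L2sq_on S h = (\<integral>\<^sup>+ y. ennreal ((norm (indicator S y *\<^sub>R h y))\<^sup>2) \<partial>lborel)" for h :: "real \<Rightarrow> 'a"
    unfolding L2sq_on_def by (intro nn_integral_cong) (auto simp: indicator_def)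
  have m: "(\<lambda>y. indicator S y *\<^sub>R f y) \<in> borel_measurable lborel" "(\<lambda>y. indicator S y *\<^sub>R g y) \<in> borel_measurable lborel"
    using assms by (simp_all add: set_borel_measurable_def)
  have mm: "(\<lambda>y. ennreal ((norm (indicator S y *\<^sub>R f y))\<^sup>2)) \<in> borel_measurable lborel"
    "(\<lambda>y. ennreal ((norm (indicator S y *\<^sub>R g y))\<^sup>2)) \<in> borel_measurable lborel"
    using m by measurable
  have mm2: "(\<lambda>y. 2 * ennreal ((norm (indicator S y *\<^sub>R f y))\<^sup>2)) \<in> borel_measurable lborel"
    "(\<lambda>y. 2 * ennreal ((norm (indicator S y *\<^sub>R g y))\<^sup>2)) \<in> borel_measurable lborel"
    by (intro borel_measurable_times_ennreal mm measurable_const; simp)+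
  have le: "(norm (a + b))\<^sup>2 \<le> 2 * (norm a)\<^sup>2 + 2 * (norm b)\<^sup>2" for a b :: 'a
  proof -
    have "(norm (a + b))\<^sup>2 \<le> (norm a + norm b)\<^sup>2" by (intro power_mono norm_triangle_ineq) simp
    also have "\<dots> \<le> 2 * (norm a)\<^sup>2 + 2 * (norm b)\<^sup>2"
      using zero_le_power2[of "norm a - norm b"] by (simp add: power2_sum power2_diff)
    finally show ?thesis .
  qed
  have "L2sq_on S (\<lambda>y. f y + g y) \<le> (\<integral>\<^sup>+ y. 2 * ennreal ((norm (indicator S y *\<^sub>R f y))\<^sup>2)
      + 2 * ennreal ((norm (indicator S y *\<^sub>R g y))\<^sup>2) \<partial>lborel)"
    unfolding eq
  proof (rule nn_integral_mono)
    fix y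
    have "ennreal ((norm (indicator S y *\<^sub>R (f y + g y)))\<^sup>2)
      \<le> ennreal (2 * (norm (indicator S y *\<^sub>R f y))\<^sup>2 + 2 * (norm (indicator S y *\<^sub>R g y))\<^sup>2)"
      unfolding scaleR_add_right by (intro ennreal_leI le)
    then show "ennreal ((norm (indicator S y *\<^sub>R (f y + g y)))\<^sup>2)
      \<le> 2 * ennreal ((norm (indicator S y *\<^sub>R f y))\<^sup>2) + 2 * ennreal ((norm (indicator S y *\<^sub>R g y))\<^sup>2)"
      by (simp only: ennreal_plus ennreal_mult zero_le_power2 mult_nonneg_nonneg zero_le_numeral ennreal_numeral)
  qed
  also have "\<dots> = 2 * L2sq_on S f + 2 * L2sq_on S g"
    unfolding eq
    by (simp only: nn_integral_add[OF mm2] nn_integral_cmult[OF mm(1)] nn_integral_cmult[OF mm(2)])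
  finally show ?thesis .
qed

lemma wdx_L2:
  assumes "weak_deriv_torus f g" "in_L2 g"
  shows "in_L2 (wdx f)" "L2norm (wdx f) = L2norm g"
proof -
  have eq: "L2sq (wdx f) = L2sq g" by (rule L2sq_on_cong_AE[OF wdx_AE[OF assms(1)]])
  show "L2norm (wdx f) = L2norm g" by (simp add: L2norm_def eq)
  have "set_integrable lborel {0..1} (wdx f)"
    by (rule weak_deriv_torus_integrable(2)[OF weak_deriv_torus_wdx[OF assms(1)]])
  then have "set_borel_measurable lborel {0..1} (wdx f)"
    by (simp add: set_integrable_def set_borel_measurable_def borel_measurable_integrable)
  then show "in_L2 (wdx f)" using assms(2) eq by (simp add: in_L2_def)
qed

text \<open>
  The dual norm is tested with multiples \<open>-c e\<close> of the error itself, normalised so that their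
  derivative has norm at most one. The best multiple gives Young's inequality for the pairing; if
  the derivative of \<open>e\<close> vanishes, then all multiples are admissible, and a positive pairing
  forces an infinite norm.
\<close>

lemma Hm1norm_quadratic_bound:
  assumes e: "in_H1 e" "weak_deriv_torus e e'" "in_L2 e'"
    and G: "\<And>c. c > 0 \<Longrightarrow> G (\<lambda>y. - c * e y) = c * g"
  shows "ennreal (2 * g - (LINT y:{0..1}|lborel. (e' y)\<^sup>2)) \<le> (Hm1norm G)\<^sup>2"
proof -
  define D where "D = (LINT y:{0..1}|lborel. (e' y)\<^sup>2)"
  have D0: "D \<ge> 0" unfolding D_def set_lebesgue_integral_def by (rule integral_nonneg_AE) auto
  have test: "ennreal (c * g) \<le> Hm1norm G" if c: "c > 0" "c\<^sup>2 * D \<le> 1" for c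
  proof -
    have w: "weak_deriv_torus (\<lambda>y. - c * e y) (\<lambda>y. - c * e' y)" by (rule weak_deriv_torus_cmult[OF e(2)])
    have l: "in_L2 (\<lambda>y. - c * e' y)" by (rule in_L2_cmult[OF e(3)])
    have "in_L2 (\<lambda>y. - c * e y)" using e(1) by (intro in_L2_cmult) (simp add: in_H1_def)
    moreover have "periodic1 (\<lambda>y. - c * e y)" using e(1) by (simp add: in_H1_def periodic1_def)
    ultimately have H1: "in_H1 (\<lambda>y. - c * e y)" using w l unfolding in_H1_def by blast
    have "(LINT y:{0..1}|lborel. (- c * e' y)\<^sup>2) = c\<^sup>2 * D" by (simp add: power_mult_distrib D_def)
    then have "L2sq (\<lambda>y. - c * e' y) = ennreal (c\<^sup>2 * D)" using L2sq_eq[OF l] by simp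
    then have "L2norm (wdx (\<lambda>y. - c * e y)) = ennreal (sqrt (c\<^sup>2 * D))"
      using wdx_L2(2)[OF w l] D0 by (simp add: L2norm_def sqrt_ennreal_def)
    also have "\<dots> \<le> 1" using c(2) D0 by (simp add: ennreal_le_1)
    finally have "ennreal (G (\<lambda>y. - c * e y)) \<le> Hm1norm G"
      unfolding Hm1norm_def using H1 by (intro SUP_upper) simp
    then show ?thesis unfolding G[OF c(1)] .
  qed
  show ?thesis
  proof (cases "g \<le> 0")
    case True
    then show ?thesis using D0 by (simp add: D_def[symmetric] ennreal_neg)
  next
    case g: False
    show ?thesis
    proof (cases "D = 0")
      case True
      have "Hm1norm G = \<infinity>"
      proof (rule ccontr)
        assume "Hm1norm G \<noteq> \<infinity>"
        then obtain h where h: "h \<ge> 0" "Hm1norm G = ennreal h" by (cases "Hm1norm G") auto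
        \<comment> \<open>every multiple is admissible; this one exceeds the supposed finite norm \<open>h\<close>\<close>
        have "ennreal ((h + 1) / g * g) \<le> ennreal h"
          using test[of "(h + 1) / g"] True g h by (simp del: ennreal_le_iff)
        then show False using g h(1) by (simp add: ennreal_le_iff)
      qed
      then show ?thesis by (simp add: power2_eq_square ennreal_top_mult)
    next
      case False
      then have Dp: "D > 0" using D0 by simp
      define r where "r = g / sqrt D"
      \<comment> \<open>\<open>1 / sqrt D\<close> is the largest admissible multiple\<close>
      have r: "ennreal r \<le> Hm1norm G"
        using test[of "1 / sqrt D"] Dp by (simp add: r_def power_divide)
      have "r\<^sup>2 = g\<^sup>2 / D" using Dp by (simp add: r_def power_divide)
      moreover have "2 * g - D \<le> g\<^sup>2 / D"
      proof -
        have "(2 * g - D) * D \<le> g\<^sup>2" using zero_le_power2[of "g - D"] by (simp add: power2_eq_square algebra_simps)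
        then show ?thesis using Dp by (simp add: field_simps)
      qed
      ultimately have "ennreal (2 * g - D) \<le> ennreal (r\<^sup>2)" by (simp add: ennreal_leI)
      also have "\<dots> = (ennreal r)\<^sup>2" using g Dp by (simp add: r_def ennreal_power)
      also have "\<dots> \<le> (Hm1norm G)\<^sup>2" by (rule power_mono[OF r]) simp
      finally show ?thesis by (simp add: D_def)
    qed
  qed
qed

lemma primitive_on_subinterval:
  assumes P: "primitive_on a b f g" and cd: "a \<le> c" "c \<le> d" "d \<le> b" shows "primitive_on c d f g"
proof (rule primitive_onI)
  show "set_integrable lborel {c..d} g"
    by (rule set_integrable_subset[OF primitive_on_integrable[OF P]]) (use cd in auto)
  fix y assume y: "y \<in> {c..d}"
  have "(LINT z:{a..y}|lborel. g z) = (LINT z:{a..c}|lborel. g z) + (LINT z:{c..y}|lborel. g z)"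
    by (rule set_integrable_interval_split[OF primitive_on_integrable[OF P]]) (use y cd in auto)
  moreover have "f y = f a + (LINT z:{a..y}|lborel. g z)" "f c = f a + (LINT z:{a..c}|lborel. g z)"
    using primitive_on_integral[OF P, of y] primitive_on_integral[OF P, of c] y cd by auto
  ultimately show "f y = f c + (LINT z:{c..y}|lborel. g z)" by simp
qed

lemma AE_lborel_translate:
  fixes c :: real
  assumes "AE y in lborel. Q y" shows "AE y in lborel. Q (c + y)"
proof -
  have "AE y in distr lborel borel ((+) c). Q y" unfolding lborel_distr_plus by (rule assms)
  then show ?thesis by (rule AE_distrD[rotated]) simp
qed

context mesh begin

definition prev_cell :: "nat \<Rightarrow> nat" where "prev_cell j = (if j = 0 then M - 1 else j - 1)"

lemma prev_cell: assumes "j < M" shows "prev_cell j < M" "Suc (prev_cell j) = (if j = 0 then M else j)"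
  using assms mesh_simps(1) by (auto simp: prev_cell_def)

text \<open>
  Subtracting a piecewise polynomial from a continuous periodic function leaves the jumps of the
  polynomial, whichever function was subtracted from. At the node \<open>0\<close> the left trace is taken from
  the last cell by periodicity.
\<close>

lemma jump_continuous_minus_dg:
  assumes f: "periodic1 f" and F: "continuous_on {0..1} F" "F 1 = F 0"
    and fF: "AE y in lborel. y \<in> {0..1} \<longrightarrow> f y = F y" and w: "w \<in> dg_space x M r" and j: "j < M"
  shows "jump (\<lambda>y. f y - w y) (x j) = poly (cell_poly x r w j) (x j)
     - poly (cell_poly x r w (prev_cell j)) (x (Suc (prev_cell j)))"
proof -
  have cont: "((\<lambda>y. F y - poly p y) \<longlongrightarrow> F c - poly p c) (at c within {0..1})" if "c \<in> {0..1}" for p :: "real poly" and c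
    using that F(1) by (intro tendsto_intros) (auto simp: continuous_on_def)
  have R: "tr_right (\<lambda>y. f y - w y) (x j) = F (x j) - poly (cell_poly x r w j) (x j)"
  proof (rule tr_right_eq[OF _ mesh_simps(4)[OF j]])
    let ?p = "cell_poly x r w j"
    have rng: "0 \<le> x j" "x j < x (Suc j)" "x (Suc j) \<le> 1" using mesh_range[of j] mesh_range[of "Suc j"] mesh_simps(4) j by auto
    have "at_right (x j) \<le> at (x j) within {0..1}"
      unfolding at_within_Icc_at_right[OF rng(2), symmetric] by (rule at_le) (use rng in auto)
    then show "((\<lambda>y. F y - poly ?p y) \<longlongrightarrow> F (x j) - poly ?p (x j)) (at_right (x j))"
      by (rule tendsto_mono) (rule cont, use rng in auto)
    show "AE y in lborel. y \<in> {x j<..<x (Suc j)} \<longrightarrow> f y - w y = F y - poly ?p y"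
      using fF by (rule eventually_mono) (use cell_poly(2)[OF w j] rng in auto)
  qed
  define k where "k = prev_cell j"
  have k: "k < M" using prev_cell(1)[OF j] by (simp add: k_def)
  let ?p = "cell_poly x r w k" and ?b = "x (Suc k)"
  have rng: "0 \<le> x k" "x k < ?b" "?b \<le> 1" using mesh_range[of k] mesh_range[of "Suc k"] mesh_simps(4) k by auto
  have lim: "((\<lambda>y. F y - poly ?p y) \<longlongrightarrow> F ?b - poly ?p ?b) (at_left ?b)"
  proof (rule tendsto_mono)
    show "at_left ?b \<le> at ?b within {0..1}"
      unfolding at_within_Icc_at_left[OF rng(2), symmetric] by (rule at_le) (use rng in auto)
  qed (rule cont, use rng in auto)
  have ae: "AE y in lborel. y \<in> {x k<..<?b} \<longrightarrow> f y - w y = F y - poly ?p y"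
    using fF by (rule eventually_mono) (use cell_poly(2)[OF w k] rng in auto)
  have L: "tr_left (\<lambda>y. f y - w y) (x j) = F (x j) - poly ?p ?b"
  proof (cases "j = 0")
    case False
    then have "?b = x j" using prev_cell(2)[OF j] by (simp add: k_def)
    then show ?thesis using tr_left_eq[OF lim rng(2) ae] by simp
  next
    case True
    have b1: "?b = 1" using prev_cell(2)[OF j] True mesh_simps(3) by (simp add: k_def)
    have "tr_left (\<lambda>y. f y - w y) 0 = F 1 - poly ?p 1"
    proof (rule tr_left_eq[where a = "x k - 1"])
      have "filterlim (\<lambda>y. 1 + y) (at_left ?b) (at_left (0::real))"
        by (auto simp: b1 filterlim_at eventually_at_left_field intro!: tendsto_eq_intros exI[of _ "-1"])
      from filterlim_compose[OF lim this]
      show "((\<lambda>y. F (1 + y) - poly ?p (1 + y)) \<longlongrightarrow> F 1 - poly ?p 1) (at_left 0)" by (simp only: b1)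
      show "x k - 1 < 0" using rng b1 by simp
      have per: "f (1 + y) = f y" "w (1 + y) = w y" for y
        using f dg_periodic[OF w, of y] unfolding periodic1_def by (simp_all only: add.commute[of 1 y])
      show "AE y in lborel. y \<in> {x k - 1<..<0} \<longrightarrow> f y - w y = F (1 + y) - poly ?p (1 + y)"
        using AE_lborel_translate[OF ae, of 1]
      proof (rule eventually_mono)
        fix y assume h: "1 + y \<in> {x k<..<?b} \<longrightarrow> f (1 + y) - w (1 + y) = F (1 + y) - poly ?p (1 + y)"
        show "y \<in> {x k - 1<..<0} \<longrightarrow> f y - w y = F (1 + y) - poly ?p (1 + y)"
          using h unfolding per by (simp add: b1)
      qed
    qed
    then show ?thesis using True F(2) mesh_simps(2) b1 by simp
  qed
  show ?thesis unfolding jump_def R L by (simp add: k_def)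
qed

text \<open>
  The open cells are disjoint.
\<close>

lemma sum_cells_le:
  fixes f :: "real \<Rightarrow> ennreal"
  assumes "(\<lambda>y. f y * indicator {0..1} y) \<in> borel_measurable lborel"
  shows "(\<Sum>j<M. \<integral>\<^sup>+ y\<in>{x j<..<x (Suc j)}. f y \<partial>lborel) \<le> (\<integral>\<^sup>+ y\<in>{0..1}. f y \<partial>lborel)"
proof -
  have sub: "{x j<..<x (Suc j)} \<subseteq> {0..1}" if "j < M" for j
    using mesh_range[of j] mesh_range[of "Suc j"] that by auto
  have "(\<Sum>j<M. \<integral>\<^sup>+ y\<in>{x j<..<x (Suc j)}. f y \<partial>lborel)
    = (\<Sum>j<M. \<integral>\<^sup>+ y. f y * indicator {0..1} y * indicator {x j<..<x (Suc j)} y \<partial>lborel)"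
    by (intro sum.cong refl nn_integral_cong) (use sub in \<open>auto simp: indicator_def subset_eq\<close>)
  also have "\<dots> = (\<integral>\<^sup>+ y. (\<Sum>j<M. f y * indicator {0..1} y * indicator {x j<..<x (Suc j)} y) \<partial>lborel)"
    by (rule nn_integral_sum[symmetric]) (intro borel_measurable_times_ennreal assms, simp)
  also have "\<dots> \<le> (\<integral>\<^sup>+ y\<in>{0..1}. f y \<partial>lborel)"
  proof (rule nn_integral_mono)
    fix y
    have "(\<Sum>j<M. indicator {x j<..<x (Suc j)} y :: ennreal) \<le> 1"
    proof (cases "\<exists>j<M. y \<in> {x j<..<x (Suc j)}")
      case True
      then obtain i where i: "i < M" "y \<in> {x i<..<x (Suc i)}" by blast
      have "(\<Sum>j<M. indicator {x j<..<x (Suc j)} y :: ennreal) = (\<Sum>j<M. if j = i then 1 else 0)"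
      proof (rule sum.cong[OF refl])
        fix j assume "j \<in> {..<M}"
        then have "j = i" if "y \<in> {x j<..<x (Suc j)}"
          using mesh_cell_unique[of j i y] i that by auto
        then show "(indicator {x j<..<x (Suc j)} y :: ennreal) = (if j = i then 1 else 0)"
          using i(2) by (cases "y \<in> {x j<..<x (Suc j)}") (auto simp del: greaterThanLessThan_iff)
      qed
      then show ?thesis using i(1) by simp
    next
      case False
      then have "(\<Sum>j<M. indicator {x j<..<x (Suc j)} y :: ennreal) = (\<Sum>j<M. 0)"
        by (intro sum.cong refl) (simp del: greaterThanLessThan_iff)
      then show ?thesis by simp
    qed
    then have "f y * indicator {0..1} y * (\<Sum>j<M. indicator {x j<..<x (Suc j)} y) \<le> f y * indicator {0..1} y * 1"
      by (rule mult_left_mono) simp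
    then show "(\<Sum>j<M. f y * indicator {0..1} y * indicator {x j<..<x (Suc j)} y) \<le> f y * indicator {0..1} y"
      by (simp add: sum_distrib_left)
  qed
  finally show ?thesis .
qed

end

text \<open>
  A squared norm of a function whose coefficients depend measurably on a parameter.
\<close>

lemma nn_integral_tensor_measurable:
  fixes c m :: "nat \<Rightarrow> real \<Rightarrow> real"
  assumes c[measurable]: "\<And>k. c k \<in> borel_measurable borel" and m[measurable]: "\<And>k. m k \<in> borel_measurable borel"
  shows "(\<lambda>s. \<integral>\<^sup>+ y\<in>{a<..<b}. ennreal ((\<Sum>k\<le>n. c k s * m k y)\<^sup>2) \<partial>lborel) \<in> borel_measurable borel"
  by measurable

section \<open>Comparing the solution with the reconstruction\<close>

text \<open>
  The solution and the reconstructions on the same time interval and with the same viscosity.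
\<close>

locale dg_error = dg_reconstruction + entropy_solution_rep
begin

sublocale approx: entropy_solution_approximation T \<epsilon> u v vx u0 v0 basis basis_fun basis_dx
  "basis_coeff fst" "basis_coeff_dt fst" "basis_coeff snd" "basis_coeff_dt snd" P
proof unfold_locales
  fix b assume b: "b \<in> basis"
  show "primitive_on 0 1 (basis_fun b) (basis_dx b)" by (rule basis_fun_primitive)
  show "basis_fun b 1 = basis_fun b 0" by (rule basis_fun_periodic)
  show "bounded_measurable_on 0 1 (basis_dx b)" by (rule basis_dx_bounded_measurable)
  show "primitive_on 0 T (basis_coeff fst b) (basis_coeff_dt fst b)" "bounded_measurable_on 0 T (basis_coeff_dt fst b)"
    "primitive_on 0 T (basis_coeff snd b) (basis_coeff_dt snd b)" "bounded_measurable_on 0 T (basis_coeff_dt snd b)"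
    by (rule basis_coeff_dt; use b in simp)+
next
  show "bounded_measurable_cyl T P" by (rule P_bounded_measurable)
next
  show "bounded_measurable_on 0 1 (P t)" if "t \<in> {0..T}" for t by (rule P_slice[OF that])
qed

lemma approx_eq:
  assumes t: "t \<in> {0..T}"
  shows "y \<in> {0..1} \<Longrightarrow> approx.uh t y = fst (uts t y)" "y \<in> {0..1} \<Longrightarrow> approx.vh t y = snd (uts t y)"
    "approx.uhx t y = Pc_dx fst t y" "approx.vhx t y = Pc_dx snd t y"
  using uts_basis[of fst t y] uts_basis[of snd t y] t
  by (simp_all add: approx.uh_def approx.vh_def approx.uhx_def approx.vhx_def)

text \<open>
  The residuals are defined with classical derivatives of the reconstruction, which exist away from
  the nodes at almost every time and there agree with the derivatives of the expansion.
\<close>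

lemma residual_norm_eq:
  "AE t in lborel. t \<in> {0<..<T} \<longrightarrow>
     L2norm (\<lambda>y. (res_u uts t y, res_v1 Ah \<epsilon> ut uts t y)) = L2norm (\<lambda>y. (approx.ru t y, approx.r1 t y))"
  using uts_dt[of fst, OF insertI1] uts_dt[of snd, OF insertI2[OF singletonI]]
proof eventually_elim
  case (elim t)
  show ?case
  proof
    assume t: "t \<in> {0<..<T}"
    then have t': "t \<in> {0..T}" by simp
    have "AE y in lborel. y \<in> {0..1} \<longrightarrow> (res_u uts t y, res_v1 Ah \<epsilon> ut uts t y) = (approx.ru t y, approx.r1 t y)"
      using AE_mesh_cell
    proof (rule eventually_mono, intro impI)
      fix y :: real assume "y \<in> {0..1} \<longrightarrow> (\<exists>j<M. y \<in> {x j<..<x (Suc j)})" and y: "y \<in> {0..1}"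
      then obtain j where j: "j < M" "y \<in> {x j<..<x (Suc j)}" by blast
      have dts: "deriv (\<lambda>t. fst (uts t y)) t = approx.uht t y" "deriv (\<lambda>t. snd (uts t y)) t = approx.vht t y"
        unfolding approx.uht_def approx.vht_def
        by (intro DERIV_imp_deriv bspec[OF mp[OF elim(1) t] y] bspec[OF mp[OF elim(2) t] y])+
      have dxs: "deriv (\<lambda>y. fst (uts t y)) y = approx.uhx t y" "deriv (\<lambda>y. snd (uts t y)) y = approx.vhx t y"
        unfolding approx_eq(3,4)[OF t']
        by (intro DERIV_imp_deriv uts_dx[OF _ t' j]; simp)+
      show "(res_u uts t y, res_v1 Ah \<epsilon> ut uts t y) = (approx.ru t y, approx.r1 t y)"
        by (simp add: res_u_def res_v1_def approx.ru_def approx.r1_def dts dxs P_def)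
    qed
    from L2sq_on_cong_AE[OF this]
    show "L2norm (\<lambda>y. (res_u uts t y, res_v1 Ah \<epsilon> ut uts t y)) = L2norm (\<lambda>y. (approx.ru t y, approx.r1 t y))"
      by (simp add: L2norm_def)
  qed
qed

text \<open>At almost every time the error in \<open>v\<close> is an admissible test function for the third residual.\<close>

lemma error_slice:
  assumes eps: "\<epsilon> > 0"
  shows "AE t in lborel. t \<in> {0<..<T} \<longrightarrow>
    weak_deriv_torus (v t) (vx t) \<and> in_L2 (vx t) \<and> periodic1 (v t) \<and>
    weak_deriv_torus (\<lambda>y. v t y - snd (uts t y)) (\<lambda>y. vx t y - approx.vhx t y) \<and>
    in_L2 (\<lambda>y. vx t y - approx.vhx t y) \<and> in_H1 (\<lambda>y. v t y - snd (uts t y))"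
  using vx_is_weak_derivative[OF eps] approx.vx_slice_L2[OF eps] v_H1[OF eps]
proof eventually_elim
  case (elim t)
  show ?case
  proof
    assume t: "t \<in> {0<..<T}"
    then have t': "t \<in> {0..T}" by simp
    have per: "periodic1 (v t)" using elim(3) t by (simp add: in_H1_def)
    note dg = dg2_component[OF uts_dg[OF t'], of snd, simplified]
    have s: "weak_deriv_torus (\<lambda>y. snd (uts t y)) (approx.vhx t)"
      using weak_deriv_torus_primitive[OF uts_primitive[OF _ t', of snd]] dg_periodic[OF dg, of 0]
      by (simp add: approx_eq(4)[OF t', abs_def])
    have w: "weak_deriv_torus (\<lambda>y. v t y - snd (uts t y)) (\<lambda>y. vx t y - approx.vhx t y)"
      using elim(1) t s by (intro weak_deriv_torus_diff) auto
    have l: "in_L2 (\<lambda>y. vx t y - approx.vhx t y)" using elim(2) t by (intro in_L2_diff approx.slices_L2) auto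
    have "in_L2 (\<lambda>y. v t y - snd (uts t y))" by (intro in_L2_diff L2(2) t' component_L2[OF dg])
    moreover have "periodic1 (\<lambda>y. v t y - snd (uts t y))"
      using per dg_periodic[OF dg] by (simp add: periodic1_def)
    ultimately show "weak_deriv_torus (v t) (vx t) \<and> in_L2 (vx t) \<and> periodic1 (v t) \<and>
      weak_deriv_torus (\<lambda>y. v t y - snd (uts t y)) (\<lambda>y. vx t y - approx.vhx t y) \<and>
      in_L2 (\<lambda>y. vx t y - approx.vhx t y) \<and> in_H1 (\<lambda>y. v t y - snd (uts t y))"
      using w l elim(1,2) t per unfolding in_H1_def by blast
  qed
qed

text \<open>
  The test functions are multiples of the error, for which the pairing with the third residual is a
  multiple of \<open>diffusion_residual\<close>.
\<close>

lemma diffusion_residual_bound: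
  assumes eps: "\<epsilon> > 0"
  shows "AE t in lborel. t \<in> {0<..<T} \<longrightarrow>
    ennreal (- 2 * approx.diffusion_residual (\<lambda>t y. snd (Ah (ut t) y)) t - approx.dxe_sq t) \<le> (Hm1norm (res_v2 Ah ut uts t))\<^sup>2"
  using error_slice[OF eps]
proof (rule eventually_mono, intro impI)
  fix t
  let ?A = "\<lambda>t y. snd (Ah (ut t) y)" and ?e = "\<lambda>y. v t y - snd (uts t y)" and ?e' = "\<lambda>y. vx t y - approx.vhx t y"
  assume t: "t \<in> {0<..<T}" and "t \<in> {0<..<T} \<longrightarrow>
    weak_deriv_torus (v t) (vx t) \<and> in_L2 (vx t) \<and> periodic1 (v t) \<and> weak_deriv_torus ?e ?e' \<and> in_L2 ?e' \<and> in_H1 ?e"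
  then have w: "weak_deriv_torus ?e ?e'" and l: "in_L2 ?e'" and H1: "in_H1 ?e" by blast+
  from t have t': "t \<in> {0..T}" by simp
  note dg = dg2_component[OF uts_dg[OF t'], of snd, simplified]
  have s: "weak_deriv_torus (\<lambda>y. snd (uts t y)) (approx.vhx t)"
    using weak_deriv_torus_primitive[OF uts_primitive[OF _ t', of snd]] dg_periodic[OF dg, of 0]
    by (simp add: approx_eq(4)[OF t', abs_def])
  have sl: "in_L2 (approx.vhx t)" by (rule approx.slices_L2)
  have "res_v2 Ah ut uts t (\<lambda>y. - c * ?e y) = c * (- approx.diffusion_residual ?A t)" if c: "c > 0" for c
  proof -
    have w': "weak_deriv_torus (\<lambda>y. - c * ?e y) (\<lambda>y. - c * ?e' y)" by (rule weak_deriv_torus_cmult[OF w])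
    have l': "in_L2 (\<lambda>y. - c * ?e' y)" by (rule in_L2_cmult[OF l])
    have "(LINT y:{0..1}|lborel. wdx (\<lambda>y. snd (uts t y)) y * wdx (\<lambda>y. - c * ?e y) y)
      = (LINT y:{0..1}|lborel. approx.vhx t y * (- c * ?e' y))"
    proof (rule set_integral_eq_AE)
      show "set_integrable lborel {0..1} (\<lambda>y. wdx (\<lambda>y. snd (uts t y)) y * wdx (\<lambda>y. - c * ?e y) y)"
        by (intro in_L2_mult wdx_L2(1)[OF s sl] wdx_L2(1)[OF w' l'])
      show "set_integrable lborel {0..1} (\<lambda>y. approx.vhx t y * (- c * ?e' y))" by (intro in_L2_mult sl l')
      show "AE y in lborel. y \<in> {0..1} \<longrightarrow> wdx (\<lambda>y. snd (uts t y)) y * wdx (\<lambda>y. - c * ?e y) y = approx.vhx t y * (- c * ?e' y)"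
        using wdx_AE[OF s] wdx_AE[OF w'] by eventually_elim simp
    qed
    also have "\<dots> = (LINT y:{0..1}|lborel. (- c) * (approx.vhx t y * ?e' y))" by (simp only: mult.left_commute)
    also have "\<dots> = (- c) * (LINT y:{0..1}|lborel. approx.vhx t y * ?e' y)" by (rule set_integral_mult_right)
    finally have 1: "pair_dxx (\<lambda>y. snd (uts t y)) (\<lambda>y. - c * ?e y) = c * (LINT y:{0..1}|lborel. approx.vhx t y * ?e' y)"
      by (simp add: pair_dxx_def)
    have "pair_fun (?A t) (\<lambda>y. - c * ?e y) = (LINT y:{0..1}|lborel. (- c) * (?A t y * (v t y - approx.vh t y)))"
      unfolding pair_fun_def by (rule set_lebesgue_integral_cong) (auto simp: approx_eq(2)[OF t'])
    also have "\<dots> = (- c) * (LINT y:{0..1}|lborel. ?A t y * (v t y - approx.vh t y))" by (rule set_integral_mult_right)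
    finally show ?thesis
      unfolding res_v2_def approx.diffusion_residual_def 1 by (simp add: algebra_simps)
  qed
  from Hm1norm_quadratic_bound[OF H1 w l this]
  show "ennreal (- 2 * approx.diffusion_residual ?A t - approx.dxe_sq t) \<le> (Hm1norm (res_v2 Ah ut uts t))\<^sup>2"
    by (simp add: approx.dxe_sq_def)
qed

section \<open>The broken norm of the error\<close>

definition broken_density :: "(real \<Rightarrow> real) \<Rightarrow> ennreal" where
  "broken_density f = (\<Sum>j<M. L2sq_on {x j<..<x (Suc j)} (wdx_on (x j) (x (Suc j)) f) + ennreal ((jump f (x j))\<^sup>2 / h_node x M j))"

lemma broken_sq_eq: "broken_sq x M t f = (\<integral>\<^sup>+ s\<in>{0..t}. broken_density (f s) \<partial>lborel)"
  by (simp add: broken_sq_def broken_density_def)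

text \<open>
  Cell polynomials of the difference of the two reconstructions of \<open>v\<close>.
\<close>

definition gap :: "real \<Rightarrow> nat \<Rightarrow> real poly" where "gap s j = Pc snd s j - pc snd s j"

lemma poly_primitive: "primitive_on a b (poly p) (poly (pderiv p))" for p :: "real poly"
  by (rule DERIV_primitive_on[OF poly_DERIV]) (intro continuous_intros)

lemma ut_cell:
  assumes "s \<in> {0..T}" "j < M" "y \<in> {x j..<x (Suc j)}" shows "snd (ut s y) = poly (pc snd s j) y"
  using cell_poly(2)[OF dg2_component[OF ut_dg[OF assms(1)], of snd] assms(2,3)] by (simp add: pc_def)

lemma wdx_on_gap:
  assumes s: "s \<in> {0..T}" and j: "j < M"
  shows "AE y in lborel. y \<in> {x j<..<x (Suc j)} \<longrightarrow>
    wdx_on (x j) (x (Suc j)) (\<lambda>y. snd (uts s y) - snd (ut s y)) y = poly (pderiv (gap s j)) y"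
proof (rule wdx_on_AE[OF poly_primitive])
  have sub: "{x j..x (Suc j)} \<subseteq> {0..1}" using mesh_range[of j] mesh_range[of "Suc j"] j by auto
  show "set_integrable lborel {x j..x (Suc j)} (\<lambda>y. snd (uts s y) - snd (ut s y))"
  proof (rule set_integrable_subset[OF _ _ sub])
    show "set_integrable lborel {0..1} (\<lambda>y. snd (uts s y) - snd (ut s y))"
      by (intro in_L2_integrable in_L2_diff component_L2[OF dg2_component[OF uts_dg[OF s]]] component_L2[OF dg2_component[OF ut_dg[OF s]]]) auto
  qed simp
  show "AE y in lborel. y \<in> {x j..x (Suc j)} \<longrightarrow> snd (uts s y) - snd (ut s y) = poly (gap s j) y"
    using AE_lborel_singleton[of "x (Suc j)"]
  proof (rule eventually_mono, intro impI)
    fix y assume "y \<noteq> x (Suc j)" "y \<in> {x j..x (Suc j)}"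
    then have y: "y \<in> {x j..<x (Suc j)}" by simp
    show "snd (uts s y) - snd (ut s y) = poly (gap s j) y"
      using uts_cell[of snd, OF _ s j, of y] ut_cell[OF s j y] y by (simp add: gap_def)
  qed
qed (rule mesh_simps(4)[OF j])

lemma wdx_on_error:
  assumes s: "s \<in> {0..T}" and j: "j < M" and w: "weak_deriv_torus (v s) (vx s)"
  shows "AE y in lborel. y \<in> {x j<..<x (Suc j)} \<longrightarrow>
    wdx_on (x j) (x (Suc j)) (\<lambda>y. v s y - snd (ut s y)) y = (vx s y - approx.vhx s y) + poly (pderiv (gap s j)) y"
proof -
  obtain \<kappa> where \<kappa>: "AE y in lborel. y \<in> {0..1} \<longrightarrow> v s y = \<kappa> + (LINT z:{0..y}|lborel. vx s z)"
    by (rule weak_deriv_torus_representative[OF w])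
  define V where "V = (\<lambda>y. \<kappa> + (LINT z:{0..y}|lborel. vx s z))"
  have rng: "0 \<le> x j" "x j < x (Suc j)" "x (Suc j) \<le> 1" using mesh_range[of j] mesh_range[of "Suc j"] mesh_simps(4) j by auto
  have V: "primitive_on (x j) (x (Suc j)) V (vx s)"
    unfolding V_def
    by (rule primitive_on_subinterval[OF primitive_on_indefinite[OF weak_deriv_torus_integrable(2)[OF w]]]) (use rng in auto)
  let ?p = "pc snd s j"
  have P: "primitive_on (x j) (x (Suc j)) (\<lambda>y. V y + (- 1) * poly ?p y) (\<lambda>y. vx s y + (- 1) * poly (pderiv ?p) y)"
    by (intro primitive_on_add primitive_on_cmult V poly_primitive)
  have "AE y in lborel. y \<in> {x j<..<x (Suc j)} \<longrightarrow>
    wdx_on (x j) (x (Suc j)) (\<lambda>y. v s y - snd (ut s y)) y = vx s y + (- 1) * poly (pderiv ?p) y"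
  proof (rule wdx_on_AE[OF P])
    show "set_integrable lborel {x j..x (Suc j)} (\<lambda>y. v s y - snd (ut s y))"
    proof (rule set_integrable_subset)
      show "set_integrable lborel {0..1} (\<lambda>y. v s y - snd (ut s y))"
        by (intro in_L2_integrable in_L2_diff L2(2) s component_L2[OF dg2_component[OF ut_dg[OF s]]]) auto
    qed (use rng in auto)
    show "AE y in lborel. y \<in> {x j..x (Suc j)} \<longrightarrow> v s y - snd (ut s y) = V y + (- 1) * poly ?p y"
      using AE_lborel_singleton[of "x (Suc j)"] \<kappa>
    proof eventually_elim
      case (elim y)
      then show ?case using ut_cell[OF s j, of y] rng by (auto simp: V_def)
    qed
  qed (rule rng)
  then show ?thesis
  proof (rule eventually_mono, intro impI)
    fix y assume y: "y \<in> {x j<..<x (Suc j)}" and "y \<in> {x j<..<x (Suc j)} \<longrightarrow>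
      wdx_on (x j) (x (Suc j)) (\<lambda>y. v s y - snd (ut s y)) y = vx s y + (- 1) * poly (pderiv ?p) y"
    then show "wdx_on (x j) (x (Suc j)) (\<lambda>y. v s y - snd (ut s y)) y = (vx s y - approx.vhx s y) + poly (pderiv (gap s j)) y"
      using Pc_dx_cell[of snd, OF _ s j, of y] approx_eq(4)[OF s, of y] by (simp add: gap_def pderiv_diff)
  qed
qed

lemma jump_reconstruction_eq:
  assumes s: "s \<in> {0..T}" and j: "j < M"
  shows "jump (\<lambda>y. snd (uts s y) - snd (ut s y)) (x j)
    = poly (pc snd s j) (x j) - poly (pc snd s (prev_cell j)) (x (Suc (prev_cell j)))"
proof -
  note dg = dg2_component[OF ut_dg[OF s], of snd, simplified]
  note dg' = dg2_component[OF uts_dg[OF s], of snd, simplified]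
  have per: "periodic1 (\<lambda>y. snd (uts s y))" using dg_periodic[OF dg'] by (simp add: periodic1_def)
  have "snd (uts s 1) = snd (uts s 0)" using dg_periodic[OF dg', of 0] by simp
  from jump_continuous_minus_dg[OF per primitive_on_continuous[OF uts_primitive[OF _ s, of snd]] this _ dg j]
  show ?thesis by (simp add: pc_def)
qed

text \<open>
  The solution and the space-time reconstruction are both continuous, so both jumps come from the
  temporal reconstruction alone.
\<close>

lemma jump_error_eq:
  assumes s: "s \<in> {0..T}" and j: "j < M" and w: "weak_deriv_torus (v s) (vx s)" and per: "periodic1 (v s)"
  shows "jump (\<lambda>y. v s y - snd (ut s y)) (x j) = jump (\<lambda>y. snd (uts s y) - snd (ut s y)) (x j)"
proof -
  obtain \<kappa> where \<kappa>: "AE y in lborel. y \<in> {0..1} \<longrightarrow> v s y = \<kappa> + (LINT z:{0..y}|lborel. vx s z)"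
    by (rule weak_deriv_torus_representative[OF w])
  note V = primitive_on_indefinite[OF weak_deriv_torus_integrable(2)[OF w], of \<kappa>]
  note dg = dg2_component[OF ut_dg[OF s], of snd, simplified]
  have "\<kappa> + (LINT z:{0..1}|lborel. vx s z) = \<kappa> + (LINT z:{0..0}|lborel. vx s z)"
    using weak_deriv_torus_mean[OF w] set_integral_at_point[of lborel 0 "vx s"] by simp
  from jump_continuous_minus_dg[OF per primitive_on_continuous[OF V] this \<kappa> dg j]
  show ?thesis unfolding jump_reconstruction_eq[OF s j] by (simp add: pc_def)
qed

end

lemma set_borel_measurable_pair:
  assumes "set_borel_measurable lborel S f" "set_borel_measurable lborel S g"
  shows "set_borel_measurable lborel S (\<lambda>y. (f y :: real, g y :: real))"
  using borel_measurable_Pair[OF assms[unfolded set_borel_measurable_def]]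
  by (simp add: set_borel_measurable_def)

context dg_error begin

text \<open>
  The derivative of the error on a cell is the sum of the derivatives of \<open>v - V\<close> and of the gap.
  The cellwise norms of the former add up to \<open>dxe_sq\<close>, and the jumps are those of the gap.
\<close>

lemma broken_density_le:
  assumes s: "s \<in> {0..T}" and w: "weak_deriv_torus (v s) (vx s)" and per: "periodic1 (v s)"
    and l: "in_L2 (\<lambda>y. vx s y - approx.vhx s y)"
  shows "broken_density (\<lambda>y. v s y - snd (ut s y))
    \<le> 2 * ennreal (approx.dxe_sq s) + 2 * broken_density (\<lambda>y. snd (uts s y) - snd (ut s y))"
proof -
  let ?e = "\<lambda>y. vx s y - approx.vhx s y"
  let ?W = "\<lambda>j. wdx_on (x j) (x (Suc j)) (\<lambda>y. v s y - snd (ut s y))"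
  let ?K = "\<lambda>j. wdx_on (x j) (x (Suc j)) (\<lambda>y. snd (uts s y) - snd (ut s y))"
  let ?J = "\<lambda>j. ennreal ((jump (\<lambda>y. snd (uts s y) - snd (ut s y)) (x j))\<^sup>2 / h_node x M j)"
  have J: "ennreal ((jump (\<lambda>y. v s y - snd (ut s y)) (x j))\<^sup>2 / h_node x M j) = ?J j" if "j < M" for j
    unfolding jump_error_eq[OF s that w per] ..
  have sub: "{x j<..<x (Suc j)} \<subseteq> {0..1}" if "j < M" for j
    using mesh_range[of j] mesh_range[of "Suc j"] that by auto
  have W: "L2sq_on {x j<..<x (Suc j)} (?W j) \<le> 2 * L2sq_on {x j<..<x (Suc j)} ?e + 2 * L2sq_on {x j<..<x (Suc j)} (?K j)"
    if j: "j < M" for j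
  proof -
    let ?S = "{x j<..<x (Suc j)}" and ?r = "poly (pderiv (gap s j))"
    have "set_borel_measurable lborel ?S ?e"
      using l sub[OF j] set_borel_measurable_subset[of lborel "{0..1}" ?e ?S] by (simp add: in_L2_def)
    moreover have "?r \<in> borel_measurable borel" by (intro borel_measurable_continuous_onI continuous_intros)
    then have "set_borel_measurable lborel ?S ?r" by (simp add: set_borel_measurable_def)
    ultimately have "L2sq_on ?S (\<lambda>y. ?e y + ?r y) \<le> 2 * L2sq_on ?S ?e + 2 * L2sq_on ?S ?r" by (rule L2sq_on_add_le)
    then show ?thesis
      unfolding L2sq_on_cong_AE[OF wdx_on_error[OF s j w]] L2sq_on_cong_AE[OF wdx_on_gap[OF s j]] .
  qed
  have double: "a \<le> 2 * a" for a :: ennreal using mult_right_mono[of 1 2 a] by simp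
  have "broken_density (\<lambda>y. v s y - snd (ut s y)) = (\<Sum>j<M. L2sq_on {x j<..<x (Suc j)} (?W j) + ?J j)"
    unfolding broken_density_def by (intro sum.cong refl) (simp add: J)
  also have "\<dots> \<le> (\<Sum>j<M. (2 * L2sq_on {x j<..<x (Suc j)} ?e + 2 * L2sq_on {x j<..<x (Suc j)} (?K j)) + 2 * ?J j)"
    by (intro sum_mono add_mono W double) simp
  also have "\<dots> = 2 * (\<Sum>j<M. L2sq_on {x j<..<x (Suc j)} ?e) + 2 * broken_density (\<lambda>y. snd (uts s y) - snd (ut s y))"
    by (simp only: broken_density_def sum.distrib sum_distrib_left distrib_left add.assoc)
  also have "\<dots> \<le> 2 * L2sq ?e + 2 * broken_density (\<lambda>y. snd (uts s y) - snd (ut s y))"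
  proof (intro add_right_mono mult_left_mono)
    have "(\<lambda>y. indicator {0..1} y *\<^sub>R ?e y) \<in> borel_measurable lborel"
      using l by (simp add: in_L2_def set_borel_measurable_def)
    then have m0: "(\<lambda>y. ennreal ((norm (indicator {0..1} y *\<^sub>R ?e y))\<^sup>2)) \<in> borel_measurable lborel" by measurable
    have eq: "(\<lambda>y. ennreal ((norm (indicator {0..1} y *\<^sub>R ?e y))\<^sup>2)) = (\<lambda>y. ennreal ((norm (?e y))\<^sup>2) * indicator {0..1} y)"
      by (auto simp: indicator_def)
    have m: "(\<lambda>y. ennreal ((norm (?e y))\<^sup>2) * indicator {0..1} y) \<in> borel_measurable lborel" using m0 unfolding eq .
    show "(\<Sum>j<M. L2sq_on {x j<..<x (Suc j)} ?e) \<le> L2sq ?e"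
      unfolding L2sq_on_def by (rule sum_cells_le[OF m])
  qed simp
  also have "L2sq ?e = ennreal (approx.dxe_sq s)" using L2sq_eq[OF l] by (simp add: approx.dxe_sq_def)
  finally show ?thesis .
qed

lemma continuous_indicator_measurable:
  "continuous_on {0..T} f \<Longrightarrow> (\<lambda>s. indicator {0..T} s * f s) \<in> borel_measurable borel" for f :: "real \<Rightarrow> real"
  using borel_measurable_continuous_on_indicator[of "{0..T}" f] by simp

text \<open>
  The integrand is a sum of squared norms and of squares of jumps of polynomials whose coefficients
  are continuous in time.
\<close>

lemma broken_density_measurable:
  "(\<lambda>s. broken_density (\<lambda>y. snd (uts s y) - snd (ut s y)) * indicator {0..T} s) \<in> borel_measurable lborel"
proof -
  \<comment> \<open>the factor \<open>indicator {0..T}\<close> makes the coefficients measurable on the whole line\<close>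
  define c where "c = (\<lambda>j k s. indicator {0..T} s * coeff (pderiv (gap s j)) k)"
  define J where "J = (\<lambda>j s. poly (pc snd s j) (x j) - poly (pc snd s (prev_cell j)) (x (Suc (prev_cell j))))"
  define B where "B = (\<lambda>s. \<Sum>j<M. (\<integral>\<^sup>+ y\<in>{x j<..<x (Suc j)}. ennreal ((\<Sum>k\<le>q. c j k s * y ^ k)\<^sup>2) \<partial>lborel)
      + ennreal ((indicator {0..T} s * J j s)\<^sup>2 / h_node x M j))"
  have lip: "continuous_on {0..T} (\<lambda>s. coeff (Pc snd s j) k)" "continuous_on {0..T} (\<lambda>s. coeff (pc snd s j) k)"
    if "j < M" for j k
    by (intro lipschitz_real_continuous Pc_lipschitz pc_lipschitz that; simp)+
  have c: "c j k \<in> borel_measurable borel" if "j < M" for j k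
    unfolding c_def coeff_pderiv gap_def coeff_diff
    by (intro continuous_indicator_measurable continuous_intros lip that)
  have J: "(\<lambda>s. indicator {0..T} s * J j s) \<in> borel_measurable borel" if "j < M" for j
    unfolding J_def
  proof (intro continuous_indicator_measurable continuous_on_diff)
    have "continuous_on {0..T} (\<lambda>s. poly (pc snd s i) y)" if "i < M" for i y
      by (rule lipschitz_real_continuous[OF lipschitz_real_poly_eval[of T "\<lambda>s. pc snd s i" q]])
         (use pc_lipschitz[of snd i] pc_degree[of snd _ i] that in auto)
    then show "continuous_on {0..T} (\<lambda>s. poly (pc snd s j) (x j))"
      "continuous_on {0..T} (\<lambda>s. poly (pc snd s (prev_cell j)) (x (Suc (prev_cell j))))"
      using that prev_cell(1)[OF that] by auto
  qed
  have Bm: "B \<in> borel_measurable borel"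
    unfolding B_def
  proof (intro borel_measurable_sum borel_measurable_add)
    fix j assume "j \<in> {..<M}"
    then have j: "j < M" by simp
    show "(\<lambda>s. \<integral>\<^sup>+ y\<in>{x j<..<x (Suc j)}. ennreal ((\<Sum>k\<le>q. c j k s * y ^ k)\<^sup>2) \<partial>lborel) \<in> borel_measurable borel"
      by (rule nn_integral_tensor_measurable[OF c[OF j]]) simp
    show "(\<lambda>s. ennreal ((indicator {0..T} s * J j s)\<^sup>2 / h_node x M j)) \<in> borel_measurable borel"
      using J[OF j] by measurable
  qed
  have "broken_density (\<lambda>y. snd (uts s y) - snd (ut s y)) = B s" if s: "s \<in> {0..T}" for s
    unfolding broken_density_def B_def
  proof (rule sum.cong[OF refl])
    fix j assume "j \<in> {..<M}"
    then have j: "j < M" by simp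
    have deg: "degree (pderiv (gap s j)) \<le> q"
    proof -
      have "degree (gap s j) \<le> q + 1"
        unfolding gap_def by (intro degree_diff_le Pc_degree le_trans[OF pc_degree] s j) auto
      then show ?thesis by (simp add: degree_pderiv)
    qed
    have "L2sq_on {x j<..<x (Suc j)} (wdx_on (x j) (x (Suc j)) (\<lambda>y. snd (uts s y) - snd (ut s y)))
      = L2sq_on {x j<..<x (Suc j)} (poly (pderiv (gap s j)))" by (rule L2sq_on_cong_AE[OF wdx_on_gap[OF s j]])
    also have "\<dots> = (\<integral>\<^sup>+ y\<in>{x j<..<x (Suc j)}. ennreal ((\<Sum>k\<le>q. c j k s * y ^ k)\<^sup>2) \<partial>lborel)"
      using s unfolding L2sq_on_def by (simp add: poly_eq_sum[OF deg] c_def)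
    finally have 1: "L2sq_on {x j<..<x (Suc j)} (wdx_on (x j) (x (Suc j)) (\<lambda>y. snd (uts s y) - snd (ut s y)))
      = (\<integral>\<^sup>+ y\<in>{x j<..<x (Suc j)}. ennreal ((\<Sum>k\<le>q. c j k s * y ^ k)\<^sup>2) \<partial>lborel)" .
    have 2: "jump (\<lambda>y. snd (uts s y) - snd (ut s y)) (x j) = indicator {0..T} s * J j s"
      using s jump_reconstruction_eq[OF s j] by (simp add: J_def)
    show "L2sq_on {x j<..<x (Suc j)} (wdx_on (x j) (x (Suc j)) (\<lambda>y. snd (uts s y) - snd (ut s y)))
        + ennreal ((jump (\<lambda>y. snd (uts s y) - snd (ut s y)) (x j))\<^sup>2 / h_node x M j)
      = (\<integral>\<^sup>+ y\<in>{x j<..<x (Suc j)}. ennreal ((\<Sum>k\<le>q. c j k s * y ^ k)\<^sup>2) \<partial>lborel)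
        + ennreal ((indicator {0..T} s * J j s)\<^sup>2 / h_node x M j)"
      unfolding 1 2 ..
  qed
  then have "(\<lambda>s. broken_density (\<lambda>y. snd (uts s y) - snd (ut s y)) * indicator {0..T} s) = (\<lambda>s. B s * indicator {0..T} s)"
    by (intro ext) (auto simp: indicator_def)
  moreover have "(\<lambda>s. B s * indicator {0..T} s) \<in> borel_measurable lborel" using Bm by measurable
  ultimately show ?thesis by simp
qed

lemma AE_open_interval: assumes "\<And>t. t \<in> {0<..<T} \<Longrightarrow> Q t \<Longrightarrow> R t" "AE t in lborel. t \<in> {0<..<T} \<longrightarrow> Q t"
  shows "AE t in lborel. t \<in> {0..T} \<longrightarrow> R t"
  using assms(2) AE_lborel_singleton[of "0::real"] AE_lborel_singleton[of T]
  by eventually_elim (use assms(1) in auto)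

lemma broken_sq_error:
  assumes eps: "\<epsilon> > 0" and t: "t \<in> {0..T}"
  shows "broken_sq x M t (\<lambda>s y. v s y - snd (ut s y))
    \<le> 2 * (\<integral>\<^sup>+ s\<in>{0..t}. ennreal (approx.dxe_sq s) \<partial>lborel) + 2 * broken_sq x M t (\<lambda>s y. snd (uts s y) - snd (ut s y))"
proof -
  let ?b = "\<lambda>s. broken_density (\<lambda>y. v s y - snd (ut s y))" and ?k = "\<lambda>s. broken_density (\<lambda>y. snd (uts s y) - snd (ut s y))"
  have "AE s in lborel. s \<in> {0..T} \<longrightarrow> ?b s \<le> 2 * ennreal (approx.dxe_sq s) + 2 * ?k s"
    by (rule AE_open_interval[OF _ error_slice[OF eps]]) (rule broken_density_le, auto)
  then have "broken_sq x M t (\<lambda>s y. v s y - snd (ut s y))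
    \<le> (\<integral>\<^sup>+ s. 2 * (ennreal (approx.dxe_sq s) * indicator {0..t} s) + 2 * (?k s * indicator {0..t} s) \<partial>lborel)"
    unfolding broken_sq_eq
    by (intro nn_integral_mono_AE) (use t in \<open>auto elim!: eventually_mono simp: indicator_def\<close>)
  also have "\<dots> = 2 * (\<integral>\<^sup>+ s\<in>{0..t}. ennreal (approx.dxe_sq s) \<partial>lborel) + 2 * (\<integral>\<^sup>+ s\<in>{0..t}. ?k s \<partial>lborel)"
  proof -
    have "(\<lambda>s. indicator {0..T} s *\<^sub>R approx.dxe_sq s) \<in> borel_measurable lborel"
      using approx.dxe_sq_integrable[OF eps] by (simp add: set_integrable_def borel_measurable_integrable)
    then have "(\<lambda>s. ennreal (indicator {0..T} s *\<^sub>R approx.dxe_sq s) * indicator {0..t} s) \<in> borel_measurable lborel" by measurable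
    moreover have "(\<lambda>s. ennreal (indicator {0..T} s *\<^sub>R approx.dxe_sq s) * indicator {0..t} s) = (\<lambda>s. ennreal (approx.dxe_sq s) * indicator {0..t} s)"
      using t by (auto simp: indicator_def)
    ultimately have m1: "(\<lambda>s. ennreal (approx.dxe_sq s) * indicator {0..t} s) \<in> borel_measurable lborel" by simp
    have "(\<lambda>s. ?k s * indicator {0..T} s * indicator {0..t} s) \<in> borel_measurable lborel"
      by (intro borel_measurable_times_ennreal broken_density_measurable) simp
    moreover have "(\<lambda>s. ?k s * indicator {0..T} s * indicator {0..t} s) = (\<lambda>s. ?k s * indicator {0..t} s)"
      using t by (auto simp: indicator_def)
    ultimately have m2: "(\<lambda>s. ?k s * indicator {0..t} s) \<in> borel_measurable lborel" by simp
    have d: "(\<lambda>s. 2 * f s) \<in> borel_measurable lborel" if "f \<in> borel_measurable lborel" for f :: "real \<Rightarrow> ennreal"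
      using that by measurable
    show ?thesis by (simp only: nn_integral_add[OF d[OF m1] d[OF m2]] nn_integral_cmult[OF m1] nn_integral_cmult[OF m2])
  qed
  finally show ?thesis by (simp only: broken_sq_eq)
qed

lemma L2sq_error: assumes t: "t \<in> {0..T}" shows "L2sq (\<lambda>y. (u t y, v t y) - uts t y) = ennreal (approx.rel t)"
proof -
  have "L2sq (\<lambda>y. (u t y, v t y) - uts t y) = L2sq (\<lambda>y. (u t y - approx.uh t y, v t y - approx.vh t y))"
    by (rule L2sq_on_cong_AE) (use approx_eq(1,2)[OF t] in \<open>auto intro!: AE_I2 simp: prod_eq_iff\<close>)
  then show ?thesis using L2norm_pair(2)[OF approx.e_L2(1)[OF t] approx.e_L2(2)[OF t]] by (simp add: approx.rel_def)
qed

lemma ut_grid: assumes "i \<le> N" shows "tt i \<in> {0..T}" "ut (tt i) = U i"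
proof -
  have g: "tt 0 = 0" "tt N = T" using grid by (auto simp: time_grid_def)
  show "tt i \<in> {0..T}" using time_grid_mono[OF grid, of 0 i] time_grid_mono[OF grid, of i N] assms g by auto
  have N: "N > 0" using g T0 by (cases N) auto
  define n where "n = (if i < N then i else N - 1)"
  have "n < N" "i \<in> {n, Suc n}" using assms N by (auto simp: n_def)
  then show "ut (tt i) = U i" using tempo unfolding temporal_reconstruction_def by blast
qed

text \<open>
  The factor one half compensates the constant 2 of the triangle inequality for squares.
\<close>

lemma half_L2sq_le:
  assumes i: "i \<le> N"
  shows "ennreal (1 / 2) * L2sq (\<lambda>y. (u (tt i) y, v (tt i) y) - U i y)
    \<le> ennreal (approx.rel (tt i)) + L2sq (\<lambda>y. uts (tt i) y - U i y)"
proof -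
  note t = ut_grid(1)[OF i]
  let ?a = "\<lambda>y. (u (tt i) y, v (tt i) y) - uts (tt i) y" and ?b = "\<lambda>y. uts (tt i) y - U i y"
  have comp: "in_L2 (\<lambda>y. sel (uts (tt i) y))" "in_L2 (\<lambda>y. sel (ut (tt i) y))" if "sel \<in> {fst, snd}" for sel
    using component_L2[OF dg2_component[OF uts_dg[OF t] that]] component_L2[OF dg2_component[OF ut_dg[OF t] that]] by auto
  note fL = comp[of fst, simplified] and sL = comp[of snd, simplified]
  have "set_borel_measurable lborel {0..1} (\<lambda>y. (u (tt i) y - fst (uts (tt i) y), v (tt i) y - snd (uts (tt i) y)))"
    using in_L2_diff[OF L2(1)[OF t] fL(1)] in_L2_diff[OF L2(2)[OF t] sL(1)]
    by (intro set_borel_measurable_pair) (simp_all add: in_L2_def)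
  moreover have "?a = (\<lambda>y. (u (tt i) y - fst (uts (tt i) y), v (tt i) y - snd (uts (tt i) y)))" by (auto simp: prod_eq_iff)
  ultimately have a: "set_borel_measurable lborel {0..1} ?a" by simp
  have "set_borel_measurable lborel {0..1} (\<lambda>y. (fst (uts (tt i) y) - fst (ut (tt i) y), snd (uts (tt i) y) - snd (ut (tt i) y)))"
    using in_L2_diff[OF fL] in_L2_diff[OF sL] by (intro set_borel_measurable_pair) (simp_all add: in_L2_def)
  moreover have "?b = (\<lambda>y. (fst (uts (tt i) y) - fst (ut (tt i) y), snd (uts (tt i) y) - snd (ut (tt i) y)))"
    using ut_grid(2)[OF i] by (auto simp: prod_eq_iff)
  ultimately have b: "set_borel_measurable lborel {0..1} ?b" by simp
  have half: "ennreal (1 / 2) * (2 * c) = c" for c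
  proof -
    have "ennreal (1 / 2) * 2 = ennreal (1 / 2 * 2)" by (simp only: ennreal_mult'' zero_le_numeral ennreal_numeral)
    then show ?thesis by (simp add: mult.assoc[symmetric])
  qed
  have "ennreal (1 / 2) * L2sq (\<lambda>y. ?a y + ?b y) \<le> ennreal (1 / 2) * (2 * L2sq ?a + 2 * L2sq ?b)"
    by (intro mult_left_mono L2sq_on_add_le a b) simp
  also have "\<dots> = L2sq ?a + L2sq ?b" by (simp only: distrib_left half)
  also have "L2sq ?a = ennreal (approx.rel (tt i))" by (rule L2sq_error[OF t])
  finally show ?thesis by simp
qed

text \<open>
  For \<open>\<epsilon> = 0\<close> the left-hand side vanishes, whatever value the broken norm of the
  non-differentiable error has.
\<close>

lemma half_broken_sq_le:
  assumes t: "t \<in> {0..T}"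
  shows "ennreal (\<epsilon> / 2) * broken_sq x M t (\<lambda>s y. v s y - snd (ut s y))
    \<le> ennreal \<epsilon> * (\<integral>\<^sup>+ s\<in>{0..t}. ennreal (approx.dxe_sq s) \<partial>lborel)
      + ennreal \<epsilon> * broken_sq x M t (\<lambda>s y. snd (uts s y) - snd (ut s y))"
proof (cases "\<epsilon> > 0")
  case False
  then have "ennreal (\<epsilon> / 2) = 0" using eps0 by simp
  then show ?thesis by simp
next
  case True
  have half: "ennreal (\<epsilon> / 2) * (2 * c) = ennreal \<epsilon> * c" for c
  proof -
    have "ennreal (\<epsilon> / 2) * 2 = ennreal (\<epsilon> / 2 * 2)" by (simp only: ennreal_mult'' zero_le_numeral ennreal_numeral)
    then show ?thesis by (simp add: mult.assoc[symmetric])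
  qed
  have "ennreal (\<epsilon> / 2) * broken_sq x M t (\<lambda>s y. v s y - snd (ut s y))
    \<le> ennreal (\<epsilon> / 2) * (2 * (\<integral>\<^sup>+ s\<in>{0..t}. ennreal (approx.dxe_sq s) \<partial>lborel) + 2 * broken_sq x M t (\<lambda>s y. snd (uts s y) - snd (ut s y)))"
    by (intro mult_left_mono broken_sq_error[OF True t]) simp
  then show ?thesis by (simp only: distrib_left half)
qed

lemma a_posteriori_estimate:
  assumes i: "i \<le> N"
  shows "ennreal (1 / 2) * L2sq (\<lambda>y. (u (tt i) y, v (tt i) y) - U i y)
       + ennreal (\<epsilon> / 2) * broken_sq x M (tt i) (\<lambda>s y. v s y - snd (ut s y))
     \<le> 4 * L2sq (\<lambda>y. (u 0 y, v 0 y) - uts 0 y)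
       + 4 * (\<integral>\<^sup>+ s\<in>{0..tt i}. L2norm (\<lambda>y. (res_u uts s y, res_v1 Ah \<epsilon> ut uts s y)) \<partial>lborel)\<^sup>2
       + 4 * ennreal \<epsilon> * (\<integral>\<^sup>+ s\<in>{0..tt i}. (Hm1norm (res_v2 Ah ut uts s))\<^sup>2 \<partial>lborel)
       + 2 * L2sq (\<lambda>y. uts (tt i) y - U i y)
       + 4 * ennreal \<epsilon> * broken_sq x M (tt i) (\<lambda>s y. snd (uts s y) - snd (ut s y))"
proof -
  note t = ut_grid(1)[OF i]
  define L where "L = L2sq (\<lambda>y. uts (tt i) y - U i y)"
  define I where "I = (\<integral>\<^sup>+ s\<in>{0..tt i}. ennreal (approx.dxe_sq s) \<partial>lborel)"
  define K where "K = broken_sq x M (tt i) (\<lambda>s y. snd (uts s y) - snd (ut s y))"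
  define R where "R = (\<integral>\<^sup>+ s\<in>{0..tt i}. L2norm (\<lambda>y. (res_u uts s y, res_v1 Ah \<epsilon> ut uts s y)) \<partial>lborel)\<^sup>2"
  define H where "H = (\<integral>\<^sup>+ s\<in>{0..tt i}. (Hm1norm (res_v2 Ah ut uts s))\<^sup>2 \<partial>lborel)"
  define r0 where "r0 = L2sq (\<lambda>y. (u 0 y, v 0 y) - uts 0 y)"
  have AE: "AE s in lborel. s \<in> {0..T} \<longrightarrow>
    L2norm (\<lambda>y. (res_u uts s y, res_v1 Ah \<epsilon> ut uts s y)) = L2norm (\<lambda>y. (approx.ru s y, approx.r1 s y))"
    by (rule AE_open_interval[OF _ residual_norm_eq])
  have R: "(\<integral>\<^sup>+ s\<in>{0..tt i}. L2norm (\<lambda>y. (approx.ru s y, approx.r1 s y)) \<partial>lborel)\<^sup>2 = R"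
    unfolding R_def
    by (intro arg_cong[where f = "\<lambda>a. a\<^sup>2"] nn_integral_cong_AE) (use AE t in \<open>auto elim!: eventually_mono simp: indicator_def\<close>)
  have "ennreal (approx.rel (tt i)) + ennreal \<epsilon> * I \<le> 2 * ennreal (approx.rel 0) + 4 * R + 2 * (ennreal \<epsilon> * H)"
    unfolding R[symmetric] I_def H_def
  proof (rule approx.error_estimate[OF t P_def])
    show "AE s in lborel. s \<in> {0<..<tt i} \<longrightarrow>
      ennreal (- 2 * approx.diffusion_residual (\<lambda>t y. snd (Ah (ut t) y)) s - approx.dxe_sq s) \<le> (Hm1norm (res_v2 Ah ut uts s))\<^sup>2"
      if "\<epsilon> > 0" using diffusion_residual_bound[OF that] by (rule eventually_mono) (use t in auto)
  qed
  also have "ennreal (approx.rel 0) = r0" using L2sq_error[of 0] T0 by (simp add: r0_def)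
  finally have est: "ennreal (approx.rel (tt i)) + ennreal \<epsilon> * I \<le> 2 * r0 + 4 * R + 2 * (ennreal \<epsilon> * H)" .
  have up: "2 * a \<le> 4 * a" "a \<le> 2 * a" "a \<le> 4 * a" for a :: ennreal
    using mult_right_mono[of 2 4 a] mult_right_mono[of 1 2 a] mult_right_mono[of 1 4 a] by simp_all
  have "ennreal (1 / 2) * L2sq (\<lambda>y. (u (tt i) y, v (tt i) y) - U i y)
       + ennreal (\<epsilon> / 2) * broken_sq x M (tt i) (\<lambda>s y. v s y - snd (ut s y))
    \<le> (ennreal (approx.rel (tt i)) + L) + (ennreal \<epsilon> * I + ennreal \<epsilon> * K)"
    unfolding L_def I_def K_def by (intro add_mono half_L2sq_le[OF i] half_broken_sq_le[OF t])
  also have "\<dots> = (ennreal (approx.rel (tt i)) + ennreal \<epsilon> * I) + L + ennreal \<epsilon> * K" by (simp only: ac_simps)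
  also have "\<dots> \<le> (2 * r0 + 4 * R + 2 * (ennreal \<epsilon> * H)) + 2 * L + 4 * (ennreal \<epsilon> * K)"
    by (intro add_mono est up)
  also have "\<dots> \<le> (4 * r0 + 4 * R + 4 * (ennreal \<epsilon> * H)) + 2 * L + 4 * (ennreal \<epsilon> * K)"
    by (intro add_mono up order_refl)
  finally show ?thesis by (simp only: r0_def R_def H_def L_def K_def mult.assoc)
qed

end

theorem corollary7p4:
  fixes T \<epsilon> :: real
    and u v :: "real \<Rightarrow> real \<Rightarrow> real" and u0 v0 :: "real \<Rightarrow> real"
    and x :: "nat \<Rightarrow> real" and M q :: nat
    and F w :: "state \<Rightarrow> state \<Rightarrow> state"
    and fh Ah :: "(real \<Rightarrow> state) \<Rightarrow> (real \<Rightarrow> state)"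
    and m :: imex_tableau and p :: nat
    and tt :: "nat \<Rightarrow> real" and N :: nat
    and U :: "nat \<Rightarrow> real \<Rightarrow> state"
    and ut uts :: "real \<Rightarrow> real \<Rightarrow> state"
    and i :: nat
  assumes "T > 0" and "\<epsilon> \<ge> 0"
    and "in_H1 u0" and "in_H1 v0"
    and "entropy_solution T \<epsilon> u v u0 v0"
    and "weakly_continuous_L2 T u" and "weakly_continuous_L2 T v"
    and "in_L2_cyl T u" and "\<epsilon> > 0 \<longrightarrow> in_L2_H1 T v"
    and "periodic_mesh x M" and "q \<ge> 1"
    and "numerical_flux F w (mesh_size x M)"
    and "dg_flux_operator x M q F fh"
    and "diffusion_operator x M q Ah"
    and "semidiscrete_lipschitz x M q fh Ah"
    and "imex_method m" and "has_order m p" and "p \<le> 3"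
    and "time_grid tt N T"
    and "rkdg_approximation x M q fh Ah \<epsilon> m tt N (\<lambda>y. (u 0 y, v 0 y)) U"
    and "temporal_reconstruction x M q fh Ah \<epsilon> tt N U ut"
    and "space_time_reconstruction x M q w T ut uts"
    and "i \<le> N"
  shows "ennreal (1 / 2) * L2sq (\<lambda>y. (u (tt i) y, v (tt i) y) - U i y)
       + ennreal (\<epsilon> / 2) * broken_sq x M (tt i) (\<lambda>s y. v s y - snd (ut s y))
     \<le> 4 * L2sq (\<lambda>y. (u 0 y, v 0 y) - uts 0 y)
       + 4 * (\<integral>\<^sup>+ s\<in>{0..tt i}. L2norm (\<lambda>y. (res_u uts s y, res_v1 Ah \<epsilon> ut uts s y)) \<partial>lborel)\<^sup>2
       + 4 * ennreal \<epsilon> * (\<integral>\<^sup>+ s\<in>{0..tt i}. (Hm1norm (res_v2 Ah ut uts s))\<^sup>2 \<partial>lborel)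
       + 2 * L2sq (\<lambda>y. uts (tt i) y - U i y)
       + 4 * ennreal \<epsilon> * broken_sq x M (tt i) (\<lambda>s y. snd (uts s y) - snd (ut s y))"
proof -
  have H1_L2: "in_L2 f" if "in_H1 f" for f using that by (simp add: in_H1_def)
  obtain vx where rep: "entropy_solution_rep T \<epsilon> u v vx u0 v0"
  proof -
    from \<open>entropy_solution T \<epsilon> u v u0 v0\<close> obtain vx where
      vx: "\<epsilon> > 0 \<longrightarrow> (\<forall>\<phi>. test_fun_open T \<phi> \<longrightarrow>
          int_cyl T (\<lambda>t x. v t x * dx \<phi> t x) = - int_cyl T (\<lambda>t x. vx t x * \<phi> t x))"
        "in_L1_cyl T (\<lambda>t x. \<epsilon> * vx t x)"
        "\<forall>\<phi>. test_fun T \<phi> \<longrightarrow> int_cyl T (\<lambda>t x. dt \<phi> t x * u t x - dx \<phi> t x * v t x)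
            + (LINT x:{0..1}|lborel. u0 x * \<phi> 0 x) = 0"
        "\<forall>\<phi>. test_fun T \<phi> \<longrightarrow> int_cyl T (\<lambda>t x. dt \<phi> t x * v t x - dx \<phi> t x * (u t x + \<epsilon> * vx t x))
            + (LINT x:{0..1}|lborel. v0 x * \<phi> 0 x) = 0"
        "\<forall>\<Phi>. test_fun T \<Phi> \<and> (\<forall>t\<ge>0. \<forall>x. \<Phi> t x \<ge> 0) \<longrightarrow>
          in_L1_cyl T (\<lambda>t x. \<epsilon> * \<Phi> t x * (vx t x)\<^sup>2) \<and>
          int_cyl T (\<lambda>t x. dt \<Phi> t x * eta (u t x) (v t x)
                        + dx \<Phi> t x * (- u t x * v t x - \<epsilon> * v t x * vx t x)
                        - \<epsilon> * \<Phi> t x * (vx t x)\<^sup>2)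
            + (LINT x:{0..1}|lborel. \<Phi> 0 x * eta (u0 x) (v0 x)) \<ge> 0"
      and Linf: "in_Linf_cyl T u" "in_Linf_cyl T v"
      unfolding entropy_solution_def by blast
    have "entropy_solution_rep T \<epsilon> u v vx u0 v0"
    proof (rule entropy_solution_rep.intro)
      show "AE t in lborel. t \<in> {0<..<T} \<longrightarrow> in_H1 (v t)" if "\<epsilon> > 0"
        using \<open>\<epsilon> > 0 \<longrightarrow> in_L2_H1 T v\<close> that by (simp add: in_L2_H1_def)
      show "in_L2 u0" "in_L2 v0" by (intro H1_L2 \<open>in_H1 u0\<close> \<open>in_H1 v0\<close>)+
    qed (rule assms(1,2,6,7) Linf vx(2) vx(1)[rule_format] vx(3)[rule_format] vx(4)[rule_format]
          vx(5)[THEN spec, THEN mp, OF conjI]; assumption?)+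
    then show ?thesis by (rule that)
  qed
  have rec: "dg_reconstruction x M T \<epsilon> q w fh Ah tt N U ut uts"
  proof (intro dg_reconstruction.intro mesh.intro dg_reconstruction_axioms.intro)
    show "\<exists>r>0. \<exists>L. L-lipschitz_on (ball z r) (\<lambda>(a, b). w a b)" for z
      using \<open>numerical_flux F w (mesh_size x M)\<close> unfolding numerical_flux_def by (elim conjE) (erule spec)
    show "fh \<phi> \<in> dg_space2 x M q" if "\<phi> \<in> dg_space2 x M q" for \<phi>
      using \<open>dg_flux_operator x M q F fh\<close> that by (simp add: dg_flux_operator_def)
  qed (rule assms)+
  interpret dg_error x M T \<epsilon> q w fh Ah tt N U ut uts u v vx u0 v0
    by (rule dg_error.intro[OF rec rep])
  show ?thesis by (rule a_posteriori_estimate[OF \<open>i \<le> N\<close>])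
qed

end
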